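(* Let $H$ be a Hopf algebra with invertible antipode over a field $\Bbbk$, equipped with a bicovariant differential calculus $(\Omega^\bullet,\wedge,\mathrm d)$. Let $M,N$ be bicovariant bimodules over $H$, finitely generated as right $H$-modules, and let $\nabla^M\in\mathrm{Con}_H(M)$, $\nabla^N\in\mathrm{Con}_H(N)$ be right connections. Then $$\nabla^M\oplus\nabla^N:=\sigma^{\mathcal W}_{23}\circ(\nabla^M\,\hat\otimes\,\mathrm{id}_N)+\mathrm{id}_M\,\hat\otimes\,\nabla^N$$ defines a right connection $\nabla^M\oplus\nabla^N\in\mathrm{Con}_H(M\otimes_HN)$. On elements it reads $$(\nabla^M\oplus\nabla^N)(m\otimes_Hn)=\sigma^{\mathcal W}_{23}\big(\nabla^M(m_0S(m_1))\otimes_Hm_2n\big)+\nabla^N_{-2}m_0S(\nabla^N_{-1}m_1)\otimes_H\nabla^N_0(m_2n)$$ for $m\in M$, $n\in N$. Moreover, $$\nabla^M\oplus\nabla^N=\mathrm d^{M\otimes_HN}+\sigma^{\mathcal W}_{23}\circ\big((\nabla^M-\mathrm d^M)\otimes_{\sigma^{\mathcal W}}\mathrm{id}_N\big)+\mathrm{id}_M\otimes_{\sigma^{\mathcal W}}(\nabla^N-\mathrm d^N).$$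
   Context: $\Bbbk$ is a field, $\otimes=\otimes_\Bbbk$, $H$ is a Hopf algebra with coproduct $\Delta(h)=h_1\otimes h_2$ and invertible antipode $S$, $\overline S=S^{-1}$. Right/left coactions: $m\mapsto m_0\otimes m_1$, $m\mapsto m_{-1}\otimes m_0$, iterated as $m_0\otimes m_1\otimes m_2$, $m_{-2}\otimes m_{-1}\otimes m_0$, etc. A bicovariant bimodule is an $H$-bimodule $M$ with commuting right and left $H$-coactions satisfying $\delta_M(amb)=\Delta(a)\delta_M(m)\Delta(b)$, $\lambda_M(amb)=\Delta(a)\lambda_M(m)\Delta(b)$. $M\otimes_HN$ is again one, with actions on the outer factors and diagonal coactions. The Woronowicz braiding is the isomorphism of bicovariant bimodules $\sigma^{\mathcal W}_{M,N}\colon M\otimes_HN\to N\otimes_HM$, $\sigma^{\mathcal W}_{M,N}(m\otimes_Hn)=m_{-2}n_0S(n_1)\otimes_HS(m_{-1})m_0n_2$; $\sigma^{\mathcal W}_{23}$ means $\sigma^{\mathcal W}$ applied to the 2nd and 3rd tensor factors. Rational morphisms: $\mathrm{HOM}(M,N)$ is the space of $\Bbbk$-linear $\phi\colon M\to N$ for which $\delta^{\mathrm{Ad}}(\phi)(m)=\phi(m_0)_0\otimes\phi(m_0)_1S(m_1)$ defines an element $\phi_0\otimes\phi_1$ of $\mathrm{Hom}_\Bbbk(M,N)\otimes H\subseteq\mathrm{Hom}_\Bbbk(M,N\otimes H)$ and $\lambda^{\mathrm{Ad}}(\phi)(m)=\phi(m_0)_{-1}\overline S(m_{-1})\otimes\phi(m_0)_0$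 defines an element $\phi_{-1}\otimes\phi_0$ of $H\otimes\mathrm{Hom}_\Bbbk(M,N)\subseteq\mathrm{Hom}_\Bbbk(M,H\otimes N)$. These are coactions; iterations are $\phi_{-2}\otimes\phi_{-1}\otimes\phi_0$ etc. For rational $\phi\colon M\to M'$, $\psi\colon N\to N'$ between bicovariant bimodules, $\phi\,\hat\otimes\,\psi\colon M\otimes_HN\to M'\otimes_HN'$ is the well-defined rational map $(\phi\,\hat\otimes\,\psi)(m\otimes_Hn)=\phi(\psi_{-2}m_0S(\psi_{-1}m_1))\otimes_H\psi_0(m_2n)$. If $\phi,\psi$ are also right $H$-linear this is denoted $\phi\otimes_{\sigma^{\mathcal W}}\psi$, and equals $\phi(\psi_{-2}m_0S(m_1))\otimes_HS(\psi_{-1})\psi_0(m_2n)$ on $m\otimes_Hn$. If $M$ is finitely generated as a right $H$-module, right $H$-linear maps $M\to N$ and right connections on $M$ are rational. A differential calculus on $H$ is a differential graded algebra $(\Omega^\bullet=\bigoplus_{k\ge0}\Omega^k,\wedge,\mathrm d)$ with $\Omega^0=H$ and $\Omega^k=\mathrm{span}_\Bbbk\{a^0\mathrm da^1\wedge\cdots\wedge\mathrm da^k\}$; it is bicovariant if $\Omega^\bullet$ is a graded $H$-bicomodule algebra (with coactions extending $\Delta$ in degree $0$) and $\mathrm d$ is $H$-bicolinear. A right connection on a right $H$-module $M$ is a linear map $\nabla\colon M\to M\otimes_H\Omega^1$ with $\nabla(ma)=\nabla(m)a+m\otimes_H\mathrm da$; the set of them is $\mathrm{Con}_H(M)$. The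 canonical right connection of a bicovariant bimodule $M$ is $\mathrm d^M(m)=m_0S(m_1)\otimes_H\mathrm dm_2$. *)

theory Defs
  imports "HOL-Algebra.Algebra"
begin

section \<open>Tensor products\<close>

text \<open>
  The tensor product of a right \<open>A\<close>-module (action \<open>ra\<close>) and a left \<open>A\<close>-module (action \<open>la\<close>)
  is the free abelian group on pairs modulo the usual relators; an element is a coset
  of formal integer combinations of pairs.
\<close>

definition tensor_relators ::
  "'a set \<Rightarrow> ('m \<Rightarrow> 'a \<Rightarrow> 'm) \<Rightarrow> ('a \<Rightarrow> 'n \<Rightarrow> 'n) \<Rightarrow>
   ('m, 'p) ring_scheme \<Rightarrow> ('n, 'q) ring_scheme \<Rightarrow> ('m \<times> 'n \<Rightarrow>\<^sub>0 int) set" where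
  "tensor_relators A ra la M N =
     {frag_of (x \<oplus>\<^bsub>M\<^esub> x', y) - frag_of (x, y) - frag_of (x', y) | x x' y.
        x \<in> carrier M \<and> x' \<in> carrier M \<and> y \<in> carrier N} \<union>
     {frag_of (x, y \<oplus>\<^bsub>N\<^esub> y') - frag_of (x, y) - frag_of (x, y') | x y y'.
        x \<in> carrier M \<and> y \<in> carrier N \<and> y' \<in> carrier N} \<union>
     {frag_of (ra x a, y) - frag_of (x, la a y) | x a y.
        x \<in> carrier M \<and> a \<in> A \<and> y \<in> carrier N}"

definition tensor_group ::
  "'a set \<Rightarrow> ('m \<Rightarrow> 'a \<Rightarrow> 'm) \<Rightarrow> ('a \<Rightarrow> 'n \<Rightarrow> 'n) \<Rightarrow>
   ('m, 'p) ring_scheme \<Rightarrow> ('n, 'q) ring_scheme \<Rightarrow> ('m \<times> 'n \<Rightarrow>\<^sub>0 int) set monoid" where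
  "tensor_group A ra la M N =
     (let F = free_Abelian_group (carrier M \<times> carrier N)
      in F Mod generate F (tensor_relators A ra la M N))"

text \<open>The pure tensor \<open>x \<otimes> y\<close>: the zero of a tensor product is the subgroup of relations itself,
  so the coset of \<open>frag_of (x, y)\<close> is its translate.\<close>

definition pure_tensor ::
  "('m \<times> 'n \<Rightarrow>\<^sub>0 int) set \<Rightarrow> 'm \<Rightarrow> 'n \<Rightarrow> ('m \<times> 'n \<Rightarrow>\<^sub>0 int) set" where
  "pure_tensor Z x y = (\<lambda>c. c + frag_of (x, y)) ` Z"

abbreviation ptens ::
  "(('m \<times> 'n \<Rightarrow>\<^sub>0 int) set, 'p) ring_scheme \<Rightarrow> 'm \<Rightarrow> 'n \<Rightarrow> ('m \<times> 'n \<Rightarrow>\<^sub>0 int) set"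
  (infixl \<open>\<boxtimes>\<index>\<close> 68) where
  "x \<boxtimes>\<^bsub>T\<^esub> y \<equiv> pure_tensor \<zero>\<^bsub>T\<^esub> x y"

text \<open>
  \<open>sweedler Z t f\<close> is the sum of \<open>f x\<^sub>i y\<^sub>i\<close> in \<open>Z\<close> for \<open>t\<close> the sum of \<open>x\<^sub>i \<otimes> y\<^sub>i\<close>, i.e. the value at \<open>t\<close> of
  the map induced by \<open>f\<close>.  It does not depend on the representative as soon as \<open>f\<close> is biadditive
  and balanced.  Iterated Sweedler notation is expressed by nesting.
\<close>

definition sweedler ::
  "('z, 'p) ring_scheme \<Rightarrow> ('m \<times> 'n \<Rightarrow>\<^sub>0 int) set \<Rightarrow> ('m \<Rightarrow> 'n \<Rightarrow> 'z) \<Rightarrow> 'z" where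
  "sweedler Z t f =
     (let c = (SOME c. c \<in> t)
      in \<Oplus>\<^bsub>Z\<^esub>p\<in>Poly_Mapping.keys c. add_pow Z (Poly_Mapping.lookup c p) (f (fst p) (snd p)))"

text \<open>For modules that are not algebras, the fields \<^const>\<open>monoid.mult\<close> and \<^const>\<open>monoid.one\<close> of the
  record are irrelevant.\<close>

definition module_tensor ::
  "'a set \<Rightarrow> ('m \<Rightarrow> 'a \<Rightarrow> 'm) \<Rightarrow> ('a \<Rightarrow> 'n \<Rightarrow> 'n) \<Rightarrow>
   ('k, 'm, 'p) module_scheme \<Rightarrow> ('n, 'q) ring_scheme \<Rightarrow>
   ('k, ('m \<times> 'n \<Rightarrow>\<^sub>0 int) set) module" where
  "module_tensor A ra la M N =
     (let G = tensor_group A ra la M N;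
          B = \<lparr>carrier = carrier G, monoid.mult = undefined, monoid.one = undefined,
               ring.zero = \<one>\<^bsub>G\<^esub>, ring.add = monoid.mult G\<rparr>
      in \<lparr>carrier = carrier G, monoid.mult = undefined, monoid.one = undefined,
          ring.zero = \<one>\<^bsub>G\<^esub>, ring.add = monoid.mult G,
          smult = (\<lambda>r t. sweedler B t (\<lambda>x y. (r \<odot>\<^bsub>M\<^esub> x) \<boxtimes>\<^bsub>B\<^esub> y))\<rparr>)"

definition tensK ::
  "('k, 'o) ring_scheme \<Rightarrow> ('k, 'm, 'p) module_scheme \<Rightarrow> ('k, 'n, 'q) module_scheme \<Rightarrow>
   ('k, ('m \<times> 'n \<Rightarrow>\<^sub>0 int) set) module" where
  "tensK K M N = module_tensor (carrier K) (\<lambda>x r. r \<odot>\<^bsub>M\<^esub> x) (\<lambda>r y. r \<odot>\<^bsub>N\<^esub> y) M N"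


section \<open>Linear maps\<close>

definition klinear ::
  "('k, 'o) ring_scheme \<Rightarrow> ('k, 'm, 'p) module_scheme \<Rightarrow> ('k, 'n, 'q) module_scheme \<Rightarrow>
   ('m \<Rightarrow> 'n) \<Rightarrow> bool" where
  "klinear K V W f \<longleftrightarrow>
     f \<in> carrier V \<rightarrow> carrier W \<and>
     (\<forall>x\<in>carrier V. \<forall>y\<in>carrier V. f (x \<oplus>\<^bsub>V\<^esub> y) = f x \<oplus>\<^bsub>W\<^esub> f y) \<and>
     (\<forall>r\<in>carrier K. \<forall>x\<in>carrier V. f (r \<odot>\<^bsub>V\<^esub> x) = r \<odot>\<^bsub>W\<^esub> f x)"

definition homK ::
  "('k, 'o) ring_scheme \<Rightarrow> ('k, 'm, 'p) module_scheme \<Rightarrow> ('k, 'n, 'q) module_scheme \<Rightarrow>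
   ('k, 'm \<Rightarrow> 'n) module" where
  "homK K V W =
     \<lparr>carrier = {f \<in> extensional (carrier V). klinear K V W f},
      monoid.mult = undefined, monoid.one = undefined,
      ring.zero = (\<lambda>x\<in>carrier V. \<zero>\<^bsub>W\<^esub>),
      ring.add = (\<lambda>f g. \<lambda>x\<in>carrier V. f x \<oplus>\<^bsub>W\<^esub> g x),
      smult = (\<lambda>r f. \<lambda>x\<in>carrier V. r \<odot>\<^bsub>W\<^esub> f x)\<rparr>"

definition kspan ::
  "('k, 'o) ring_scheme \<Rightarrow> ('k, 'm, 'p) module_scheme \<Rightarrow> 'm set \<Rightarrow> 'm set" where
  "kspan K V S = \<Inter>{W. submodule W K V \<and> S \<subseteq> W}"


section \<open>Hopf algebras\<close>

record ('k, 'h) hopf = "('k, 'h) module" +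
  comult :: "'h \<Rightarrow> ('h \<times> 'h \<Rightarrow>\<^sub>0 int) set"
  counit :: "'h \<Rightarrow> 'k"
  antipode :: "'h \<Rightarrow> 'h"

locale hopf_algebra =
  fixes K :: "('k, 'o) ring_scheme" and H :: "('k, 'h, 'x) hopf_scheme"
  assumes field: "field K"
    and ring: "ring H"
    and module: "Module.module K H"
    and smult_mult:
      "\<lbrakk>r \<in> carrier K; a \<in> carrier H; b \<in> carrier H\<rbrakk> \<Longrightarrow>
        (r \<odot>\<^bsub>H\<^esub> a) \<otimes>\<^bsub>H\<^esub> b = r \<odot>\<^bsub>H\<^esub> (a \<otimes>\<^bsub>H\<^esub> b)"
      "\<lbrakk>r \<in> carrier K; a \<in> carrier H; b \<in> carrier H\<rbrakk> \<Longrightarrow>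
        a \<otimes>\<^bsub>H\<^esub> (r \<odot>\<^bsub>H\<^esub> b) = r \<odot>\<^bsub>H\<^esub> (a \<otimes>\<^bsub>H\<^esub> b)"
    and comult_linear: "klinear K H (tensK K H H) (comult H)"
    and coassoc:
      "a \<in> carrier H \<Longrightarrow>
        sweedler (tensK K (tensK K H H) H) (comult H a) (\<lambda>b a3.
          sweedler (tensK K (tensK K H H) H) (comult H b) (\<lambda>a1 a2.
            (a1 \<boxtimes>\<^bsub>tensK K H H\<^esub> a2) \<boxtimes>\<^bsub>tensK K (tensK K H H) H\<^esub> a3)) =
        sweedler (tensK K (tensK K H H) H) (comult H a) (\<lambda>a1 b.
          sweedler (tensK K (tensK K H H) H) (comult H b) (\<lambda>a2 a3.
            (a1 \<boxtimes>\<^bsub>tensK K H H\<^esub> a2) \<boxtimes>\<^bsub>tensK K (tensK K H H) H\<^esub> a3))"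
    and counit_ring_hom: "counit H \<in> ring_hom H K"
    and counit_smult:
      "\<lbrakk>r \<in> carrier K; a \<in> carrier H\<rbrakk> \<Longrightarrow> counit H (r \<odot>\<^bsub>H\<^esub> a) = r \<otimes>\<^bsub>K\<^esub> counit H a"
    and counit:
      "a \<in> carrier H \<Longrightarrow> sweedler H (comult H a) (\<lambda>a1 a2. counit H a1 \<odot>\<^bsub>H\<^esub> a2) = a"
      "a \<in> carrier H \<Longrightarrow> sweedler H (comult H a) (\<lambda>a1 a2. counit H a2 \<odot>\<^bsub>H\<^esub> a1) = a"
    and comult_mult:
      "\<lbrakk>a \<in> carrier H; b \<in> carrier H\<rbrakk> \<Longrightarrow>
        comult H (a \<otimes>\<^bsub>H\<^esub> b) =
        sweedler (tensK K H H) (comult H a) (\<lambda>a1 a2.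
          sweedler (tensK K H H) (comult H b) (\<lambda>b1 b2.
            (a1 \<otimes>\<^bsub>H\<^esub> b1) \<boxtimes>\<^bsub>tensK K H H\<^esub> (a2 \<otimes>\<^bsub>H\<^esub> b2)))"
    and comult_one: "comult H \<one>\<^bsub>H\<^esub> = \<one>\<^bsub>H\<^esub> \<boxtimes>\<^bsub>tensK K H H\<^esub> \<one>\<^bsub>H\<^esub>"
    and antipode_linear: "klinear K H H (antipode H)"
    and antipode:
      "a \<in> carrier H \<Longrightarrow>
        sweedler H (comult H a) (\<lambda>a1 a2. antipode H a1 \<otimes>\<^bsub>H\<^esub> a2) = counit H a \<odot>\<^bsub>H\<^esub> \<one>\<^bsub>H\<^esub>"
      "a \<in> carrier H \<Longrightarrow>
        sweedler H (comult H a) (\<lambda>a1 a2. a1 \<otimes>\<^bsub>H\<^esub> antipode H a2) = counit H a \<odot>\<^bsub>H\<^esub> \<one>\<^bsub>H\<^esub>"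

definition antipode_inv :: "('k, 'h, 'x) hopf_scheme \<Rightarrow> 'h \<Rightarrow> 'h" where
  "antipode_inv H = inv_into (carrier H) (antipode H)"


section \<open>Bicovariant bimodules\<close>

record ('k, 'h, 'm) bimod = "('k, 'm) module" +
  lact :: "'h \<Rightarrow> 'm \<Rightarrow> 'm"  (infixr \<open>\<triangleright>\<index>\<close> 74)
  ract :: "'m \<Rightarrow> 'h \<Rightarrow> 'm"  (infixl \<open>\<triangleleft>\<index>\<close> 72)
  rcoact :: "'m \<Rightarrow> ('m \<times> 'h \<Rightarrow>\<^sub>0 int) set"
  lcoact :: "'m \<Rightarrow> ('h \<times> 'm \<Rightarrow>\<^sub>0 int) set"

locale bicomodule =
  fixes K :: "('k, 'o) ring_scheme" and H :: "('k, 'h, 'x) hopf_scheme"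
    and M :: "('k, 'h, 'm, 'y) bimod_scheme"
  assumes module: "Module.module K M"
    and rcoact_linear: "klinear K M (tensK K M H) (rcoact M)"
    and rcoact_coassoc:
      "m \<in> carrier M \<Longrightarrow>
        sweedler (tensK K (tensK K M H) H) (rcoact M m) (\<lambda>m' a2.
          sweedler (tensK K (tensK K M H) H) (rcoact M m') (\<lambda>m0 a1.
            (m0 \<boxtimes>\<^bsub>tensK K M H\<^esub> a1) \<boxtimes>\<^bsub>tensK K (tensK K M H) H\<^esub> a2)) =
        sweedler (tensK K (tensK K M H) H) (rcoact M m) (\<lambda>m0 a.
          sweedler (tensK K (tensK K M H) H) (comult H a) (\<lambda>a1 a2.
            (m0 \<boxtimes>\<^bsub>tensK K M H\<^esub> a1) \<boxtimes>\<^bsub>tensK K (tensK K M H) H\<^esub> a2))"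
    and rcoact_counit:
      "m \<in> carrier M \<Longrightarrow> sweedler M (rcoact M m) (\<lambda>m0 a. counit H a \<odot>\<^bsub>M\<^esub> m0) = m"
    and lcoact_linear: "klinear K M (tensK K H M) (lcoact M)"
    and lcoact_coassoc:
      "m \<in> carrier M \<Longrightarrow>
        sweedler (tensK K H (tensK K H M)) (lcoact M m) (\<lambda>a2 m'.
          sweedler (tensK K H (tensK K H M)) (lcoact M m') (\<lambda>a1 m0.
            a2 \<boxtimes>\<^bsub>tensK K H (tensK K H M)\<^esub> (a1 \<boxtimes>\<^bsub>tensK K H M\<^esub> m0))) =
        sweedler (tensK K H (tensK K H M)) (lcoact M m) (\<lambda>a m0.
          sweedler (tensK K H (tensK K H M)) (comult H a) (\<lambda>a2 a1.
            a2 \<boxtimes>\<^bsub>tensK K H (tensK K H M)\<^esub> (a1 \<boxtimes>\<^bsub>tensK K H M\<^esub> m0)))"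
    and lcoact_counit:
      "m \<in> carrier M \<Longrightarrow> sweedler M (lcoact M m) (\<lambda>a m0. counit H a \<odot>\<^bsub>M\<^esub> m0) = m"
    and coactions_commute:
      "m \<in> carrier M \<Longrightarrow>
        sweedler (tensK K (tensK K H M) H) (rcoact M m) (\<lambda>m' b.
          sweedler (tensK K (tensK K H M) H) (lcoact M m') (\<lambda>a m0.
            (a \<boxtimes>\<^bsub>tensK K H M\<^esub> m0) \<boxtimes>\<^bsub>tensK K (tensK K H M) H\<^esub> b)) =
        sweedler (tensK K (tensK K H M) H) (lcoact M m) (\<lambda>a m'.
          sweedler (tensK K (tensK K H M) H) (rcoact M m') (\<lambda>m0 b.
            (a \<boxtimes>\<^bsub>tensK K H M\<^esub> m0) \<boxtimes>\<^bsub>tensK K (tensK K H M) H\<^esub> b))"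

locale bicovariant_bimodule = bicomodule +
  assumes lact_linear: "a \<in> carrier H \<Longrightarrow> klinear K M M (lact M a)"
    and lact_add: "\<lbrakk>a \<in> carrier H; b \<in> carrier H; m \<in> carrier M\<rbrakk> \<Longrightarrow>
      (a \<oplus>\<^bsub>H\<^esub> b) \<triangleright>\<^bsub>M\<^esub> m = (a \<triangleright>\<^bsub>M\<^esub> m) \<oplus>\<^bsub>M\<^esub> (b \<triangleright>\<^bsub>M\<^esub> m)"
    and lact_smult: "\<lbrakk>r \<in> carrier K; a \<in> carrier H; m \<in> carrier M\<rbrakk> \<Longrightarrow>
      (r \<odot>\<^bsub>H\<^esub> a) \<triangleright>\<^bsub>M\<^esub> m = r \<odot>\<^bsub>M\<^esub> (a \<triangleright>\<^bsub>M\<^esub> m)"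
    and lact_mult: "\<lbrakk>a \<in> carrier H; b \<in> carrier H; m \<in> carrier M\<rbrakk> \<Longrightarrow>
      (a \<otimes>\<^bsub>H\<^esub> b) \<triangleright>\<^bsub>M\<^esub> m = a \<triangleright>\<^bsub>M\<^esub> (b \<triangleright>\<^bsub>M\<^esub> m)"
    and lact_one: "m \<in> carrier M \<Longrightarrow> \<one>\<^bsub>H\<^esub> \<triangleright>\<^bsub>M\<^esub> m = m"
    and ract_linear: "a \<in> carrier H \<Longrightarrow> klinear K M M (\<lambda>m. m \<triangleleft>\<^bsub>M\<^esub> a)"
    and ract_add: "\<lbrakk>a \<in> carrier H; b \<in> carrier H; m \<in> carrier M\<rbrakk> \<Longrightarrow>
      m \<triangleleft>\<^bsub>M\<^esub> (a \<oplus>\<^bsub>H\<^esub> b) = (m \<triangleleft>\<^bsub>M\<^esub> a) \<oplus>\<^bsub>M\<^esub> (m \<triangleleft>\<^bsub>M\<^esub> b)"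
    and ract_smult: "\<lbrakk>r \<in> carrier K; a \<in> carrier H; m \<in> carrier M\<rbrakk> \<Longrightarrow>
      m \<triangleleft>\<^bsub>M\<^esub> (r \<odot>\<^bsub>H\<^esub> a) = r \<odot>\<^bsub>M\<^esub> (m \<triangleleft>\<^bsub>M\<^esub> a)"
    and ract_mult: "\<lbrakk>a \<in> carrier H; b \<in> carrier H; m \<in> carrier M\<rbrakk> \<Longrightarrow>
      m \<triangleleft>\<^bsub>M\<^esub> (a \<otimes>\<^bsub>H\<^esub> b) = (m \<triangleleft>\<^bsub>M\<^esub> a) \<triangleleft>\<^bsub>M\<^esub> b"
    and ract_one: "m \<in> carrier M \<Longrightarrow> m \<triangleleft>\<^bsub>M\<^esub> \<one>\<^bsub>H\<^esub> = m"
    and actions_commute: "\<lbrakk>a \<in> carrier H; b \<in> carrier H; m \<in> carrier M\<rbrakk> \<Longrightarrow>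
      (a \<triangleright>\<^bsub>M\<^esub> m) \<triangleleft>\<^bsub>M\<^esub> b = a \<triangleright>\<^bsub>M\<^esub> (m \<triangleleft>\<^bsub>M\<^esub> b)"
    and rcoact_covariant: "\<lbrakk>a \<in> carrier H; b \<in> carrier H; m \<in> carrier M\<rbrakk> \<Longrightarrow>
      rcoact M (a \<triangleright>\<^bsub>M\<^esub> m \<triangleleft>\<^bsub>M\<^esub> b) =
      sweedler (tensK K M H) (comult H a) (\<lambda>a1 a2.
        sweedler (tensK K M H) (rcoact M m) (\<lambda>m0 m1.
          sweedler (tensK K M H) (comult H b) (\<lambda>b1 b2.
            (a1 \<triangleright>\<^bsub>M\<^esub> m0 \<triangleleft>\<^bsub>M\<^esub> b1) \<boxtimes>\<^bsub>tensK K M H\<^esub> (a2 \<otimes>\<^bsub>H\<^esub> m1 \<otimes>\<^bsub>H\<^esub> b2))))"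
    and lcoact_covariant: "\<lbrakk>a \<in> carrier H; b \<in> carrier H; m \<in> carrier M\<rbrakk> \<Longrightarrow>
      lcoact M (a \<triangleright>\<^bsub>M\<^esub> m \<triangleleft>\<^bsub>M\<^esub> b) =
      sweedler (tensK K H M) (comult H a) (\<lambda>a1 a2.
        sweedler (tensK K H M) (lcoact M m) (\<lambda>m1 m0.
          sweedler (tensK K H M) (comult H b) (\<lambda>b1 b2.
            (a1 \<otimes>\<^bsub>H\<^esub> m1 \<otimes>\<^bsub>H\<^esub> b1) \<boxtimes>\<^bsub>tensK K H M\<^esub> (a2 \<triangleright>\<^bsub>M\<^esub> m0 \<triangleleft>\<^bsub>M\<^esub> b2))))"

definition right_fin_gen ::
  "('k, 'h, 'x) hopf_scheme \<Rightarrow> ('k, 'h, 'm, 'y) bimod_scheme \<Rightarrow> bool" where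
  "right_fin_gen H M \<longleftrightarrow>
     (\<exists>S. finite S \<and> S \<subseteq> carrier M \<and>
        (\<forall>m\<in>carrier M. \<exists>c\<in>S \<rightarrow> carrier H. m = (\<Oplus>\<^bsub>M\<^esub>s\<in>S. s \<triangleleft>\<^bsub>M\<^esub> c s)))"

definition right_linear ::
  "('k, 'h, 'x) hopf_scheme \<Rightarrow> ('k, 'h, 'm, 'y) bimod_scheme \<Rightarrow>
   ('k, 'h, 'n, 'z) bimod_scheme \<Rightarrow> ('m \<Rightarrow> 'n) \<Rightarrow> bool" where
  "right_linear H M N f \<longleftrightarrow>
     (\<forall>m\<in>carrier M. \<forall>a\<in>carrier H. f (m \<triangleleft>\<^bsub>M\<^esub> a) = f m \<triangleleft>\<^bsub>N\<^esub> a)"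

text \<open>The tensor product over \<open>H\<close>, with actions on the outer factors and diagonal coactions.\<close>

definition tensH ::
  "('k, 'o) ring_scheme \<Rightarrow> ('k, 'h, 'x) hopf_scheme \<Rightarrow> ('k, 'h, 'm, 'y) bimod_scheme \<Rightarrow>
   ('k, 'h, 'n, 'z) bimod_scheme \<Rightarrow> ('k, 'h, ('m \<times> 'n \<Rightarrow>\<^sub>0 int) set) bimod" where
  "tensH K H M N =
     (let T = module_tensor (carrier H) (ract M) (lact N) M N
      in module.extend T
        \<lparr>lact = (\<lambda>a t. sweedler T t (\<lambda>m n. (a \<triangleright>\<^bsub>M\<^esub> m) \<boxtimes>\<^bsub>T\<^esub> n)),
         ract = (\<lambda>t a. sweedler T t (\<lambda>m n. m \<boxtimes>\<^bsub>T\<^esub> (n \<triangleleft>\<^bsub>N\<^esub> a))),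
         rcoact = (\<lambda>t. sweedler (tensK K T H) t (\<lambda>m n.
           sweedler (tensK K T H) (rcoact M m) (\<lambda>m0 m1.
             sweedler (tensK K T H) (rcoact N n) (\<lambda>n0 n1.
               (m0 \<boxtimes>\<^bsub>T\<^esub> n0) \<boxtimes>\<^bsub>tensK K T H\<^esub> (m1 \<otimes>\<^bsub>H\<^esub> n1))))),
         lcoact = (\<lambda>t. sweedler (tensK K H T) t (\<lambda>m n.
           sweedler (tensK K H T) (lcoact M m) (\<lambda>m1 m0.
             sweedler (tensK K H T) (lcoact N n) (\<lambda>n1 n0.
               (m1 \<otimes>\<^bsub>H\<^esub> n1) \<boxtimes>\<^bsub>tensK K H T\<^esub> (m0 \<boxtimes>\<^bsub>T\<^esub> n0)))))\<rparr>)"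

definition assoc_right ::
  "('k, 'o) ring_scheme \<Rightarrow> ('k, 'h, 'x) hopf_scheme \<Rightarrow> ('k, 'h, 'm, 'y) bimod_scheme \<Rightarrow>
   ('k, 'h, 'n, 'z) bimod_scheme \<Rightarrow> ('k, 'h, 'p, 'w) bimod_scheme \<Rightarrow>
   ((('m \<times> 'n \<Rightarrow>\<^sub>0 int) set \<times> 'p \<Rightarrow>\<^sub>0 int) set \<Rightarrow> ('m \<times> ('n \<times> 'p \<Rightarrow>\<^sub>0 int) set \<Rightarrow>\<^sub>0 int) set)" where
  "assoc_right K H M N P =
     (\<lambda>t\<in>carrier (tensH K H (tensH K H M N) P).
        let R = tensH K H M (tensH K H N P)
        in sweedler R t (\<lambda>s p. sweedler R s (\<lambda>m n. m \<boxtimes>\<^bsub>R\<^esub> (n \<boxtimes>\<^bsub>tensH K H N P\<^esub> p))))"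

definition assoc_left ::
  "('k, 'o) ring_scheme \<Rightarrow> ('k, 'h, 'x) hopf_scheme \<Rightarrow> ('k, 'h, 'm, 'y) bimod_scheme \<Rightarrow>
   ('k, 'h, 'n, 'z) bimod_scheme \<Rightarrow> ('k, 'h, 'p, 'w) bimod_scheme \<Rightarrow>
   (('m \<times> ('n \<times> 'p \<Rightarrow>\<^sub>0 int) set \<Rightarrow>\<^sub>0 int) set \<Rightarrow> (('m \<times> 'n \<Rightarrow>\<^sub>0 int) set \<times> 'p \<Rightarrow>\<^sub>0 int) set)" where
  "assoc_left K H M N P =
     (\<lambda>t\<in>carrier (tensH K H M (tensH K H N P)).
        let L = tensH K H (tensH K H M N) P
        in sweedler L t (\<lambda>m s. sweedler L s (\<lambda>n p. (m \<boxtimes>\<^bsub>tensH K H M N\<^esub> n) \<boxtimes>\<^bsub>L\<^esub> p)))"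


section \<open>The Woronowicz braiding\<close>

definition woronowicz ::
  "('k, 'o) ring_scheme \<Rightarrow> ('k, 'h, 'x) hopf_scheme \<Rightarrow> ('k, 'h, 'm, 'y) bimod_scheme \<Rightarrow>
   ('k, 'h, 'n, 'z) bimod_scheme \<Rightarrow>
   (('m \<times> 'n \<Rightarrow>\<^sub>0 int) set \<Rightarrow> ('n \<times> 'm \<Rightarrow>\<^sub>0 int) set)" where
  "woronowicz K H M N =
     (\<lambda>t\<in>carrier (tensH K H M N).
        let R = tensH K H N M
        in sweedler R t (\<lambda>m n.
          sweedler R (lcoact M m) (\<lambda>a2 m'. sweedler R (lcoact M m') (\<lambda>a1 m0.
            sweedler R (rcoact N n) (\<lambda>n' b2. sweedler R (rcoact N n') (\<lambda>n0 b1.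
              (a2 \<triangleright>\<^bsub>N\<^esub> n0 \<triangleleft>\<^bsub>N\<^esub> antipode H b1) \<boxtimes>\<^bsub>R\<^esub> (antipode H a1 \<triangleright>\<^bsub>M\<^esub> m0 \<triangleleft>\<^bsub>M\<^esub> b2)))))))"

text \<open>\<open>woronowicz23 K H M P N\<close> maps \<open>(M \<otimes>\<^sub>H P) \<otimes>\<^sub>H N\<close> to \<open>(M \<otimes>\<^sub>H N) \<otimes>\<^sub>H P\<close>.\<close>

definition woronowicz23 ::
  "('k, 'o) ring_scheme \<Rightarrow> ('k, 'h, 'x) hopf_scheme \<Rightarrow> ('k, 'h, 'm, 'y) bimod_scheme \<Rightarrow>
   ('k, 'h, 'p, 'w) bimod_scheme \<Rightarrow> ('k, 'h, 'n, 'z) bimod_scheme \<Rightarrow>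
   ((('m \<times> 'p \<Rightarrow>\<^sub>0 int) set \<times> 'n \<Rightarrow>\<^sub>0 int) set \<Rightarrow> (('m \<times> 'n \<Rightarrow>\<^sub>0 int) set \<times> 'p \<Rightarrow>\<^sub>0 int) set)" where
  "woronowicz23 K H M P N =
     (\<lambda>t\<in>carrier (tensH K H (tensH K H M P) N).
        let R = tensH K H M (tensH K H N P)
        in assoc_left K H M N P
          (sweedler R (assoc_right K H M P N t) (\<lambda>m s. m \<boxtimes>\<^bsub>R\<^esub> woronowicz K H P N s)))"


section \<open>Rational morphisms\<close>

text \<open>\<open>radj_elem\<close> and \<open>ladj_elem\<close> say that the element of \<open>Hom \<otimes> H\<close> resp. \<open>H \<otimes> Hom\<close>, viewed as a
  map into \<open>N \<otimes> H\<close> resp. \<open>H \<otimes> N\<close>, is the adjoint coaction of the given linear map.\<close>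

definition radj_elem ::
  "('k, 'o) ring_scheme \<Rightarrow> ('k, 'h, 'x) hopf_scheme \<Rightarrow> ('k, 'h, 'm, 'y) bimod_scheme \<Rightarrow>
   ('k, 'h, 'n, 'z) bimod_scheme \<Rightarrow> ('m \<Rightarrow> 'n) \<Rightarrow> (('m \<Rightarrow> 'n) \<times> 'h \<Rightarrow>\<^sub>0 int) set \<Rightarrow> bool" where
  "radj_elem K H M N \<phi> t \<longleftrightarrow>
     t \<in> carrier (tensK K (homK K M N) H) \<and>
     (\<forall>m\<in>carrier M.
        sweedler (tensK K N H) t (\<lambda>f a. f m \<boxtimes>\<^bsub>tensK K N H\<^esub> a) =
        sweedler (tensK K N H) (rcoact M m) (\<lambda>m0 m1.
          sweedler (tensK K N H) (rcoact N (\<phi> m0)) (\<lambda>n0 n1.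
            n0 \<boxtimes>\<^bsub>tensK K N H\<^esub> (n1 \<otimes>\<^bsub>H\<^esub> antipode H m1))))"

definition ladj_elem ::
  "('k, 'o) ring_scheme \<Rightarrow> ('k, 'h, 'x) hopf_scheme \<Rightarrow> ('k, 'h, 'm, 'y) bimod_scheme \<Rightarrow>
   ('k, 'h, 'n, 'z) bimod_scheme \<Rightarrow> ('m \<Rightarrow> 'n) \<Rightarrow> ('h \<times> ('m \<Rightarrow> 'n) \<Rightarrow>\<^sub>0 int) set \<Rightarrow> bool" where
  "ladj_elem K H M N \<phi> t \<longleftrightarrow>
     t \<in> carrier (tensK K H (homK K M N)) \<and>
     (\<forall>m\<in>carrier M.
        sweedler (tensK K H N) t (\<lambda>a f. a \<boxtimes>\<^bsub>tensK K H N\<^esub> f m) =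
        sweedler (tensK K H N) (lcoact M m) (\<lambda>m1 m0.
          sweedler (tensK K H N) (lcoact N (\<phi> m0)) (\<lambda>n1 n0.
            (n1 \<otimes>\<^bsub>H\<^esub> antipode_inv H m1) \<boxtimes>\<^bsub>tensK K H N\<^esub> n0)))"

definition HOM ::
  "('k, 'o) ring_scheme \<Rightarrow> ('k, 'h, 'x) hopf_scheme \<Rightarrow> ('k, 'h, 'm, 'y) bimod_scheme \<Rightarrow>
   ('k, 'h, 'n, 'z) bimod_scheme \<Rightarrow> ('m \<Rightarrow> 'n) set" where
  "HOM K H M N =
     {\<phi> \<in> carrier (homK K M N). (\<exists>t. radj_elem K H M N \<phi> t) \<and> (\<exists>t. ladj_elem K H M N \<phi> t)}"

definition lAd ::
  "('k, 'o) ring_scheme \<Rightarrow> ('k, 'h, 'x) hopf_scheme \<Rightarrow> ('k, 'h, 'm, 'y) bimod_scheme \<Rightarrow>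
   ('k, 'h, 'n, 'z) bimod_scheme \<Rightarrow> ('m \<Rightarrow> 'n) \<Rightarrow> ('h \<times> ('m \<Rightarrow> 'n) \<Rightarrow>\<^sub>0 int) set" where
  "lAd K H M N \<phi> = (THE t. ladj_elem K H M N \<phi> t)"

text \<open>
  \<open>hat_tensor K H M M' N N' \<phi> \<psi>\<close> is \<open>\<phi> \<otimes>^ \<psi>\<close> for \<open>\<phi>\<close> from \<open>M\<close> to \<open>M'\<close> and \<open>\<psi>\<close> from \<open>N\<close> to \<open>N'\<close>.
  It is a partial operation, given only for rational maps.  The iterated coaction of \<open>\<psi>\<close> is
  obtained by applying the coproduct to the \<open>H\<close>-leg of \<open>lAd \<psi>\<close>.
\<close>

definition hat_tensor ::
  "('k, 'o) ring_scheme \<Rightarrow> ('k, 'h, 'x) hopf_scheme \<Rightarrow>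
   ('k, 'h, 'm, 'y) bimod_scheme \<Rightarrow> ('k, 'h, 'm1, 'y1) bimod_scheme \<Rightarrow>
   ('k, 'h, 'n, 'z) bimod_scheme \<Rightarrow> ('k, 'h, 'n1, 'z1) bimod_scheme \<Rightarrow>
   ('m \<Rightarrow> 'm1) \<Rightarrow> ('n \<Rightarrow> 'n1) \<Rightarrow> (('m \<times> 'n \<Rightarrow>\<^sub>0 int) set \<Rightarrow> ('m1 \<times> 'n1 \<Rightarrow>\<^sub>0 int) set)" where
  "hat_tensor K H M M' N N' \<phi> \<psi> =
     (if \<phi> \<in> HOM K H M M' \<and> \<psi> \<in> HOM K H N N'
      then (\<lambda>t\<in>carrier (tensH K H M N).
        let R = tensH K H M' N'
        in sweedler R t (\<lambda>m n.
          sweedler R (lAd K H N N' \<psi>) (\<lambda>p \<psi>0. sweedler R (comult H p) (\<lambda>p2 p1.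
            sweedler R (rcoact M m) (\<lambda>m' m2. sweedler R (rcoact M m') (\<lambda>m0 m1.
              \<phi> (p2 \<triangleright>\<^bsub>M\<^esub> m0 \<triangleleft>\<^bsub>M\<^esub> antipode H (p1 \<otimes>\<^bsub>H\<^esub> m1)) \<boxtimes>\<^bsub>R\<^esub> \<psi>0 (m2 \<triangleright>\<^bsub>N\<^esub> n)))))))
      else undefined)"

text \<open>For right \<open>H\<close>-linear rational maps \<open>\<phi> \<otimes>^ \<psi>\<close> is written with subscript \<open>\<sigma>\<close>; again partial.\<close>

definition sigma_tensor ::
  "('k, 'o) ring_scheme \<Rightarrow> ('k, 'h, 'x) hopf_scheme \<Rightarrow>
   ('k, 'h, 'm, 'y) bimod_scheme \<Rightarrow> ('k, 'h, 'm1, 'y1) bimod_scheme \<Rightarrow>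
   ('k, 'h, 'n, 'z) bimod_scheme \<Rightarrow> ('k, 'h, 'n1, 'z1) bimod_scheme \<Rightarrow>
   ('m \<Rightarrow> 'm1) \<Rightarrow> ('n \<Rightarrow> 'n1) \<Rightarrow> (('m \<times> 'n \<Rightarrow>\<^sub>0 int) set \<Rightarrow> ('m1 \<times> 'n1 \<Rightarrow>\<^sub>0 int) set)" where
  "sigma_tensor K H M M' N N' \<phi> \<psi> =
     (if right_linear H M M' \<phi> \<and> right_linear H N N' \<psi>
      then hat_tensor K H M M' N N' \<phi> \<psi> else undefined)"


section \<open>Differential calculi\<close>

text \<open>
  A graded algebra is presented by its components \<open>forms \<Omega> k\<close> and the products between them;
  \<open>incl \<Omega>\<close> is the identification of \<open>H\<close> with the degree zero component.  The bimodule structure of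
  each component is multiplication by degree zero elements.
\<close>

record ('k, 'h, 'w) calculus =
  forms :: "nat \<Rightarrow> ('k, 'h, 'w) bimod"
  wedge :: "nat \<Rightarrow> nat \<Rightarrow> 'w \<Rightarrow> 'w \<Rightarrow> 'w"
  diff :: "nat \<Rightarrow> 'w \<Rightarrow> 'w"
  incl :: "'h \<Rightarrow> 'w"

fun monomial_form :: "('k, 'h, 'w, 'v) calculus_scheme \<Rightarrow> (nat \<Rightarrow> 'h) \<Rightarrow> nat \<Rightarrow> 'w" where
  "monomial_form \<Omega> a 0 = incl \<Omega> (a 0)"
| "monomial_form \<Omega> a (Suc k) =
     wedge \<Omega> k 1 (monomial_form \<Omega> a k) (diff \<Omega> 0 (incl \<Omega> (a (Suc k))))"

locale differential_calculus =
  fixes K :: "('k, 'o) ring_scheme" and H :: "('k, 'h, 'x) hopf_scheme"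
    and \<Omega> :: "('k, 'h, 'w, 'v) calculus_scheme"
  assumes module: "Module.module K (forms \<Omega> k)"
    and incl_linear: "klinear K H (forms \<Omega> 0) (incl \<Omega>)"
    and incl_bij: "bij_betw (incl \<Omega>) (carrier H) (carrier (forms \<Omega> 0))"
    and incl_mult: "\<lbrakk>a \<in> carrier H; b \<in> carrier H\<rbrakk> \<Longrightarrow>
      incl \<Omega> (a \<otimes>\<^bsub>H\<^esub> b) = wedge \<Omega> 0 0 (incl \<Omega> a) (incl \<Omega> b)"
    and wedge_linear_right: "u \<in> carrier (forms \<Omega> i) \<Longrightarrow>
      klinear K (forms \<Omega> j) (forms \<Omega> (i + j)) (wedge \<Omega> i j u)"
    and wedge_linear_left: "v \<in> carrier (forms \<Omega> j) \<Longrightarrow>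
      klinear K (forms \<Omega> i) (forms \<Omega> (i + j)) (\<lambda>u. wedge \<Omega> i j u v)"
    and wedge_assoc:
      "\<lbrakk>u \<in> carrier (forms \<Omega> i); v \<in> carrier (forms \<Omega> j); w \<in> carrier (forms \<Omega> k)\<rbrakk> \<Longrightarrow>
        wedge \<Omega> (i + j) k (wedge \<Omega> i j u v) w = wedge \<Omega> i (j + k) u (wedge \<Omega> j k v w)"
    and wedge_one:
      "u \<in> carrier (forms \<Omega> k) \<Longrightarrow> wedge \<Omega> 0 k (incl \<Omega> \<one>\<^bsub>H\<^esub>) u = u"
      "u \<in> carrier (forms \<Omega> k) \<Longrightarrow> wedge \<Omega> k 0 u (incl \<Omega> \<one>\<^bsub>H\<^esub>) = u"
    and lact_wedge: "\<lbrakk>a \<in> carrier H; u \<in> carrier (forms \<Omega> k)\<rbrakk> \<Longrightarrow>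
      a \<triangleright>\<^bsub>forms \<Omega> k\<^esub> u = wedge \<Omega> 0 k (incl \<Omega> a) u"
    and ract_wedge: "\<lbrakk>a \<in> carrier H; u \<in> carrier (forms \<Omega> k)\<rbrakk> \<Longrightarrow>
      u \<triangleleft>\<^bsub>forms \<Omega> k\<^esub> a = wedge \<Omega> k 0 u (incl \<Omega> a)"
    and diff_linear: "klinear K (forms \<Omega> k) (forms \<Omega> (Suc k)) (diff \<Omega> k)"
    and diff_diff: "u \<in> carrier (forms \<Omega> k) \<Longrightarrow>
      diff \<Omega> (Suc k) (diff \<Omega> k u) = \<zero>\<^bsub>forms \<Omega> (Suc (Suc k))\<^esub>"
    and leibniz: "\<lbrakk>u \<in> carrier (forms \<Omega> i); v \<in> carrier (forms \<Omega> j)\<rbrakk> \<Longrightarrow>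
      diff \<Omega> (i + j) (wedge \<Omega> i j u v) =
      wedge \<Omega> (Suc i) j (diff \<Omega> i u) v \<oplus>\<^bsub>forms \<Omega> (Suc (i + j))\<^esub>
        (if even i then wedge \<Omega> i (Suc j) u (diff \<Omega> j v)
         else \<ominus>\<^bsub>forms \<Omega> (Suc (i + j))\<^esub> wedge \<Omega> i (Suc j) u (diff \<Omega> j v))"
    and generated: "carrier (forms \<Omega> k) =
      kspan K (forms \<Omega> k) {monomial_form \<Omega> a k | a. a \<in> UNIV \<rightarrow> carrier H}"

locale bicovariant_calculus = differential_calculus +
  assumes bicomodule: "bicomodule K H (forms \<Omega> k)"
    and rcoact_incl: "a \<in> carrier H \<Longrightarrow>
      rcoact (forms \<Omega> 0) (incl \<Omega> a) =
      sweedler (tensK K (forms \<Omega> 0) H) (comult H a) (\<lambda>a1 a2. incl \<Omega> a1 \<boxtimes>\<^bsub>tensK K (forms \<Omega> 0) H\<^esub> a2)"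
    and lcoact_incl: "a \<in> carrier H \<Longrightarrow>
      lcoact (forms \<Omega> 0) (incl \<Omega> a) =
      sweedler (tensK K H (forms \<Omega> 0)) (comult H a) (\<lambda>a1 a2. a1 \<boxtimes>\<^bsub>tensK K H (forms \<Omega> 0)\<^esub> incl \<Omega> a2)"
    and rcoact_wedge: "\<lbrakk>u \<in> carrier (forms \<Omega> i); v \<in> carrier (forms \<Omega> j)\<rbrakk> \<Longrightarrow>
      rcoact (forms \<Omega> (i + j)) (wedge \<Omega> i j u v) =
      sweedler (tensK K (forms \<Omega> (i + j)) H) (rcoact (forms \<Omega> i) u) (\<lambda>u0 u1.
        sweedler (tensK K (forms \<Omega> (i + j)) H) (rcoact (forms \<Omega> j) v) (\<lambda>v0 v1.
          wedge \<Omega> i j u0 v0 \<boxtimes>\<^bsub>tensK K (forms \<Omega> (i + j)) H\<^esub> (u1 \<otimes>\<^bsub>H\<^esub> v1)))"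
    and lcoact_wedge: "\<lbrakk>u \<in> carrier (forms \<Omega> i); v \<in> carrier (forms \<Omega> j)\<rbrakk> \<Longrightarrow>
      lcoact (forms \<Omega> (i + j)) (wedge \<Omega> i j u v) =
      sweedler (tensK K H (forms \<Omega> (i + j))) (lcoact (forms \<Omega> i) u) (\<lambda>u1 u0.
        sweedler (tensK K H (forms \<Omega> (i + j))) (lcoact (forms \<Omega> j) v) (\<lambda>v1 v0.
          (u1 \<otimes>\<^bsub>H\<^esub> v1) \<boxtimes>\<^bsub>tensK K H (forms \<Omega> (i + j))\<^esub> wedge \<Omega> i j u0 v0))"
    and rcoact_diff: "u \<in> carrier (forms \<Omega> k) \<Longrightarrow>
      rcoact (forms \<Omega> (Suc k)) (diff \<Omega> k u) =
      sweedler (tensK K (forms \<Omega> (Suc k)) H) (rcoact (forms \<Omega> k) u) (\<lambda>u0 u1.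
        diff \<Omega> k u0 \<boxtimes>\<^bsub>tensK K (forms \<Omega> (Suc k)) H\<^esub> u1)"
    and lcoact_diff: "u \<in> carrier (forms \<Omega> k) \<Longrightarrow>
      lcoact (forms \<Omega> (Suc k)) (diff \<Omega> k u) =
      sweedler (tensK K H (forms \<Omega> (Suc k))) (lcoact (forms \<Omega> k) u) (\<lambda>u1 u0.
        u1 \<boxtimes>\<^bsub>tensK K H (forms \<Omega> (Suc k))\<^esub> diff \<Omega> k u0)"


section \<open>Connections\<close>

definition Con ::
  "('k, 'o) ring_scheme \<Rightarrow> ('k, 'h, 'x) hopf_scheme \<Rightarrow> ('k, 'h, 'w, 'v) calculus_scheme \<Rightarrow>
   ('k, 'h, 'm, 'y) bimod_scheme \<Rightarrow> ('m \<Rightarrow> ('m \<times> 'w \<Rightarrow>\<^sub>0 int) set) set" where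
  "Con K H \<Omega> M =
     {D \<in> carrier (homK K M (tensH K H M (forms \<Omega> 1))).
        \<forall>m\<in>carrier M. \<forall>a\<in>carrier H.
          D (m \<triangleleft>\<^bsub>M\<^esub> a) =
          (D m \<triangleleft>\<^bsub>tensH K H M (forms \<Omega> 1)\<^esub> a) \<oplus>\<^bsub>tensH K H M (forms \<Omega> 1)\<^esub>
          (m \<boxtimes>\<^bsub>tensH K H M (forms \<Omega> 1)\<^esub> diff \<Omega> 0 (incl \<Omega> a))}"

definition canonical_connection ::
  "('k, 'o) ring_scheme \<Rightarrow> ('k, 'h, 'x) hopf_scheme \<Rightarrow> ('k, 'h, 'w, 'v) calculus_scheme \<Rightarrow>
   ('k, 'h, 'm, 'y) bimod_scheme \<Rightarrow> 'm \<Rightarrow> ('m \<times> 'w \<Rightarrow>\<^sub>0 int) set" where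
  "canonical_connection K H \<Omega> M =
     (\<lambda>m\<in>carrier M.
        let R = tensH K H M (forms \<Omega> 1)
        in sweedler R (rcoact M m) (\<lambda>m' m2. sweedler R (rcoact M m') (\<lambda>m0 m1.
          (m0 \<triangleleft>\<^bsub>M\<^esub> antipode H m1) \<boxtimes>\<^bsub>R\<^esub> diff \<Omega> 0 (incl \<Omega> m2))))"

text \<open>The second summand takes values in \<open>M \<otimes>\<^sub>H (N \<otimes>\<^sub>H \<Omega>\<^sup>1)\<close> and is rebracketed to
  \<open>(M \<otimes>\<^sub>H N) \<otimes>\<^sub>H \<Omega>\<^sup>1\<close>.\<close>

definition connection_sum ::
  "('k, 'o) ring_scheme \<Rightarrow> ('k, 'h, 'x) hopf_scheme \<Rightarrow> ('k, 'h, 'w, 'v) calculus_scheme \<Rightarrow>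
   ('k, 'h, 'm, 'y) bimod_scheme \<Rightarrow> ('k, 'h, 'n, 'z) bimod_scheme \<Rightarrow>
   ('m \<Rightarrow> ('m \<times> 'w \<Rightarrow>\<^sub>0 int) set) \<Rightarrow> ('n \<Rightarrow> ('n \<times> 'w \<Rightarrow>\<^sub>0 int) set) \<Rightarrow>
   (('m \<times> 'n \<Rightarrow>\<^sub>0 int) set \<Rightarrow> (('m \<times> 'n \<Rightarrow>\<^sub>0 int) set \<times> 'w \<Rightarrow>\<^sub>0 int) set)" where
  "connection_sum K H \<Omega> M N DM DN =
     compose (carrier (tensH K H M N)) (woronowicz23 K H M (forms \<Omega> 1) N)
       (hat_tensor K H M (tensH K H M (forms \<Omega> 1)) N N DM (\<lambda>n\<in>carrier N. n))
     \<oplus>\<^bsub>homK K (tensH K H M N) (tensH K H (tensH K H M N) (forms \<Omega> 1))\<^esub>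
     compose (carrier (tensH K H M N)) (assoc_left K H M N (forms \<Omega> 1))
       (hat_tensor K H M M N (tensH K H N (forms \<Omega> 1)) (\<lambda>m\<in>carrier M. m) DN)"

end

theory Submission
  imports Defs
begin

text \<open>A bicovariant bimodule is spanned by the elements \<open>x u\<close> with \<open>x\<close> right coinvariant and \<open>u \<in> H\<close>, so a
  linear map on \<open>M \<otimes>\<^sub>H N\<close> is determined by its values on \<open>x \<otimes> n\<close> with \<open>x\<close> coinvariant. On such elements
  \<open>d\<^sup>M x = 0\<close> and the tensor product of rational maps is \<open>\<phi> (\<psi>\<^bsub>-2\<^esub> x S \<psi>\<^bsub>-1\<^esub>) \<otimes> \<psi>\<^sub>0 n\<close>. Hence the left summand
  vanishes for the connection \<open>d\<^sup>M\<close>, while the right summand of \<open>d\<^sup>N\<close> is the canonical connection of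
  \<open>M \<otimes>\<^sub>H N\<close>. Every connection differs from the canonical one by a right linear map, both summands are
  additive in the connection, and they turn right linear maps into right linear maps; this gives the
  Leibniz rule and the last formula together. Rationality of a right linear map \<open>\<phi>\<close> on a finitely
  generated \<open>M\<close> holds since \<open>m \<mapsto> \<phi>\<^bsub>-1\<^esub> \<otimes> \<phi>\<^sub>0 m\<close> is again right linear in the second leg, so its first leg
  stays in the finite-dimensional space needed for a finite set of generators.\<close>

text \<open>Two obstacles shape the text. A Sweedler sum is evaluated at an arbitrary
  representative, so every manipulation has to be justified on formal sums: linear maps pass through
  a sum and independent sums may be exchanged for arbitrary summands with values in the carrier,
  whereas evaluating at a pure tensor or rewriting the summed element requires multilinearity.
  Moreover \<open>lAd\<close> is a definite description, so nothing can be computed with it before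
  the canonical map from \<open>H \<otimes> Hom(M, N)\<close> to
  \<open>Hom(M, H \<otimes> N)\<close> is known to be injective. In place of a basis of
  \<open>H\<close>, both this injectivity and rationality use finite-rank operators on
  \<open>H\<close> that fix a given finite set, built by rank-one corrections from separating
  functionals. Bicolinear maps such as the identity and the canonical connection have
  \<open>lAd\<close> equal to \<open>1 \<otimes> \<phi>\<close>, which is why the hat tensor product
  becomes explicit on coinvariants. For right linear maps more than rationality is retained: the
  second legs of \<open>lAd\<close> can be chosen right linear, and this is what makes the hat
  tensor product right linear.\<close>

section \<open>Evaluation of formal integer combinations in an abelian group\<close>

definition frag_eval :: "('z, 'p) ring_scheme \<Rightarrow> ('s \<Rightarrow> 'z) \<Rightarrow> ('s \<Rightarrow>\<^sub>0 int) \<Rightarrow> 'z" where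
  "frag_eval Z f c = (\<Oplus>\<^bsub>Z\<^esub>p\<in>Poly_Mapping.keys c. add_pow Z (Poly_Mapping.lookup c p) (f p))"

lemma sweedler_frag_eval:
  "sweedler Z t f = frag_eval Z (\<lambda>p. f (fst p) (snd p)) (SOME c. c \<in> t)"
  by (simp add: sweedler_def frag_eval_def Let_def)

text \<open>Finite sums are defined through this relation. Arguing on it directly allows summands to
  be exchanged without knowing that their values lie in a carrier, as \<open>frag_eval_cong\<close>
  demands for an arbitrary record \<open>Z\<close>.\<close>

lemma foldSetD_cong:
  assumes "(B, x) \<in> foldSetD D f e" "\<And>a. a \<in> B \<Longrightarrow> f a = g a"
  shows "(B, x) \<in> foldSetD D g e"
  using assms
proof (induction rule: foldSetD.induct)
  case (insertI a A y)
  hence "f a = g a" "(A, y) \<in> foldSetD D g e" by auto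
  thus ?case using insertI by (metis foldSetD.insertI)
qed (rule foldSetD.emptyI)

lemma frag_eval_cong:
  fixes Z :: "('b, 'p) ring_scheme"
  assumes "\<And>p. p \<in> Poly_Mapping.keys c \<Longrightarrow> f p = g p"
  shows "frag_eval Z f c = frag_eval Z g c"
proof -
  have "(Poly_Mapping.keys c, x) \<in> foldSetD D (h \<circ> (\<lambda>p. add_pow Z (Poly_Mapping.lookup c p) (f p))) e \<longleftrightarrow>
      (Poly_Mapping.keys c, x) \<in> foldSetD D (h \<circ> (\<lambda>p. add_pow Z (Poly_Mapping.lookup c p) (g p))) e"
    for D and h :: "'b \<Rightarrow> 'b \<Rightarrow> 'b" and e x
    by (rule iffI; erule foldSetD_cong) (simp_all add: assms)
  thus ?thesis
    unfolding frag_eval_def finsum_def finprod_def foldD_def by simp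
qed

context abelian_group
begin

lemma add_pow_int_closed: "x \<in> carrier G \<Longrightarrow> add_pow G (k::int) x \<in> carrier G"
  using add.int_pow_closed[of x k] by (simp add: add_pow_def)

lemma add_pow_int_add:
  "x \<in> carrier G \<Longrightarrow> add_pow G (j + k :: int) x = add_pow G j x \<oplus> add_pow G k x"
  using add.int_pow_mult[of x j k] by (simp add: add_pow_def)

text \<open>Cancellation can make the support of a sum smaller than the union of the supports, so
  values are compared over a common finite index set \<open>B\<close>, on which the extra terms have
  coefficient zero.\<close>

lemma frag_eval_superset:
  assumes "f \<in> S \<rightarrow> carrier G" "Poly_Mapping.keys c \<subseteq> S" "Poly_Mapping.keys c \<subseteq> B" "B \<subseteq> S" "finite B"
  shows "frag_eval G f c = (\<Oplus>p\<in>B. add_pow G (Poly_Mapping.lookup c p) (f p))"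
  unfolding frag_eval_def
proof (rule add.finprod_mono_neutral_cong_left)
  show "add_pow G (Poly_Mapping.lookup c i) (f i) = \<zero>" if "i \<in> B - Poly_Mapping.keys c" for i
    using that by (simp add: in_keys_iff add_pow_def)
qed (use assms in \<open>auto intro!: add_pow_int_closed\<close>)

lemma frag_eval_closed:
  "\<lbrakk>f \<in> S \<rightarrow> carrier G; Poly_Mapping.keys c \<subseteq> S\<rbrakk> \<Longrightarrow> frag_eval G f c \<in> carrier G"
  unfolding frag_eval_def by (rule finsum_closed) (auto intro!: add_pow_int_closed)

lemma frag_eval_add:
  assumes "f \<in> S \<rightarrow> carrier G" "Poly_Mapping.keys c \<subseteq> S" "Poly_Mapping.keys d \<subseteq> S"
  shows "frag_eval G f (c + d) = frag_eval G f c \<oplus> frag_eval G f d"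
proof -
  let ?B = "Poly_Mapping.keys c \<union> Poly_Mapping.keys d"
  have B: "Poly_Mapping.keys (c + d) \<subseteq> ?B" by (rule keys_add)
  have "frag_eval G f (c + d) = (\<Oplus>p\<in>?B. add_pow G (Poly_Mapping.lookup (c + d) p) (f p))"
    by (rule frag_eval_superset[OF assms(1)]) (use assms B in auto)
  also have "\<dots> = (\<Oplus>p\<in>?B. add_pow G (Poly_Mapping.lookup c p) (f p) \<oplus> add_pow G (Poly_Mapping.lookup d p) (f p))"
    by (rule add.finprod_cong') (use assms in \<open>auto simp: lookup_add intro!: add_pow_int_add add_pow_int_closed\<close>)
  also have "\<dots> = (\<Oplus>p\<in>?B. add_pow G (Poly_Mapping.lookup c p) (f p)) \<oplus> (\<Oplus>p\<in>?B. add_pow G (Poly_Mapping.lookup d p) (f p))"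
    by (rule add.finprod_multf) (use assms in \<open>auto intro!: add_pow_int_closed\<close>)
  also have "\<dots> = frag_eval G f c \<oplus> frag_eval G f d"
    by (subst (1 2) frag_eval_superset[OF assms(1), where B = ?B]) (use assms in auto)
  finally show ?thesis .
qed

lemma frag_eval_of: "f p \<in> carrier G \<Longrightarrow> frag_eval G f (frag_of p) = f p"
  using finsum_insert[of "{}" p "\<lambda>q. add_pow G (Poly_Mapping.lookup (frag_of p) q) (f q)"]
    add.int_pow_1[of "f p"]
  by (simp add: frag_eval_def add_pow_def del: add.int_pow_1)

lemma frag_eval_hom:
  assumes "f \<in> S \<rightarrow> carrier G"
  shows "group_hom (free_Abelian_group S) (add_monoid G) (frag_eval G f)"
  by (intro group_hom.intro group_hom_axioms.intro homI)
    (use assms frag_eval_add[OF assms] frag_eval_closed[OF assms] in \<open>auto simp: a_group\<close>)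

lemma frag_eval_zero: "frag_eval G f 0 = \<zero>"
  by (simp add: frag_eval_def)

lemma frag_eval_diff:
  assumes "f \<in> S \<rightarrow> carrier G" "Poly_Mapping.keys c \<subseteq> S" "Poly_Mapping.keys d \<subseteq> S"
  shows "frag_eval G f (c - d) = frag_eval G f c \<ominus> frag_eval G f d"
proof -
  have "Poly_Mapping.keys (c - d) \<subseteq> S"
    using keys_diff[of c d] assms by blast
  hence "frag_eval G f (c - d) \<oplus> frag_eval G f d = frag_eval G f c"
    using frag_eval_add[OF assms(1), of "c - d" d] assms by simp
  thus ?thesis
    using frag_eval_closed[OF assms(1)] assms \<open>Poly_Mapping.keys (c - d) \<subseteq> S\<close>
    by (metis add.inv_solve_right' minus_eq)
qed

text \<open>An additive map between abelian groups respects negatives, hence integer combinations;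
  the induction runs over generators and differences. The summand \<open>f\<close> is arbitrary, so
  the result also applies to sums that are not induced by a balanced map.\<close>

lemma frag_eval_push:
  assumes W: "abelian_group W" and f: "f \<in> S \<rightarrow> carrier G" and c: "Poly_Mapping.keys c \<subseteq> S"
    and g: "\<And>x. x \<in> carrier G \<Longrightarrow> g x \<in> carrier W"
    and g_add: "\<And>x y. \<lbrakk>x \<in> carrier G; y \<in> carrier G\<rbrakk> \<Longrightarrow> g (x \<oplus> y) = g x \<oplus>\<^bsub>W\<^esub> g y"
  shows "g (frag_eval G f c) = frag_eval W (\<lambda>p. g (f p)) c"
proof -
  interpret W: abelian_group W by fact
  interpret g: group_hom "add_monoid G" "add_monoid W" g
    by (intro group_hom.intro group_hom_axioms.intro homI) (simp_all add: a_group W.a_group g g_add)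
  have gf: "(\<lambda>p. g (f p)) \<in> S \<rightarrow> carrier W" using f g by auto
  have g_diff: "g (x \<ominus> y) = g x \<ominus>\<^bsub>W\<^esub> g y" if "x \<in> carrier G" "y \<in> carrier G" for x y
    using that g.hom_inv[of y] by (simp add: minus_eq W.minus_eq g_add a_inv_def)
  have "Poly_Mapping.keys c \<subseteq> S \<and> g (frag_eval G f c) = frag_eval W (\<lambda>p. g (f p)) c"
    using c
  proof (induction c rule: frag_induction)
    case zero
    show ?case using g.hom_one by (simp add: frag_eval_zero W.frag_eval_zero)
  next
    case (one p)
    hence "f p \<in> carrier G" using f by auto
    thus ?case using one by (simp add: frag_eval_of W.frag_eval_of g)
  next
    case (diff a b)
    hence ab: "Poly_Mapping.keys a \<subseteq> S" "Poly_Mapping.keys b \<subseteq> S" by auto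
    have "Poly_Mapping.keys (a - b) \<subseteq> S" using keys_diff[of a b] ab by blast
    thus ?case
      using diff by (simp add: frag_eval_diff[OF f ab] W.frag_eval_diff[OF gf ab] g_diff
          frag_eval_closed[OF f ab(1)] frag_eval_closed[OF f ab(2)])
  qed
  thus ?thesis by simp
qed

lemma frag_eval_fun_add:
  assumes f: "f \<in> S \<rightarrow> carrier G" and g: "g \<in> S \<rightarrow> carrier G" and c: "Poly_Mapping.keys c \<subseteq> S"
  shows "frag_eval G (\<lambda>p. f p \<oplus> g p) c = frag_eval G f c \<oplus> frag_eval G g c"
proof -
  have "frag_eval G (\<lambda>p. f p \<oplus> g p) c =
      (\<Oplus>p\<in>Poly_Mapping.keys c. add_pow G (Poly_Mapping.lookup c p) (f p) \<oplus> add_pow G (Poly_Mapping.lookup c p) (g p))"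
    unfolding frag_eval_def
  proof (rule add.finprod_cong')
    have fg: "f p \<in> carrier G" "g p \<in> carrier G" if "p \<in> Poly_Mapping.keys c" for p
      using that f g c by auto
    show "(\<lambda>p. add_pow G (Poly_Mapping.lookup c p) (f p) \<oplus> add_pow G (Poly_Mapping.lookup c p) (g p))
        \<in> Poly_Mapping.keys c \<rightarrow> carrier G"
      using fg by (auto intro!: add_pow_int_closed)
    show "add_pow G (Poly_Mapping.lookup c p) (f p \<oplus> g p) =
        add_pow G (Poly_Mapping.lookup c p) (f p) \<oplus> add_pow G (Poly_Mapping.lookup c p) (g p)"
      if "p \<in> Poly_Mapping.keys c" for p
      using add.int_pow_distrib[OF fg[OF that]] by (simp add: add_pow_def)
  qed simp
  also have "\<dots> = frag_eval G f c \<oplus> frag_eval G g c"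
    unfolding frag_eval_def
    by (rule add.finprod_multf) (use assms in \<open>auto intro!: add_pow_int_closed\<close>)
  finally show ?thesis .
qed

text \<open>Both sides are additive in \<open>c\<close>, and on a single generator both reduce to
  the evaluation of \<open>f p\<close> at \<open>d\<close>. This is the source of every exchange of
  independent Sweedler sums.\<close>

lemma frag_eval_swap:
  assumes f: "\<And>p q. \<lbrakk>p \<in> S; q \<in> S'\<rbrakk> \<Longrightarrow> f p q \<in> carrier G"
    and c: "Poly_Mapping.keys c \<subseteq> S" and d: "Poly_Mapping.keys d \<subseteq> S'"
  shows "frag_eval G (\<lambda>p. frag_eval G (f p) d) c = frag_eval G (\<lambda>q. frag_eval G (\<lambda>p. f p q) c) d"
proof -
  have 1: "f p \<in> S' \<rightarrow> carrier G" if "p \<in> S" for p using f that by auto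
  have 2: "(\<lambda>p. f p q) \<in> S \<rightarrow> carrier G" if "q \<in> S'" for q using f that by auto
  have 3: "(\<lambda>p. frag_eval G (f p) d) \<in> S \<rightarrow> carrier G"
    using frag_eval_closed[OF 1 d] by auto
  have 4: "(\<lambda>q. frag_eval G (\<lambda>p. f p q) c) \<in> S' \<rightarrow> carrier G" if "Poly_Mapping.keys c \<subseteq> S" for c
    using frag_eval_closed[OF 2 that] by auto
  have "Poly_Mapping.keys c \<subseteq> S \<and> ?thesis"
    using c
  proof (induction c rule: frag_induction)
    case zero
    \<comment> \<open>The value obtained from the zero summand equals its own double, hence
      vanishes.\<close>
    have "frag_eval G (\<lambda>q. \<zero>) d \<oplus> frag_eval G (\<lambda>q. \<zero>) d = frag_eval G (\<lambda>q. \<zero>) d"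
      using frag_eval_fun_add[of "\<lambda>_. \<zero>" S' "\<lambda>_. \<zero>" d] d by simp
    hence "frag_eval G (\<lambda>q. \<zero>) d = \<zero>"
      using frag_eval_closed[of "\<lambda>_. \<zero>" S' d] d by (simp add: add.l_cancel_one')
    thus ?case by (simp add: frag_eval_zero)
  next
    case (one p)
    have "frag_eval G (\<lambda>q. frag_eval G (\<lambda>p. f p q) (frag_of p)) d = frag_eval G (f p) d"
      by (rule frag_eval_cong) (use one d f in \<open>auto simp: frag_eval_of\<close>)
    thus ?case using one frag_eval_closed[OF 1[OF one] d]
      by (simp add: frag_eval_of)
  next
    case (diff a b)
    hence ab: "Poly_Mapping.keys a \<subseteq> S" "Poly_Mapping.keys b \<subseteq> S" by auto
    have ok: "Poly_Mapping.keys (a - b) \<subseteq> S" using keys_diff[of a b] ab by blast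
    let ?F = "\<lambda>c. frag_eval G (\<lambda>q. frag_eval G (\<lambda>p. f p q) c) d"
    have "?F a = frag_eval G (\<lambda>q. frag_eval G (\<lambda>p. f p q) (a - b) \<oplus> frag_eval G (\<lambda>p. f p q) b) d"
      by (rule frag_eval_cong)
        (use d frag_eval_add[OF 2 ok ab(2)] in \<open>auto simp: subset_iff\<close>)
    also have "\<dots> = ?F (a - b) \<oplus> ?F b"
      by (rule frag_eval_fun_add[OF 4[OF ok] 4[OF ab(2)] d])
    finally have "?F (a - b) = ?F a \<ominus> ?F b"
      using frag_eval_closed[OF 4[OF ok] d] frag_eval_closed[OF 4[OF ab(2)] d]
      by (metis add.inv_solve_right' minus_eq frag_eval_closed[OF 4[OF ab(1)] d])
    thus ?case using diff ok by (simp add: frag_eval_diff[OF 3 ab])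
  qed
  thus ?thesis by simp
qed

end

section \<open>Balanced tensor products\<close>

definition balanced_map ::
  "'a set \<Rightarrow> ('m \<Rightarrow> 'a \<Rightarrow> 'm) \<Rightarrow> ('a \<Rightarrow> 'n \<Rightarrow> 'n) \<Rightarrow> ('m, 'p) ring_scheme \<Rightarrow>
   ('n, 'q) ring_scheme \<Rightarrow> ('z, 'r) ring_scheme \<Rightarrow> ('m \<Rightarrow> 'n \<Rightarrow> 'z) \<Rightarrow> bool" where
  "balanced_map A ra la M N Z f \<longleftrightarrow>
     (\<forall>x\<in>carrier M. \<forall>y\<in>carrier N. f x y \<in> carrier Z) \<and>
     (\<forall>x\<in>carrier M. \<forall>x'\<in>carrier M. \<forall>y\<in>carrier N. f (x \<oplus>\<^bsub>M\<^esub> x') y = f x y \<oplus>\<^bsub>Z\<^esub> f x' y) \<and>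
     (\<forall>x\<in>carrier M. \<forall>y\<in>carrier N. \<forall>y'\<in>carrier N. f x (y \<oplus>\<^bsub>N\<^esub> y') = f x y \<oplus>\<^bsub>Z\<^esub> f x y') \<and>
     (\<forall>x\<in>carrier M. \<forall>a\<in>A. \<forall>y\<in>carrier N. f (ra x a) y = f x (la a y))"

locale tensor_datum = M: abelian_group M + N: abelian_group N
  for M :: "('k, 'm, 'p) module_scheme" and N :: "('n, 'q) ring_scheme" +
  fixes A :: "'a set" and ra :: "'m \<Rightarrow> 'a \<Rightarrow> 'm" and la :: "'a \<Rightarrow> 'n \<Rightarrow> 'n"
  assumes ra_closed: "\<lbrakk>x \<in> carrier M; a \<in> A\<rbrakk> \<Longrightarrow> ra x a \<in> carrier M"
    and la_closed: "\<lbrakk>a \<in> A; y \<in> carrier N\<rbrakk> \<Longrightarrow> la a y \<in> carrier N"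
begin

abbreviation "F \<equiv> free_Abelian_group (carrier M \<times> carrier N)"
abbreviation "R \<equiv> generate F (tensor_relators A ra la M N)"
abbreviation "T \<equiv> module_tensor A ra la M N"
abbreviation "keys_ok c \<equiv> Poly_Mapping.keys c \<subseteq> carrier M \<times> carrier N"
abbreviation "coset c \<equiv> R #>\<^bsub>F\<^esub> c"

lemma relators_sub: "tensor_relators A ra la M N \<subseteq> carrier F"
proof -
  have "keys_ok (frag_of p - frag_of q - frag_of r)"
    if "p \<in> carrier M \<times> carrier N" "q \<in> carrier M \<times> carrier N" "r \<in> carrier M \<times> carrier N" for p q r
    using that keys_diff[of "frag_of p - frag_of q" "frag_of r"] keys_diff[of "frag_of p" "frag_of q"]
    by auto
  moreover have "keys_ok (frag_of p - frag_of q)"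
    if "p \<in> carrier M \<times> carrier N" "q \<in> carrier M \<times> carrier N" for p q
    using that keys_diff[of "frag_of p" "frag_of q"] by auto
  ultimately show ?thesis
    unfolding tensor_relators_def by (auto simp: ra_closed la_closed)
qed

sublocale F: comm_group F by (rule abelian_free_Abelian_group)

lemma R_subgroup: "subgroup R F"
  by (rule F.generate_is_subgroup[OF relators_sub])

sublocale R: subgroup R F by (rule R_subgroup)

lemma R_normal: "R \<lhd> F"
  by (rule F.normal_iff_subgroup[THEN iffD2, OF R_subgroup])

lemma FactGroup_comm: "comm_group (F Mod R)"
  by (rule F.abelian_FactGroup[OF R_subgroup])

lemma T_simps:
  "carrier T = carrier (F Mod R)" "\<zero>\<^bsub>T\<^esub> = R" "s \<oplus>\<^bsub>T\<^esub> t = s <#>\<^bsub>F\<^esub> t"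
  by (simp_all add: module_tensor_def tensor_group_def Let_def)

lemma abelian_group_T: "abelian_group T"
proof -
  interpret Q: comm_group "F Mod R" by (rule FactGroup_comm)
  show ?thesis
    using Q.m_closed Q.m_assoc Q.m_comm Q.l_one Q.l_inv_ex Q.one_closed
    by (intro abelian_groupI) (simp_all add: T_simps Bex_def del: Q.l_one)
qed

lemma coset_image: "coset c = (\<lambda>h. h + c) ` R"
  by (auto simp: r_coset_def)

lemma carrier_T: "t \<in> carrier T \<longleftrightarrow> (\<exists>c. keys_ok c \<and> t = coset c)"
  unfolding T_simps carrier_FactGroup by (simp add: image_iff Bex_def)

lemma pure_coset: "x \<boxtimes>\<^bsub>T\<^esub> y = coset (frag_of (x, y))"
  by (simp add: pure_tensor_def T_simps coset_image)

lemma coset_add: "\<lbrakk>keys_ok c; keys_ok d\<rbrakk> \<Longrightarrow> coset c \<oplus>\<^bsub>T\<^esub> coset d = coset (c + d)"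
  using normal.rcos_sum[OF R_normal, of c d] by (simp add: T_simps)

lemma coset_eqI:
  assumes "keys_ok c" "keys_ok d" "c - d \<in> R"
  shows "coset c = coset d"
proof -
  have "c \<in> coset d"
    unfolding coset_image using assms(3) by (auto intro!: image_eqI[of _ _ "c - d"])
  thus ?thesis
    using F.repr_independence[of c R d] assms R_subgroup by auto
qed

lemma relator_in: "c \<in> tensor_relators A ra la M N \<Longrightarrow> c \<in> R"
  by (rule generate.incl)

lemma pure_closed: "\<lbrakk>x \<in> carrier M; y \<in> carrier N\<rbrakk> \<Longrightarrow> x \<boxtimes>\<^bsub>T\<^esub> y \<in> carrier T"
  unfolding carrier_T pure_coset by (rule exI[of _ "frag_of (x, y)"]) simp

lemma keys_ok_add: "\<lbrakk>keys_ok c; keys_ok d\<rbrakk> \<Longrightarrow> keys_ok (c + d)"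
  using keys_add[of c d] by blast

lemma pure_add_left:
  assumes "x \<in> carrier M" "x' \<in> carrier M" "y \<in> carrier N"
  shows "(x \<oplus>\<^bsub>M\<^esub> x') \<boxtimes>\<^bsub>T\<^esub> y = x \<boxtimes>\<^bsub>T\<^esub> y \<oplus>\<^bsub>T\<^esub> x' \<boxtimes>\<^bsub>T\<^esub> y"
proof -
  have "frag_of (x \<oplus>\<^bsub>M\<^esub> x', y) - (frag_of (x, y) + frag_of (x', y)) \<in> R"
    by (rule relator_in) (use assms in \<open>auto simp: tensor_relators_def diff_diff_eq\<close>)
  thus ?thesis
    unfolding pure_coset using assms
    by (subst coset_add) (simp, simp, rule coset_eqI, simp_all add: keys_ok_add)
qed

lemma pure_add_right:
  assumes "x \<in> carrier M" "y \<in> carrier N" "y' \<in> carrier N"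
  shows "x \<boxtimes>\<^bsub>T\<^esub> (y \<oplus>\<^bsub>N\<^esub> y') = x \<boxtimes>\<^bsub>T\<^esub> y \<oplus>\<^bsub>T\<^esub> x \<boxtimes>\<^bsub>T\<^esub> y'"
proof -
  have "frag_of (x, y \<oplus>\<^bsub>N\<^esub> y') - (frag_of (x, y) + frag_of (x, y')) \<in> R"
    by (rule relator_in) (use assms in \<open>auto simp: tensor_relators_def diff_diff_eq\<close>)
  thus ?thesis
    unfolding pure_coset using assms
    by (subst coset_add) (simp, simp, rule coset_eqI, simp_all add: keys_ok_add)
qed

lemma pure_balanced:
  assumes "x \<in> carrier M" "a \<in> A" "y \<in> carrier N"
  shows "ra x a \<boxtimes>\<^bsub>T\<^esub> y = x \<boxtimes>\<^bsub>T\<^esub> la a y"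
proof -
  have "frag_of (ra x a, y) - frag_of (x, la a y) \<in> R"
    by (rule relator_in) (use assms in \<open>auto simp: tensor_relators_def diff_diff_eq\<close>)
  thus ?thesis
    unfolding pure_coset using assms
    by (intro coset_eqI) (simp_all add: ra_closed la_closed)
qed

lemma pure_zero_left:
  assumes "y \<in> carrier N"
  shows "\<zero>\<^bsub>M\<^esub> \<boxtimes>\<^bsub>T\<^esub> y = \<zero>\<^bsub>T\<^esub>"
proof -
  interpret T: abelian_group T by (rule abelian_group_T)
  show ?thesis
    using pure_add_left[of "\<zero>\<^bsub>M\<^esub>" "\<zero>\<^bsub>M\<^esub>" y] pure_closed[of "\<zero>\<^bsub>M\<^esub>" y] assms
    by (simp add: T.add.r_cancel_one')
qed

lemma pure_minus_left:
  assumes "x \<in> carrier M" "y \<in> carrier N"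
  shows "(\<ominus>\<^bsub>M\<^esub> x) \<boxtimes>\<^bsub>T\<^esub> y = \<ominus>\<^bsub>T\<^esub> (x \<boxtimes>\<^bsub>T\<^esub> y)"
proof -
  interpret T: abelian_group T by (rule abelian_group_T)
  show ?thesis
    using pure_add_left[of "\<ominus>\<^bsub>M\<^esub> x" x y] pure_closed assms pure_zero_left
    by (metis M.a_inv_closed M.l_neg T.minus_equality)
qed

text \<open>Pure tensors and sums suffice because the negative of a pure tensor is again pure, by
  negating its left factor.\<close>

lemma T_induct [consumes 1, case_names pure add]:
  assumes "t \<in> carrier T"
    and pure: "\<And>x y. \<lbrakk>x \<in> carrier M; y \<in> carrier N\<rbrakk> \<Longrightarrow> P (x \<boxtimes>\<^bsub>T\<^esub> y)"
    and add: "\<And>s t. \<lbrakk>s \<in> carrier T; t \<in> carrier T; P s; P t\<rbrakk> \<Longrightarrow> P (s \<oplus>\<^bsub>T\<^esub> t)"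
  shows "P t"
proof -
  interpret T: abelian_group T by (rule abelian_group_T)
  \<comment> \<open>Formal sums are generated through differences, so the property is carried along
    for a coset and for its negative at the same time.\<close>
  define Q where "Q c \<longleftrightarrow> keys_ok c \<and> P (coset c) \<and> P (\<ominus>\<^bsub>T\<^esub> coset c)" for c
  obtain c where c: "keys_ok c" "t = coset c" using assms(1) carrier_T by blast
  have "Q c" using c(1)
  proof (induction c rule: frag_induction)
    case zero
    have "coset 0 = \<zero>\<^bsub>T\<^esub>" by (auto simp: coset_image T_simps)
    moreover have "P \<zero>\<^bsub>T\<^esub>"
      using pure[of "\<zero>\<^bsub>M\<^esub>" "\<zero>\<^bsub>N\<^esub>"] by (simp add: pure_zero_left)
    ultimately show ?case by (simp add: Q_def T.minus_equality[of "\<zero>\<^bsub>T\<^esub>" "\<zero>\<^bsub>T\<^esub>"])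
  next
    case (one p)
    obtain x y where p: "p = (x, y)" "x \<in> carrier M" "y \<in> carrier N" using one by (cases p) auto
    show ?case
      using pure[of x y] pure[of "\<ominus>\<^bsub>M\<^esub> x" y] p pure_minus_left[of x y] by (simp add: Q_def pure_coset)
  next
    case (diff a b)
    have True: "keys_ok a" "keys_ok b" and PQ: "P (coset a)" "P (\<ominus>\<^bsub>T\<^esub> coset a)"
        "P (coset b)" "P (\<ominus>\<^bsub>T\<^esub> coset b)" using diff by (simp_all add: Q_def)
    show ?case
    proof -
      have ok: "keys_ok (a - b)" using keys_diff[of a b] True by blast
      have mem: "coset a \<in> carrier T" "coset b \<in> carrier T" "coset (a - b) \<in> carrier T"
        unfolding carrier_T using True ok by auto
      have "coset (a - b) \<oplus>\<^bsub>T\<^esub> coset b = coset a"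
        using coset_add[OF ok, of b] True by simp
      hence eq: "coset (a - b) = coset a \<oplus>\<^bsub>T\<^esub> \<ominus>\<^bsub>T\<^esub> coset b"
        using mem T.add.inv_solve_right' by metis
      hence eq': "\<ominus>\<^bsub>T\<^esub> coset (a - b) = \<ominus>\<^bsub>T\<^esub> coset a \<oplus>\<^bsub>T\<^esub> coset b"
        using mem by (simp add: T.minus_add)
      show ?thesis
        unfolding Q_def eq' unfolding eq using PQ mem ok by (simp add: add)
    qed
  qed
  thus ?thesis by (simp add: Q_def c)
qed

context
  fixes Z :: "('z, 'r) ring_scheme" and f :: "'m \<Rightarrow> 'n \<Rightarrow> 'z"
  assumes Z: "abelian_group Z"
begin

interpretation Z: abelian_group Z by (rule Z)

text \<open>A balanced map sends each of the three families of relators to zero. The kernel of the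
  evaluation is a subgroup, so it contains everything they generate.\<close>

lemma frag_eval_relation:
  assumes bal: "balanced_map A ra la M N Z f" and "c \<in> R"
  shows "frag_eval Z (\<lambda>p. f (fst p) (snd p)) c = \<zero>\<^bsub>Z\<^esub>"
proof -
  let ?f = "\<lambda>p. f (fst p) (snd p)"
  have f: "?f \<in> carrier M \<times> carrier N \<rightarrow> carrier Z"
    using bal by (auto simp: balanced_map_def)
  interpret h: group_hom F "add_monoid Z" "frag_eval Z ?f"
    by (rule Z.frag_eval_hom[OF f])
  have "tensor_relators A ra la M N \<subseteq> kernel F (add_monoid Z) (frag_eval Z ?f)"
  proof
    fix c assume c: "c \<in> tensor_relators A ra la M N"
    have ok: "keys_ok c" 
      using subsetD[OF relators_sub c] unfolding carrier_free_Abelian_group_iff .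
    have ok2: "keys_ok (frag_of p - frag_of q)"
      if "p \<in> carrier M \<times> carrier N" "q \<in> carrier M \<times> carrier N" for p q
      using that keys_diff[of "frag_of p" "frag_of q"] by auto
    have val: "frag_eval Z ?f (frag_of (x, y)) = f x y" "f x y \<in> carrier Z"
      if "x \<in> carrier M" "y \<in> carrier N" for x y
      using that bal by (simp_all add: Z.frag_eval_of balanced_map_def)
    have canc: "(u \<oplus>\<^bsub>Z\<^esub> v) \<ominus>\<^bsub>Z\<^esub> u \<ominus>\<^bsub>Z\<^esub> v = \<zero>\<^bsub>Z\<^esub>" "v \<ominus>\<^bsub>Z\<^esub> v = \<zero>\<^bsub>Z\<^esub>"
      if "u \<in> carrier Z" "v \<in> carrier Z" for u v
    proof -
      have "(u \<oplus>\<^bsub>Z\<^esub> v) \<ominus>\<^bsub>Z\<^esub> u = v"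
        using that by (metis Z.minus_eq Z.add.inv_solve_right' Z.a_comm Z.a_closed)
      thus "(u \<oplus>\<^bsub>Z\<^esub> v) \<ominus>\<^bsub>Z\<^esub> u \<ominus>\<^bsub>Z\<^esub> v = \<zero>\<^bsub>Z\<^esub>" "v \<ominus>\<^bsub>Z\<^esub> v = \<zero>\<^bsub>Z\<^esub>"
        using that by (simp_all add: Z.minus_eq Z.r_neg)
    qed
    consider x x' y where "x \<in> carrier M" "x' \<in> carrier M" "y \<in> carrier N"
        "c = frag_of (x \<oplus>\<^bsub>M\<^esub> x', y) - frag_of (x, y) - frag_of (x', y)"
      | x y y' where "x \<in> carrier M" "y \<in> carrier N" "y' \<in> carrier N"
        "c = frag_of (x, y \<oplus>\<^bsub>N\<^esub> y') - frag_of (x, y) - frag_of (x, y')"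
      | x a y where "x \<in> carrier M" "a \<in> A" "y \<in> carrier N"
        "c = frag_of (ra x a, y) - frag_of (x, la a y)"
      using c unfolding tensor_relators_def
      by (elim UnE CollectE exE conjE) (assumption | rule that(1) that(2) that(3))+
    hence "frag_eval Z ?f c = \<zero>\<^bsub>Z\<^esub>"
    proof cases
      case 1
      moreover have "f (x \<oplus>\<^bsub>M\<^esub> x') y = f x y \<oplus>\<^bsub>Z\<^esub> f x' y"
        using bal 1 by (simp add: balanced_map_def)
      ultimately show ?thesis
        by (simp add: Z.frag_eval_diff[OF f] ok2 val canc)
    next
      case 2
      moreover have "f x (y \<oplus>\<^bsub>N\<^esub> y') = f x y \<oplus>\<^bsub>Z\<^esub> f x y'"
        using bal 2 by (simp add: balanced_map_def)
      ultimately show ?thesis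
        by (simp add: Z.frag_eval_diff[OF f] ok2 val canc)
    next
      case 3
      moreover have "f (ra x a) y = f x (la a y)"
        using bal 3 by (simp add: balanced_map_def)
      ultimately show ?thesis
        by (simp add: Z.frag_eval_diff[OF f] val canc(2)[OF Z.zero_closed] ra_closed la_closed)
    qed
    thus "c \<in> kernel F (add_monoid Z) (frag_eval Z ?f)"
      using ok by (simp add: kernel_def)
  qed
  hence "R \<subseteq> kernel F (add_monoid Z) (frag_eval Z ?f)"
    by (rule F.generate_subgroup_incl) (rule h.subgroup_kernel)
  thus ?thesis using assms(2) by (auto simp: kernel_def)
qed

text \<open>The representative picked by \<open>SOME\<close> differs from \<open>c\<close> by a
  relation, and relations evaluate to zero. Here the dependence on the choice disappears.\<close>

lemma sweedler_coset:
  assumes bal: "balanced_map A ra la M N Z f" and ok: "keys_ok c"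
  shows "sweedler Z (coset c) f = frag_eval Z (\<lambda>p. f (fst p) (snd p)) c"
proof -
  let ?f = "\<lambda>p. f (fst p) (snd p)"
  have f: "?f \<in> carrier M \<times> carrier N \<rightarrow> carrier Z"
    using bal by (auto simp: balanced_map_def)
  define d where "d = (SOME d. d \<in> coset c)"
  have "c \<in> coset c"
    using F.rcos_self[OF _ R_subgroup, of c] ok by simp
  hence "d \<in> coset c" unfolding d_def by (rule someI)
  then obtain h where h: "h \<in> R" "d = h + c" by (auto simp: coset_image)
  have "keys_ok h" 
    using subsetD[OF R.subset h(1)] unfolding carrier_free_Abelian_group_iff .
  have "sweedler Z (coset c) f = frag_eval Z ?f d"
    by (simp add: sweedler_def frag_eval_def d_def Let_def)
  also have "\<dots> = frag_eval Z ?f c"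
    using Z.frag_eval_add[OF f \<open>keys_ok h\<close> ok] frag_eval_relation[OF bal h(1)]
      Z.frag_eval_closed[OF f ok] by (simp add: h)
  finally show ?thesis .
qed

lemma sweedler_pure:
  assumes "balanced_map A ra la M N Z f" "x \<in> carrier M" "y \<in> carrier N"
  shows "sweedler Z (x \<boxtimes>\<^bsub>T\<^esub> y) f = f x y"
  using sweedler_coset[OF assms(1), of "frag_of (x, y)"] assms
  by (simp add: pure_coset Z.frag_eval_of balanced_map_def)

lemma sweedler_add:
  assumes bal: "balanced_map A ra la M N Z f" and "s \<in> carrier T" "t \<in> carrier T"
  shows "sweedler Z (s \<oplus>\<^bsub>T\<^esub> t) f = sweedler Z s f \<oplus>\<^bsub>Z\<^esub> sweedler Z t f"
proof -
  have f: "(\<lambda>p. f (fst p) (snd p)) \<in> carrier M \<times> carrier N \<rightarrow> carrier Z"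
    using bal by (auto simp: balanced_map_def)
  obtain c where c: "keys_ok c" "s = coset c" using assms(2) unfolding carrier_T by auto
  obtain d where d: "keys_ok d" "t = coset d" using assms(3) unfolding carrier_T by auto
  show ?thesis
    unfolding c(2) d(2) coset_add[OF c(1) d(1)] sweedler_coset[OF bal c(1)]
      sweedler_coset[OF bal d(1)] sweedler_coset[OF bal keys_ok_add[OF c(1) d(1)]]
    by (rule Z.frag_eval_add[OF f c(1) d(1)])
qed

end

text \<open>No balancedness is needed for statements about a single sum, since the chosen
  representative only involves pairs of elements of the carriers.\<close>

lemma some_rep_keys:
  assumes "t \<in> carrier T"
  shows "keys_ok (SOME c. c \<in> t)"
proof -
  obtain c where c: "keys_ok c" "t = coset c" using assms carrier_T by blast
  have "c \<in> t" using F.rcos_self[OF _ R_subgroup, of c] c by simp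
  hence "(SOME c. c \<in> t) \<in> t" by (rule someI)
  moreover have "t \<subseteq> carrier F" using c F.r_coset_subset_G[OF R.subset, of c] by simp
  ultimately have "(SOME c. c \<in> t) \<in> carrier F" by (rule rev_subsetD)
  thus ?thesis unfolding carrier_free_Abelian_group_iff .
qed

lemma sweedler_closed:
  assumes "abelian_group Z" "t \<in> carrier T" "\<And>x y. \<lbrakk>x \<in> carrier M; y \<in> carrier N\<rbrakk> \<Longrightarrow> f x y \<in> carrier Z"
  shows "sweedler Z t f \<in> carrier Z"
  unfolding sweedler_frag_eval
  by (rule abelian_group.frag_eval_closed[OF assms(1) _ some_rep_keys[OF assms(2)]])
    (use assms(3) in auto)

lemma sweedler_cong:
  assumes "t \<in> carrier T" "\<And>x y. \<lbrakk>x \<in> carrier M; y \<in> carrier N\<rbrakk> \<Longrightarrow> f x y = g x y"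
  shows "sweedler Z t f = sweedler Z t g"
proof -
  have "f (fst p) (snd p) = g (fst p) (snd p)" if "p \<in> Poly_Mapping.keys (SOME c. c \<in> t)" for p
    using that some_rep_keys[OF assms(1)] assms(2) by auto
  thus ?thesis unfolding sweedler_frag_eval by (rule frag_eval_cong)
qed

end

text \<open>A Sweedler sum reads only the carrier, the zero and the addition of its target. In
  \<open>module_tensor\<close> and \<open>tensH\<close> the scalar multiplication and the actions
  are defined by sums in a smaller record than the final one; this lemma identifies the two
  readings.\<close>

lemma sweedler_record_cong:
  assumes "carrier Z = carrier Z'" "\<zero>\<^bsub>Z\<^esub> = \<zero>\<^bsub>Z'\<^esub>" "\<And>x y. x \<oplus>\<^bsub>Z\<^esub> y = x \<oplus>\<^bsub>Z'\<^esub> y"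
  shows "sweedler Z t f = sweedler Z' t f"
proof -
  have "ring.add Z = ring.add Z'" using assms(3) by blast
  thus ?thesis
    using assms(1,2)
    by (simp add: sweedler_def finsum_def finprod_def add_pow_def int_pow_def nat_pow_def m_inv_def Let_def cong: if_cong)
qed

section \<open>Linear maps and Sweedler sums of linear expressions\<close>

lemma klinear_closed: "\<lbrakk>klinear K V W f; x \<in> carrier V\<rbrakk> \<Longrightarrow> f x \<in> carrier W"
  by (auto simp: klinear_def)

lemma klinear_add:
  "\<lbrakk>klinear K V W f; x \<in> carrier V; y \<in> carrier V\<rbrakk> \<Longrightarrow> f (x \<oplus>\<^bsub>V\<^esub> y) = f x \<oplus>\<^bsub>W\<^esub> f y"
  by (simp add: klinear_def)

lemma klinear_smult:
  "\<lbrakk>klinear K V W f; r \<in> carrier K; x \<in> carrier V\<rbrakk> \<Longrightarrow> f (r \<odot>\<^bsub>V\<^esub> x) = r \<odot>\<^bsub>W\<^esub> f x"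
  by (simp add: klinear_def)

lemma klinearI:
  assumes "\<And>x. x \<in> carrier V \<Longrightarrow> f x \<in> carrier W"
    and "\<And>x y. \<lbrakk>x \<in> carrier V; y \<in> carrier V\<rbrakk> \<Longrightarrow> f (x \<oplus>\<^bsub>V\<^esub> y) = f x \<oplus>\<^bsub>W\<^esub> f y"
    and "\<And>r x. \<lbrakk>r \<in> carrier K; x \<in> carrier V\<rbrakk> \<Longrightarrow> f (r \<odot>\<^bsub>V\<^esub> x) = r \<odot>\<^bsub>W\<^esub> f x"
  shows "klinear K V W f"
  using assms by (auto simp: klinear_def)

lemma klinear_group_hom:
  assumes "klinear K V W f" "abelian_group V" "abelian_group W"
  shows "group_hom (add_monoid V) (add_monoid W) f"
  using assms by (intro group_hom.intro group_hom_axioms.intro homI)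
    (auto simp: klinear_def abelian_group.a_group)

lemma klinear_zero:
  assumes "klinear K V W f" "abelian_group V" "abelian_group W"
  shows "f \<zero>\<^bsub>V\<^esub> = \<zero>\<^bsub>W\<^esub>"
  using group_hom.hom_one[OF klinear_group_hom[OF assms]] by simp

lemma klinear_cong:
  assumes "\<And>x. x \<in> carrier V \<Longrightarrow> f x = g x" "Module.module K V"
  shows "klinear K V W f = klinear K V W g"
proof -
  interpret V: Module.module K V by fact
  show ?thesis unfolding klinear_def using assms(1) by (auto simp: Pi_iff)
qed

text \<open>The summand is cut off outside the carriers. This makes the congruence rule
  \<open>sw_cong\<close> valid for every \<open>t\<close>, so the simplifier may assume carrier
  membership of the bound legs while rewriting below a sum.\<close>

definition sw where
  "sw A B Z t f = sweedler Z t (\<lambda>x y. if x \<in> carrier A \<and> y \<in> carrier B then f x y else undefined)"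

lemma sw_cong [cong]:
  assumes "s = t" "\<And>x y. \<lbrakk>x \<in> carrier A; y \<in> carrier B\<rbrakk> \<Longrightarrow> f x y = g x y"
  shows "sw A B Z s f = sw A B Z t g"
  using assms by (auto simp: sw_def cong: if_cong)

locale tensor_module_datum = tensor_datum M N A ra la + KM: Module.module K M
  for K :: "('k, 'o) ring_scheme" and M :: "('k, 'm, 'p) module_scheme"
    and N :: "('n, 'q) ring_scheme"
    and A :: "'a set" and ra :: "'m \<Rightarrow> 'a \<Rightarrow> 'm" and la :: "'a \<Rightarrow> 'n \<Rightarrow> 'n" +
  assumes ra_smult: "\<lbrakk>r \<in> carrier K; x \<in> carrier M; a \<in> A\<rbrakk> \<Longrightarrow> ra (r \<odot>\<^bsub>M\<^esub> x) a = r \<odot>\<^bsub>M\<^esub> ra x a"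
begin

interpretation T: abelian_group T by (rule abelian_group_T)

lemma pure_balanced_map:
  assumes "r \<in> carrier K"
  shows "balanced_map A ra la M N T (\<lambda>x y. (r \<odot>\<^bsub>M\<^esub> x) \<boxtimes>\<^bsub>T\<^esub> y)"
  using assms
  by (auto simp: balanced_map_def pure_closed pure_add_left pure_add_right KM.smult_r_distr
      ra_smult[symmetric] pure_balanced)

lemma smult_T: "r \<odot>\<^bsub>T\<^esub> t = sweedler T t (\<lambda>x y. (r \<odot>\<^bsub>M\<^esub> x) \<boxtimes>\<^bsub>T\<^esub> y)"
proof -
  define B :: "(('m \<times> 'n \<Rightarrow>\<^sub>0 int) set) ring"
    where "B = \<lparr>carrier = carrier T, monoid.mult = undefined, monoid.one = undefined,
    ring.zero = \<zero>\<^bsub>T\<^esub>, ring.add = (\<lambda>x y. x \<oplus>\<^bsub>T\<^esub> y)\<rparr>"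
  have "r \<odot>\<^bsub>T\<^esub> t = sweedler B t (\<lambda>x y. (r \<odot>\<^bsub>M\<^esub> x) \<boxtimes>\<^bsub>B\<^esub> y)"
    by (simp add: B_def module_tensor_def Let_def)
  also have "\<dots> = sweedler T t (\<lambda>x y. (r \<odot>\<^bsub>M\<^esub> x) \<boxtimes>\<^bsub>T\<^esub> y)"
    by (subst sweedler_record_cong[of B T]) (simp_all add: B_def)
  finally show ?thesis .
qed

lemma smult_pure:
  "\<lbrakk>r \<in> carrier K; x \<in> carrier M; y \<in> carrier N\<rbrakk> \<Longrightarrow> r \<odot>\<^bsub>T\<^esub> (x \<boxtimes>\<^bsub>T\<^esub> y) = (r \<odot>\<^bsub>M\<^esub> x) \<boxtimes>\<^bsub>T\<^esub> y"
  unfolding smult_T by (rule sweedler_pure[OF abelian_group_T pure_balanced_map])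

lemma smult_T_add:
  "\<lbrakk>r \<in> carrier K; s \<in> carrier T; t \<in> carrier T\<rbrakk> \<Longrightarrow> r \<odot>\<^bsub>T\<^esub> (s \<oplus>\<^bsub>T\<^esub> t) = r \<odot>\<^bsub>T\<^esub> s \<oplus>\<^bsub>T\<^esub> r \<odot>\<^bsub>T\<^esub> t"
  unfolding smult_T by (rule sweedler_add[OF abelian_group_T pure_balanced_map])

lemma smult_T_closed: "\<lbrakk>r \<in> carrier K; t \<in> carrier T\<rbrakk> \<Longrightarrow> r \<odot>\<^bsub>T\<^esub> t \<in> carrier T"
  unfolding smult_T by (rule sweedler_closed[OF abelian_group_T]) (auto intro: pure_closed)

lemma module_T: "Module.module K T"
proof (rule moduleI)
  fix r s t assume rs: "r \<in> carrier K" "s \<in> carrier K" and t: "t \<in> carrier T"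
  show "(r \<oplus>\<^bsub>K\<^esub> s) \<odot>\<^bsub>T\<^esub> t = r \<odot>\<^bsub>T\<^esub> t \<oplus>\<^bsub>T\<^esub> s \<odot>\<^bsub>T\<^esub> t"
    using t
    by (induction rule: T_induct)
      (use rs in \<open>simp_all add: smult_pure KM.smult_l_distr pure_add_left smult_T_add smult_T_closed T.a_ac\<close>)
  show "(r \<otimes>\<^bsub>K\<^esub> s) \<odot>\<^bsub>T\<^esub> t = r \<odot>\<^bsub>T\<^esub> (s \<odot>\<^bsub>T\<^esub> t)"
    using t
    by (induction rule: T_induct)
      (use rs in \<open>simp_all add: smult_pure KM.smult_assoc1 smult_T_add smult_T_closed\<close>)
next
  fix t assume t: "t \<in> carrier T"
  show "\<one>\<^bsub>K\<^esub> \<odot>\<^bsub>T\<^esub> t = t"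
    using t by (induction rule: T_induct) (simp_all add: smult_pure smult_T_add)
qed (simp_all add: abelian_group_T smult_T_closed smult_T_add KM.R.cring_axioms)

lemma sweedler_sw: "t \<in> carrier T \<Longrightarrow> sweedler Z t f = sw M N Z t f"
  unfolding sw_def by (rule sweedler_cong) auto

lemma sw_closed:
  assumes "Module.module K Z" "t \<in> carrier T"
    "\<And>x y. \<lbrakk>x \<in> carrier M; y \<in> carrier N\<rbrakk> \<Longrightarrow> f x y \<in> carrier Z"
  shows "sw M N Z t f \<in> carrier Z"
  using sweedler_closed[OF module.axioms(2)[OF assms(1)] assms(2,3)] assms(2) by (simp add: sweedler_sw)

lemma sw_pure:
  assumes "balanced_map A ra la M N Z f" "Module.module K Z" "x \<in> carrier M" "y \<in> carrier N"
  shows "sw M N Z (x \<boxtimes>\<^bsub>T\<^esub> y) f = f x y"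
  using sweedler_pure[OF module.axioms(2)[OF assms(2)] assms(1,3,4)] assms
  by (simp add: sweedler_sw pure_closed)

lemma sw_add:
  assumes "balanced_map A ra la M N Z f" "Module.module K Z" "s \<in> carrier T" "t \<in> carrier T"
  shows "sw M N Z (s \<oplus>\<^bsub>T\<^esub> t) f = sw M N Z s f \<oplus>\<^bsub>Z\<^esub> sw M N Z t f"
  using sweedler_add[OF module.axioms(2)[OF assms(2)] assms(1,3,4)] assms
  by (simp add: sweedler_sw)

text \<open>Scalars act on \<open>T\<close> through the left factor, so homogeneity of
  \<open>f\<close> in its first argument turns into homogeneity of the induced map; the check is
  made on pure tensors.\<close>

lemma sw_klinear:
  assumes f: "balanced_map A ra la M N Z f" and Z: "Module.module K Z"
    and f_smult: "\<And>r x y. \<lbrakk>r \<in> carrier K; x \<in> carrier M; y \<in> carrier N\<rbrakk> \<Longrightarrow>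
      f (r \<odot>\<^bsub>M\<^esub> x) y = r \<odot>\<^bsub>Z\<^esub> f x y"
  shows "klinear K T Z (\<lambda>t. sw M N Z t f)"
proof (rule klinearI)
  interpret Z: Module.module K Z by fact
  interpret T: Module.module K T by (rule module_T)
  have cl: "f x y \<in> carrier Z" if "x \<in> carrier M" "y \<in> carrier N" for x y
    using f that by (simp add: balanced_map_def)
  show "sw M N Z t f \<in> carrier Z" if "t \<in> carrier T" for t
    using that Z by (simp add: sw_closed cl)
  show "sw M N Z (s \<oplus>\<^bsub>T\<^esub> t) f = sw M N Z s f \<oplus>\<^bsub>Z\<^esub> sw M N Z t f"
    if "s \<in> carrier T" "t \<in> carrier T" for s t
    using that Z f by (simp add: sw_add)
  fix r t assume r: "r \<in> carrier K" and t: "t \<in> carrier T"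
  show "sw M N Z (r \<odot>\<^bsub>T\<^esub> t) f = r \<odot>\<^bsub>Z\<^esub> sw M N Z t f"
    using t
  proof (induction rule: T_induct)
    case (pure x y)
    thus ?case using r f Z by (simp add: smult_pure f_smult sw_pure)
  next
    case (add s t)
    thus ?case using r f Z by (simp add: T.smult_r_distr Z.smult_r_distr sw_add sw_closed cl)
  qed
qed

lemma sw_push:
  assumes g: "klinear K Z W g" and Z: "Module.module K Z" and W: "Module.module K W"
    and t: "t \<in> carrier T"
    and f: "\<And>x y. \<lbrakk>x \<in> carrier M; y \<in> carrier N\<rbrakk> \<Longrightarrow> f x y \<in> carrier Z"
  shows "g (sw M N Z t f) = sw M N W t (\<lambda>x y. g (f x y))"
  unfolding sweedler_sw[OF t, symmetric] sweedler_frag_eval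
  by (rule abelian_group.frag_eval_push[OF module.axioms(2)[OF Z] module.axioms(2)[OF W] _ some_rep_keys[OF t]])
    (use f g in \<open>auto simp: klinear_def\<close>)

lemma sw_fun_add:
  assumes Z: "Module.module K Z" and t: "t \<in> carrier T"
    and f: "\<And>x y. \<lbrakk>x \<in> carrier M; y \<in> carrier N\<rbrakk> \<Longrightarrow> f x y \<in> carrier Z"
    and g: "\<And>x y. \<lbrakk>x \<in> carrier M; y \<in> carrier N\<rbrakk> \<Longrightarrow> g x y \<in> carrier Z"
  shows "sw M N Z t (\<lambda>x y. f x y \<oplus>\<^bsub>Z\<^esub> g x y) = sw M N Z t f \<oplus>\<^bsub>Z\<^esub> sw M N Z t g"
  unfolding sweedler_sw[OF t, symmetric] sweedler_frag_eval
  by (rule abelian_group.frag_eval_fun_add[OF module.axioms(2)[OF Z] _ _ some_rep_keys[OF t]])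
    (use f g in auto)

text \<open>The representative depends on \<open>t\<close> alone and is the same for all values of
  the parameter, so linearity holds summand by summand.\<close>

lemma sw_klinear_param:
  assumes Z: "Module.module K Z" and t: "t \<in> carrier T"
    and f: "\<And>u v. \<lbrakk>u \<in> carrier M; v \<in> carrier N\<rbrakk> \<Longrightarrow> klinear K V Z (\<lambda>x. f x u v)"
  shows "klinear K V Z (\<lambda>x. sw M N Z t (f x))"
proof (rule klinearI)
  interpret Z: Module.module K Z by fact
  have smult: "klinear K Z Z (\<lambda>z. r \<odot>\<^bsub>Z\<^esub> z)" if "r \<in> carrier K" for r
    using that by (intro klinearI) (auto simp: Z.smult_r_distr Z.smult_assoc1[symmetric] KM.R.m_comm)
  note [simp] = klinear_closed[OF f]
  show "sw M N Z t (f x) \<in> carrier Z" if "x \<in> carrier V" for x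
    using that by (simp add: sw_closed[OF Z t])
  show "sw M N Z t (f (x \<oplus>\<^bsub>V\<^esub> y)) = sw M N Z t (f x) \<oplus>\<^bsub>Z\<^esub> sw M N Z t (f y)"
    if "x \<in> carrier V" "y \<in> carrier V" for x y
    using klinear_add[OF f] that by (simp add: sw_fun_add[OF Z t, symmetric])
  show "sw M N Z t (f (r \<odot>\<^bsub>V\<^esub> x)) = r \<odot>\<^bsub>Z\<^esub> sw M N Z t (f x)"
    if "r \<in> carrier K" "x \<in> carrier V" for r x
    using klinear_smult[OF f] that by (simp add: sw_push[OF smult Z Z t])
qed

end

lemma sw_swap_datum:
  assumes D: "tensor_module_datum K A B I ra la" and E: "tensor_module_datum K C D J rb lb"
    and Z: "Module.module K Z"
    and t: "t \<in> carrier (module_tensor I ra la A B)" and s: "s \<in> carrier (module_tensor J rb lb C D)"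
    and f: "\<And>x y u v. \<lbrakk>x \<in> carrier A; y \<in> carrier B; u \<in> carrier C; v \<in> carrier D\<rbrakk> \<Longrightarrow>
      f x y u v \<in> carrier Z"
  shows "sw A B Z t (\<lambda>x y. sw C D Z s (f x y)) = sw C D Z s (\<lambda>u v. sw A B Z t (\<lambda>x y. f x y u v))"
proof -
  interpret AB: tensor_module_datum K A B I ra la by fact
  interpret CD: tensor_module_datum K C D J rb lb by fact
  show ?thesis
    unfolding AB.sweedler_sw[OF t, symmetric] CD.sweedler_sw[OF s, symmetric] sweedler_frag_eval
    by (rule abelian_group.frag_eval_swap[OF module.axioms(2)[OF Z] _ AB.some_rep_keys[OF t]
        CD.some_rep_keys[OF s], of "\<lambda>p q. f (fst p) (snd p) (fst q) (snd q)"])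
      (use f in auto)
qed

section \<open>Bilinear maps and tensor products over the base field\<close>

context hopf_algebra
begin

abbreviation "kmod V \<equiv> Module.module K V"

lemma K_cring: "cring K"
  using field by (simp add: field.axioms(1) domain.axioms(1))

lemma kmod_H [simp]: "kmod H"
  by (rule module)

lemma kmod_group: "kmod V \<Longrightarrow> abelian_group V"
  by (rule module.axioms(2))

definition bil where
  "bil A B Z f \<longleftrightarrow> (\<forall>x\<in>carrier A. klinear K B Z (f x)) \<and> (\<forall>y\<in>carrier B. klinear K A Z (\<lambda>x. f x y))"

lemma bilI:
  assumes "\<And>x. x \<in> carrier A \<Longrightarrow> klinear K B Z (\<lambda>y. f x y)"
    and "\<And>y. y \<in> carrier B \<Longrightarrow> klinear K A Z (\<lambda>x. f x y)"
  shows "bil A B Z f"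
  using assms by (simp add: bil_def)

lemma bil1: "bil A B Z f \<Longrightarrow> x \<in> carrier A \<Longrightarrow> klinear K B Z (f x)"
  by (simp add: bil_def)

lemma bil2: "bil A B Z f \<Longrightarrow> y \<in> carrier B \<Longrightarrow> klinear K A Z (\<lambda>x. f x y)"
  by (simp add: bil_def)

lemma bil_closed: "\<lbrakk>bil A B Z f; x \<in> carrier A; y \<in> carrier B\<rbrakk> \<Longrightarrow> f x y \<in> carrier Z"
  by (metis bil1 klinear_closed)

lemma tensK_datum:
  assumes "kmod A" "kmod B"
  shows "tensor_module_datum K A B (carrier K) (\<lambda>x r. r \<odot>\<^bsub>A\<^esub> x) (\<lambda>r y. r \<odot>\<^bsub>B\<^esub> y)"
proof -
  interpret A: Module.module K A by fact
  interpret B: Module.module K B by fact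
  show ?thesis
    by unfold_locales (auto simp: A.smult_assoc1[symmetric] A.R.m_comm)
qed

lemma bil_balanced:
  assumes "bil A B Z f" "kmod A" "kmod B"
  shows "balanced_map (carrier K) (\<lambda>x r. r \<odot>\<^bsub>A\<^esub> x) (\<lambda>r y. r \<odot>\<^bsub>B\<^esub> y) A B Z f"
  using bil_closed[OF assms(1)] klinear_add[OF bil1[OF assms(1)]] klinear_add[OF bil2[OF assms(1)]]
    klinear_smult[OF bil1[OF assms(1)]] klinear_smult[OF bil2[OF assms(1)]]
  unfolding balanced_map_def by simp

context
  fixes A :: "('k, 'a, 'p) module_scheme" and B :: "('k, 'b, 'q) module_scheme"
  assumes A: "kmod A" and B: "kmod B"
begin

interpretation D: tensor_module_datum K A B "carrier K" "\<lambda>x r. r \<odot>\<^bsub>A\<^esub> x" "\<lambda>r y. r \<odot>\<^bsub>B\<^esub> y"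
  by (rule tensK_datum[OF A B])

lemmas tensK_fold = tensK_def[symmetric, of K A B]

lemma kmod_tensK [simp]: "kmod (tensK K A B)"
  unfolding tensK_def by (rule D.module_T)

lemma tensK_closed [simp]:
  "\<lbrakk>x \<in> carrier A; y \<in> carrier B\<rbrakk> \<Longrightarrow> x \<boxtimes>\<^bsub>tensK K A B\<^esub> y \<in> carrier (tensK K A B)"
  unfolding tensK_def by (rule D.pure_closed)

lemma tensK_bil: "bil A B (tensK K A B) (\<lambda>x y. x \<boxtimes>\<^bsub>tensK K A B\<^esub> y)"
  by (intro bilI klinearI)
    (simp_all add: D.smult_pure[unfolded tensK_fold] D.pure_balanced[unfolded tensK_fold, symmetric]
      D.pure_add_left[unfolded tensK_fold] D.pure_add_right[unfolded tensK_fold])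

lemmas tensK_induct [consumes 1, case_names pure add] = D.T_induct[unfolded tensK_fold]
lemmas sweedler_sw = D.sweedler_sw[unfolded tensK_fold]
lemmas sw_closed [simp] = D.sw_closed[unfolded tensK_fold]
lemmas sw_push = D.sw_push[unfolded tensK_fold]
lemmas sw_fun_add = D.sw_fun_add[unfolded tensK_fold]
lemmas sw_klinear_param [simp] = D.sw_klinear_param[unfolded tensK_fold]

lemma sw_pure [simp]:
  assumes "bil A B Z f" "kmod Z" "x \<in> carrier A" "y \<in> carrier B"
  shows "sw A B Z (x \<boxtimes>\<^bsub>tensK K A B\<^esub> y) f = f x y"
  by (rule D.sw_pure[unfolded tensK_fold, OF bil_balanced[OF assms(1) A B] assms(2-4)])

lemma sw_klinear_tens:
  assumes "bil A B Z f" "kmod Z"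
  shows "klinear K (tensK K A B) Z (\<lambda>t. sw A B Z t f)"
  by (rule D.sw_klinear[unfolded tensK_fold, OF bil_balanced[OF assms(1) A B] assms(2)])
    (rule klinear_smult[OF bil2[OF assms(1)]])

end

lemma sw_swap:
  assumes A: "kmod A" and B: "kmod B" and C: "kmod C" and D: "kmod D" and Z: "kmod Z"
    and t: "t \<in> carrier (tensK K A B)" and s: "s \<in> carrier (tensK K C D)"
    and f: "\<And>x y u v. \<lbrakk>x \<in> carrier A; y \<in> carrier B; u \<in> carrier C; v \<in> carrier D\<rbrakk> \<Longrightarrow>
      f x y u v \<in> carrier Z"
  shows "sw A B Z t (\<lambda>x y. sw C D Z s (f x y)) = sw C D Z s (\<lambda>u v. sw A B Z t (\<lambda>x y. f x y u v))"
  by (rule sw_swap_datum[OF tensK_datum[OF A B] tensK_datum[OF C D] Z, folded tensK_def, OF t s f])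

section \<open>Hopf algebras\<close>

abbreviation "HH \<equiv> tensK K H H"
abbreviation "Dl \<equiv> comult H"
abbreviation "S \<equiv> antipode H"
abbreviation "eps \<equiv> counit H"
abbreviation "csum Z a f \<equiv> sw H H Z (comult H a) f"

lemma mult_simps [simp]:
  "\<lbrakk>a \<in> carrier H; b \<in> carrier H\<rbrakk> \<Longrightarrow> a \<otimes>\<^bsub>H\<^esub> b \<in> carrier H"
  "\<one>\<^bsub>H\<^esub> \<in> carrier H"
  "a \<in> carrier H \<Longrightarrow> \<one>\<^bsub>H\<^esub> \<otimes>\<^bsub>H\<^esub> a = a"
  "a \<in> carrier H \<Longrightarrow> a \<otimes>\<^bsub>H\<^esub> \<one>\<^bsub>H\<^esub> = a"
proof -
  interpret H: Ring.ring H by (rule ring)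
  show "\<lbrakk>a \<in> carrier H; b \<in> carrier H\<rbrakk> \<Longrightarrow> a \<otimes>\<^bsub>H\<^esub> b \<in> carrier H"
  "\<one>\<^bsub>H\<^esub> \<in> carrier H"
  "a \<in> carrier H \<Longrightarrow> \<one>\<^bsub>H\<^esub> \<otimes>\<^bsub>H\<^esub> a = a"
  "a \<in> carrier H \<Longrightarrow> a \<otimes>\<^bsub>H\<^esub> \<one>\<^bsub>H\<^esub> = a" by auto
qed

lemma m_assoc:
  "\<lbrakk>a \<in> carrier H; b \<in> carrier H; c \<in> carrier H\<rbrakk> \<Longrightarrow> a \<otimes>\<^bsub>H\<^esub> b \<otimes>\<^bsub>H\<^esub> c = a \<otimes>\<^bsub>H\<^esub> (b \<otimes>\<^bsub>H\<^esub> c)"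
proof -
  interpret H: Ring.ring H by (rule ring)
  show "\<lbrakk>a \<in> carrier H; b \<in> carrier H; c \<in> carrier H\<rbrakk> \<Longrightarrow> ?thesis" by (rule H.m_assoc)
qed

lemma smult_closed [simp]:
  "\<lbrakk>kmod V; r \<in> carrier K; x \<in> carrier V\<rbrakk> \<Longrightarrow> r \<odot>\<^bsub>V\<^esub> x \<in> carrier V"
  by (rule module.smult_closed)

lemma comult_closed [simp]: "a \<in> carrier H \<Longrightarrow> comult H a \<in> carrier HH"
  by (rule klinear_closed[OF comult_linear])

lemma S_closed [simp]: "a \<in> carrier H \<Longrightarrow> S a \<in> carrier H"
  by (rule klinear_closed[OF antipode_linear])

lemma eps_closed [simp]: "a \<in> carrier H \<Longrightarrow> eps a \<in> carrier K"
  using counit_ring_hom by (rule ring_hom_closed)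

lemma eps_mult: "\<lbrakk>a \<in> carrier H; b \<in> carrier H\<rbrakk> \<Longrightarrow> eps (a \<otimes>\<^bsub>H\<^esub> b) = eps a \<otimes>\<^bsub>K\<^esub> eps b"
  using counit_ring_hom by (rule ring_hom_mult)

lemma eps_add: "\<lbrakk>a \<in> carrier H; b \<in> carrier H\<rbrakk> \<Longrightarrow> eps (a \<oplus>\<^bsub>H\<^esub> b) = eps a \<oplus>\<^bsub>K\<^esub> eps b"
  using counit_ring_hom by (rule ring_hom_add)

lemma eps_one: "eps \<one>\<^bsub>H\<^esub> = \<one>\<^bsub>K\<^esub>"
  using counit_ring_hom by (rule ring_hom_one)

lemma smult_one [simp]: "\<lbrakk>kmod V; x \<in> carrier V\<rbrakk> \<Longrightarrow> \<one>\<^bsub>K\<^esub> \<odot>\<^bsub>V\<^esub> x = x"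
  by (rule module.smult_one)

text \<open>The \<open>[simp]\<close> rules derived from this one prove linearity of a nested
  expression by following its structure. The side conditions of nearly all later Sweedler rewriting
  are of this kind.\<close>

lemma lin_comp:
  "\<lbrakk>klinear K A B g; klinear K V A f\<rbrakk> \<Longrightarrow> klinear K V B (\<lambda>x. g (f x))"
  unfolding klinear_def by (auto simp: Pi_iff)

lemma lin_id [simp]: "klinear K V V (\<lambda>x. x)"
  by (simp add: klinear_def)

lemma lin_S [simp]: "klinear K V H f \<Longrightarrow> klinear K V H (\<lambda>x. S (f x))"
  by (rule lin_comp[OF antipode_linear])

lemma lin_comult [simp]: "klinear K V H f \<Longrightarrow> klinear K V HH (\<lambda>x. Dl (f x))"
  by (rule lin_comp[OF comult_linear])

declare antipode_linear [simp] comult_linear [simp]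

lemma bil_comp1: "bil A B Z g \<Longrightarrow> klinear K V A f \<Longrightarrow> b \<in> carrier B \<Longrightarrow> klinear K V Z (\<lambda>x. g (f x) b)"
  by (rule lin_comp[OF bil2])

lemma bil_comp2: "bil A B Z g \<Longrightarrow> klinear K V B f \<Longrightarrow> a \<in> carrier A \<Longrightarrow> klinear K V Z (\<lambda>x. g a (f x))"
  by (rule lin_comp[OF bil1])

lemma mult_bil: "bil H H H (\<lambda>a b. a \<otimes>\<^bsub>H\<^esub> b)"
proof -
  interpret H: Ring.ring H by (rule ring)
  show ?thesis
    by (intro bilI klinearI) (auto simp: H.l_distr H.r_distr smult_mult)
qed

lemmas lin_mult [simp] = bil_comp1[OF mult_bil] bil_comp2[OF mult_bil]

lemma smult_bil_eps: "kmod Z \<Longrightarrow> bil H Z Z (\<lambda>a z. eps a \<odot>\<^bsub>Z\<^esub> z)"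
  by (intro bilI klinearI)
    (auto simp: eps_add counit_smult module.smult_l_distr module.smult_r_distr module.smult_assoc1[symmetric]
      cring.cring_simprules(14)[OF K_cring])

lemmas lin_eps [simp] = bil_comp1[OF smult_bil_eps] bil_comp2[OF smult_bil_eps]

lemma smult_klinear: "\<lbrakk>kmod Z; r \<in> carrier K\<rbrakk> \<Longrightarrow> klinear K Z Z (\<lambda>z. r \<odot>\<^bsub>Z\<^esub> z)"
  by (intro klinearI)
    (auto simp: module.smult_r_distr module.smult_assoc1[symmetric] cring.cring_simprules(14)[OF K_cring])

lemma lin_smult [simp]:
  "\<lbrakk>kmod Z; r \<in> carrier K; klinear K V Z f\<rbrakk> \<Longrightarrow> klinear K V Z (\<lambda>x. r \<odot>\<^bsub>Z\<^esub> f x)"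
  by (rule lin_comp[OF smult_klinear])

lemma lin_tensK [simp]:
  "\<lbrakk>kmod A; kmod B; klinear K V A f; b \<in> carrier B\<rbrakk> \<Longrightarrow> klinear K V (tensK K A B) (\<lambda>x. f x \<boxtimes>\<^bsub>tensK K A B\<^esub> b)"
  "\<lbrakk>kmod A; kmod B; klinear K V B g; a \<in> carrier A\<rbrakk> \<Longrightarrow> klinear K V (tensK K A B) (\<lambda>x. a \<boxtimes>\<^bsub>tensK K A B\<^esub> g x)"
  by (rule bil_comp1[OF tensK_bil] bil_comp2[OF tensK_bil]; assumption)+

lemma lin_sw1 [simp]:
  "\<lbrakk>kmod A; kmod B; kmod Z; klinear K V (tensK K A B) g; bil A B Z f\<rbrakk> \<Longrightarrow>
    klinear K V Z (\<lambda>x. sw A B Z (g x) f)"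
  by (rule lin_comp[OF sw_klinear_tens])

definition tri where
  "tri A B C Z f \<longleftrightarrow> (\<forall>a\<in>carrier A. bil B C Z (f a)) \<and> (\<forall>b\<in>carrier B. bil A C Z (\<lambda>a c. f a b c))
    \<and> (\<forall>c\<in>carrier C. bil A B Z (\<lambda>a b. f a b c))"

lemma tri_comp:
  assumes "tri A B C Z g"
  shows "\<lbrakk>klinear K V A p; b \<in> carrier B; c \<in> carrier C\<rbrakk> \<Longrightarrow> klinear K V Z (\<lambda>x. g (p x) b c)"
    and "\<lbrakk>klinear K V B q; a \<in> carrier A; c \<in> carrier C\<rbrakk> \<Longrightarrow> klinear K V Z (\<lambda>x. g a (q x) c)"
    and "\<lbrakk>klinear K V C r; a \<in> carrier A; b \<in> carrier B\<rbrakk> \<Longrightarrow> klinear K V Z (\<lambda>x. g a b (r x))"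
  using assms by (auto simp: tri_def intro: bil_comp1 bil_comp2)

lemma tri_closed:
  "\<lbrakk>tri A B C Z f; a \<in> carrier A; b \<in> carrier B; c \<in> carrier C\<rbrakk> \<Longrightarrow> f a b c \<in> carrier Z"
  unfolding tri_def by (metis bil_closed)

lemma sweedler_comult: "a \<in> carrier H \<Longrightarrow> sweedler Z (Dl a) f = csum Z a f"
  by (simp add: sweedler_sw)

text \<open>Coassociativity is an identity in \<open>tensK K HH H\<close>. A trilinear
  \<open>f\<close> induces the linear map \<open>?g\<close> on that space, which transports the
  identity to the target \<open>Z\<close>. The comodule laws below are brought into usable form in
  the same way.\<close>

lemma c_coassoc:
  assumes "a \<in> carrier H" "kmod Z" and f: "tri H H H Z f"
  shows "csum Z a (\<lambda>b a3. csum Z b (\<lambda>a1 a2. f a1 a2 a3)) =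
    csum Z a (\<lambda>a1 b. csum Z b (\<lambda>a2 a3. f a1 a2 a3))"
proof -
  let ?T = "tensK K HH H"
  let ?g = "\<lambda>t. sw HH H Z t (\<lambda>s c. sw H H Z s (\<lambda>a b. f a b c))"
  note [simp] = tri_comp[OF f] tri_closed[OF f]
  have g: "klinear K ?T Z ?g"
    using assms by (simp add: bil_def)
  have "?g (csum ?T a (\<lambda>b a3. csum ?T b (\<lambda>a1 a2. (a1 \<boxtimes>\<^bsub>HH\<^esub> a2) \<boxtimes>\<^bsub>?T\<^esub> a3))) =
      ?g (csum ?T a (\<lambda>a1 b. csum ?T b (\<lambda>a2 a3. (a1 \<boxtimes>\<^bsub>HH\<^esub> a2) \<boxtimes>\<^bsub>?T\<^esub> a3)))"
    using coassoc[OF assms(1)] assms(1) by (simp add: sweedler_comult)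
  thus ?thesis
    using assms by (simp add: sw_push[OF _ _ g] bil_def)
qed

lemma c_counit1:
  assumes "a \<in> carrier H" "kmod Z" and f: "klinear K H Z f"
  shows "csum Z a (\<lambda>a1 a2. eps a1 \<odot>\<^bsub>Z\<^esub> f a2) = f a"
proof -
  have "f a = f (csum H a (\<lambda>a1 a2. eps a1 \<odot>\<^bsub>H\<^esub> a2))"
    using counit(1)[OF assms(1)] assms(1) by (simp add: sweedler_comult)
  also have "\<dots> = csum Z a (\<lambda>a1 a2. eps a1 \<odot>\<^bsub>Z\<^esub> f a2)"
    using assms by (simp add: sw_push[OF _ _ f] klinear_smult[OF f])
  finally show ?thesis by simp
qed

lemma c_counit2:
  assumes "a \<in> carrier H" "kmod Z" and f: "klinear K H Z f"
  shows "csum Z a (\<lambda>a1 a2. eps a2 \<odot>\<^bsub>Z\<^esub> f a1) = f a"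
proof -
  have "f a = f (csum H a (\<lambda>a1 a2. eps a2 \<odot>\<^bsub>H\<^esub> a1))"
    using counit(2)[OF assms(1)] assms(1) by (simp add: sweedler_comult)
  also have "\<dots> = csum Z a (\<lambda>a1 a2. eps a2 \<odot>\<^bsub>Z\<^esub> f a1)"
    using assms by (simp add: sw_push[OF _ _ f] klinear_smult[OF f])
  finally show ?thesis by simp
qed

lemma c_antipode1:
  assumes "a \<in> carrier H" "kmod Z" and f: "klinear K H Z f"
  shows "csum Z a (\<lambda>a1 a2. f (S a1 \<otimes>\<^bsub>H\<^esub> a2)) = eps a \<odot>\<^bsub>Z\<^esub> f \<one>\<^bsub>H\<^esub>"
proof -
  have "f (csum H a (\<lambda>a1 a2. S a1 \<otimes>\<^bsub>H\<^esub> a2)) = eps a \<odot>\<^bsub>Z\<^esub> f \<one>\<^bsub>H\<^esub>"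
    using antipode(1)[OF assms(1)] assms by (simp add: sweedler_comult klinear_smult[OF f])
  thus ?thesis
    using assms by (simp add: sw_push[OF _ _ f])
qed

lemma c_antipode2:
  assumes "a \<in> carrier H" "kmod Z" and f: "klinear K H Z f"
  shows "csum Z a (\<lambda>a1 a2. f (a1 \<otimes>\<^bsub>H\<^esub> S a2)) = eps a \<odot>\<^bsub>Z\<^esub> f \<one>\<^bsub>H\<^esub>"
proof -
  have "f (csum H a (\<lambda>a1 a2. a1 \<otimes>\<^bsub>H\<^esub> S a2)) = eps a \<odot>\<^bsub>Z\<^esub> f \<one>\<^bsub>H\<^esub>"
    using antipode(2)[OF assms(1)] assms by (simp add: sweedler_comult klinear_smult[OF f])
  thus ?thesis
    using assms by (simp add: sw_push[OF _ _ f])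
qed

text \<open>Cancellation of an antipode against its neighbour in a threefold coproduct. In the last
  two identities the cancelling pair already sits in the inner coproduct; in the first two,
  coassociativity moves it there.\<close>

lemma c_cancel:
  assumes a: "a \<in> carrier H" and Z: "kmod Z" and f: "bil H H Z f"
  shows "csum Z a (\<lambda>a1 b. csum Z b (\<lambda>a2 a3. f (S a1 \<otimes>\<^bsub>H\<^esub> a2) a3)) = f \<one>\<^bsub>H\<^esub> a"
    and "csum Z a (\<lambda>a1 b. csum Z b (\<lambda>a2 a3. f (a1 \<otimes>\<^bsub>H\<^esub> S a2) a3)) = f \<one>\<^bsub>H\<^esub> a"
    and "csum Z a (\<lambda>a1 b. csum Z b (\<lambda>a2 a3. f a1 (S a2 \<otimes>\<^bsub>H\<^esub> a3))) = f a \<one>\<^bsub>H\<^esub>"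
    and "csum Z a (\<lambda>a1 b. csum Z b (\<lambda>a2 a3. f a1 (a2 \<otimes>\<^bsub>H\<^esub> S a3))) = f a \<one>\<^bsub>H\<^esub>"
proof -
  note [simp] = bil_comp1[OF f] bil_comp2[OF f] bil1[OF f] bil2[OF f] bil_closed[OF f] Z a
  have "csum Z a (\<lambda>a1 b. csum Z b (\<lambda>a2 a3. f (S a1 \<otimes>\<^bsub>H\<^esub> a2) a3)) =
      csum Z a (\<lambda>b a3. csum Z b (\<lambda>a1 a2. f (S a1 \<otimes>\<^bsub>H\<^esub> a2) a3))"
    by (subst c_coassoc) (simp_all add: tri_def bil_def)
  also have "\<dots> = f \<one>\<^bsub>H\<^esub> a"
    by (simp add: c_antipode1[where f = "\<lambda>x. f x u" for u] c_counit1)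
  finally show "csum Z a (\<lambda>a1 b. csum Z b (\<lambda>a2 a3. f (S a1 \<otimes>\<^bsub>H\<^esub> a2) a3)) = f \<one>\<^bsub>H\<^esub> a" .
  have "csum Z a (\<lambda>a1 b. csum Z b (\<lambda>a2 a3. f (a1 \<otimes>\<^bsub>H\<^esub> S a2) a3)) =
      csum Z a (\<lambda>b a3. csum Z b (\<lambda>a1 a2. f (a1 \<otimes>\<^bsub>H\<^esub> S a2) a3))"
    by (subst c_coassoc) (simp_all add: tri_def bil_def)
  also have "\<dots> = f \<one>\<^bsub>H\<^esub> a"
    by (simp add: c_antipode2[where f = "\<lambda>x. f x u" for u] c_counit1)
  finally show "csum Z a (\<lambda>a1 b. csum Z b (\<lambda>a2 a3. f (a1 \<otimes>\<^bsub>H\<^esub> S a2) a3)) = f \<one>\<^bsub>H\<^esub> a" .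
  show "csum Z a (\<lambda>a1 b. csum Z b (\<lambda>a2 a3. f a1 (S a2 \<otimes>\<^bsub>H\<^esub> a3))) = f a \<one>\<^bsub>H\<^esub>"
    by (simp add: c_antipode1 c_counit2[where f = "\<lambda>x. f x \<one>\<^bsub>H\<^esub>"])
  show "csum Z a (\<lambda>a1 b. csum Z b (\<lambda>a2 a3. f a1 (a2 \<otimes>\<^bsub>H\<^esub> S a3))) = f a \<one>\<^bsub>H\<^esub>"
    by (simp add: c_antipode2 c_counit2[where f = "\<lambda>x. f x \<one>\<^bsub>H\<^esub>"])
qed

lemma c_mult:
  assumes "a \<in> carrier H" "b \<in> carrier H" "kmod Z" and f: "bil H H Z f"
  shows "csum Z (a \<otimes>\<^bsub>H\<^esub> b) f =
    csum Z a (\<lambda>a1 a2. csum Z b (\<lambda>b1 b2. f (a1 \<otimes>\<^bsub>H\<^esub> b1) (a2 \<otimes>\<^bsub>H\<^esub> b2)))"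
  using assms bil_closed[OF f]
  by (simp add: comult_mult sweedler_comult sw_push[OF _ _ sw_klinear_tens[OF _ _ f]])

lemma c_one:
  assumes "kmod Z" and f: "bil H H Z f"
  shows "csum Z \<one>\<^bsub>H\<^esub> f = f \<one>\<^bsub>H\<^esub> \<one>\<^bsub>H\<^esub>"
  using assms by (simp add: comult_one)

lemma S_one [simp]: "S \<one>\<^bsub>H\<^esub> = \<one>\<^bsub>H\<^esub>"
proof -
  have "S \<one>\<^bsub>H\<^esub> = csum H \<one>\<^bsub>H\<^esub> (\<lambda>a1 a2. S a1 \<otimes>\<^bsub>H\<^esub> a2)"
    by (simp add: c_one bil_def)
  also have "\<dots> = \<one>\<^bsub>H\<^esub>"
    by (simp add: c_antipode1[where f = "\<lambda>x. x"] eps_one)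
  finally show ?thesis .
qed

text \<open>Uniqueness of convolution inverses, written out: \<open>S (a \<otimes> b)\<close> is a
  left and \<open>S b \<otimes> S a\<close> a right inverse of the multiplication, both regarded as
  maps on \<open>H \<otimes> H\<close>.\<close>

lemma S_mult:
  assumes a: "a \<in> carrier H" and b: "b \<in> carrier H"
  shows "S (a \<otimes>\<^bsub>H\<^esub> b) = S b \<otimes>\<^bsub>H\<^esub> S a"
proof -
  \<comment> \<open>The middle term of the argument, with summand
    \<open>S(a1 b1) (a2 b2) (S(b3) S(a3))\<close>. Collapsing its last two factors leaves
    \<open>S (a \<otimes> b)\<close>, collapsing the first two leaves
    \<open>S b \<otimes> S a\<close>.\<close>
  let ?L = "csum H a (\<lambda>a1 a'. csum H a' (\<lambda>a2 a3. csum H b (\<lambda>b1 b'. csum H b' (\<lambda>b2 b3.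
    S (a1 \<otimes>\<^bsub>H\<^esub> b1) \<otimes>\<^bsub>H\<^esub> (a2 \<otimes>\<^bsub>H\<^esub> (b2 \<otimes>\<^bsub>H\<^esub> S b3) \<otimes>\<^bsub>H\<^esub> S a3)))))"
  note [simp] = a b
  have 1: "?L = S (a \<otimes>\<^bsub>H\<^esub> b)"
    by (simp add: bil_def c_cancel(4)[where f = "\<lambda>b1 z. S (a1 \<otimes>\<^bsub>H\<^esub> b1) \<otimes>\<^bsub>H\<^esub> (a2 \<otimes>\<^bsub>H\<^esub> z \<otimes>\<^bsub>H\<^esub> S a3)" for a1 a2 a3]
        c_cancel(4)[where f = "\<lambda>a1 z. S (a1 \<otimes>\<^bsub>H\<^esub> b) \<otimes>\<^bsub>H\<^esub> z"])
  let ?G = "\<lambda>a1 a2 a3 b1 b2 b3. S (a1 \<otimes>\<^bsub>H\<^esub> b1) \<otimes>\<^bsub>H\<^esub> (a2 \<otimes>\<^bsub>H\<^esub> b2) \<otimes>\<^bsub>H\<^esub> (S b3 \<otimes>\<^bsub>H\<^esub> S a3)"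
  have "?L = csum H a (\<lambda>a1 a'. csum H a' (\<lambda>a2 a3. csum H b (\<lambda>b1 b'. csum H b' (\<lambda>b2 b3. ?G a1 a2 a3 b1 b2 b3))))"
    by (simp add: m_assoc)
  also have "\<dots> = csum H a (\<lambda>a' a3. csum H a' (\<lambda>a1 a2. csum H b (\<lambda>b' b3. csum H b' (\<lambda>b1 b2. ?G a1 a2 a3 b1 b2 b3))))"
    by (simp add: c_coassoc tri_def bil_def)
  also have "\<dots> = csum H a (\<lambda>a' a3. csum H b (\<lambda>b' b3. csum H a' (\<lambda>a1 a2. csum H b' (\<lambda>b1 b2. ?G a1 a2 a3 b1 b2 b3))))"
    by (rule sw_cong[OF refl], rule sw_swap) simp_all
  also have "\<dots> = csum H a (\<lambda>a' a3. csum H b (\<lambda>b' b3. csum H (a' \<otimes>\<^bsub>H\<^esub> b') (\<lambda>x y. S x \<otimes>\<^bsub>H\<^esub> y \<otimes>\<^bsub>H\<^esub> (S b3 \<otimes>\<^bsub>H\<^esub> S a3))))"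
    by (simp add: c_mult bil_def)
  also have "\<dots> = csum H a (\<lambda>a' a3. eps a' \<odot>\<^bsub>H\<^esub> csum H b (\<lambda>b' b3. eps b' \<odot>\<^bsub>H\<^esub> (S b3 \<otimes>\<^bsub>H\<^esub> S a3)))"
    by (simp add: c_antipode1[where f = "\<lambda>x. x \<otimes>\<^bsub>H\<^esub> y" for y] eps_mult module.smult_assoc1[OF kmod_H]
        sw_push[OF _ _ smult_klinear])
  also have "\<dots> = S b \<otimes>\<^bsub>H\<^esub> S a"
    by (simp add: c_counit1)
  finally show ?thesis using 1 by simp
qed

text \<open>The same uniqueness argument for maps from \<open>H\<close> to
  \<open>H \<otimes> H\<close>: the coproduct of \<open>S a\<close> and the flipped tensor
  \<open>S(a2) \<otimes> S(a1)\<close> are both convolution inverse to the coproduct.\<close>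

lemma c_S:
  assumes a: "a \<in> carrier H" and Z: "kmod Z" and f: "bil H H Z f"
  shows "csum Z (S a) f = csum Z a (\<lambda>a1 a2. f (S a2) (S a1))"
proof -
  note [simp] = bil_comp1[OF f] bil_comp2[OF f] bil1[OF f] bil2[OF f] bil_closed[OF f] Z a
  let ?G = "\<lambda>x y u v p q. f (x \<otimes>\<^bsub>H\<^esub> u \<otimes>\<^bsub>H\<^esub> S q) (y \<otimes>\<^bsub>H\<^esub> v \<otimes>\<^bsub>H\<^esub> S p)"
  let ?L = "csum Z a (\<lambda>a1 b. csum Z (S a1) (\<lambda>x y. csum Z b (\<lambda>b1 b2. csum Z b1 (\<lambda>u v. csum Z b2 (\<lambda>p q. ?G x y u v p q)))))"
  \<comment> \<open>Collapse on the right: the coproduct of \<open>b1\<close> times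
    \<open>S q \<otimes> S p\<close> cancels first in the second leg and then in the first.\<close>
  have inner: "csum Z b (\<lambda>b1 b2. csum Z b1 (\<lambda>u v. csum Z b2 (\<lambda>p q. ?G x y u v p q))) = eps b \<odot>\<^bsub>Z\<^esub> f x y"
    if [simp]: "b \<in> carrier H" "x \<in> carrier H" "y \<in> carrier H" for b x y
  proof -
    have "csum Z b (\<lambda>b1 b2. csum Z b1 (\<lambda>u v. csum Z b2 (\<lambda>p q. ?G x y u v p q))) =
        csum Z b (\<lambda>u w. csum Z w (\<lambda>v b2. csum Z b2 (\<lambda>p q. ?G x y u v p q)))"
      by (subst c_coassoc) (simp_all add: tri_def bil_def)
    also have "\<dots> = csum Z b (\<lambda>u w. csum Z w (\<lambda>v b2. csum Z b2 (\<lambda>p q. f (x \<otimes>\<^bsub>H\<^esub> u \<otimes>\<^bsub>H\<^esub> S q) (y \<otimes>\<^bsub>H\<^esub> (v \<otimes>\<^bsub>H\<^esub> S p)))))"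
      by (simp add: m_assoc)
    also have "\<dots> = csum Z b (\<lambda>u w. f (x \<otimes>\<^bsub>H\<^esub> u \<otimes>\<^bsub>H\<^esub> S w) y)"
      by (simp add: c_cancel(2)[where f = "\<lambda>z q. f (x \<otimes>\<^bsub>H\<^esub> u \<otimes>\<^bsub>H\<^esub> S q) (y \<otimes>\<^bsub>H\<^esub> z)" for u] bil_def)
    also have "\<dots> = csum Z b (\<lambda>u w. f (x \<otimes>\<^bsub>H\<^esub> (u \<otimes>\<^bsub>H\<^esub> S w)) y)"
      by (simp add: m_assoc)
    also have "\<dots> = eps b \<odot>\<^bsub>Z\<^esub> f x y"
      by (simp add: c_antipode2[where f = "\<lambda>z. f (x \<otimes>\<^bsub>H\<^esub> z) y"])
    finally show ?thesis .
  qed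
  have "?L = csum Z a (\<lambda>a1 b. csum Z (S a1) (\<lambda>x y. eps b \<odot>\<^bsub>Z\<^esub> f x y))"
    by (simp add: inner)
  also have "\<dots> = csum Z a (\<lambda>a1 b. eps b \<odot>\<^bsub>Z\<^esub> csum Z (S a1) f)"
    by (simp add: sw_push[OF _ _ smult_klinear])
  also have "\<dots> = csum Z (S a) f"
    by (simp add: c_counit2[where f = "\<lambda>x. csum Z (S x) f"] bil_def)
  finally have "?L = csum Z (S a) f" .
  \<comment> \<open>Collapse on the left: the coproducts of \<open>S a1\<close> and
    \<open>b1\<close> multiply to the coproduct of \<open>S a1 \<otimes> b1\<close>, which the
    antipode axiom reduces to that of the unit.\<close>
  moreover have "?L = csum Z a (\<lambda>a1 a2. f (S a2) (S a1))"
  proof -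
    have "?L = csum Z a (\<lambda>a1 b. csum Z b (\<lambda>b1 b2. csum Z b2 (\<lambda>p q. csum Z (S a1) (\<lambda>x y. csum Z b1 (\<lambda>u v. ?G x y u v p q)))))"
    proof -
      have "csum Z (S a1) (\<lambda>x y. csum Z b (\<lambda>b1 b2. csum Z b1 (\<lambda>u v. csum Z b2 (\<lambda>p q. ?G x y u v p q)))) =
        csum Z b (\<lambda>b1 b2. csum Z b2 (\<lambda>p q. csum Z (S a1) (\<lambda>x y. csum Z b1 (\<lambda>u v. ?G x y u v p q))))"
        if [simp]: "a1 \<in> carrier H" "b \<in> carrier H" for a1 b
      proof -
        have "csum Z (S a1) (\<lambda>x y. csum Z b (\<lambda>b1 b2. csum Z b1 (\<lambda>u v. csum Z b2 (\<lambda>p q. ?G x y u v p q)))) =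
          csum Z b (\<lambda>b1 b2. csum Z (S a1) (\<lambda>x y. csum Z b1 (\<lambda>u v. csum Z b2 (\<lambda>p q. ?G x y u v p q))))"
          by (rule sw_swap) simp_all
        also have "\<dots> = csum Z b (\<lambda>b1 b2. csum Z (S a1) (\<lambda>x y. csum Z b2 (\<lambda>p q. csum Z b1 (\<lambda>u v. ?G x y u v p q))))"
          by (rule sw_cong[OF refl], rule sw_cong[OF refl], rule sw_swap) simp_all
        also have "\<dots> = csum Z b (\<lambda>b1 b2. csum Z b2 (\<lambda>p q. csum Z (S a1) (\<lambda>x y. csum Z b1 (\<lambda>u v. ?G x y u v p q))))"
          by (rule sw_cong[OF refl], rule sw_swap) simp_all
        finally show ?thesis .
      qed
      thus ?thesis by simp
    qed
    also have "\<dots> = csum Z a (\<lambda>a1 b. csum Z b (\<lambda>b1 b2. csum Z b2 (\<lambda>p q. csum Z (S a1 \<otimes>\<^bsub>H\<^esub> b1) (\<lambda>x y. f (x \<otimes>\<^bsub>H\<^esub> S q) (y \<otimes>\<^bsub>H\<^esub> S p)))))"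
      by (simp add: c_mult bil_def)
    also have "\<dots> = csum Z a (\<lambda>a1 a2. f (S a2) (S a1))"
      by (subst c_cancel(1)[where f = "\<lambda>z b2. csum Z b2 (\<lambda>p q. csum Z z (\<lambda>x y. f (x \<otimes>\<^bsub>H\<^esub> S q) (y \<otimes>\<^bsub>H\<^esub> S p)))"])
        (simp_all add: bil_def c_one)
    finally show ?thesis .
  qed
  ultimately show ?thesis by simp
qed

end

section \<open>Hopf algebras with invertible antipode\<close>

locale hopf_algebra_bij = hopf_algebra K H
  for K :: "('k, 'o) ring_scheme" and H :: "('k, 'h, 'x) hopf_scheme" +
  assumes S_bij: "bij_betw (antipode H) (carrier H) (carrier H)"
begin

abbreviation "S' \<equiv> antipode_inv H"

lemma S'_closed [simp]: "a \<in> carrier H \<Longrightarrow> S' a \<in> carrier H"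
  using S_bij unfolding antipode_inv_def by (metis bij_betw_def inv_into_into)

lemma S_S' [simp]: "a \<in> carrier H \<Longrightarrow> S (S' a) = a"
  using S_bij unfolding antipode_inv_def by (metis bij_betw_def f_inv_into_f)

lemma S_inject: "\<lbrakk>S a = S b; a \<in> carrier H; b \<in> carrier H\<rbrakk> \<Longrightarrow> a = b"
  using S_bij by (meson bij_betw_def inj_onD)

lemma S'_linear [simp]: "klinear K H H S'"
proof -
  interpret H: Module.module K H by simp
  show ?thesis
    by (rule klinearI; (rule S_inject)?)
      (simp_all add: klinear_add[OF antipode_linear] klinear_smult[OF antipode_linear])
qed

lemma lin_S' [simp]: "klinear K V H f \<Longrightarrow> klinear K V H (\<lambda>x. S' (f x))"
  by (rule lin_comp[OF S'_linear])

lemma S'_mult: "\<lbrakk>a \<in> carrier H; b \<in> carrier H\<rbrakk> \<Longrightarrow> S' (a \<otimes>\<^bsub>H\<^esub> b) = S' b \<otimes>\<^bsub>H\<^esub> S' a"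
  by (rule S_inject) (simp_all add: S_mult)

text \<open>The antipode reverses products, so it turns \<open>a2 S'(a1)\<close> into
  \<open>a1 S(a2)\<close>. The identity therefore holds after applying \<open>S\<close>, which is
  injective.\<close>

lemma c_antipode_inv:
  assumes "a \<in> carrier H" "kmod Z" and f: "klinear K H Z f"
  shows "csum Z a (\<lambda>a1 a2. f (a2 \<otimes>\<^bsub>H\<^esub> S' a1)) = eps a \<odot>\<^bsub>Z\<^esub> f \<one>\<^bsub>H\<^esub>"
proof -
  have "S (csum H a (\<lambda>a1 a2. a2 \<otimes>\<^bsub>H\<^esub> S' a1)) = csum H a (\<lambda>a1 a2. a1 \<otimes>\<^bsub>H\<^esub> S a2)"
    using assms(1) by (simp add: sw_push[OF _ _ antipode_linear] S_mult)
  also have "\<dots> = S (eps a \<odot>\<^bsub>H\<^esub> \<one>\<^bsub>H\<^esub>)"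
    using assms(1) by (simp add: c_antipode2[where f = "\<lambda>x. x"] klinear_smult[OF antipode_linear])
  finally have "csum H a (\<lambda>a1 a2. a2 \<otimes>\<^bsub>H\<^esub> S' a1) = eps a \<odot>\<^bsub>H\<^esub> \<one>\<^bsub>H\<^esub>"
    by (rule S_inject) (simp_all add: assms)
  hence "f (csum H a (\<lambda>a1 a2. a2 \<otimes>\<^bsub>H\<^esub> S' a1)) = eps a \<odot>\<^bsub>Z\<^esub> f \<one>\<^bsub>H\<^esub>"
    using assms by (simp add: klinear_smult[OF f])
  thus ?thesis
    using assms by (simp add: sw_push[OF _ _ f])
qed

lemma c_cancel_inv:
  assumes a: "a \<in> carrier H" and Z: "kmod Z" and f: "bil H H Z f"
  shows "csum Z a (\<lambda>a1 b. csum Z b (\<lambda>a2 a3. f (a2 \<otimes>\<^bsub>H\<^esub> S' a1) a3)) = f \<one>\<^bsub>H\<^esub> a"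
proof -
  note [simp] = bil_comp1[OF f] bil_comp2[OF f] bil1[OF f] bil2[OF f] bil_closed[OF f] Z a
  have "csum Z a (\<lambda>a1 b. csum Z b (\<lambda>a2 a3. f (a2 \<otimes>\<^bsub>H\<^esub> S' a1) a3)) =
      csum Z a (\<lambda>b a3. csum Z b (\<lambda>a1 a2. f (a2 \<otimes>\<^bsub>H\<^esub> S' a1) a3))"
    by (subst c_coassoc) (simp_all add: tri_def bil_def)
  also have "\<dots> = f \<one>\<^bsub>H\<^esub> a"
    by (simp add: c_antipode_inv[where f = "\<lambda>x. f x u" for u] c_counit1)
  finally show ?thesis .
qed

end

lemma abelian_group_record_cong:
  assumes "abelian_group V" "carrier W = carrier V" "\<zero>\<^bsub>W\<^esub> = \<zero>\<^bsub>V\<^esub>" "\<And>x y. x \<oplus>\<^bsub>W\<^esub> y = x \<oplus>\<^bsub>V\<^esub> y"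
  shows "abelian_group W"
proof -
  interpret V: abelian_group V by fact
  show ?thesis
    by (rule abelian_groupI) (auto simp: assms(2-4) V.a_ac intro: V.l_neg)
qed

lemma module_record_cong:
  assumes "Module.module K V" "carrier W = carrier V" "\<zero>\<^bsub>W\<^esub> = \<zero>\<^bsub>V\<^esub>" "\<And>x y. x \<oplus>\<^bsub>W\<^esub> y = x \<oplus>\<^bsub>V\<^esub> y"
    "\<And>r x. r \<odot>\<^bsub>W\<^esub> x = r \<odot>\<^bsub>V\<^esub> x"
  shows "Module.module K W"
proof -
  interpret V: Module.module K V by fact
  show ?thesis
    by (rule moduleI)
      (auto simp: assms(2-5) V.smult_l_distr V.smult_r_distr V.smult_assoc1 V.R.cring_axioms V.R.is_cring
        intro: abelian_group_record_cong[OF V.abelian_group_axioms])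
qed

context hopf_algebra
begin

section \<open>Bimodules and their tensor products\<close>

text \<open>The bimodule axioms as a predicate on the record, separate from the coactions, so that
  they can be derived for tensor products and then handed to the simplifier as a single
  hypothesis.\<close>

definition hbimod where
  "hbimod M \<longleftrightarrow> kmod M \<and> bil H M M (lact M) \<and> bil M H M (ract M) \<and>
    (\<forall>a\<in>carrier H. \<forall>b\<in>carrier H. \<forall>m\<in>carrier M.
      (a \<otimes>\<^bsub>H\<^esub> b) \<triangleright>\<^bsub>M\<^esub> m = a \<triangleright>\<^bsub>M\<^esub> (b \<triangleright>\<^bsub>M\<^esub> m) \<and>
      m \<triangleleft>\<^bsub>M\<^esub> (a \<otimes>\<^bsub>H\<^esub> b) = (m \<triangleleft>\<^bsub>M\<^esub> a) \<triangleleft>\<^bsub>M\<^esub> b \<and>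
      (a \<triangleright>\<^bsub>M\<^esub> m) \<triangleleft>\<^bsub>M\<^esub> b = a \<triangleright>\<^bsub>M\<^esub> (m \<triangleleft>\<^bsub>M\<^esub> b)) \<and>
    (\<forall>m\<in>carrier M. \<one>\<^bsub>H\<^esub> \<triangleright>\<^bsub>M\<^esub> m = m \<and> m \<triangleleft>\<^bsub>M\<^esub> \<one>\<^bsub>H\<^esub> = m)"

lemma hbimod_kmod [simp]: "hbimod M \<Longrightarrow> kmod M"
  by (simp add: hbimod_def)

lemma lact_bil: "hbimod M \<Longrightarrow> bil H M M (\<lambda>a m. a \<triangleright>\<^bsub>M\<^esub> m)"
  by (simp add: hbimod_def)

lemma ract_bil: "hbimod M \<Longrightarrow> bil M H M (\<lambda>m a. m \<triangleleft>\<^bsub>M\<^esub> a)"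
  by (simp add: hbimod_def)

lemma act_closed [simp]:
  "\<lbrakk>hbimod M; a \<in> carrier H; m \<in> carrier M\<rbrakk> \<Longrightarrow> a \<triangleright>\<^bsub>M\<^esub> m \<in> carrier M"
  "\<lbrakk>hbimod M; a \<in> carrier H; m \<in> carrier M\<rbrakk> \<Longrightarrow> m \<triangleleft>\<^bsub>M\<^esub> a \<in> carrier M"
  by (auto intro: bil_closed[OF lact_bil] bil_closed[OF ract_bil])

lemma act_one [simp]:
  "\<lbrakk>hbimod M; m \<in> carrier M\<rbrakk> \<Longrightarrow> \<one>\<^bsub>H\<^esub> \<triangleright>\<^bsub>M\<^esub> m = m"
  "\<lbrakk>hbimod M; m \<in> carrier M\<rbrakk> \<Longrightarrow> m \<triangleleft>\<^bsub>M\<^esub> \<one>\<^bsub>H\<^esub> = m"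
  by (auto simp: hbimod_def)

lemma act_mult:
  "\<lbrakk>hbimod M; a \<in> carrier H; b \<in> carrier H; m \<in> carrier M\<rbrakk> \<Longrightarrow> (a \<otimes>\<^bsub>H\<^esub> b) \<triangleright>\<^bsub>M\<^esub> m = a \<triangleright>\<^bsub>M\<^esub> (b \<triangleright>\<^bsub>M\<^esub> m)"
  "\<lbrakk>hbimod M; a \<in> carrier H; b \<in> carrier H; m \<in> carrier M\<rbrakk> \<Longrightarrow> m \<triangleleft>\<^bsub>M\<^esub> (a \<otimes>\<^bsub>H\<^esub> b) = (m \<triangleleft>\<^bsub>M\<^esub> a) \<triangleleft>\<^bsub>M\<^esub> b"
  "\<lbrakk>hbimod M; a \<in> carrier H; b \<in> carrier H; m \<in> carrier M\<rbrakk> \<Longrightarrow> (a \<triangleright>\<^bsub>M\<^esub> m) \<triangleleft>\<^bsub>M\<^esub> b = a \<triangleright>\<^bsub>M\<^esub> (m \<triangleleft>\<^bsub>M\<^esub> b)"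
  unfolding hbimod_def by blast+

lemma lin_act [simp]:
  "\<lbrakk>hbimod M; klinear K V H f; m \<in> carrier M\<rbrakk> \<Longrightarrow> klinear K V M (\<lambda>x. f x \<triangleright>\<^bsub>M\<^esub> m)"
  "\<lbrakk>hbimod M; klinear K V M g; a \<in> carrier H\<rbrakk> \<Longrightarrow> klinear K V M (\<lambda>x. a \<triangleright>\<^bsub>M\<^esub> g x)"
  "\<lbrakk>hbimod M; klinear K V M g; a \<in> carrier H\<rbrakk> \<Longrightarrow> klinear K V M (\<lambda>x. g x \<triangleleft>\<^bsub>M\<^esub> a)"
  "\<lbrakk>hbimod M; klinear K V H f; m \<in> carrier M\<rbrakk> \<Longrightarrow> klinear K V M (\<lambda>x. m \<triangleleft>\<^bsub>M\<^esub> f x)"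
  by (rule bil_comp1[OF lact_bil] bil_comp2[OF lact_bil] bil_comp1[OF ract_bil] bil_comp2[OF ract_bil]; assumption)+

definition hbal where
  "hbal M N Z f \<longleftrightarrow> bil M N Z f \<and>
    (\<forall>m\<in>carrier M. \<forall>a\<in>carrier H. \<forall>n\<in>carrier N. f (m \<triangleleft>\<^bsub>M\<^esub> a) n = f m (a \<triangleright>\<^bsub>N\<^esub> n))"

lemma tensH_datum:
  assumes "hbimod M" "hbimod N"
  shows "tensor_module_datum K M N (carrier H) (ract M) (lact N)"
proof -
  interpret M: Module.module K M using assms(1) by simp
  interpret N: Module.module K N using assms(2) by simp
  show ?thesis
    using assms by unfold_locales (auto simp: klinear_smult[OF bil2[OF ract_bil]])
qed

lemma hbal_balanced:
  assumes "hbal M N Z f" "hbimod M" "hbimod N"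
  shows "balanced_map (carrier H) (ract M) (lact N) M N Z f"
proof -
  have f: "bil M N Z f" using assms by (simp add: hbal_def)
  show ?thesis
  using bil_closed[OF f] klinear_add[OF bil1[OF f]] klinear_add[OF bil2[OF f]] assms(1)
  unfolding balanced_map_def hbal_def by simp
qed

lemma tensH_simps:
  "carrier (tensH K H M N) = carrier (module_tensor (carrier H) (ract M) (lact N) M N)"
  "\<zero>\<^bsub>tensH K H M N\<^esub> = \<zero>\<^bsub>module_tensor (carrier H) (ract M) (lact N) M N\<^esub>"
  "x \<oplus>\<^bsub>tensH K H M N\<^esub> y = x \<oplus>\<^bsub>module_tensor (carrier H) (ract M) (lact N) M N\<^esub> y"
  "r \<odot>\<^bsub>tensH K H M N\<^esub> x = r \<odot>\<^bsub>module_tensor (carrier H) (ract M) (lact N) M N\<^esub> x"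
  by (simp_all add: tensH_def Let_def module.extend_def)

lemma klinear_tensH:
  "klinear K (tensH K H M N) Z = klinear K (module_tensor (carrier H) (ract M) (lact N) M N) Z"
  "klinear K Z (tensH K H M N) = klinear K Z (module_tensor (carrier H) (ract M) (lact N) M N)"
  by (simp_all add: klinear_def tensH_simps fun_eq_iff)

context
  fixes M :: "('k, 'h, 'm, 'y) bimod_scheme" and N :: "('k, 'h, 'n, 'z) bimod_scheme"
  assumes M: "hbimod M" and N: "hbimod N"
begin

interpretation D: tensor_module_datum K M N "carrier H" "ract M" "lact N"
  by (rule tensH_datum[OF M N])

lemma kmod_tensH [simp]: "kmod (tensH K H M N)"
  by (rule module_record_cong[OF D.module_T]) (simp_all add: tensH_simps)

lemma tensH_closed [simp]:
  "\<lbrakk>x \<in> carrier M; y \<in> carrier N\<rbrakk> \<Longrightarrow> x \<boxtimes>\<^bsub>tensH K H M N\<^esub> y \<in> carrier (tensH K H M N)"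
  unfolding tensH_simps by (rule D.pure_closed)

lemma tensH_balanced:
  "\<lbrakk>x \<in> carrier M; a \<in> carrier H; y \<in> carrier N\<rbrakk> \<Longrightarrow>
    (x \<triangleleft>\<^bsub>M\<^esub> a) \<boxtimes>\<^bsub>tensH K H M N\<^esub> y = x \<boxtimes>\<^bsub>tensH K H M N\<^esub> (a \<triangleright>\<^bsub>N\<^esub> y)"
  unfolding tensH_simps by (rule D.pure_balanced)

text \<open>A scalar acts as the corresponding multiple of the unit of \<open>H\<close>. Moving
  scalars across the tensor sign over \<open>H\<close> thus becomes an instance of balancedness, and
  pure tensors are bilinear over the field.\<close>

lemma smult_lact: "\<lbrakk>r \<in> carrier K; n \<in> carrier N\<rbrakk> \<Longrightarrow> r \<odot>\<^bsub>N\<^esub> n = (r \<odot>\<^bsub>H\<^esub> \<one>\<^bsub>H\<^esub>) \<triangleright>\<^bsub>N\<^esub> n"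
  using N by (simp add: klinear_smult[OF bil2[OF lact_bil]])

lemma smult_ract: "\<lbrakk>r \<in> carrier K; m \<in> carrier M\<rbrakk> \<Longrightarrow> r \<odot>\<^bsub>M\<^esub> m = m \<triangleleft>\<^bsub>M\<^esub> (r \<odot>\<^bsub>H\<^esub> \<one>\<^bsub>H\<^esub>)"
  using M by (simp add: klinear_smult[OF bil1[OF ract_bil]])

lemma tensH_bil: "bil M N (tensH K H M N) (\<lambda>x y. x \<boxtimes>\<^bsub>tensH K H M N\<^esub> y)"
proof (intro bilI klinearI)
  show "x \<boxtimes>\<^bsub>tensH K H M N\<^esub> (r \<odot>\<^bsub>N\<^esub> y) = r \<odot>\<^bsub>tensH K H M N\<^esub> (x \<boxtimes>\<^bsub>tensH K H M N\<^esub> y)"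
    if "r \<in> carrier K" "x \<in> carrier M" "y \<in> carrier N" for r x y
    using that D.smult_pure[of r x y, folded tensH_simps]
    by (simp add: smult_lact tensH_balanced[symmetric] smult_ract)
qed (simp_all add: D.smult_pure[folded tensH_simps] D.pure_add_left[folded tensH_simps] D.pure_add_right[folded tensH_simps])

lemma lin_tensH [simp]:
  "\<lbrakk>klinear K V M f; n \<in> carrier N\<rbrakk> \<Longrightarrow> klinear K V (tensH K H M N) (\<lambda>x. f x \<boxtimes>\<^bsub>tensH K H M N\<^esub> n)"
  "\<lbrakk>klinear K V N g; m \<in> carrier M\<rbrakk> \<Longrightarrow> klinear K V (tensH K H M N) (\<lambda>x. m \<boxtimes>\<^bsub>tensH K H M N\<^esub> g x)"
  by (rule bil_comp1[OF tensH_bil] bil_comp2[OF tensH_bil]; assumption)+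

lemmas tensH_induct [consumes 1, case_names pure add] = D.T_induct[folded tensH_simps]
lemmas sweedler_sw_tensH = D.sweedler_sw[folded tensH_simps]
lemmas sw_tensH_closed [simp] = D.sw_closed[folded tensH_simps]
lemmas sw_tensH_klinear_param [simp] = D.sw_klinear_param[folded tensH_simps]

lemma sw_tensH_pure [simp]:
  assumes "hbal M N Z f" "kmod Z" "x \<in> carrier M" "y \<in> carrier N"
  shows "sw M N Z (x \<boxtimes>\<^bsub>tensH K H M N\<^esub> y) f = f x y"
  by (rule D.sw_pure[folded tensH_simps, OF hbal_balanced[OF assms(1) M N] assms(2-4)])

lemma sw_klinear_tensH:
  assumes f: "hbal M N Z f" and "kmod Z"
  shows "klinear K (tensH K H M N) Z (\<lambda>t. sw M N Z t f)"
  unfolding klinear_tensH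
  by (rule D.sw_klinear[OF hbal_balanced[OF f M N] assms(2)])
    (use f in \<open>auto simp: hbal_def intro: klinear_smult[OF bil2]\<close>)

lemma lin_sw_tensH [simp]:
  "\<lbrakk>kmod Z; klinear K V (tensH K H M N) g; hbal M N Z f\<rbrakk> \<Longrightarrow> klinear K V Z (\<lambda>x. sw M N Z (g x) f)"
  by (rule lin_comp[OF sw_klinear_tensH])

lemma klinear_tensH_eqI:
  assumes "klinear K (tensH K H M N) Z f" "klinear K (tensH K H M N) Z g" "t \<in> carrier (tensH K H M N)"
    and "\<And>x y. \<lbrakk>x \<in> carrier M; y \<in> carrier N\<rbrakk> \<Longrightarrow>
      f (x \<boxtimes>\<^bsub>tensH K H M N\<^esub> y) = g (x \<boxtimes>\<^bsub>tensH K H M N\<^esub> y)"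
  shows "f t = g t"
  using assms(3)
  by (induction rule: tensH_induct) (simp_all add: assms(4) klinear_add[OF assms(1)] klinear_add[OF assms(2)])

lemma lact_hbal: "a \<in> carrier H \<Longrightarrow> hbal M N (tensH K H M N) (\<lambda>m n. (a \<triangleright>\<^bsub>M\<^esub> m) \<boxtimes>\<^bsub>tensH K H M N\<^esub> n)"
  using M N by (simp add: hbal_def bil_def act_mult(3)[symmetric] tensH_balanced)

lemma ract_hbal: "a \<in> carrier H \<Longrightarrow> hbal M N (tensH K H M N) (\<lambda>m n. m \<boxtimes>\<^bsub>tensH K H M N\<^esub> (n \<triangleleft>\<^bsub>N\<^esub> a))"
  using M N by (simp add: hbal_def bil_def act_mult tensH_balanced)

lemma lact_tensH:
  assumes "t \<in> carrier (tensH K H M N)"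
  shows "a \<triangleright>\<^bsub>tensH K H M N\<^esub> t = sw M N (tensH K H M N) t (\<lambda>m n. (a \<triangleright>\<^bsub>M\<^esub> m) \<boxtimes>\<^bsub>tensH K H M N\<^esub> n)"
proof -
  let ?T = "module_tensor (carrier H) (ract M) (lact N) M N"
  have "a \<triangleright>\<^bsub>tensH K H M N\<^esub> t = sweedler ?T t (\<lambda>m n. (a \<triangleright>\<^bsub>M\<^esub> m) \<boxtimes>\<^bsub>?T\<^esub> n)"
    by (simp add: tensH_def Let_def module.extend_def)
  also have "\<dots> = sweedler (tensH K H M N) t (\<lambda>m n. (a \<triangleright>\<^bsub>M\<^esub> m) \<boxtimes>\<^bsub>tensH K H M N\<^esub> n)"
    unfolding tensH_simps by (rule sweedler_record_cong) (simp_all add: tensH_simps)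
  finally show ?thesis using assms by (simp add: sweedler_sw_tensH)
qed

lemma ract_tensH:
  assumes "t \<in> carrier (tensH K H M N)"
  shows "t \<triangleleft>\<^bsub>tensH K H M N\<^esub> a = sw M N (tensH K H M N) t (\<lambda>m n. m \<boxtimes>\<^bsub>tensH K H M N\<^esub> (n \<triangleleft>\<^bsub>N\<^esub> a))"
proof -
  let ?T = "module_tensor (carrier H) (ract M) (lact N) M N"
  have "t \<triangleleft>\<^bsub>tensH K H M N\<^esub> a = sweedler ?T t (\<lambda>m n. m \<boxtimes>\<^bsub>?T\<^esub> (n \<triangleleft>\<^bsub>N\<^esub> a))"
    by (simp add: tensH_def Let_def module.extend_def)
  also have "\<dots> = sweedler (tensH K H M N) t (\<lambda>m n. m \<boxtimes>\<^bsub>tensH K H M N\<^esub> (n \<triangleleft>\<^bsub>N\<^esub> a))"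
    unfolding tensH_simps by (rule sweedler_record_cong) (simp_all add: tensH_simps)
  finally show ?thesis using assms by (simp add: sweedler_sw_tensH)
qed

lemma act_tensH_pure [simp]:
  assumes "a \<in> carrier H" "m \<in> carrier M" "n \<in> carrier N"
  shows "a \<triangleright>\<^bsub>tensH K H M N\<^esub> (m \<boxtimes>\<^bsub>tensH K H M N\<^esub> n) = (a \<triangleright>\<^bsub>M\<^esub> m) \<boxtimes>\<^bsub>tensH K H M N\<^esub> n"
    and "(m \<boxtimes>\<^bsub>tensH K H M N\<^esub> n) \<triangleleft>\<^bsub>tensH K H M N\<^esub> a = m \<boxtimes>\<^bsub>tensH K H M N\<^esub> (n \<triangleleft>\<^bsub>N\<^esub> a)"
  using assms lact_hbal ract_hbal by (simp_all add: lact_tensH ract_tensH)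

lemma tensH_act_bil:
  "bil H (tensH K H M N) (tensH K H M N) (lact (tensH K H M N))"
  "bil (tensH K H M N) H (tensH K H M N) (ract (tensH K H M N))"
proof -
  let ?T = "tensH K H M N"
  have 1: "klinear K ?T ?T (\<lambda>t. a \<triangleright>\<^bsub>?T\<^esub> t)" if "a \<in> carrier H" for a
    by (rule iffD2[OF klinear_cong[OF lact_tensH kmod_tensH]])
      (use that in \<open>simp_all add: sw_klinear_tensH lact_hbal\<close>)
  have 2: "klinear K ?T ?T (\<lambda>t. t \<triangleleft>\<^bsub>?T\<^esub> a)" if "a \<in> carrier H" for a
    by (rule iffD2[OF klinear_cong[OF ract_tensH kmod_tensH]])
      (use that in \<open>simp_all add: sw_klinear_tensH ract_hbal\<close>)
  have 3: "klinear K H ?T (\<lambda>a. a \<triangleright>\<^bsub>?T\<^esub> t)" if "t \<in> carrier ?T" for t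
    using that M N by (simp add: lact_tensH)
  have 4: "klinear K H ?T (\<lambda>a. t \<triangleleft>\<^bsub>?T\<^esub> a)" if "t \<in> carrier ?T" for t
    using that M N by (simp add: ract_tensH)
  show "bil H ?T ?T (lact ?T)" "bil ?T H ?T (ract ?T)"
    using 1 2 3 4 by (auto simp: bil_def)
qed

lemma hbimod_tensH [simp]: "hbimod (tensH K H M N)"
proof -
  let ?T = "tensH K H M N"
  note 1 = klinear_closed[OF bil1[OF tensH_act_bil(1)]] klinear_closed[OF bil2[OF tensH_act_bil(2)]]
    klinear_add[OF bil1[OF tensH_act_bil(1)]] klinear_add[OF bil2[OF tensH_act_bil(2)]]
  have "(a \<otimes>\<^bsub>H\<^esub> b) \<triangleright>\<^bsub>?T\<^esub> t = a \<triangleright>\<^bsub>?T\<^esub> (b \<triangleright>\<^bsub>?T\<^esub> t) \<and>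
      t \<triangleleft>\<^bsub>?T\<^esub> (a \<otimes>\<^bsub>H\<^esub> b) = (t \<triangleleft>\<^bsub>?T\<^esub> a) \<triangleleft>\<^bsub>?T\<^esub> b \<and>
      (a \<triangleright>\<^bsub>?T\<^esub> t) \<triangleleft>\<^bsub>?T\<^esub> b = a \<triangleright>\<^bsub>?T\<^esub> (t \<triangleleft>\<^bsub>?T\<^esub> b)"
    if "a \<in> carrier H" "b \<in> carrier H" "t \<in> carrier ?T" for a b t
    using that(3) by (induction rule: tensH_induct) (use that(1,2) M N in \<open>simp_all add: act_mult 1\<close>)
  moreover have "\<one>\<^bsub>H\<^esub> \<triangleright>\<^bsub>?T\<^esub> t = t \<and> t \<triangleleft>\<^bsub>?T\<^esub> \<one>\<^bsub>H\<^esub> = t" if "t \<in> carrier ?T" for t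
    using that by (induction rule: tensH_induct) (use M N in \<open>simp_all add: 1\<close>)
  ultimately show ?thesis
    unfolding hbimod_def by (intro conjI ballI kmod_tensH tensH_act_bil) simp_all
qed

end

section \<open>Covariant bimodules and coinvariants\<close>

abbreviation "rsum Z M m f \<equiv> sw M H Z (rcoact M m) f"
abbreviation "lsum Z M m f \<equiv> sw H M Z (lcoact M m) f"

text \<open>The fragment of right covariance that targets of rational maps supply. It and
  \<open>lcov\<close> are the properties transferred to tensor products over \<open>H\<close>
  below.\<close>

definition rcov where
  "rcov M \<longleftrightarrow> hbimod M \<and> klinear K M (tensK K M H) (rcoact M) \<and>
    (\<forall>m\<in>carrier M. \<forall>b\<in>carrier H. rcoact M (m \<triangleleft>\<^bsub>M\<^esub> b) =
      rsum (tensK K M H) M m (\<lambda>m0 m1. csum (tensK K M H) b (\<lambda>b1 b2.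
        (m0 \<triangleleft>\<^bsub>M\<^esub> b1) \<boxtimes>\<^bsub>tensK K M H\<^esub> (m1 \<otimes>\<^bsub>H\<^esub> b2))))"

definition lcov where
  "lcov M \<longleftrightarrow> hbimod M \<and> klinear K M (tensK K H M) (lcoact M) \<and>
    (\<forall>m\<in>carrier M. \<forall>b\<in>carrier H. lcoact M (m \<triangleleft>\<^bsub>M\<^esub> b) =
      lsum (tensK K H M) M m (\<lambda>m1 m0. csum (tensK K H M) b (\<lambda>b1 b2.
        (m1 \<otimes>\<^bsub>H\<^esub> b1) \<boxtimes>\<^bsub>tensK K H M\<^esub> (m0 \<triangleleft>\<^bsub>M\<^esub> b2))))"

lemma rcov_hbimod [simp]: "rcov M \<Longrightarrow> hbimod M"
  by (simp add: rcov_def)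

lemma lcov_hbimod [simp]: "lcov M \<Longrightarrow> hbimod M"
  by (simp add: lcov_def)

lemma rcoact_linear' [simp]: "rcov M \<Longrightarrow> klinear K M (tensK K M H) (rcoact M)"
  by (simp add: rcov_def)

lemma lcoact_linear' [simp]: "lcov M \<Longrightarrow> klinear K M (tensK K H M) (lcoact M)"
  by (simp add: lcov_def)

lemma rcoact_closed [simp]: "\<lbrakk>rcov M; m \<in> carrier M\<rbrakk> \<Longrightarrow> rcoact M m \<in> carrier (tensK K M H)"
  by (rule klinear_closed[OF rcoact_linear'])

lemma lcoact_closed [simp]: "\<lbrakk>lcov M; m \<in> carrier M\<rbrakk> \<Longrightarrow> lcoact M m \<in> carrier (tensK K H M)"
  by (rule klinear_closed[OF lcoact_linear'])

lemma lin_rcoact [simp]: "\<lbrakk>rcov M; klinear K V M f\<rbrakk> \<Longrightarrow> klinear K V (tensK K M H) (\<lambda>x. rcoact M (f x))"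
  by (rule lin_comp[OF rcoact_linear'])

lemma lin_lcoact [simp]: "\<lbrakk>lcov M; klinear K V M f\<rbrakk> \<Longrightarrow> klinear K V (tensK K H M) (\<lambda>x. lcoact M (f x))"
  by (rule lin_comp[OF lcoact_linear'])

lemma sweedler_rcoact: "\<lbrakk>rcov M; m \<in> carrier M\<rbrakk> \<Longrightarrow> sweedler Z (rcoact M m) f = rsum Z M m f"
  by (simp add: sweedler_sw)

lemma sweedler_lcoact: "\<lbrakk>lcov M; m \<in> carrier M\<rbrakk> \<Longrightarrow> sweedler Z (lcoact M m) f = lsum Z M m f"
  by (simp add: sweedler_sw)

lemma rcoact_ract:
  "\<lbrakk>rcov M; m \<in> carrier M; b \<in> carrier H\<rbrakk> \<Longrightarrow> rcoact M (m \<triangleleft>\<^bsub>M\<^esub> b) =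
      rsum (tensK K M H) M m (\<lambda>m0 m1. csum (tensK K M H) b (\<lambda>b1 b2.
        (m0 \<triangleleft>\<^bsub>M\<^esub> b1) \<boxtimes>\<^bsub>tensK K M H\<^esub> (m1 \<otimes>\<^bsub>H\<^esub> b2)))"
  unfolding rcov_def by blast

lemma lcoact_ract:
  "\<lbrakk>lcov M; m \<in> carrier M; b \<in> carrier H\<rbrakk> \<Longrightarrow> lcoact M (m \<triangleleft>\<^bsub>M\<^esub> b) =
      lsum (tensK K H M) M m (\<lambda>m1 m0. csum (tensK K H M) b (\<lambda>b1 b2.
        (m1 \<otimes>\<^bsub>H\<^esub> b1) \<boxtimes>\<^bsub>tensK K H M\<^esub> (m0 \<triangleleft>\<^bsub>M\<^esub> b2)))"
  unfolding lcov_def by blast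

lemma r_ract:
  assumes "rcov M" "m \<in> carrier M" "a \<in> carrier H" "kmod Z" and f: "bil M H Z f"
  shows "rsum Z M (m \<triangleleft>\<^bsub>M\<^esub> a) f =
    rsum Z M m (\<lambda>m0 m1. csum Z a (\<lambda>a1 a2. f (m0 \<triangleleft>\<^bsub>M\<^esub> a1) (m1 \<otimes>\<^bsub>H\<^esub> a2)))"
  using assms by (simp add: rcoact_ract sw_push[OF _ _ sw_klinear_tens[OF _ _ f]])

lemma l_ract:
  assumes "lcov M" "m \<in> carrier M" "a \<in> carrier H" "kmod Z" and f: "bil H M Z f"
  shows "lsum Z M (m \<triangleleft>\<^bsub>M\<^esub> a) f =
    lsum Z M m (\<lambda>m1 m0. csum Z a (\<lambda>a1 a2. f (m1 \<otimes>\<^bsub>H\<^esub> a1) (m0 \<triangleleft>\<^bsub>M\<^esub> a2)))"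
  using assms by (simp add: lcoact_ract sw_push[OF _ _ sw_klinear_tens[OF _ _ f]])

abbreviation "bicov M \<equiv> bicovariant_bimodule K H M"

lemma bicov_hbimod [simp]:
  assumes "bicov M"
  shows "hbimod M"
proof -
  interpret M: bicovariant_bimodule K H M by fact
  show ?thesis
    unfolding hbimod_def
    by (intro conjI ballI M.module bilI klinearI)
      (simp_all add: M.lact_add M.lact_smult M.lact_mult M.lact_one M.ract_add M.ract_smult M.ract_mult
        M.ract_one M.actions_commute klinear_closed[OF M.lact_linear] klinear_closed[OF M.ract_linear]
        klinear_add[OF M.lact_linear] klinear_add[OF M.ract_linear]
        klinear_smult[OF M.lact_linear] klinear_smult[OF M.ract_linear])
qed

lemma bicov_covariant:
  assumes "bicov M" "a \<in> carrier H" "b \<in> carrier H" "m \<in> carrier M"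
  shows "rcoact M (a \<triangleright>\<^bsub>M\<^esub> m \<triangleleft>\<^bsub>M\<^esub> b) =
      csum (tensK K M H) a (\<lambda>a1 a2. rsum (tensK K M H) M m (\<lambda>m0 m1. csum (tensK K M H) b (\<lambda>b1 b2.
        (a1 \<triangleright>\<^bsub>M\<^esub> m0 \<triangleleft>\<^bsub>M\<^esub> b1) \<boxtimes>\<^bsub>tensK K M H\<^esub> (a2 \<otimes>\<^bsub>H\<^esub> m1 \<otimes>\<^bsub>H\<^esub> b2))))"
    and "lcoact M (a \<triangleright>\<^bsub>M\<^esub> m \<triangleleft>\<^bsub>M\<^esub> b) =
      csum (tensK K H M) a (\<lambda>a1 a2. lsum (tensK K H M) M m (\<lambda>m1 m0. csum (tensK K H M) b (\<lambda>b1 b2.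
        (a1 \<otimes>\<^bsub>H\<^esub> m1 \<otimes>\<^bsub>H\<^esub> b1) \<boxtimes>\<^bsub>tensK K H M\<^esub> (a2 \<triangleright>\<^bsub>M\<^esub> m0 \<triangleleft>\<^bsub>M\<^esub> b2))))"
proof -
  interpret M: bicovariant_bimodule K H M by fact
  have [simp]: "kmod M" by (rule M.module)
  have r: "sweedler Z (rcoact M m) f = rsum Z M m f" for Z f
    using klinear_closed[OF M.rcoact_linear assms(4)] by (simp add: sweedler_sw)
  have l: "sweedler Z (lcoact M m) f = lsum Z M m f" for Z f
    using klinear_closed[OF M.lcoact_linear assms(4)] by (simp add: sweedler_sw)
  show "rcoact M (a \<triangleright>\<^bsub>M\<^esub> m \<triangleleft>\<^bsub>M\<^esub> b) =
      csum (tensK K M H) a (\<lambda>a1 a2. rsum (tensK K M H) M m (\<lambda>m0 m1. csum (tensK K M H) b (\<lambda>b1 b2.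
        (a1 \<triangleright>\<^bsub>M\<^esub> m0 \<triangleleft>\<^bsub>M\<^esub> b1) \<boxtimes>\<^bsub>tensK K M H\<^esub> (a2 \<otimes>\<^bsub>H\<^esub> m1 \<otimes>\<^bsub>H\<^esub> b2))))"
    using M.rcoact_covariant[OF assms(2,3,4)] assms by (simp add: r sweedler_comult)
  show "lcoact M (a \<triangleright>\<^bsub>M\<^esub> m \<triangleleft>\<^bsub>M\<^esub> b) =
      csum (tensK K H M) a (\<lambda>a1 a2. lsum (tensK K H M) M m (\<lambda>m1 m0. csum (tensK K H M) b (\<lambda>b1 b2.
        (a1 \<otimes>\<^bsub>H\<^esub> m1 \<otimes>\<^bsub>H\<^esub> b1) \<boxtimes>\<^bsub>tensK K H M\<^esub> (a2 \<triangleright>\<^bsub>M\<^esub> m0 \<triangleleft>\<^bsub>M\<^esub> b2))))"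
    using M.lcoact_covariant[OF assms(2,3,4)] assms by (simp add: l sweedler_comult)
qed

lemma bicov_rcov [simp]:
  assumes M: "bicov M"
  shows "rcov M"
proof -
  interpret M: bicovariant_bimodule K H M by fact
  have [simp]: "hbimod M" using M by simp
  note [simp] = klinear_closed[OF M.rcoact_linear]
  have "rcoact M (m \<triangleleft>\<^bsub>M\<^esub> b) = rsum (tensK K M H) M m (\<lambda>m0 m1. csum (tensK K M H) b (\<lambda>b1 b2.
        (m0 \<triangleleft>\<^bsub>M\<^esub> b1) \<boxtimes>\<^bsub>tensK K M H\<^esub> (m1 \<otimes>\<^bsub>H\<^esub> b2)))"
    if "m \<in> carrier M" "b \<in> carrier H" for m b
    using bicov_covariant(1)[OF M _ that(2,1), of "\<one>\<^bsub>H\<^esub>"] that by (simp add: c_one bil_def)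
  thus ?thesis unfolding rcov_def by (intro conjI ballI M.rcoact_linear) simp_all
qed

lemma bicov_lcov [simp]:
  assumes M: "bicov M"
  shows "lcov M"
proof -
  interpret M: bicovariant_bimodule K H M by fact
  have [simp]: "hbimod M" using M by simp
  note [simp] = klinear_closed[OF M.lcoact_linear]
  have "lcoact M (m \<triangleleft>\<^bsub>M\<^esub> b) = lsum (tensK K H M) M m (\<lambda>m1 m0. csum (tensK K H M) b (\<lambda>b1 b2.
        (m1 \<otimes>\<^bsub>H\<^esub> b1) \<boxtimes>\<^bsub>tensK K H M\<^esub> (m0 \<triangleleft>\<^bsub>M\<^esub> b2)))"
    if "m \<in> carrier M" "b \<in> carrier H" for m b
    using bicov_covariant(2)[OF M _ that(2,1), of "\<one>\<^bsub>H\<^esub>"] that by (simp add: c_one bil_def)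
  thus ?thesis unfolding lcov_def by (intro conjI ballI M.lcoact_linear) simp_all
qed

lemma r_lact:
  assumes "bicov M" "m \<in> carrier M" "a \<in> carrier H" "kmod Z" and f: "bil M H Z f"
  shows "rsum Z M (a \<triangleright>\<^bsub>M\<^esub> m) f =
    csum Z a (\<lambda>a1 a2. rsum Z M m (\<lambda>m0 m1. f (a1 \<triangleright>\<^bsub>M\<^esub> m0) (a2 \<otimes>\<^bsub>H\<^esub> m1)))"
proof -
  have "rcoact M (a \<triangleright>\<^bsub>M\<^esub> m) = csum (tensK K M H) a (\<lambda>a1 a2. rsum (tensK K M H) M m (\<lambda>m0 m1.
        (a1 \<triangleright>\<^bsub>M\<^esub> m0) \<boxtimes>\<^bsub>tensK K M H\<^esub> (a2 \<otimes>\<^bsub>H\<^esub> m1)))"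
    using bicov_covariant(1)[OF assms(1,3) _ assms(2), of "\<one>\<^bsub>H\<^esub>"] assms by (simp add: c_one bil_def)
  thus ?thesis
    using assms by (simp add: sw_push[OF _ _ sw_klinear_tens[OF _ _ f]])
qed

lemma l_lact:
  assumes "bicov M" "m \<in> carrier M" "a \<in> carrier H" "kmod Z" and f: "bil H M Z f"
  shows "lsum Z M (a \<triangleright>\<^bsub>M\<^esub> m) f =
    csum Z a (\<lambda>a1 a2. lsum Z M m (\<lambda>m1 m0. f (a1 \<otimes>\<^bsub>H\<^esub> m1) (a2 \<triangleright>\<^bsub>M\<^esub> m0)))"
proof -
  have "lcoact M (a \<triangleright>\<^bsub>M\<^esub> m) = csum (tensK K H M) a (\<lambda>a1 a2. lsum (tensK K H M) M m (\<lambda>m1 m0.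
        (a1 \<otimes>\<^bsub>H\<^esub> m1) \<boxtimes>\<^bsub>tensK K H M\<^esub> (a2 \<triangleright>\<^bsub>M\<^esub> m0)))"
    using bicov_covariant(2)[OF assms(1,3) _ assms(2), of "\<one>\<^bsub>H\<^esub>"] assms by (simp add: c_one bil_def)
  thus ?thesis
    using assms by (simp add: sw_push[OF _ _ sw_klinear_tens[OF _ _ f]])
qed

lemma r_coassoc:
  assumes M: "bicov M" and m: "m \<in> carrier M" and Z: "kmod Z" and f: "tri M H H Z f"
  shows "rsum Z M m (\<lambda>m' a2. rsum Z M m' (\<lambda>m0 a1. f m0 a1 a2)) =
    rsum Z M m (\<lambda>m0 a. csum Z a (\<lambda>a1 a2. f m0 a1 a2))"
proof -
  interpret M: bicovariant_bimodule K H M by fact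
  let ?MH = "tensK K M H" and ?T = "tensK K (tensK K M H) H"
  let ?g = "\<lambda>t. sw ?MH H Z t (\<lambda>s c. sw M H Z s (\<lambda>a b. f a b c))"
  note [simp] = tri_comp[OF f] tri_closed[OF f] m M Z
  have g: "klinear K ?T Z ?g" by (simp add: bil_def)
  have "?g (rsum ?T M m (\<lambda>m' a2. rsum ?T M m' (\<lambda>m0 a1. (m0 \<boxtimes>\<^bsub>?MH\<^esub> a1) \<boxtimes>\<^bsub>?T\<^esub> a2))) =
      ?g (rsum ?T M m (\<lambda>m0 a. csum ?T a (\<lambda>a1 a2. (m0 \<boxtimes>\<^bsub>?MH\<^esub> a1) \<boxtimes>\<^bsub>?T\<^esub> a2)))"
    using M.rcoact_coassoc[OF m] by (simp add: sweedler_comult sweedler_rcoact)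
  thus ?thesis by (simp add: sw_push[OF _ _ g] bil_def)
qed

lemma l_coassoc:
  assumes M: "bicov M" and m: "m \<in> carrier M" and Z: "kmod Z" and f: "tri H H M Z f"
  shows "lsum Z M m (\<lambda>a2 m'. lsum Z M m' (\<lambda>a1 m0. f a2 a1 m0)) =
    lsum Z M m (\<lambda>a m0. csum Z a (\<lambda>a2 a1. f a2 a1 m0))"
proof -
  interpret M: bicovariant_bimodule K H M by fact
  let ?HM = "tensK K H M" and ?T = "tensK K H (tensK K H M)"
  let ?g = "\<lambda>t. sw H ?HM Z t (\<lambda>c s. sw H M Z s (\<lambda>a b. f c a b))"
  note [simp] = tri_comp[OF f] tri_closed[OF f] m M Z
  have g: "klinear K ?T Z ?g" by (simp add: bil_def)
  have "?g (lsum ?T M m (\<lambda>a2 m'. lsum ?T M m' (\<lambda>a1 m0. a2 \<boxtimes>\<^bsub>?T\<^esub> (a1 \<boxtimes>\<^bsub>?HM\<^esub> m0)))) =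
      ?g (lsum ?T M m (\<lambda>a m0. csum ?T a (\<lambda>a2 a1. a2 \<boxtimes>\<^bsub>?T\<^esub> (a1 \<boxtimes>\<^bsub>?HM\<^esub> m0))))"
    using M.lcoact_coassoc[OF m] by (simp add: sweedler_comult sweedler_lcoact)
  thus ?thesis by (simp add: sw_push[OF _ _ g] bil_def)
qed

text \<open>Needed for the left coaction of right coinvariants, see
  \<open>coinv_lsum\<close>.\<close>

lemma rl_commute:
  assumes M: "bicov M" and m: "m \<in> carrier M" and Z: "kmod Z" and f: "tri H M H Z f"
  shows "rsum Z M m (\<lambda>m' b. lsum Z M m' (\<lambda>a m0. f a m0 b)) =
    lsum Z M m (\<lambda>a m'. rsum Z M m' (\<lambda>m0 b. f a m0 b))"
proof -
  interpret M: bicovariant_bimodule K H M by fact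
  let ?HM = "tensK K H M" and ?T = "tensK K (tensK K H M) H"
  let ?g = "\<lambda>t. sw ?HM H Z t (\<lambda>s c. sw H M Z s (\<lambda>a b. f a b c))"
  note [simp] = tri_comp[OF f] tri_closed[OF f] m M Z
  have g: "klinear K ?T Z ?g" by (simp add: bil_def)
  have "?g (rsum ?T M m (\<lambda>m' b. lsum ?T M m' (\<lambda>a m0. (a \<boxtimes>\<^bsub>?HM\<^esub> m0) \<boxtimes>\<^bsub>?T\<^esub> b))) =
      ?g (lsum ?T M m (\<lambda>a m'. rsum ?T M m' (\<lambda>m0 b. (a \<boxtimes>\<^bsub>?HM\<^esub> m0) \<boxtimes>\<^bsub>?T\<^esub> b)))"
    using M.coactions_commute[OF m] by (simp add: sweedler_rcoact sweedler_lcoact)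
  thus ?thesis by (simp add: sw_push[OF _ _ g] bil_def)
qed

lemma r_counit:
  assumes M: "bicov M" and m: "m \<in> carrier M" and Z: "kmod Z" and f: "klinear K M Z f"
  shows "rsum Z M m (\<lambda>m0 a. eps a \<odot>\<^bsub>Z\<^esub> f m0) = f m"
proof -
  interpret M: bicovariant_bimodule K H M by fact
  have "f m = f (rsum M M m (\<lambda>m0 a. eps a \<odot>\<^bsub>M\<^esub> m0))"
    using M.rcoact_counit[OF m] M m by (simp add: sweedler_rcoact)
  thus ?thesis using M m Z by (simp add: sw_push[OF _ _ f] klinear_smult[OF f])
qed

lemma l_counit:
  assumes M: "bicov M" and m: "m \<in> carrier M" and Z: "kmod Z" and f: "klinear K M Z f"
  shows "lsum Z M m (\<lambda>a m0. eps a \<odot>\<^bsub>Z\<^esub> f m0) = f m"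
proof -
  interpret M: bicovariant_bimodule K H M by fact
  have "f m = f (lsum M M m (\<lambda>a m0. eps a \<odot>\<^bsub>M\<^esub> m0))"
    using M.lcoact_counit[OF m] M m by (simp add: sweedler_lcoact)
  thus ?thesis using M m Z by (simp add: sw_push[OF _ _ f] klinear_smult[OF f])
qed

definition coinv where
  "coinv M x \<longleftrightarrow> x \<in> carrier M \<and> rcoact M x = x \<boxtimes>\<^bsub>tensK K M H\<^esub> \<one>\<^bsub>H\<^esub>"

lemma coinv_closed [simp]: "coinv M x \<Longrightarrow> x \<in> carrier M"
  by (simp add: coinv_def)

lemma coinv_rsum:
  assumes "rcov M" "coinv M x" "kmod Z" "bil M H Z f"
  shows "rsum Z M x f = f x \<one>\<^bsub>H\<^esub>"
  using assms by (simp add: coinv_def)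

lemma coinv_ract:
  assumes "rcov M" "coinv M x" "kmod Z" "u \<in> carrier H" and f: "bil M H Z f"
  shows "rsum Z M (x \<triangleleft>\<^bsub>M\<^esub> u) f = csum Z u (\<lambda>u1 u2. f (x \<triangleleft>\<^bsub>M\<^esub> u1) u2)"
  using assms by (simp add: r_ract coinv_rsum bil_def bil_comp1[OF f] bil_comp2[OF f])

definition coinv_proj where
  "coinv_proj M m = rsum M M m (\<lambda>m0 m1. m0 \<triangleleft>\<^bsub>M\<^esub> S m1)"

text \<open>Since the antipode reverses the coproduct, the coaction of \<open>m0 S(m1)\<close> is
  \<open>m0 S(m3) \<otimes> m1 S(m2)\<close>, and the second leg collapses to the unit.\<close>

lemma coinv_coinv_proj:
  assumes M [simp]: "bicov M" and m [simp]: "m \<in> carrier M"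
  shows "coinv M (coinv_proj M m)"
proof -
  let ?T = "tensK K M H"
  have "rcoact M (coinv_proj M m) = rsum ?T M m (\<lambda>m0 m1. rcoact M (m0 \<triangleleft>\<^bsub>M\<^esub> S m1))"
    unfolding coinv_proj_def by (simp add: sw_push[OF _ _ rcoact_linear'])
  also have "\<dots> = rsum ?T M m (\<lambda>m0 m1. rsum ?T M m0 (\<lambda>x y. csum ?T (S m1) (\<lambda>u v. (x \<triangleleft>\<^bsub>M\<^esub> u) \<boxtimes>\<^bsub>?T\<^esub> (y \<otimes>\<^bsub>H\<^esub> v))))"
    by (simp add: rcoact_ract)
  also have "\<dots> = rsum ?T M m (\<lambda>m0 m1. rsum ?T M m0 (\<lambda>x y. csum ?T m1 (\<lambda>p q. (x \<triangleleft>\<^bsub>M\<^esub> S q) \<boxtimes>\<^bsub>?T\<^esub> (y \<otimes>\<^bsub>H\<^esub> S p))))"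
    by (simp add: c_S bil_def)
  also have "\<dots> = rsum ?T M m (\<lambda>x w. csum ?T w (\<lambda>y c. csum ?T c (\<lambda>p q. (x \<triangleleft>\<^bsub>M\<^esub> S q) \<boxtimes>\<^bsub>?T\<^esub> (y \<otimes>\<^bsub>H\<^esub> S p))))"
    by (simp add: r_coassoc tri_def bil_def)
  also have "\<dots> = rsum ?T M m (\<lambda>x w. (x \<triangleleft>\<^bsub>M\<^esub> S w) \<boxtimes>\<^bsub>?T\<^esub> \<one>\<^bsub>H\<^esub>)"
    by (simp add: c_cancel(2)[where f = "\<lambda>z q. (x \<triangleleft>\<^bsub>M\<^esub> S q) \<boxtimes>\<^bsub>?T\<^esub> z" for x] bil_def)
  also have "\<dots> = coinv_proj M m \<boxtimes>\<^bsub>?T\<^esub> \<one>\<^bsub>H\<^esub>"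
    unfolding coinv_proj_def by (simp add: sw_push[where W = ?T and g = "\<lambda>z. z \<boxtimes>\<^bsub>?T\<^esub> \<one>\<^bsub>H\<^esub>"])
  finally show ?thesis by (simp add: coinv_def coinv_proj_def)
qed

text \<open>The sum is \<open>m0 S(m1) m2\<close>; the antipode cancels and the counit law returns
  \<open>m\<close>.\<close>

lemma coinv_decomposition:
  assumes M [simp]: "bicov M" and m [simp]: "m \<in> carrier M"
  shows "rsum M M m (\<lambda>m0 m1. coinv_proj M m0 \<triangleleft>\<^bsub>M\<^esub> m1) = m"
proof -
  have "rsum M M m (\<lambda>m0 m1. coinv_proj M m0 \<triangleleft>\<^bsub>M\<^esub> m1) =
      rsum M M m (\<lambda>m0 c. rsum M M m0 (\<lambda>x b. x \<triangleleft>\<^bsub>M\<^esub> (S b \<otimes>\<^bsub>H\<^esub> c)))"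
    by (simp add: coinv_proj_def sw_push[where W = M and g = "\<lambda>z. z \<triangleleft>\<^bsub>M\<^esub> c" for c] act_mult)
  also have "\<dots> = rsum M M m (\<lambda>x w. csum M w (\<lambda>b c. x \<triangleleft>\<^bsub>M\<^esub> (S b \<otimes>\<^bsub>H\<^esub> c)))"
    by (simp add: r_coassoc tri_def bil_def)
  also have "\<dots> = m"
    by (simp add: c_antipode1 r_counit[where f = "\<lambda>x. x"])
  finally show ?thesis .
qed

text \<open>The fundamental theorem of Hopf modules: \<open>M\<close> is spanned by \<open>x \<triangleleft> u\<close> with \<open>x\<close> coinvariant.\<close>

lemma coinv_eqI:
  assumes M: "bicov M" and m: "m \<in> carrier M" and Z: "kmod Z"
    and f: "klinear K M Z f" and g: "klinear K M Z g"
    and eq: "\<And>x u. \<lbrakk>coinv M x; u \<in> carrier H\<rbrakk> \<Longrightarrow> f (x \<triangleleft>\<^bsub>M\<^esub> u) = g (x \<triangleleft>\<^bsub>M\<^esub> u)"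
  shows "f m = g m"
proof -
  have cl: "coinv_proj M m0 \<in> carrier M" if "m0 \<in> carrier M" for m0
    using coinv_coinv_proj[OF M that] by simp
  have "f m = f (rsum M M m (\<lambda>m0 m1. coinv_proj M m0 \<triangleleft>\<^bsub>M\<^esub> m1))"
    using M m by (simp add: coinv_decomposition)
  also have "\<dots> = rsum Z M m (\<lambda>m0 m1. f (coinv_proj M m0 \<triangleleft>\<^bsub>M\<^esub> m1))"
    using M m Z cl by (simp add: sw_push[OF _ _ f])
  also have "\<dots> = rsum Z M m (\<lambda>m0 m1. g (coinv_proj M m0 \<triangleleft>\<^bsub>M\<^esub> m1))"
    using M by (simp add: eq coinv_coinv_proj)
  also have "\<dots> = g (rsum M M m (\<lambda>m0 m1. coinv_proj M m0 \<triangleleft>\<^bsub>M\<^esub> m1))"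
    using M m Z cl by (simp add: sw_push[OF _ _ g])
  also have "\<dots> = g m"
    using M m by (simp add: coinv_decomposition)
  finally show ?thesis .
qed

lemma tensK_record_cong:
  assumes "carrier V = carrier V'" "\<And>x y. x \<oplus>\<^bsub>V\<^esub> y = x \<oplus>\<^bsub>V'\<^esub> y" "\<And>r x. r \<odot>\<^bsub>V\<^esub> x = r \<odot>\<^bsub>V'\<^esub> x"
  shows "tensK K V B = tensK K V' B" and "tensK K B V = tensK K B V'"
  by (simp_all add: tensK_def module_tensor_def tensor_group_def tensor_relators_def Let_def assms)

text \<open>In \<open>tensH\<close> the coactions are written over the bare module
  \<open>?T\<close>, before actions and coactions are attached. Both records agree in everything
  that \<open>tensK\<close> and pure tensors read.\<close>

lemma coact_tensH:
  assumes M: "hbimod M" and N: "hbimod N" and t: "t \<in> carrier (tensH K H M N)"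
  defines "T \<equiv> tensH K H M N"
  shows "rcoact T t = sw M N (tensK K T H) t (\<lambda>m n.
      sweedler (tensK K T H) (rcoact M m) (\<lambda>m0 m1. sweedler (tensK K T H) (rcoact N n) (\<lambda>n0 n1.
        (m0 \<boxtimes>\<^bsub>T\<^esub> n0) \<boxtimes>\<^bsub>tensK K T H\<^esub> (m1 \<otimes>\<^bsub>H\<^esub> n1))))"
    and "lcoact T t = sw M N (tensK K H T) t (\<lambda>m n.
      sweedler (tensK K H T) (lcoact M m) (\<lambda>m1 m0. sweedler (tensK K H T) (lcoact N n) (\<lambda>n1 n0.
        (m1 \<otimes>\<^bsub>H\<^esub> n1) \<boxtimes>\<^bsub>tensK K H T\<^esub> (m0 \<boxtimes>\<^bsub>T\<^esub> n0))))"
proof -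
  let ?T = "module_tensor (carrier H) (ract M) (lact N) M N"
  have eq: "tensK K ?T H = tensK K T H" "tensK K H ?T = tensK K H T"
    unfolding T_def by (rule tensK_record_cong; simp add: tensH_simps)+
  have zero: "\<zero>\<^bsub>?T\<^esub> = \<zero>\<^bsub>T\<^esub>"
    unfolding T_def tensH_simps ..
  show "rcoact T t = sw M N (tensK K T H) t (\<lambda>m n.
      sweedler (tensK K T H) (rcoact M m) (\<lambda>m0 m1. sweedler (tensK K T H) (rcoact N n) (\<lambda>n0 n1.
        (m0 \<boxtimes>\<^bsub>T\<^esub> n0) \<boxtimes>\<^bsub>tensK K T H\<^esub> (m1 \<otimes>\<^bsub>H\<^esub> n1))))"
    using t by (simp add: sweedler_sw_tensH[OF M N, symmetric] eq[symmetric] zero[symmetric])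
      (simp add: T_def tensH_def Let_def module.extend_def)
  show "lcoact T t = sw M N (tensK K H T) t (\<lambda>m n.
      sweedler (tensK K H T) (lcoact M m) (\<lambda>m1 m0. sweedler (tensK K H T) (lcoact N n) (\<lambda>n1 n0.
        (m1 \<otimes>\<^bsub>H\<^esub> n1) \<boxtimes>\<^bsub>tensK K H T\<^esub> (m0 \<boxtimes>\<^bsub>T\<^esub> n0))))"
    using t by (simp add: sweedler_sw_tensH[OF M N, symmetric] eq[symmetric] zero[symmetric])
      (simp add: T_def tensH_def Let_def module.extend_def)
qed

context
  fixes M :: "('k, 'h, 'm, 'y) bimod_scheme" and N :: "('k, 'h, 'n, 'z) bimod_scheme"
  assumes M: "bicov M" and N: "bicov N"
begin

private abbreviation "T \<equiv> tensH K H M N"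

text \<open>The diagonal coactions descend to the tensor product over \<open>H\<close>: an element
  \<open>a\<close> acting on the right of \<open>m\<close> or on the left of \<open>n\<close> has
  one leg of its coproduct between the module factors and the other between the coaction factors.
  The two expressions differ by the order of independent sums.\<close>

lemma coact_tensH_hbal:
  "hbal M N (tensK K T H) (\<lambda>m n. rsum (tensK K T H) M m (\<lambda>m0 m1. rsum (tensK K T H) N n (\<lambda>n0 n1.
        (m0 \<boxtimes>\<^bsub>T\<^esub> n0) \<boxtimes>\<^bsub>tensK K T H\<^esub> (m1 \<otimes>\<^bsub>H\<^esub> n1))))"
  "hbal M N (tensK K H T) (\<lambda>m n. lsum (tensK K H T) M m (\<lambda>m1 m0. lsum (tensK K H T) N n (\<lambda>n1 n0.
        (m1 \<otimes>\<^bsub>H\<^esub> n1) \<boxtimes>\<^bsub>tensK K H T\<^esub> (m0 \<boxtimes>\<^bsub>T\<^esub> n0))))"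
  using M N
  by (simp_all add: hbal_def bil_def r_ract r_lact l_ract l_lact tensH_balanced m_assoc
      sw_swap[of N H H H _ "rcoact N n" "Dl a" for n a] sw_swap[of H N H H _ "lcoact N n" "Dl a" for n a])

lemma rcoact_tensH_pure:
  assumes "m \<in> carrier M" "n \<in> carrier N"
  shows "rcoact T (m \<boxtimes>\<^bsub>T\<^esub> n) = rsum (tensK K T H) M m (\<lambda>m0 m1. rsum (tensK K T H) N n (\<lambda>n0 n1.
        (m0 \<boxtimes>\<^bsub>T\<^esub> n0) \<boxtimes>\<^bsub>tensK K T H\<^esub> (m1 \<otimes>\<^bsub>H\<^esub> n1)))"
  using assms M N coact_tensH_hbal
  by (simp add: coact_tensH sweedler_rcoact)

lemma lcoact_tensH_pure:
  assumes "m \<in> carrier M" "n \<in> carrier N"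
  shows "lcoact T (m \<boxtimes>\<^bsub>T\<^esub> n) = lsum (tensK K H T) M m (\<lambda>m1 m0. lsum (tensK K H T) N n (\<lambda>n1 n0.
        (m1 \<otimes>\<^bsub>H\<^esub> n1) \<boxtimes>\<^bsub>tensK K H T\<^esub> (m0 \<boxtimes>\<^bsub>T\<^esub> n0)))"
  using assms M N coact_tensH_hbal
  by (simp add: coact_tensH sweedler_lcoact)

lemma coact_tensH_linear:
  "klinear K T (tensK K T H) (rcoact T)" "klinear K T (tensK K H T) (lcoact T)"
proof -
  have [simp]: "kmod T" using M N by simp
  have [simp]: "hbimod M" "hbimod N" using M N by auto
  note h = coact_tensH_hbal
  show "klinear K T (tensK K T H) (rcoact T)"
    by (rule iffD2[OF klinear_cong[where g = "\<lambda>t. sw M N (tensK K T H) t (\<lambda>m n. rsum (tensK K T H) M m (\<lambda>m0 m1. rsum (tensK K T H) N n (\<lambda>n0 n1.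
        (m0 \<boxtimes>\<^bsub>T\<^esub> n0) \<boxtimes>\<^bsub>tensK K T H\<^esub> (m1 \<otimes>\<^bsub>H\<^esub> n1))))"]])
      (use M N h in \<open>simp_all add: coact_tensH sweedler_rcoact sw_klinear_tensH\<close>)
  show "klinear K T (tensK K H T) (lcoact T)"
    by (rule iffD2[OF klinear_cong[where g = "\<lambda>t. sw M N (tensK K H T) t (\<lambda>m n. lsum (tensK K H T) M m (\<lambda>m1 m0. lsum (tensK K H T) N n (\<lambda>n1 n0.
        (m1 \<otimes>\<^bsub>H\<^esub> n1) \<boxtimes>\<^bsub>tensK K H T\<^esub> (m0 \<boxtimes>\<^bsub>T\<^esub> n0))))"]])
      (use M N h in \<open>simp_all add: coact_tensH sweedler_lcoact sw_klinear_tensH\<close>)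
qed

lemma r_tensH:
  assumes "m \<in> carrier M" "n \<in> carrier N" "kmod Z" and f: "bil T H Z f"
  shows "rsum Z T (m \<boxtimes>\<^bsub>T\<^esub> n) f =
    rsum Z M m (\<lambda>m0 m1. rsum Z N n (\<lambda>n0 n1. f (m0 \<boxtimes>\<^bsub>T\<^esub> n0) (m1 \<otimes>\<^bsub>H\<^esub> n1)))"
  using assms M N by (simp add: rcoact_tensH_pure sw_push[OF _ _ sw_klinear_tens[OF _ _ f]])

lemma l_tensH:
  assumes "m \<in> carrier M" "n \<in> carrier N" "kmod Z" and f: "bil H T Z f"
  shows "lsum Z T (m \<boxtimes>\<^bsub>T\<^esub> n) f =
    lsum Z M m (\<lambda>m1 m0. lsum Z N n (\<lambda>n1 n0. f (m1 \<otimes>\<^bsub>H\<^esub> n1) (m0 \<boxtimes>\<^bsub>T\<^esub> n0)))"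
  using assms M N by (simp add: lcoact_tensH_pure sw_push[OF _ _ sw_klinear_tens[OF _ _ f]])

lemma rcov_tensH [simp]: "rcov T"
proof -
  have [simp]: "hbimod M" "hbimod N" "bicov M" "bicov N" using M N by auto
  note [simp] = coact_tensH_linear klinear_closed[OF coact_tensH_linear(1)] lin_comp[OF coact_tensH_linear(1)]
  have "rcoact T (t \<triangleleft>\<^bsub>T\<^esub> b) = rsum (tensK K T H) T t (\<lambda>m0 m1. csum (tensK K T H) b (\<lambda>b1 b2.
        (m0 \<triangleleft>\<^bsub>T\<^esub> b1) \<boxtimes>\<^bsub>tensK K T H\<^esub> (m1 \<otimes>\<^bsub>H\<^esub> b2)))"
    if t: "t \<in> carrier T" and [simp]: "b \<in> carrier H" for t b
    by (rule klinear_tensH_eqI[OF _ _ _ _ t, where Z = "tensK K T H"], simp_all add: r_tensH bil_def)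
      (simp add: rcoact_tensH_pure r_ract m_assoc bil_def)
  thus ?thesis
    unfolding rcov_def by (intro conjI ballI coact_tensH_linear) simp_all
qed

lemma lcov_tensH [simp]: "lcov T"
proof -
  have [simp]: "hbimod M" "hbimod N" "bicov M" "bicov N" using M N by auto
  note [simp] = coact_tensH_linear klinear_closed[OF coact_tensH_linear(2)] lin_comp[OF coact_tensH_linear(2)]
  have "lcoact T (t \<triangleleft>\<^bsub>T\<^esub> b) = lsum (tensK K H T) T t (\<lambda>m1 m0. csum (tensK K H T) b (\<lambda>b1 b2.
        (m1 \<otimes>\<^bsub>H\<^esub> b1) \<boxtimes>\<^bsub>tensK K H T\<^esub> (m0 \<triangleleft>\<^bsub>T\<^esub> b2)))"
    if t: "t \<in> carrier T" and [simp]: "b \<in> carrier H" for t b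
    by (rule klinear_tensH_eqI[OF _ _ _ _ t, where Z = "tensK K H T"], simp_all add: l_tensH bil_def)
      (simp add: lcoact_tensH_pure l_ract m_assoc bil_def)
  thus ?thesis
    unfolding lcov_def by (intro conjI ballI coact_tensH_linear) simp_all
qed

end

section \<open>Differential calculi\<close>

text \<open>The coactions commute, so the module leg of the left coaction of a right coinvariant is
  again coinvariant. This is a statement about the whole sum: the legs of a chosen representative
  need not be coinvariant one by one.\<close>

lemma coinv_lsum:
  assumes M: "bicov M" and x: "coinv M x" and Z: "kmod Z" and f: "tri H M H Z f"
  shows "lsum Z M x (\<lambda>a x0. rsum Z M x0 (\<lambda>y b. f a y b)) = lsum Z M x (\<lambda>a x0. f a x0 \<one>\<^bsub>H\<^esub>)"
proof -
  note [simp] = tri_comp[OF f] tri_closed[OF f]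
  have "rsum Z M x (\<lambda>m' b. lsum Z M m' (\<lambda>a m0. f a m0 b)) = lsum Z M x (\<lambda>a x0. f a x0 \<one>\<^bsub>H\<^esub>)"
    using M x Z by (simp add: coinv_rsum bil_def)
  thus ?thesis using M x Z f by (simp add: rl_commute)
qed

text \<open>A bicovariant first-order calculus: the data left from the graded calculus when degree
  zero is identified with \<open>H\<close> and only one-forms are kept.\<close>

definition fodc where
  "fodc W d \<longleftrightarrow> bicov W \<and> klinear K H W d \<and>
    (\<forall>a\<in>carrier H. \<forall>b\<in>carrier H. d (a \<otimes>\<^bsub>H\<^esub> b) = (d a \<triangleleft>\<^bsub>W\<^esub> b) \<oplus>\<^bsub>W\<^esub> (a \<triangleright>\<^bsub>W\<^esub> d b)) \<and>
    (\<forall>a\<in>carrier H. rcoact W (d a) = csum (tensK K W H) a (\<lambda>a1 a2. d a1 \<boxtimes>\<^bsub>tensK K W H\<^esub> a2)) \<and>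
    (\<forall>a\<in>carrier H. lcoact W (d a) = csum (tensK K H W) a (\<lambda>a1 a2. a1 \<boxtimes>\<^bsub>tensK K H W\<^esub> d a2))"

definition dconn where
  "dconn M W d m = rsum (tensH K H M W) M m (\<lambda>m' m2. rsum (tensH K H M W) M m' (\<lambda>m0 m1.
     (m0 \<triangleleft>\<^bsub>M\<^esub> S m1) \<boxtimes>\<^bsub>tensH K H M W\<^esub> d m2))"

definition right_conn where
  "right_conn M W d D \<longleftrightarrow> klinear K M (tensH K H M W) D \<and> (\<forall>m\<in>carrier M. \<forall>a\<in>carrier H.
     D (m \<triangleleft>\<^bsub>M\<^esub> a) = (D m \<triangleleft>\<^bsub>tensH K H M W\<^esub> a) \<oplus>\<^bsub>tensH K H M W\<^esub> (m \<boxtimes>\<^bsub>tensH K H M W\<^esub> d a))"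

context
  fixes W :: "('k, 'h, 'w, 'y) bimod_scheme" and d
  assumes d: "fodc W d"
begin

lemma fodc_bicov [simp]: "bicov W"
  using d by (simp add: fodc_def)

lemma fodc_linear [simp]: "klinear K H W d"
  using d by (simp add: fodc_def)

lemmas fodc_closed [simp] = klinear_closed[OF fodc_linear]
lemmas lin_fodc [simp] = lin_comp[OF fodc_linear]

lemma fodc_leibniz:
  "\<lbrakk>a \<in> carrier H; b \<in> carrier H\<rbrakk> \<Longrightarrow> d (a \<otimes>\<^bsub>H\<^esub> b) = (d a \<triangleleft>\<^bsub>W\<^esub> b) \<oplus>\<^bsub>W\<^esub> (a \<triangleright>\<^bsub>W\<^esub> d b)"
  using d unfolding fodc_def by blast

lemma fodc_one: "d \<one>\<^bsub>H\<^esub> = \<zero>\<^bsub>W\<^esub>"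
proof -
  have "kmod W" by simp
  then interpret W: Module.module K W .
  have "bicov W" by simp
  hence "d \<one>\<^bsub>H\<^esub> \<oplus>\<^bsub>W\<^esub> d \<one>\<^bsub>H\<^esub> = d \<one>\<^bsub>H\<^esub>"
    using fodc_leibniz[of "\<one>\<^bsub>H\<^esub>" "\<one>\<^bsub>H\<^esub>"] by simp
  thus ?thesis by (simp add: W.add.l_cancel_one')
qed

lemma fodc_rsum:
  assumes "a \<in> carrier H" "kmod Z" and f: "bil W H Z f"
  shows "rsum Z W (d a) f = csum Z a (\<lambda>a1 a2. f (d a1) a2)"
proof -
  have "rcoact W (d a) = csum (tensK K W H) a (\<lambda>a1 a2. d a1 \<boxtimes>\<^bsub>tensK K W H\<^esub> a2)"
    using d assms(1) unfolding fodc_def by blast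
  thus ?thesis using assms by (simp add: sw_push[OF _ _ sw_klinear_tens[OF _ _ f]])
qed

lemma fodc_lsum:
  assumes "a \<in> carrier H" "kmod Z" and f: "bil H W Z f"
  shows "lsum Z W (d a) f = csum Z a (\<lambda>a1 a2. f a1 (d a2))"
proof -
  have "lcoact W (d a) = csum (tensK K H W) a (\<lambda>a1 a2. a1 \<boxtimes>\<^bsub>tensK K H W\<^esub> d a2)"
    using d assms(1) unfolding fodc_def by blast
  thus ?thesis using assms by (simp add: sw_push[OF _ _ sw_klinear_tens[OF _ _ f]])
qed

lemma dconn_linear [simp]: "rcov M \<Longrightarrow> klinear K M (tensH K H M W) (dconn M W d)"
  unfolding dconn_def[abs_def] by (simp add: bil_def)

lemma dconn_closed [simp]: "\<lbrakk>rcov M; m \<in> carrier M\<rbrakk> \<Longrightarrow> dconn M W d m \<in> carrier (tensH K H M W)"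
  by (rule klinear_closed[OF dconn_linear])

lemma lin_dconn [simp]:
  "\<lbrakk>rcov M; klinear K V M f\<rbrakk> \<Longrightarrow> klinear K V (tensH K H M W) (\<lambda>x. dconn M W d (f x))"
  by (rule lin_comp[OF dconn_linear])

text \<open>The coaction of \<open>x u\<close> only splits \<open>u\<close>, and
  \<open>u1 S(u2)\<close> collapses next to \<open>x\<close>. For a bicovariant \<open>M\<close>
  such elements span, so this formula determines the canonical connection.\<close>

lemma dconn_coinv:
  assumes "rcov M" "coinv M x" "u \<in> carrier H"
  shows "dconn M W d (x \<triangleleft>\<^bsub>M\<^esub> u) = x \<boxtimes>\<^bsub>tensH K H M W\<^esub> d u"
proof -
  let ?R = "tensH K H M W"
  note [simp] = assms
  have "dconn M W d (x \<triangleleft>\<^bsub>M\<^esub> u) =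
      csum ?R u (\<lambda>u1 u2. csum ?R u1 (\<lambda>p q. (x \<triangleleft>\<^bsub>M\<^esub> p \<triangleleft>\<^bsub>M\<^esub> S q) \<boxtimes>\<^bsub>?R\<^esub> d u2))"
    unfolding dconn_def by (simp add: coinv_ract bil_def)
  also have "\<dots> = csum ?R u (\<lambda>u1 u2. csum ?R u1 (\<lambda>p q. (x \<triangleleft>\<^bsub>M\<^esub> (p \<otimes>\<^bsub>H\<^esub> S q)) \<boxtimes>\<^bsub>?R\<^esub> d u2))"
    by (simp add: act_mult)
  also have "\<dots> = x \<boxtimes>\<^bsub>?R\<^esub> d u"
    by (simp add: c_antipode2[where f = "\<lambda>z. (x \<triangleleft>\<^bsub>M\<^esub> z) \<boxtimes>\<^bsub>?R\<^esub> d v" for v] c_counit1)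
  finally show ?thesis .
qed

lemma dconn_coinv_zero:
  assumes "rcov M" "coinv M x"
  shows "dconn M W d x = \<zero>\<^bsub>tensH K H M W\<^esub>"
proof -
  have kR: "kmod (tensH K H M W)" "kmod W" using assms by auto
  have lin: "klinear K W (tensH K H M W) (\<lambda>w. x \<boxtimes>\<^bsub>tensH K H M W\<^esub> w)"
    using assms by simp
  have "dconn M W d (x \<triangleleft>\<^bsub>M\<^esub> \<one>\<^bsub>H\<^esub>) = x \<boxtimes>\<^bsub>tensH K H M W\<^esub> d \<one>\<^bsub>H\<^esub>"
    using assms by (intro dconn_coinv) simp_all
  thus ?thesis
    using klinear_zero[OF lin kmod_group[OF kR(2)] kmod_group[OF kR(1)]] assms by (simp add: fodc_one)
qed

text \<open>On spanning elements the claim is the Leibniz rule for \<open>d (u \<otimes> a)\<close>: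
  its second term becomes the inhomogeneous term after \<open>u\<close> is moved across the tensor
  sign.\<close>

lemma dconn_leibniz:
  assumes M: "bicov M" and m: "m \<in> carrier M" and a: "a \<in> carrier H"
  shows "dconn M W d (m \<triangleleft>\<^bsub>M\<^esub> a) = (dconn M W d m \<triangleleft>\<^bsub>tensH K H M W\<^esub> a)
    \<oplus>\<^bsub>tensH K H M W\<^esub> (m \<boxtimes>\<^bsub>tensH K H M W\<^esub> d a)"
proof -
  let ?R = "tensH K H M W"
  note [simp] = M a
  have "kmod ?R" by simp
  then interpret R: Module.module K ?R .
  have lin2: "klinear K M ?R (\<lambda>m. f m \<oplus>\<^bsub>?R\<^esub> g m)" if "klinear K M ?R f" "klinear K M ?R g" for f g
    using klinear_closed[OF that(1)] klinear_closed[OF that(2)] that unfolding klinear_def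
    by (auto simp: R.smult_r_distr R.a_ac)
  show ?thesis
  proof (rule coinv_eqI[OF M m, where Z = ?R])
    fix x u assume [simp]: "coinv M x" "u \<in> carrier H"
    have "dconn M W d (x \<triangleleft>\<^bsub>M\<^esub> u \<triangleleft>\<^bsub>M\<^esub> a) = dconn M W d (x \<triangleleft>\<^bsub>M\<^esub> (u \<otimes>\<^bsub>H\<^esub> a))"
      by (simp add: act_mult)
    also have "\<dots> = (x \<boxtimes>\<^bsub>?R\<^esub> (d u \<triangleleft>\<^bsub>W\<^esub> a)) \<oplus>\<^bsub>?R\<^esub> (x \<boxtimes>\<^bsub>?R\<^esub> (u \<triangleright>\<^bsub>W\<^esub> d a))"
      by (simp add: dconn_coinv fodc_leibniz klinear_add[OF bil1[OF tensH_bil]])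
    also have "\<dots> = (dconn M W d (x \<triangleleft>\<^bsub>M\<^esub> u) \<triangleleft>\<^bsub>?R\<^esub> a) \<oplus>\<^bsub>?R\<^esub> ((x \<triangleleft>\<^bsub>M\<^esub> u) \<boxtimes>\<^bsub>?R\<^esub> d a)"
      by (simp add: dconn_coinv tensH_balanced)
    finally show "dconn M W d (x \<triangleleft>\<^bsub>M\<^esub> u \<triangleleft>\<^bsub>M\<^esub> a) = (dconn M W d (x \<triangleleft>\<^bsub>M\<^esub> u) \<triangleleft>\<^bsub>?R\<^esub> a) \<oplus>\<^bsub>?R\<^esub> ((x \<triangleleft>\<^bsub>M\<^esub> u) \<boxtimes>\<^bsub>?R\<^esub> d a)" .
  qed (simp_all add: lin2)
qed

lemma rcoact_dconn:
  assumes M: "bicov M" and m: "m \<in> carrier M"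
  defines "R \<equiv> tensH K H M W"
  shows "rcoact R (dconn M W d m) = rsum (tensK K R H) M m (\<lambda>m0 m1. dconn M W d m0 \<boxtimes>\<^bsub>tensK K R H\<^esub> m1)"
  unfolding R_def
  by (rule coinv_eqI[OF M m, where Z = "tensK K (tensH K H M W) H"])
    (use M in \<open>simp_all add: bil_def dconn_coinv coinv_ract rcoact_tensH_pure fodc_rsum coinv_rsum\<close>)

text \<open>Left colinearity is less direct than right colinearity, because the left coaction of a
  coinvariant \<open>x\<close> is in general nontrivial.\<close>

lemma lcoact_dconn:
  assumes M: "bicov M" and m: "m \<in> carrier M"
  defines "R \<equiv> tensH K H M W"
  shows "lcoact R (dconn M W d m) = lsum (tensK K H R) M m (\<lambda>m1 m0. m1 \<boxtimes>\<^bsub>tensK K H R\<^esub> dconn M W d m0)"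
  unfolding R_def
proof (rule coinv_eqI[OF M m, where Z = "tensK K H (tensH K H M W)"])
  let ?R = "tensH K H M W" and ?Z = "tensK K H (tensH K H M W)"
  note [simp] = M
  fix x u assume [simp]: "coinv M x" "u \<in> carrier H"
  have "kmod ?R" "kmod ?Z" by simp_all
  then interpret R: Module.module K ?R + Z: Module.module K ?Z .
  \<comment> \<open>The leg \<open>x0\<close> comes from a chosen representative, so
    \<open>dconn_coinv\<close> does not apply to \<open>x0 u2\<close>. The Leibniz rule splits off
    \<open>d(x0) u2\<close> instead, whose total contribution is shown to vanish.\<close>
  have key: "lsum ?Z M x (\<lambda>a x0. (a \<otimes>\<^bsub>H\<^esub> u1) \<boxtimes>\<^bsub>?Z\<^esub> dconn M W d (x0 \<triangleleft>\<^bsub>M\<^esub> u2)) =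
      lsum ?Z M x (\<lambda>a x0. (a \<otimes>\<^bsub>H\<^esub> u1) \<boxtimes>\<^bsub>?Z\<^esub> (x0 \<boxtimes>\<^bsub>?R\<^esub> d u2))"
    if [simp]: "u1 \<in> carrier H" "u2 \<in> carrier H" for u1 u2
  proof -
    \<comment> \<open>The differentiated factor is isolated as \<open>w\<close>. Coinvariance in
      summed form then replaces it by the differential of the unit, and \<open>?F\<close> is linear
      with \<open>d\<close> of the unit equal to zero.\<close>
    let ?F = "\<lambda>w. lsum ?Z M x (\<lambda>a m'. (a \<otimes>\<^bsub>H\<^esub> u1) \<boxtimes>\<^bsub>?Z\<^esub>
      (rsum ?R M m' (\<lambda>m0 m1. (m0 \<triangleleft>\<^bsub>M\<^esub> S m1) \<boxtimes>\<^bsub>?R\<^esub> w) \<triangleleft>\<^bsub>?R\<^esub> u2))"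
    have lin: "klinear K W ?Z ?F" by simp
    have "lsum ?Z M x (\<lambda>a x0. (a \<otimes>\<^bsub>H\<^esub> u1) \<boxtimes>\<^bsub>?Z\<^esub> (dconn M W d x0 \<triangleleft>\<^bsub>?R\<^esub> u2)) =
        lsum ?Z M x (\<lambda>a x0. rsum ?Z M x0 (\<lambda>m' b. (a \<otimes>\<^bsub>H\<^esub> u1) \<boxtimes>\<^bsub>?Z\<^esub>
          (rsum ?R M m' (\<lambda>m0 m1. (m0 \<triangleleft>\<^bsub>M\<^esub> S m1) \<boxtimes>\<^bsub>?R\<^esub> d b) \<triangleleft>\<^bsub>?R\<^esub> u2)))"
      unfolding dconn_def
      by (simp add: sw_push[where W = ?Z and g = "\<lambda>z. (a \<otimes>\<^bsub>H\<^esub> u1) \<boxtimes>\<^bsub>?Z\<^esub> (z \<triangleleft>\<^bsub>?R\<^esub> u2)" for a])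
    also have "\<dots> = ?F (d \<one>\<^bsub>H\<^esub>)"
      by (subst coinv_lsum) (simp_all add: tri_def bil_def)
    also have "\<dots> = \<zero>\<^bsub>?Z\<^esub>"
      unfolding fodc_one by (rule klinear_zero[OF lin]) (simp_all add: kmod_group)
    finally have zero: "lsum ?Z M x (\<lambda>a x0. (a \<otimes>\<^bsub>H\<^esub> u1) \<boxtimes>\<^bsub>?Z\<^esub> (dconn M W d x0 \<triangleleft>\<^bsub>?R\<^esub> u2)) = \<zero>\<^bsub>?Z\<^esub>" .
    have "lsum ?Z M x (\<lambda>a x0. (a \<otimes>\<^bsub>H\<^esub> u1) \<boxtimes>\<^bsub>?Z\<^esub> dconn M W d (x0 \<triangleleft>\<^bsub>M\<^esub> u2)) =
        lsum ?Z M x (\<lambda>a x0. (a \<otimes>\<^bsub>H\<^esub> u1) \<boxtimes>\<^bsub>?Z\<^esub> (dconn M W d x0 \<triangleleft>\<^bsub>?R\<^esub> u2) \<oplus>\<^bsub>?Z\<^esub>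
          (a \<otimes>\<^bsub>H\<^esub> u1) \<boxtimes>\<^bsub>?Z\<^esub> (x0 \<boxtimes>\<^bsub>?R\<^esub> d u2))"
      by (simp add: dconn_leibniz klinear_add[OF bil1[OF tensK_bil]])
    also have "\<dots> = lsum ?Z M x (\<lambda>a x0. (a \<otimes>\<^bsub>H\<^esub> u1) \<boxtimes>\<^bsub>?Z\<^esub> (x0 \<boxtimes>\<^bsub>?R\<^esub> d u2))"
      by (simp add: sw_fun_add zero)
    finally show ?thesis .
  qed
  have "lsum ?Z M (x \<triangleleft>\<^bsub>M\<^esub> u) (\<lambda>m1 m0. m1 \<boxtimes>\<^bsub>?Z\<^esub> dconn M W d m0) =
      csum ?Z u (\<lambda>u1 u2. lsum ?Z M x (\<lambda>a x0. (a \<otimes>\<^bsub>H\<^esub> u1) \<boxtimes>\<^bsub>?Z\<^esub> dconn M W d (x0 \<triangleleft>\<^bsub>M\<^esub> u2)))"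
    by (simp add: l_ract bil_def sw_swap[of H M H H ?Z "lcoact M x"])
  also have "\<dots> = csum ?Z u (\<lambda>u1 u2. lsum ?Z M x (\<lambda>a x0. (a \<otimes>\<^bsub>H\<^esub> u1) \<boxtimes>\<^bsub>?Z\<^esub> (x0 \<boxtimes>\<^bsub>?R\<^esub> d u2)))"
    by (simp add: key)
  also have "\<dots> = lcoact ?R (dconn M W d (x \<triangleleft>\<^bsub>M\<^esub> u))"
    by (simp add: dconn_coinv lcoact_tensH_pure fodc_lsum bil_def sw_swap[of H M H H ?Z "lcoact M x"])
  finally show "lcoact ?R (dconn M W d (x \<triangleleft>\<^bsub>M\<^esub> u)) = lsum ?Z M (x \<triangleleft>\<^bsub>M\<^esub> u) (\<lambda>m1 m0. m1 \<boxtimes>\<^bsub>?Z\<^esub> dconn M W d m0)"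
    by simp
qed (use M in \<open>simp_all add: bil_def\<close>)

end

text \<open>The actions on forms are products with degree-zero forms, so the bimodule laws and
  covariance are instances of \<open>wedge_assoc\<close>, \<open>rcoact_wedge\<close> and
  \<open>lcoact_wedge\<close>.\<close>

lemma calculus_bicov:
  assumes "bicovariant_calculus K H \<Omega>"
  shows "bicov (forms \<Omega> k)"
proof -
  interpret \<Omega>: bicovariant_calculus K H \<Omega> by fact
  interpret B: bicomodule K H "forms \<Omega> j" for j by (rule \<Omega>.bicomodule)
  have [simp]: "kmod (forms \<Omega> j)" for j by (rule \<Omega>.module)
  note [simp] = klinear_closed[OF \<Omega>.incl_linear]
  have incl1 [simp]: "incl \<Omega> \<one>\<^bsub>H\<^esub> \<in> carrier (forms \<Omega> 0)" by simp
  \<comment> \<open>The degrees \<open>0 + k\<close> and \<open>k + 0\<close> are normalised to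
    \<open>k\<close>, so that products with degree-zero forms are seen to stay in
    \<open>forms \<Omega> k\<close>.\<close>
  note linL = lin_comp[OF \<Omega>.wedge_linear_left[where j = k and i = 0, simplified]]
    lin_comp[OF \<Omega>.wedge_linear_right[where j = k and i = 0, simplified]]
    lin_comp[OF \<Omega>.wedge_linear_left[where j = 0 and i = k, simplified]]
    lin_comp[OF \<Omega>.wedge_linear_right[where j = 0 and i = k, simplified]]
  note cl = klinear_closed[OF \<Omega>.wedge_linear_right[where j = k and i = 0, simplified]]
    klinear_closed[OF \<Omega>.wedge_linear_right[where j = 0 and i = k, simplified]]
  note [simp] = linL lin_comp[OF \<Omega>.incl_linear] \<Omega>.incl_linear cl
  have closed: "a \<triangleright>\<^bsub>forms \<Omega> k\<^esub> u \<in> carrier (forms \<Omega> k)" "u \<triangleleft>\<^bsub>forms \<Omega> k\<^esub> a \<in> carrier (forms \<Omega> k)"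
    if "a \<in> carrier H" "u \<in> carrier (forms \<Omega> k)" for a u
    using that by (simp_all add: \<Omega>.lact_wedge \<Omega>.ract_wedge)
  have assoc: "wedge \<Omega> 0 k (wedge \<Omega> 0 0 a b) u = wedge \<Omega> 0 k a (wedge \<Omega> 0 k b u)"
    "wedge \<Omega> k 0 u (wedge \<Omega> 0 0 a b) = wedge \<Omega> k 0 (wedge \<Omega> k 0 u a) b"
    "wedge \<Omega> k 0 (wedge \<Omega> 0 k a u) b = wedge \<Omega> 0 k a (wedge \<Omega> k 0 u b)"
    if "a \<in> carrier (forms \<Omega> 0)" "b \<in> carrier (forms \<Omega> 0)" "u \<in> carrier (forms \<Omega> k)" for a b u
    using that \<Omega>.wedge_assoc[of a 0 b 0 u k] \<Omega>.wedge_assoc[of u k a 0 b 0] \<Omega>.wedge_assoc[of a 0 u k b 0] by simp_all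
  let ?F = "forms \<Omega> k"
  have lin1: "klinear K ?F ?F (lact ?F a)" if "a \<in> carrier H" for a
    by (rule iffD2[OF klinear_cong[OF \<Omega>.lact_wedge[OF that]]]) (use that in simp_all)
  have lin2: "klinear K ?F ?F (\<lambda>u. u \<triangleleft>\<^bsub>?F\<^esub> a)" if "a \<in> carrier H" for a
    by (rule iffD2[OF klinear_cong[OF \<Omega>.ract_wedge[OF that]]]) (use that in simp_all)
  have lin3: "klinear K H ?F (\<lambda>a. a \<triangleright>\<^bsub>?F\<^esub> u)" if "u \<in> carrier ?F" for u
    by (rule iffD2[OF klinear_cong[OF \<Omega>.lact_wedge[OF _ that]]]) (use that in simp_all)
  have lin4: "klinear K H ?F (\<lambda>a. u \<triangleleft>\<^bsub>?F\<^esub> a)" if "u \<in> carrier ?F" for u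
    by (rule iffD2[OF klinear_cong[OF \<Omega>.ract_wedge[OF _ that]]]) (use that in simp_all)
  have r: "rcoact (forms \<Omega> j) u \<in> carrier (tensK K (forms \<Omega> j) H)"
    and l: "lcoact (forms \<Omega> j) u \<in> carrier (tensK K H (forms \<Omega> j))"
    if "u \<in> carrier (forms \<Omega> j)" for u j
    using that klinear_closed[OF B.rcoact_linear] klinear_closed[OF B.lcoact_linear] by auto
  note [simp] = r l
  have r': "sweedler Z (rcoact (forms \<Omega> j) u) f = rsum Z (forms \<Omega> j) u f"
    if "u \<in> carrier (forms \<Omega> j)" for u j Z f
    using that by (simp add: sweedler_sw)
  have l': "sweedler Z (lcoact (forms \<Omega> j) u) f = lsum Z (forms \<Omega> j) u f"
    if "u \<in> carrier (forms \<Omega> j)" for u j Z f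
    using that by (simp add: sweedler_sw)
  have rincl: "rsum Z (forms \<Omega> 0) (incl \<Omega> a) f = csum Z a (\<lambda>a1 a2. f (incl \<Omega> a1) a2)"
    if "a \<in> carrier H" "kmod Z" "bil (forms \<Omega> 0) H Z f" for Z a f
    using that by (simp add: \<Omega>.rcoact_incl sweedler_comult sw_push[OF _ _ sw_klinear_tens])
  have lincl: "lsum Z (forms \<Omega> 0) (incl \<Omega> a) f = csum Z a (\<lambda>a1 a2. f a1 (incl \<Omega> a2))"
    if "a \<in> carrier H" "kmod Z" "bil H (forms \<Omega> 0) Z f" for Z a f
    using that by (simp add: \<Omega>.lcoact_incl sweedler_comult sw_push[OF _ _ sw_klinear_tens])
  let ?R = "tensK K ?F H" and ?L = "tensK K H ?F"
  have rl: "rcoact ?F (wedge \<Omega> 0 k (incl \<Omega> a) u) = csum ?R a (\<lambda>a1 a2. rsum ?R ?F u (\<lambda>u0 u1.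
      wedge \<Omega> 0 k (incl \<Omega> a1) u0 \<boxtimes>\<^bsub>?R\<^esub> (a2 \<otimes>\<^bsub>H\<^esub> u1)))"
    and ll: "lcoact ?F (wedge \<Omega> 0 k (incl \<Omega> a) u) = csum ?L a (\<lambda>a1 a2. lsum ?L ?F u (\<lambda>u1 u0.
      (a1 \<otimes>\<^bsub>H\<^esub> u1) \<boxtimes>\<^bsub>?L\<^esub> wedge \<Omega> 0 k (incl \<Omega> a2) u0))"
    if "a \<in> carrier H" "u \<in> carrier ?F" for a u
    using that \<Omega>.rcoact_wedge[of "incl \<Omega> a" 0 u k] \<Omega>.lcoact_wedge[of "incl \<Omega> a" 0 u k]
    by (simp_all add: r' l' rincl lincl bil_def)
  have rr: "rcoact ?F (wedge \<Omega> k 0 u (incl \<Omega> b)) = rsum ?R ?F u (\<lambda>u0 u1. csum ?R b (\<lambda>b1 b2.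
      wedge \<Omega> k 0 u0 (incl \<Omega> b1) \<boxtimes>\<^bsub>?R\<^esub> (u1 \<otimes>\<^bsub>H\<^esub> b2)))"
    and lr: "lcoact ?F (wedge \<Omega> k 0 u (incl \<Omega> b)) = lsum ?L ?F u (\<lambda>u1 u0. csum ?L b (\<lambda>b1 b2.
      (u1 \<otimes>\<^bsub>H\<^esub> b1) \<boxtimes>\<^bsub>?L\<^esub> wedge \<Omega> k 0 u0 (incl \<Omega> b2)))"
    if "b \<in> carrier H" "u \<in> carrier ?F" for b u
    using that \<Omega>.rcoact_wedge[of u k "incl \<Omega> b" 0] \<Omega>.lcoact_wedge[of u k "incl \<Omega> b" 0]
    by (simp_all add: r' l' rincl lincl bil_def)
  show ?thesis
  proof (intro bicovariant_bimodule.intro bicovariant_bimodule_axioms.intro \<Omega>.bicomodule lin1 lin2)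
    fix a b m assume [simp]: "a \<in> carrier H" "b \<in> carrier H" "m \<in> carrier ?F"
    show "(a \<oplus>\<^bsub>H\<^esub> b) \<triangleright>\<^bsub>?F\<^esub> m = (a \<triangleright>\<^bsub>?F\<^esub> m) \<oplus>\<^bsub>?F\<^esub> (b \<triangleright>\<^bsub>?F\<^esub> m)"
      "m \<triangleleft>\<^bsub>?F\<^esub> (a \<oplus>\<^bsub>H\<^esub> b) = (m \<triangleleft>\<^bsub>?F\<^esub> a) \<oplus>\<^bsub>?F\<^esub> (m \<triangleleft>\<^bsub>?F\<^esub> b)"
      by (simp_all add: klinear_add[OF lin3] klinear_add[OF lin4])
    show "(a \<otimes>\<^bsub>H\<^esub> b) \<triangleright>\<^bsub>?F\<^esub> m = a \<triangleright>\<^bsub>?F\<^esub> (b \<triangleright>\<^bsub>?F\<^esub> m)"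
      "m \<triangleleft>\<^bsub>?F\<^esub> (a \<otimes>\<^bsub>H\<^esub> b) = (m \<triangleleft>\<^bsub>?F\<^esub> a) \<triangleleft>\<^bsub>?F\<^esub> b"
      "(a \<triangleright>\<^bsub>?F\<^esub> m) \<triangleleft>\<^bsub>?F\<^esub> b = a \<triangleright>\<^bsub>?F\<^esub> (m \<triangleleft>\<^bsub>?F\<^esub> b)"
      by (simp_all add: \<Omega>.lact_wedge \<Omega>.ract_wedge \<Omega>.incl_mult assoc)
    show "rcoact ?F (a \<triangleright>\<^bsub>?F\<^esub> m \<triangleleft>\<^bsub>?F\<^esub> b) =
      sweedler ?R (comult H a) (\<lambda>a1 a2. sweedler ?R (rcoact ?F m) (\<lambda>m0 m1. sweedler ?R (comult H b) (\<lambda>b1 b2.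
            (a1 \<triangleright>\<^bsub>?F\<^esub> m0 \<triangleleft>\<^bsub>?F\<^esub> b1) \<boxtimes>\<^bsub>?R\<^esub> (a2 \<otimes>\<^bsub>H\<^esub> m1 \<otimes>\<^bsub>H\<^esub> b2))))"
      by (simp add: \<Omega>.lact_wedge \<Omega>.ract_wedge r' sweedler_comult rl rr assoc m_assoc sw_push[OF _ _ sw_klinear_tens] bil_def)
    show "lcoact ?F (a \<triangleright>\<^bsub>?F\<^esub> m \<triangleleft>\<^bsub>?F\<^esub> b) =
      sweedler ?L (comult H a) (\<lambda>a1 a2. sweedler ?L (lcoact ?F m) (\<lambda>m1 m0. sweedler ?L (comult H b) (\<lambda>b1 b2.
            (a1 \<otimes>\<^bsub>H\<^esub> m1 \<otimes>\<^bsub>H\<^esub> b1) \<boxtimes>\<^bsub>?L\<^esub> (a2 \<triangleright>\<^bsub>?F\<^esub> m0 \<triangleleft>\<^bsub>?F\<^esub> b2))))"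
      by (simp add: \<Omega>.lact_wedge \<Omega>.ract_wedge l' sweedler_comult ll lr assoc m_assoc sw_push[OF _ _ sw_klinear_tens] bil_def)
  next
    fix c a m assume "c \<in> carrier K" "a \<in> carrier H" "m \<in> carrier ?F"
    thus "(c \<odot>\<^bsub>H\<^esub> a) \<triangleright>\<^bsub>?F\<^esub> m = c \<odot>\<^bsub>?F\<^esub> (a \<triangleright>\<^bsub>?F\<^esub> m)" "m \<triangleleft>\<^bsub>?F\<^esub> (c \<odot>\<^bsub>H\<^esub> a) = c \<odot>\<^bsub>?F\<^esub> (m \<triangleleft>\<^bsub>?F\<^esub> a)"
      by (simp_all add: klinear_smult[OF lin3] klinear_smult[OF lin4])
  next
    fix m assume "m \<in> carrier ?F"
    thus "\<one>\<^bsub>H\<^esub> \<triangleright>\<^bsub>?F\<^esub> m = m" "m \<triangleleft>\<^bsub>?F\<^esub> \<one>\<^bsub>H\<^esub> = m"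
      by (simp_all add: \<Omega>.lact_wedge \<Omega>.ract_wedge \<Omega>.wedge_one)
  qed
qed

lemma calculus_fodc:
  assumes "bicovariant_calculus K H \<Omega>"
  shows "fodc (forms \<Omega> 1) (\<lambda>a. diff \<Omega> 0 (incl \<Omega> a))"
proof -
  interpret \<Omega>: bicovariant_calculus K H \<Omega> by fact
  have B: "bicov (forms \<Omega> k)" for k by (rule calculus_bicov[OF assms])
  have [simp]: "kmod (forms \<Omega> k)" for k by (rule \<Omega>.module)
  note [simp] = klinear_closed[OF \<Omega>.incl_linear] klinear_closed[OF \<Omega>.diff_linear]
    lin_comp[OF \<Omega>.incl_linear] lin_comp[OF \<Omega>.diff_linear] \<Omega>.incl_linear
  have r: "sweedler Z (rcoact (forms \<Omega> 0) (incl \<Omega> a)) f = csum Z a (\<lambda>a1 a2. f (incl \<Omega> a1) a2)"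
    if "a \<in> carrier H" "kmod Z" "bil (forms \<Omega> 0) H Z f" for Z a f
    using that B[of 0]
    by (simp add: sweedler_rcoact)
      (simp add: \<Omega>.rcoact_incl sweedler_comult sw_push[OF _ _ sw_klinear_tens])
  have l: "sweedler Z (lcoact (forms \<Omega> 0) (incl \<Omega> a)) f = csum Z a (\<lambda>a1 a2. f a1 (incl \<Omega> a2))"
    if "a \<in> carrier H" "kmod Z" "bil H (forms \<Omega> 0) Z f" for Z a f
    using that B[of 0]
    by (simp add: sweedler_lcoact)
      (simp add: \<Omega>.lcoact_incl sweedler_comult sw_push[OF _ _ sw_klinear_tens])
  show ?thesis
    unfolding fodc_def One_nat_def
  proof (intro conjI ballI B)
    show "klinear K H (forms \<Omega> (Suc 0)) (\<lambda>a. diff \<Omega> 0 (incl \<Omega> a))" by simp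
  next
    fix a b assume ab: "a \<in> carrier H" "b \<in> carrier H"
    thus "diff \<Omega> 0 (incl \<Omega> (a \<otimes>\<^bsub>H\<^esub> b)) = (diff \<Omega> 0 (incl \<Omega> a) \<triangleleft>\<^bsub>forms \<Omega> (Suc 0)\<^esub> b) \<oplus>\<^bsub>forms \<Omega> (Suc 0)\<^esub>
        (a \<triangleright>\<^bsub>forms \<Omega> (Suc 0)\<^esub> diff \<Omega> 0 (incl \<Omega> b))"
      using \<Omega>.leibniz[of "incl \<Omega> a" 0 "incl \<Omega> b" 0]
      by (simp add: \<Omega>.incl_mult \<Omega>.lact_wedge \<Omega>.ract_wedge)
  next
    fix a assume a: "a \<in> carrier H"
    show "rcoact (forms \<Omega> (Suc 0)) (diff \<Omega> 0 (incl \<Omega> a)) =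
        csum (tensK K (forms \<Omega> (Suc 0)) H) a (\<lambda>a1 a2. diff \<Omega> 0 (incl \<Omega> a1) \<boxtimes>\<^bsub>tensK K (forms \<Omega> (Suc 0)) H\<^esub> a2)"
      using a \<Omega>.rcoact_diff[of "incl \<Omega> a" 0] by (simp add: r bil_def)
    show "lcoact (forms \<Omega> (Suc 0)) (diff \<Omega> 0 (incl \<Omega> a)) =
        csum (tensK K H (forms \<Omega> (Suc 0))) a (\<lambda>a1 a2. a1 \<boxtimes>\<^bsub>tensK K H (forms \<Omega> (Suc 0))\<^esub> diff \<Omega> 0 (incl \<Omega> a2))"
      using a \<Omega>.lcoact_diff[of "incl \<Omega> a" 0] by (simp add: l bil_def)
  qed
qed

section \<open>The Woronowicz braiding\<close>

text \<open>The braiding on a pair, with each iterated coaction replaced by a single coaction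
  followed by a coproduct. In this form the effect of the actions is computed by multiplicativity of
  the coproduct; \<open>woronowicz_eq\<close> makes the identification.\<close>

definition worsum where
  "worsum M N m n = (let R = tensH K H N M in
     lsum R M m (\<lambda>a m0. csum R a (\<lambda>p q. rsum R N n (\<lambda>n0 w. csum R w (\<lambda>r s.
       (p \<triangleright>\<^bsub>N\<^esub> n0 \<triangleleft>\<^bsub>N\<^esub> S r) \<boxtimes>\<^bsub>R\<^esub> (S q \<triangleright>\<^bsub>M\<^esub> m0 \<triangleleft>\<^bsub>M\<^esub> s))))))"

context
  fixes M :: "('k, 'h, 'm, 'y) bimod_scheme" and N :: "('k, 'h, 'n, 'z) bimod_scheme"
  assumes M: "bicov M" and N: "bicov N"
begin

private abbreviation "R \<equiv> tensH K H N M"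

lemma worsum_bil: "bil M N R (worsum M N)"
  supply [simp] = M N bicov_hbimod[OF M] bicov_hbimod[OF N]
  unfolding worsum_def Let_def by (simp add: bil_def)

text \<open>Write the threefold coproduct of \<open>c\<close> as
  \<open>x \<otimes> y \<otimes> z\<close>. From the left factor comes
  \<open>S (q \<otimes> y) = S y \<otimes> S q\<close>, whose \<open>S y\<close> crosses the tensor
  sign; from the right factor comes \<open>S (y \<otimes> r) = S r \<otimes> S y\<close>. What
  remains is the order of independent sums.\<close>

lemma worsum_ract_left:
  assumes [simp]: "m \<in> carrier M" "n \<in> carrier N" "c \<in> carrier H"
  shows "worsum M N (m \<triangleleft>\<^bsub>M\<^esub> c) n = worsum M N m (c \<triangleright>\<^bsub>N\<^esub> n)"
proof -
  note [simp] = M N bicov_hbimod[OF M] bicov_hbimod[OF N]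
  let ?G = "\<lambda>p x y n0 r s m0 q z. (p \<triangleright>\<^bsub>N\<^esub> (x \<triangleright>\<^bsub>N\<^esub> n0) \<triangleleft>\<^bsub>N\<^esub> (S r \<otimes>\<^bsub>H\<^esub> S y)) \<boxtimes>\<^bsub>R\<^esub> (S q \<triangleright>\<^bsub>M\<^esub> m0 \<triangleleft>\<^bsub>M\<^esub> (z \<otimes>\<^bsub>H\<^esub> s))"
  let ?W = "\<lambda>p x y m0 q z. rsum R N n (\<lambda>n0 w. csum R w (\<lambda>r s. ?G p x y n0 r s m0 q z))"
  let ?F = "\<lambda>x y z. lsum R M m (\<lambda>a m0. csum R a (\<lambda>p q. ?W p x y m0 q z))"
  have "worsum M N (m \<triangleleft>\<^bsub>M\<^esub> c) n = lsum R M m (\<lambda>a m0. csum R c (\<lambda>c1 z. csum R a (\<lambda>p q. csum R c1 (\<lambda>x y.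
      rsum R N n (\<lambda>n0 w. csum R w (\<lambda>r s.
       ((p \<otimes>\<^bsub>H\<^esub> x) \<triangleright>\<^bsub>N\<^esub> n0 \<triangleleft>\<^bsub>N\<^esub> S r) \<boxtimes>\<^bsub>R\<^esub> (S (q \<otimes>\<^bsub>H\<^esub> y) \<triangleright>\<^bsub>M\<^esub> (m0 \<triangleleft>\<^bsub>M\<^esub> z) \<triangleleft>\<^bsub>M\<^esub> s)))))))"
    unfolding worsum_def Let_def by (simp add: l_ract c_mult bil_def)
  also have "\<dots> = lsum R M m (\<lambda>a m0. csum R c (\<lambda>c1 z. csum R a (\<lambda>p q. csum R c1 (\<lambda>x y. ?W p x y m0 q z))))"
    by (simp add: S_mult act_mult tensH_balanced[symmetric])
  also have "\<dots> = csum R c (\<lambda>c1 z. lsum R M m (\<lambda>a m0. csum R a (\<lambda>p q. csum R c1 (\<lambda>x y. ?W p x y m0 q z))))"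
    by (rule sw_swap) simp_all
  also have "\<dots> = csum R c (\<lambda>c1 z. lsum R M m (\<lambda>a m0. csum R c1 (\<lambda>x y. csum R a (\<lambda>p q. ?W p x y m0 q z))))"
    by (rule sw_cong[OF refl], rule sw_cong[OF refl], rule sw_swap) simp_all
  also have "\<dots> = csum R c (\<lambda>c1 z. csum R c1 (\<lambda>x y. ?F x y z))"
    by (rule sw_cong[OF refl], rule sw_swap) simp_all
  \<comment> \<open>Acting on \<open>m\<close> splits the first leg of the coproduct of
    \<open>c\<close>, acting on \<open>n\<close> splits the second; coassociativity matches the
    two.\<close>
  also have "\<dots> = csum R c (\<lambda>x c'. csum R c' (\<lambda>y z. ?F x y z))"
    by (rule c_coassoc) (simp_all add: tri_def bil_def)
  also have "\<dots> = csum R c (\<lambda>x c'. lsum R M m (\<lambda>a m0. csum R c' (\<lambda>y z. csum R a (\<lambda>p q. ?W p x y m0 q z))))"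
    by (rule sw_cong[OF refl], rule sw_swap) simp_all
  also have "\<dots> = csum R c (\<lambda>x c'. lsum R M m (\<lambda>a m0. csum R a (\<lambda>p q. csum R c' (\<lambda>y z. ?W p x y m0 q z))))"
    by (rule sw_cong[OF refl], rule sw_cong[OF refl], rule sw_swap) simp_all
  also have "\<dots> = csum R c (\<lambda>x c'. lsum R M m (\<lambda>a m0. csum R a (\<lambda>p q. rsum R N n (\<lambda>n0 w. csum R c' (\<lambda>y z. csum R w (\<lambda>r s. ?G p x y n0 r s m0 q z))))))"
    by (rule sw_cong[OF refl], rule sw_cong[OF refl], rule sw_cong[OF refl], rule sw_swap) simp_all
  also have "\<dots> = lsum R M m (\<lambda>a m0. csum R c (\<lambda>x c'. csum R a (\<lambda>p q. rsum R N n (\<lambda>n0 w. csum R c' (\<lambda>y z. csum R w (\<lambda>r s. ?G p x y n0 r s m0 q z))))))"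
    by (rule sw_swap) simp_all
  also have "\<dots> = lsum R M m (\<lambda>a m0. csum R a (\<lambda>p q. csum R c (\<lambda>x c'. rsum R N n (\<lambda>n0 w. csum R c' (\<lambda>y z. csum R w (\<lambda>r s. ?G p x y n0 r s m0 q z))))))"
    by (rule sw_cong[OF refl], rule sw_swap) simp_all
  also have "\<dots> = worsum M N m (c \<triangleright>\<^bsub>N\<^esub> n)"
    unfolding worsum_def Let_def by (simp add: r_lact c_mult bil_def S_mult)
  finally show ?thesis .
qed

lemma worsum_hbal: "hbal M N R (worsum M N)"
  supply [simp] = M N bicov_hbimod[OF M] bicov_hbimod[OF N]
  by (simp add: hbal_def worsum_bil worsum_ract_left)

text \<open>Of the threefold coproduct of \<open>c\<close>, the first leg acts on the outside, while
  the antipode of the second meets the third in front of \<open>m0\<close> and cancels.\<close>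

lemma worsum_lact:
  assumes [simp]: "m \<in> carrier M" "n \<in> carrier N" "c \<in> carrier H"
  shows "worsum M N (c \<triangleright>\<^bsub>M\<^esub> m) n = c \<triangleright>\<^bsub>R\<^esub> worsum M N m n"
proof -
  note [simp] = M N bicov_hbimod[OF M] bicov_hbimod[OF N]
  let ?W = "\<lambda>p q x m0 z. rsum R N n (\<lambda>n0 w. csum R w (\<lambda>r s.
      ((x \<otimes>\<^bsub>H\<^esub> p) \<triangleright>\<^bsub>N\<^esub> n0 \<triangleleft>\<^bsub>N\<^esub> S r) \<boxtimes>\<^bsub>R\<^esub> ((S q \<otimes>\<^bsub>H\<^esub> z) \<triangleright>\<^bsub>M\<^esub> m0 \<triangleleft>\<^bsub>M\<^esub> s)))"
  let ?F = "\<lambda>x z. lsum R M m (\<lambda>a m0. csum R a (\<lambda>p q. ?W p q x m0 z))"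
  have "worsum M N (c \<triangleright>\<^bsub>M\<^esub> m) n = csum R c (\<lambda>c1 c2. lsum R M m (\<lambda>a m0. csum R c1 (\<lambda>x y. csum R a (\<lambda>p q.
      rsum R N n (\<lambda>n0 w. csum R w (\<lambda>r s.
      ((x \<otimes>\<^bsub>H\<^esub> p) \<triangleright>\<^bsub>N\<^esub> n0 \<triangleleft>\<^bsub>N\<^esub> S r) \<boxtimes>\<^bsub>R\<^esub> (S (y \<otimes>\<^bsub>H\<^esub> q) \<triangleright>\<^bsub>M\<^esub> (c2 \<triangleright>\<^bsub>M\<^esub> m0) \<triangleleft>\<^bsub>M\<^esub> s)))))))"
    unfolding worsum_def Let_def by (simp add: l_lact c_mult bil_def)
  also have "\<dots> = csum R c (\<lambda>c1 c2. lsum R M m (\<lambda>a m0. csum R c1 (\<lambda>x y. csum R a (\<lambda>p q. ?W p q x m0 (S y \<otimes>\<^bsub>H\<^esub> c2)))))"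
    by (simp add: S_mult act_mult)
  also have "\<dots> = csum R c (\<lambda>c1 c2. csum R c1 (\<lambda>x y. ?F x (S y \<otimes>\<^bsub>H\<^esub> c2)))"
    by (rule sw_cong[OF refl], rule sw_swap) simp_all
  also have "\<dots> = csum R c (\<lambda>x c'. csum R c' (\<lambda>y c2. ?F x (S y \<otimes>\<^bsub>H\<^esub> c2)))"
    by (rule c_coassoc) (simp_all add: tri_def bil_def)
  also have "\<dots> = ?F c \<one>\<^bsub>H\<^esub>"
    by (subst c_cancel(3)[where f = ?F]) (simp_all add: bil_def)
  also have "\<dots> = c \<triangleright>\<^bsub>R\<^esub> worsum M N m n"
    unfolding worsum_def Let_def
    by (simp add: sw_push[where W = R and g = "\<lambda>z. c \<triangleright>\<^bsub>R\<^esub> z"] act_mult)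
  finally show ?thesis .
qed

text \<open>Here the first leg of the coproduct of \<open>c\<close> meets the antipode of the second
  behind \<open>n0\<close>, and the third leg acts on the outside.\<close>

lemma worsum_ract:
  assumes [simp]: "m \<in> carrier M" "n \<in> carrier N" "c \<in> carrier H"
  shows "worsum M N m (n \<triangleleft>\<^bsub>N\<^esub> c) = worsum M N m n \<triangleleft>\<^bsub>R\<^esub> c"
proof -
  note [simp] = M N bicov_hbimod[OF M] bicov_hbimod[OF N]
  have inner: "csum R c (\<lambda>c1 c2. csum R (w \<otimes>\<^bsub>H\<^esub> c2) (\<lambda>r s. (p \<triangleright>\<^bsub>N\<^esub> (n0 \<triangleleft>\<^bsub>N\<^esub> c1) \<triangleleft>\<^bsub>N\<^esub> S r) \<boxtimes>\<^bsub>R\<^esub> (S q \<triangleright>\<^bsub>M\<^esub> m0 \<triangleleft>\<^bsub>M\<^esub> s))) =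
      csum R w (\<lambda>r s. (p \<triangleright>\<^bsub>N\<^esub> n0 \<triangleleft>\<^bsub>N\<^esub> S r) \<boxtimes>\<^bsub>R\<^esub> (S q \<triangleright>\<^bsub>M\<^esub> m0 \<triangleleft>\<^bsub>M\<^esub> s \<triangleleft>\<^bsub>M\<^esub> c))"
    if [simp]: "p \<in> carrier H" "q \<in> carrier H" "w \<in> carrier H" "m0 \<in> carrier M" "n0 \<in> carrier N" for p q w m0 n0
  proof -
    let ?F = "\<lambda>r s z v. (p \<triangleright>\<^bsub>N\<^esub> (n0 \<triangleleft>\<^bsub>N\<^esub> z) \<triangleleft>\<^bsub>N\<^esub> S r) \<boxtimes>\<^bsub>R\<^esub> (S q \<triangleright>\<^bsub>M\<^esub> m0 \<triangleleft>\<^bsub>M\<^esub> s \<triangleleft>\<^bsub>M\<^esub> v)"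
    have "csum R c (\<lambda>c1 c2. csum R (w \<otimes>\<^bsub>H\<^esub> c2) (\<lambda>r s. (p \<triangleright>\<^bsub>N\<^esub> (n0 \<triangleleft>\<^bsub>N\<^esub> c1) \<triangleleft>\<^bsub>N\<^esub> S r) \<boxtimes>\<^bsub>R\<^esub> (S q \<triangleright>\<^bsub>M\<^esub> m0 \<triangleleft>\<^bsub>M\<^esub> s))) =
        csum R c (\<lambda>c1 c2. csum R w (\<lambda>r s. csum R c2 (\<lambda>u v. ?F r s (c1 \<otimes>\<^bsub>H\<^esub> S u) v)))"
      by (simp add: c_mult bil_def S_mult act_mult)
    also have "\<dots> = csum R w (\<lambda>r s. csum R c (\<lambda>c1 c2. csum R c2 (\<lambda>u v. ?F r s (c1 \<otimes>\<^bsub>H\<^esub> S u) v)))"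
      by (rule sw_swap) simp_all
    also have "\<dots> = csum R w (\<lambda>r s. ?F r s \<one>\<^bsub>H\<^esub> c)"
      by (rule sw_cong[OF refl], rule c_cancel(2)[where f = "?F r s" for r s]) (simp_all add: bil_def)
    finally show ?thesis by simp
  qed
  show ?thesis
    unfolding worsum_def Let_def
    by (simp add: r_ract bil_def inner sw_push[where W = R and g = "\<lambda>z. z \<triangleleft>\<^bsub>R\<^esub> c"])
qed

lemma woronowicz_eq:
  assumes t: "t \<in> carrier (tensH K H M N)"
  shows "woronowicz K H M N t = sw M N R t (worsum M N)"
proof -
  note [simp] = M N bicov_hbimod[OF M] bicov_hbimod[OF N]
  have "woronowicz K H M N t = sw M N R t (\<lambda>m n.
          lsum R M m (\<lambda>a2 m'. lsum R M m' (\<lambda>a1 m0. rsum R N n (\<lambda>n' b2. rsum R N n' (\<lambda>n0 b1.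
              (a2 \<triangleright>\<^bsub>N\<^esub> n0 \<triangleleft>\<^bsub>N\<^esub> S b1) \<boxtimes>\<^bsub>R\<^esub> (S a1 \<triangleright>\<^bsub>M\<^esub> m0 \<triangleleft>\<^bsub>M\<^esub> b2))))))"
    using t unfolding woronowicz_def Let_def
    by (simp add: sweedler_sw_tensH[where M = M and N = N] sweedler_rcoact sweedler_lcoact)
  also have "\<dots> = sw M N R t (worsum M N)"
    by (simp add: worsum_def Let_def l_coassoc r_coassoc tri_def bil_def)
  finally show ?thesis .
qed

lemma woronowicz_linear [simp]: "klinear K (tensH K H M N) R (woronowicz K H M N)"
  supply [simp] = M N bicov_hbimod[OF M] bicov_hbimod[OF N]
  by (rule iffD2[OF klinear_cong[OF woronowicz_eq]]) (simp_all add: worsum_hbal sw_klinear_tensH)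

lemma woronowicz_pure:
  "\<lbrakk>m \<in> carrier M; n \<in> carrier N\<rbrakk> \<Longrightarrow> woronowicz K H M N (m \<boxtimes>\<^bsub>tensH K H M N\<^esub> n) = worsum M N m n"
  supply [simp] = M N bicov_hbimod[OF M] bicov_hbimod[OF N]
  by (simp add: woronowicz_eq worsum_hbal)

lemma woronowicz_lact:
  assumes t: "t \<in> carrier (tensH K H M N)" and [simp]: "a \<in> carrier H"
  shows "woronowicz K H M N (a \<triangleright>\<^bsub>tensH K H M N\<^esub> t) = a \<triangleright>\<^bsub>R\<^esub> woronowicz K H M N t"
  supply [simp] = M N bicov_hbimod[OF M] bicov_hbimod[OF N]
  by (rule klinear_tensH_eqI[OF _ _ _ _ t, where Z = R])
    (simp_all add: lin_comp[OF woronowicz_linear] woronowicz_pure worsum_lact)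

lemma woronowicz_ract:
  assumes t: "t \<in> carrier (tensH K H M N)" and [simp]: "a \<in> carrier H"
  shows "woronowicz K H M N (t \<triangleleft>\<^bsub>tensH K H M N\<^esub> a) = woronowicz K H M N t \<triangleleft>\<^bsub>R\<^esub> a"
  supply [simp] = M N bicov_hbimod[OF M] bicov_hbimod[OF N]
  by (rule klinear_tensH_eqI[OF _ _ _ _ t, where Z = R])
    (simp_all add: lin_comp[OF woronowicz_linear] woronowicz_pure worsum_ract)

end

section \<open>Associativity of the tensor product over \<open>H\<close>, and the braiding of the
  last two factors\<close>

context
  fixes M :: "('k, 'h, 'm, 'y) bimod_scheme" and N :: "('k, 'h, 'n, 'z) bimod_scheme"
    and P :: "('k, 'h, 'p, 'x1) bimod_scheme"
  assumes M: "hbimod M" and N: "hbimod N" and P: "hbimod P"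
begin

lemma assoc_right_hbal:
  defines "R \<equiv> tensH K H M (tensH K H N P)"
  shows "p \<in> carrier P \<Longrightarrow> hbal M N R (\<lambda>m n. m \<boxtimes>\<^bsub>R\<^esub> (n \<boxtimes>\<^bsub>tensH K H N P\<^esub> p))"
    and "hbal (tensH K H M N) P R (\<lambda>s p. sw M N R s (\<lambda>m n. m \<boxtimes>\<^bsub>R\<^esub> (n \<boxtimes>\<^bsub>tensH K H N P\<^esub> p)))"
proof -
  note [simp] = M N P
  have 1: "hbal M N R (\<lambda>m n. m \<boxtimes>\<^bsub>R\<^esub> (n \<boxtimes>\<^bsub>tensH K H N P\<^esub> p))" if "p \<in> carrier P" for p
    using that unfolding R_def by (simp add: hbal_def bil_def tensH_balanced)
  thus "p \<in> carrier P \<Longrightarrow> hbal M N R (\<lambda>m n. m \<boxtimes>\<^bsub>R\<^esub> (n \<boxtimes>\<^bsub>tensH K H N P\<^esub> p))" .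
  have [simp]: "kmod R" unfolding R_def by simp
  have [simp]: "klinear K V R (\<lambda>x. m \<boxtimes>\<^bsub>R\<^esub> (n \<boxtimes>\<^bsub>tensH K H N P\<^esub> f x))"
    if "m \<in> carrier M" "n \<in> carrier N" "klinear K V P f" for m n f V
    using that unfolding R_def by simp
  have "sw M N R (s \<triangleleft>\<^bsub>tensH K H M N\<^esub> a) (\<lambda>m n. m \<boxtimes>\<^bsub>R\<^esub> (n \<boxtimes>\<^bsub>tensH K H N P\<^esub> p)) =
      sw M N R s (\<lambda>m n. m \<boxtimes>\<^bsub>R\<^esub> (n \<boxtimes>\<^bsub>tensH K H N P\<^esub> (a \<triangleright>\<^bsub>P\<^esub> p)))"
    if s: "s \<in> carrier (tensH K H M N)" and [simp]: "a \<in> carrier H" "p \<in> carrier P" for s a p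
    by (rule klinear_tensH_eqI[OF _ _ _ _ s, where Z = R]) (simp_all add: 1 tensH_balanced)
  thus "hbal (tensH K H M N) P R (\<lambda>s p. sw M N R s (\<lambda>m n. m \<boxtimes>\<^bsub>R\<^esub> (n \<boxtimes>\<^bsub>tensH K H N P\<^esub> p)))"
    unfolding hbal_def bil_def by (intro conjI ballI) (simp_all add: 1)
qed

lemma assoc_right_eq:
  assumes t: "t \<in> carrier (tensH K H (tensH K H M N) P)"
  shows "assoc_right K H M N P t = (let R = tensH K H M (tensH K H N P) in
    sw (tensH K H M N) P R t (\<lambda>s p. sw M N R s (\<lambda>m n. m \<boxtimes>\<^bsub>R\<^esub> (n \<boxtimes>\<^bsub>tensH K H N P\<^esub> p))))"
  using M N P t unfolding assoc_right_def Let_def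
  by (simp add: sweedler_sw_tensH[where M = M and N = N] sweedler_sw_tensH[where M = "tensH K H M N" and N = P])

lemma assoc_right_linear [simp]:
  "klinear K (tensH K H (tensH K H M N) P) (tensH K H M (tensH K H N P)) (assoc_right K H M N P)"
  supply [simp] = M N P
  by (rule iffD2[OF klinear_cong[OF assoc_right_eq]]) (simp_all add: assoc_right_hbal sw_klinear_tensH Let_def)

lemma assoc_right_pure [simp]:
  "\<lbrakk>m \<in> carrier M; n \<in> carrier N; p \<in> carrier P\<rbrakk> \<Longrightarrow>
    assoc_right K H M N P ((m \<boxtimes>\<^bsub>tensH K H M N\<^esub> n) \<boxtimes>\<^bsub>tensH K H (tensH K H M N) P\<^esub> p) =
    m \<boxtimes>\<^bsub>tensH K H M (tensH K H N P)\<^esub> (n \<boxtimes>\<^bsub>tensH K H N P\<^esub> p)"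
  supply [simp] = M N P
  by (simp add: assoc_right_eq assoc_right_hbal Let_def)

lemma assoc_left_hbal:
  defines "L \<equiv> tensH K H (tensH K H M N) P"
  shows "m \<in> carrier M \<Longrightarrow> hbal N P L (\<lambda>n p. (m \<boxtimes>\<^bsub>tensH K H M N\<^esub> n) \<boxtimes>\<^bsub>L\<^esub> p)"
    and "hbal M (tensH K H N P) L (\<lambda>m s. sw N P L s (\<lambda>n p. (m \<boxtimes>\<^bsub>tensH K H M N\<^esub> n) \<boxtimes>\<^bsub>L\<^esub> p))"
proof -
  note [simp] = M N P
  have 1: "hbal N P L (\<lambda>n p. (m \<boxtimes>\<^bsub>tensH K H M N\<^esub> n) \<boxtimes>\<^bsub>L\<^esub> p)" if "m \<in> carrier M" for m
    using that unfolding L_def by (simp add: hbal_def bil_def tensH_balanced[symmetric])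
  thus "m \<in> carrier M \<Longrightarrow> hbal N P L (\<lambda>n p. (m \<boxtimes>\<^bsub>tensH K H M N\<^esub> n) \<boxtimes>\<^bsub>L\<^esub> p)" .
  have [simp]: "kmod L" unfolding L_def by simp
  have [simp]: "klinear K V L (\<lambda>x. (f x \<boxtimes>\<^bsub>tensH K H M N\<^esub> n) \<boxtimes>\<^bsub>L\<^esub> p)"
    if "p \<in> carrier P" "n \<in> carrier N" "klinear K V M f" for p n f V
    using that unfolding L_def by simp
  have "sw N P L s (\<lambda>n p. ((m \<triangleleft>\<^bsub>M\<^esub> a) \<boxtimes>\<^bsub>tensH K H M N\<^esub> n) \<boxtimes>\<^bsub>L\<^esub> p) =
      sw N P L (a \<triangleright>\<^bsub>tensH K H N P\<^esub> s) (\<lambda>n p. (m \<boxtimes>\<^bsub>tensH K H M N\<^esub> n) \<boxtimes>\<^bsub>L\<^esub> p)"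
    if s: "s \<in> carrier (tensH K H N P)" and [simp]: "a \<in> carrier H" "m \<in> carrier M" for s a m
    by (rule klinear_tensH_eqI[OF _ _ _ _ s, where Z = L], simp_all add: 1) (simp add: tensH_balanced)
  thus "hbal M (tensH K H N P) L (\<lambda>m s. sw N P L s (\<lambda>n p. (m \<boxtimes>\<^bsub>tensH K H M N\<^esub> n) \<boxtimes>\<^bsub>L\<^esub> p))"
    unfolding hbal_def bil_def by (intro conjI ballI) (simp_all add: 1)
qed

lemma assoc_left_eq:
  assumes t: "t \<in> carrier (tensH K H M (tensH K H N P))"
  shows "assoc_left K H M N P t = (let L = tensH K H (tensH K H M N) P in
    sw M (tensH K H N P) L t (\<lambda>m s. sw N P L s (\<lambda>n p. (m \<boxtimes>\<^bsub>tensH K H M N\<^esub> n) \<boxtimes>\<^bsub>L\<^esub> p)))"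
  using M N P t unfolding assoc_left_def Let_def
  by (simp add: sweedler_sw_tensH[where M = N and N = P] sweedler_sw_tensH[where M = M and N = "tensH K H N P"])

lemma assoc_left_linear [simp]:
  "klinear K (tensH K H M (tensH K H N P)) (tensH K H (tensH K H M N) P) (assoc_left K H M N P)"
  supply [simp] = M N P
  by (rule iffD2[OF klinear_cong[OF assoc_left_eq]]) (simp_all add: assoc_left_hbal sw_klinear_tensH Let_def)

lemma assoc_left_pure [simp]:
  "\<lbrakk>m \<in> carrier M; n \<in> carrier N; p \<in> carrier P\<rbrakk> \<Longrightarrow>
    assoc_left K H M N P (m \<boxtimes>\<^bsub>tensH K H M (tensH K H N P)\<^esub> (n \<boxtimes>\<^bsub>tensH K H N P\<^esub> p)) =
    (m \<boxtimes>\<^bsub>tensH K H M N\<^esub> n) \<boxtimes>\<^bsub>tensH K H (tensH K H M N) P\<^esub> p"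
  supply [simp] = M N P
  by (simp add: assoc_left_eq assoc_left_hbal Let_def)

lemma klinear_tensH_tensH_eqI:
  assumes f: "klinear K (tensH K H M (tensH K H N P)) Z f" and g: "klinear K (tensH K H M (tensH K H N P)) Z g"
    and t: "t \<in> carrier (tensH K H M (tensH K H N P))"
    and eq: "\<And>m n p. \<lbrakk>m \<in> carrier M; n \<in> carrier N; p \<in> carrier P\<rbrakk> \<Longrightarrow>
      f (m \<boxtimes>\<^bsub>tensH K H M (tensH K H N P)\<^esub> (n \<boxtimes>\<^bsub>tensH K H N P\<^esub> p)) =
      g (m \<boxtimes>\<^bsub>tensH K H M (tensH K H N P)\<^esub> (n \<boxtimes>\<^bsub>tensH K H N P\<^esub> p))"
  shows "f t = g t"
proof (rule klinear_tensH_eqI[OF _ _ f g t])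
  note [simp] = M N P
  fix m s assume m: "m \<in> carrier M" and s: "s \<in> carrier (tensH K H N P)"
  show "f (m \<boxtimes>\<^bsub>tensH K H M (tensH K H N P)\<^esub> s) = g (m \<boxtimes>\<^bsub>tensH K H M (tensH K H N P)\<^esub> s)"
    by (rule klinear_tensH_eqI[OF _ _ _ _ s, where Z = Z]) (simp_all add: m eq lin_comp[OF f] lin_comp[OF g])
qed (use M N P in simp_all)

lemma klinear_tensH_tensH_eqI':
  assumes f: "klinear K (tensH K H (tensH K H M N) P) Z f" and g: "klinear K (tensH K H (tensH K H M N) P) Z g"
    and t: "t \<in> carrier (tensH K H (tensH K H M N) P)"
    and eq: "\<And>m n p. \<lbrakk>m \<in> carrier M; n \<in> carrier N; p \<in> carrier P\<rbrakk> \<Longrightarrow>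
      f ((m \<boxtimes>\<^bsub>tensH K H M N\<^esub> n) \<boxtimes>\<^bsub>tensH K H (tensH K H M N) P\<^esub> p) =
      g ((m \<boxtimes>\<^bsub>tensH K H M N\<^esub> n) \<boxtimes>\<^bsub>tensH K H (tensH K H M N) P\<^esub> p)"
  shows "f t = g t"
proof (rule klinear_tensH_eqI[OF _ _ f g t])
  note [simp] = M N P
  fix s p assume p: "p \<in> carrier P" and s: "s \<in> carrier (tensH K H M N)"
  show "f (s \<boxtimes>\<^bsub>tensH K H (tensH K H M N) P\<^esub> p) = g (s \<boxtimes>\<^bsub>tensH K H (tensH K H M N) P\<^esub> p)"
    by (rule klinear_tensH_eqI[OF _ _ _ _ s, where Z = Z]) (simp_all add: p eq lin_comp[OF f] lin_comp[OF g])
qed (use M N P in simp_all)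

lemma assoc_left_ract:
  assumes t: "t \<in> carrier (tensH K H M (tensH K H N P))" and [simp]: "a \<in> carrier H"
  shows "assoc_left K H M N P (t \<triangleleft>\<^bsub>tensH K H M (tensH K H N P)\<^esub> a) =
    assoc_left K H M N P t \<triangleleft>\<^bsub>tensH K H (tensH K H M N) P\<^esub> a"
  supply [simp] = M N P
  by (rule klinear_tensH_tensH_eqI[OF _ _ t, where Z = "tensH K H (tensH K H M N) P"])
    (simp_all add: lin_comp[OF assoc_left_linear])

end

context
  fixes M :: "('k, 'h, 'm, 'y) bimod_scheme" and N :: "('k, 'h, 'n, 'z) bimod_scheme"
    and P :: "('k, 'h, 'p, 'x1) bimod_scheme"
  assumes M: "hbimod M" and N: "bicov N" and P: "bicov P"
begin

private abbreviation "A \<equiv> tensH K H (tensH K H M P) N"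
private abbreviation "B \<equiv> tensH K H M (tensH K H P N)"
private abbreviation "C \<equiv> tensH K H M (tensH K H N P)"
private abbreviation "E \<equiv> tensH K H (tensH K H M N) P"

text \<open>Left linearity of the braiding is what lets the identity of \<open>M\<close> tensored
  with it descend to the tensor product over \<open>H\<close>.\<close>

lemma woronowicz_hbal: "hbal M (tensH K H P N) C (\<lambda>m s. m \<boxtimes>\<^bsub>C\<^esub> woronowicz K H P N s)"
  using M N P klinear_closed[OF woronowicz_linear[OF P N]]
  by (simp add: hbal_def bil_def lin_comp[OF woronowicz_linear] woronowicz_lact tensH_balanced)

lemma woronowicz23_eq:
  assumes t: "t \<in> carrier A"
  shows "woronowicz23 K H M P N t = assoc_left K H M N P
    (sw M (tensH K H P N) C (assoc_right K H M P N t) (\<lambda>m s. m \<boxtimes>\<^bsub>C\<^esub> woronowicz K H P N s))"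
  using M N P t klinear_closed[OF assoc_right_linear t]
  unfolding woronowicz23_def Let_def
  by (simp add: sweedler_sw_tensH[where M = M and N = "tensH K H P N"])

lemma woronowicz23_linear [simp]: "klinear K A E (woronowicz23 K H M P N)"
  supply [simp] = M N P
  by (rule iffD2[OF klinear_cong[OF woronowicz23_eq]])
    (simp_all add: lin_comp[OF assoc_left_linear] woronowicz_hbal)

lemma woronowicz23_ract:
  assumes t: "t \<in> carrier A" and [simp]: "a \<in> carrier H"
  shows "woronowicz23 K H M P N (t \<triangleleft>\<^bsub>A\<^esub> a) = woronowicz23 K H M P N t \<triangleleft>\<^bsub>E\<^esub> a"
proof (rule klinear_tensH_tensH_eqI'[OF _ _ _ _ _ t, where Z = E])
  note [simp] = M N P
  fix m p n assume [simp]: "m \<in> carrier M" "p \<in> carrier P" "n \<in> carrier N"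
  note [simp] = klinear_closed[OF woronowicz_linear[OF P N]]
  have "(p \<boxtimes>\<^bsub>tensH K H P N\<^esub> (n \<triangleleft>\<^bsub>N\<^esub> a)) = (p \<boxtimes>\<^bsub>tensH K H P N\<^esub> n) \<triangleleft>\<^bsub>tensH K H P N\<^esub> a"
    by simp
  hence eq: "woronowicz K H P N (p \<boxtimes>\<^bsub>tensH K H P N\<^esub> (n \<triangleleft>\<^bsub>N\<^esub> a)) =
      woronowicz K H P N (p \<boxtimes>\<^bsub>tensH K H P N\<^esub> n) \<triangleleft>\<^bsub>tensH K H N P\<^esub> a"
    by (simp only: woronowicz_ract[OF P N] tensH_closed bicov_hbimod M N P \<open>p \<in> carrier P\<close> \<open>n \<in> carrier N\<close> \<open>a \<in> carrier H\<close>)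
  show "woronowicz23 K H M P N (((m \<boxtimes>\<^bsub>tensH K H M P\<^esub> p) \<boxtimes>\<^bsub>A\<^esub> n) \<triangleleft>\<^bsub>A\<^esub> a) =
      woronowicz23 K H M P N ((m \<boxtimes>\<^bsub>tensH K H M P\<^esub> p) \<boxtimes>\<^bsub>A\<^esub> n) \<triangleleft>\<^bsub>E\<^esub> a"
    using assoc_left_ract[OF M _ _ , of N P "m \<boxtimes>\<^bsub>C\<^esub> woronowicz K H P N (p \<boxtimes>\<^bsub>tensH K H P N\<^esub> n)" a]
    by (simp add: woronowicz23_eq woronowicz_hbal eq)
qed (use M N P in \<open>simp_all add: lin_comp[OF woronowicz23_linear]\<close>)

end

section \<open>Finite rank operators\<close>

definition subsp where
  "subsp V U \<longleftrightarrow> U \<subseteq> carrier V \<and> \<zero>\<^bsub>V\<^esub> \<in> U \<and> (\<forall>x\<in>U. \<forall>y\<in>U. x \<oplus>\<^bsub>V\<^esub> y \<in> U) \<and>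
    (\<forall>r\<in>carrier K. \<forall>x\<in>U. r \<odot>\<^bsub>V\<^esub> x \<in> U)"

lemma subspD:
  assumes "subsp V U"
  shows "\<And>x y. \<lbrakk>x \<in> U; y \<in> U\<rbrakk> \<Longrightarrow> x \<oplus>\<^bsub>V\<^esub> y \<in> U"
    and "\<And>r x. \<lbrakk>r \<in> carrier K; x \<in> U\<rbrakk> \<Longrightarrow> r \<odot>\<^bsub>V\<^esub> x \<in> U"
    and "\<And>x. x \<in> U \<Longrightarrow> x \<in> carrier V" and "\<zero>\<^bsub>V\<^esub> \<in> U"
  using assms unfolding subsp_def by (auto dest: subsetD)

definition functional where
  "functional V g \<longleftrightarrow> g \<in> carrier V \<rightarrow> carrier K \<and>
    (\<forall>x\<in>carrier V. \<forall>y\<in>carrier V. g (x \<oplus>\<^bsub>V\<^esub> y) = g x \<oplus>\<^bsub>K\<^esub> g y) \<and>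
    (\<forall>r\<in>carrier K. \<forall>x\<in>carrier V. g (r \<odot>\<^bsub>V\<^esub> x) = r \<otimes>\<^bsub>K\<^esub> g x)"

text \<open>By Zorn's lemma there is a subspace \<open>U\<close> maximal among those containing
  \<open>W\<close> and avoiding \<open>v\<close>. It is a complement of the line through
  \<open>v\<close>, and the functional reads off the coefficient of \<open>v\<close>.\<close>

lemma separating_functional:
  assumes V: "kmod V" and W: "subsp V W" and v: "v \<in> carrier V" "v \<notin> W"
  obtains g where "functional V g" "\<And>w. w \<in> W \<Longrightarrow> g w = \<zero>\<^bsub>K\<^esub>" "g v = \<one>\<^bsub>K\<^esub>"
proof -
  interpret K: field K by (rule field)
  interpret V: Module.module K V by fact
  let ?A = "{U. subsp V U \<and> W \<subseteq> U \<and> v \<notin> U}"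
  have "\<exists>U\<in>?A. \<forall>Q\<in>?A. U \<subseteq> Q \<longrightarrow> Q = U"
  proof (rule subset_Zorn_nonempty)
    show "?A \<noteq> {}" using W v by auto
    fix C assume C: "C \<noteq> {}" "subset.chain ?A C"
    have sub: "subsp V Q" "W \<subseteq> Q" "v \<notin> Q" if "Q \<in> C" for Q
      using C that by (auto simp: subset.chain_def)
    have "subsp V (\<Union>C)"
      unfolding subsp_def
    proof (intro conjI ballI)
      show "\<Union>C \<subseteq> carrier V" using sub(1) unfolding subsp_def by blast
      show "\<zero>\<^bsub>V\<^esub> \<in> \<Union>C" using sub(1) C(1) by (auto simp: subsp_def)
      show "r \<odot>\<^bsub>V\<^esub> x \<in> \<Union>C" if "r \<in> carrier K" "x \<in> \<Union>C" for r x
        using that sub(1) unfolding subsp_def by blast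
      fix x y assume "x \<in> \<Union>C" "y \<in> \<Union>C"
      then obtain Q Y where XY: "Q \<in> C" "x \<in> Q" "Y \<in> C" "y \<in> Y" by blast
      hence "Q \<subseteq> Y \<or> Y \<subseteq> Q" using C(2) by (auto simp: subset.chain_def)
      then obtain Z where "Z \<in> C" "x \<in> Z" "y \<in> Z" using XY by blast
      thus "x \<oplus>\<^bsub>V\<^esub> y \<in> \<Union>C" using sub(1) unfolding subsp_def by blast
    qed
    thus "\<Union>C \<in> ?A" using sub C(1) by blast
  qed
  then obtain U where UA: "U \<in> ?A" "\<forall>Q\<in>?A. U \<subseteq> Q \<longrightarrow> Q = U" by (elim bexE)
  hence U: "subsp V U" "W \<subseteq> U" "v \<notin> U" by simp_all
  have maxU: "Q = U" if "subsp V Q" "v \<notin> Q" "U \<subseteq> Q" for Q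
    using UA(2) that U(2) by simp
  have Ucl: "x \<oplus>\<^bsub>V\<^esub> y \<in> U" "r \<odot>\<^bsub>V\<^esub> x \<in> U" "x \<in> carrier V" "\<zero>\<^bsub>V\<^esub> \<in> U"
    if "x \<in> U" "y \<in> U" "r \<in> carrier K" for x y r
    by (rule subspD(1)[OF U(1) that(1,2)] subspD(2)[OF U(1) that(3,1)] subspD(3)[OF U(1) that(1)]
        subspD(4)[OF U(1)])+
  have Uneg: "\<ominus>\<^bsub>V\<^esub> x \<in> U" if x: "x \<in> U" for x
  proof -
    have xV: "x \<in> carrier V" by (rule subspD(3)[OF U(1) x])
    have "\<ominus>\<^bsub>K\<^esub> \<one>\<^bsub>K\<^esub> \<odot>\<^bsub>V\<^esub> x = \<ominus>\<^bsub>V\<^esub> x"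
      unfolding V.smult_l_minus[OF K.one_closed xV] V.smult_one[OF xV] ..
    moreover have "\<ominus>\<^bsub>K\<^esub> \<one>\<^bsub>K\<^esub> \<odot>\<^bsub>V\<^esub> x \<in> U"
      by (rule subspD(2)[OF U(1) _ x]) simp
    ultimately show ?thesis by simp
  qed
  have U0: "\<zero>\<^bsub>V\<^esub> \<in> U" by (rule subspD(4)[OF U(1)])
  \<comment> \<open>For \<open>h\<close> outside \<open>U\<close>, maximality puts \<open>v\<close>
    into the span of \<open>U\<close> and \<open>h\<close>. The coefficient of \<open>h\<close> is
    nonzero since \<open>v\<close> avoids \<open>U\<close>, so the relation can be solved for
    \<open>h\<close>.\<close>
  have ex: "\<exists>c\<in>carrier K. \<exists>u\<in>U. h = u \<oplus>\<^bsub>V\<^esub> c \<odot>\<^bsub>V\<^esub> v" if h: "h \<in> carrier V" for h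
  proof (cases "h \<in> U")
    case True
    thus ?thesis using h v by (intro bexI[of _ "\<zero>\<^bsub>K\<^esub>"] bexI[of _ h]) auto
  next
    case False
    let ?Q = "{u \<oplus>\<^bsub>V\<^esub> r \<odot>\<^bsub>V\<^esub> h | u r. u \<in> U \<and> r \<in> carrier K}"
    have inQ: "u \<oplus>\<^bsub>V\<^esub> r \<odot>\<^bsub>V\<^esub> h \<in> ?Q" if "u \<in> U" "r \<in> carrier K" for u r using that by blast
    have "subsp V ?Q"
      unfolding subsp_def
    proof (intro conjI ballI)
      show "?Q \<subseteq> carrier V" using Ucl(3) U0 h by auto
      show "\<zero>\<^bsub>V\<^esub> \<in> ?Q" using inQ[OF U0 K.zero_closed] h by simp
      fix x assume "x \<in> ?Q"
      then obtain u r where x: "x = u \<oplus>\<^bsub>V\<^esub> r \<odot>\<^bsub>V\<^esub> h" "u \<in> U" "r \<in> carrier K" by blast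
      have uV: "u \<in> carrier V" using x Ucl(3) by blast
      show "s \<odot>\<^bsub>V\<^esub> x \<in> ?Q" if "s \<in> carrier K" for s
      proof -
        have "s \<odot>\<^bsub>V\<^esub> x = s \<odot>\<^bsub>V\<^esub> u \<oplus>\<^bsub>V\<^esub> (s \<otimes>\<^bsub>K\<^esub> r) \<odot>\<^bsub>V\<^esub> h"
          using x uV h that by (simp add: V.smult_r_distr V.smult_assoc1)
        thus ?thesis using x that Ucl(2) by blast
      qed
      fix y assume "y \<in> ?Q"
      then obtain u' r' where y: "y = u' \<oplus>\<^bsub>V\<^esub> r' \<odot>\<^bsub>V\<^esub> h" "u' \<in> U" "r' \<in> carrier K" by blast
      have uV': "u' \<in> carrier V" using y Ucl(3) by blast
      have "x \<oplus>\<^bsub>V\<^esub> y = (u \<oplus>\<^bsub>V\<^esub> u') \<oplus>\<^bsub>V\<^esub> (r \<oplus>\<^bsub>K\<^esub> r') \<odot>\<^bsub>V\<^esub> h"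
        using x y uV uV' h by (simp add: V.smult_l_distr V.a_ac)
      thus "x \<oplus>\<^bsub>V\<^esub> y \<in> ?Q" using x y Ucl(1) by blast
    qed
    moreover have "U \<subseteq> ?Q"
    proof
      fix u assume u: "u \<in> U"
      hence "u = u \<oplus>\<^bsub>V\<^esub> \<zero>\<^bsub>K\<^esub> \<odot>\<^bsub>V\<^esub> h" using subspD(3)[OF U(1)] h by simp
      thus "u \<in> ?Q" using u K.zero_closed by blast
    qed
    moreover have "?Q \<noteq> U"
    proof -
      have "h = \<zero>\<^bsub>V\<^esub> \<oplus>\<^bsub>V\<^esub> \<one>\<^bsub>K\<^esub> \<odot>\<^bsub>V\<^esub> h" using h by simp
      hence "h \<in> ?Q" using U0 K.one_closed by blast
      thus ?thesis using False by blast
    qed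
    ultimately have "v \<in> ?Q" using maxU[of ?Q] by blast
    then obtain u r where ur: "v = u \<oplus>\<^bsub>V\<^esub> r \<odot>\<^bsub>V\<^esub> h" "u \<in> U" "r \<in> carrier K" by blast
    have uV: "u \<in> carrier V" using ur Ucl(3) by blast
    have "r \<noteq> \<zero>\<^bsub>K\<^esub>" using ur U(3) uV h by auto
    hence r: "inv\<^bsub>K\<^esub> r \<in> carrier K" "inv\<^bsub>K\<^esub> r \<otimes>\<^bsub>K\<^esub> r = \<one>\<^bsub>K\<^esub>"
      using ur(3) by (simp_all add: K.field_Units)
    have rh: "inv\<^bsub>K\<^esub> r \<odot>\<^bsub>V\<^esub> (r \<odot>\<^bsub>V\<^esub> h) = h"
      using ur(3) h r by (simp add: V.smult_assoc1[symmetric])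
    have "inv\<^bsub>K\<^esub> r \<odot>\<^bsub>V\<^esub> v = inv\<^bsub>K\<^esub> r \<odot>\<^bsub>V\<^esub> u \<oplus>\<^bsub>V\<^esub> h"
      using ur uV h r by (simp add: V.smult_r_distr rh)
    hence "h = (\<ominus>\<^bsub>V\<^esub> (inv\<^bsub>K\<^esub> r \<odot>\<^bsub>V\<^esub> u)) \<oplus>\<^bsub>V\<^esub> inv\<^bsub>K\<^esub> r \<odot>\<^bsub>V\<^esub> v"
      using uV h r by (simp add: V.a_assoc[symmetric] V.l_neg)
    moreover have "\<ominus>\<^bsub>V\<^esub> (inv\<^bsub>K\<^esub> r \<odot>\<^bsub>V\<^esub> u) \<in> U" using Uneg Ucl(2) ur r by blast
    ultimately show ?thesis using r(1) by blast
  qed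
  \<comment> \<open>Two different coefficients would place a nonzero multiple of \<open>v\<close>,
    and hence \<open>v\<close>, in \<open>U\<close>.\<close>
  have uniq: "c = c'" if "u \<oplus>\<^bsub>V\<^esub> c \<odot>\<^bsub>V\<^esub> v = u' \<oplus>\<^bsub>V\<^esub> c' \<odot>\<^bsub>V\<^esub> v" "u \<in> U" "u' \<in> U" "c \<in> carrier K" "c' \<in> carrier K" for u u' c c'
  proof (rule ccontr)
    assume ne: "c \<noteq> c'"
    have uV: "u \<in> carrier V" "u' \<in> carrier V" using that Ucl(3) by blast+
    define e where "e = c \<ominus>\<^bsub>K\<^esub> c'"
    have e: "e \<in> carrier K" "e \<noteq> \<zero>\<^bsub>K\<^esub>" using ne that by (auto simp: e_def)
    have "e \<odot>\<^bsub>V\<^esub> v = (\<ominus>\<^bsub>V\<^esub> u) \<oplus>\<^bsub>V\<^esub> ((u \<oplus>\<^bsub>V\<^esub> c \<odot>\<^bsub>V\<^esub> v) \<oplus>\<^bsub>V\<^esub> \<ominus>\<^bsub>V\<^esub> (c' \<odot>\<^bsub>V\<^esub> v))"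
      using uV v(1) that(4,5) by (simp add: e_def K.minus_eq V.smult_l_distr V.smult_l_minus V.a_assoc V.r_neg1 V.r_neg2)
    also have "\<dots> = (\<ominus>\<^bsub>V\<^esub> u) \<oplus>\<^bsub>V\<^esub> u'"
      unfolding that(1) using uV v(1) that(4,5) by (simp add: V.a_assoc V.r_neg)
    finally have "e \<odot>\<^bsub>V\<^esub> v \<in> U" using Ucl(1) Uneg that by (metis K.one_closed)
    hence "inv\<^bsub>K\<^esub> e \<odot>\<^bsub>V\<^esub> (e \<odot>\<^bsub>V\<^esub> v) \<in> U" using Ucl(2) e by (simp add: K.field_Units)
    thus False using U(3) e v by (simp add: V.smult_assoc1[symmetric] K.field_Units)
  qed
  define g where "g h = (THE c. c \<in> carrier K \<and> (\<exists>u\<in>U. h = u \<oplus>\<^bsub>V\<^esub> c \<odot>\<^bsub>V\<^esub> v))" for h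
  have g_eq: "g (u \<oplus>\<^bsub>V\<^esub> c \<odot>\<^bsub>V\<^esub> v) = c" if "u \<in> U" "c \<in> carrier K" for u c
    unfolding g_def by (rule the_equality) (use that uniq in blast)+
  show thesis
  proof (rule that[of g])
    show "g w = \<zero>\<^bsub>K\<^esub>" if "w \<in> W" for w
      using g_eq[of w "\<zero>\<^bsub>K\<^esub>"] subsetD[OF U(2) that] subspD(3)[OF U(1), of w] v(1) by simp
    show "g v = \<one>\<^bsub>K\<^esub>" using g_eq[OF U0 K.one_closed] v by simp
    have add: "g (x \<oplus>\<^bsub>V\<^esub> y) = g x \<oplus>\<^bsub>K\<^esub> g y" if "x \<in> carrier V" "y \<in> carrier V" for x y
    proof -
      obtain c u where x: "c \<in> carrier K" "u \<in> U" "x = u \<oplus>\<^bsub>V\<^esub> c \<odot>\<^bsub>V\<^esub> v" using ex \<open>x \<in> carrier V\<close> by blast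
      obtain c' u' where y: "c' \<in> carrier K" "u' \<in> U" "y = u' \<oplus>\<^bsub>V\<^esub> c' \<odot>\<^bsub>V\<^esub> v" using ex \<open>y \<in> carrier V\<close> by blast
      have uV: "u \<in> carrier V" "u' \<in> carrier V" using x y Ucl(3) by blast+
      have "x \<oplus>\<^bsub>V\<^esub> y = (u \<oplus>\<^bsub>V\<^esub> u') \<oplus>\<^bsub>V\<^esub> (c \<oplus>\<^bsub>K\<^esub> c') \<odot>\<^bsub>V\<^esub> v"
        using x y uV v by (simp add: V.smult_l_distr V.a_ac)
      thus ?thesis using x y g_eq Ucl(1) by (metis K.a_closed)
    qed
    have smult: "g (r \<odot>\<^bsub>V\<^esub> x) = r \<otimes>\<^bsub>K\<^esub> g x" if "r \<in> carrier K" "x \<in> carrier V" for r x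
    proof -
      obtain c u where x: "c \<in> carrier K" "u \<in> U" "x = u \<oplus>\<^bsub>V\<^esub> c \<odot>\<^bsub>V\<^esub> v" using ex \<open>x \<in> carrier V\<close> by blast
      have uV: "u \<in> carrier V" using x Ucl(3) by blast
      have "r \<odot>\<^bsub>V\<^esub> x = r \<odot>\<^bsub>V\<^esub> u \<oplus>\<^bsub>V\<^esub> (r \<otimes>\<^bsub>K\<^esub> c) \<odot>\<^bsub>V\<^esub> v"
        using x uV v that by (simp add: V.smult_r_distr V.smult_assoc1)
      thus ?thesis using x g_eq Ucl(2) that by (metis K.m_closed)
    qed
    have "g x \<in> carrier K" if "x \<in> carrier V" for x
      using ex[OF that] g_eq by force
    thus "functional V g" using add smult by (auto simp: functional_def)
  qed
qed

lemma functional_bil: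
  assumes g: "functional V g" and Z: "kmod Z"
  shows "bil V Z Z (\<lambda>a z. g a \<odot>\<^bsub>Z\<^esub> z)"
proof -
  interpret Z: Module.module K Z by fact
  show ?thesis
    using g unfolding functional_def
    by (intro bilI klinearI)
      (auto simp: Pi_iff Z.smult_l_distr Z.smult_r_distr Z.smult_assoc1[symmetric] Z.R.m_comm)
qed

text \<open>A list of pairs \<open>(v, g)\<close> encodes the finite rank operator \<open>x \<mapsto> \<Sum> g x \<odot> v\<close> on \<open>H\<close>, here tensored
  with the identity of \<open>V\<close>: it maps \<open>t\<close> to \<open>\<Sum> v \<otimes> (g \<otimes> id) t\<close>.\<close>

definition tsum where
  "tsum Z ps = foldr (\<lambda>p z. p \<oplus>\<^bsub>Z\<^esub> z) ps \<zero>\<^bsub>Z\<^esub>"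

definition frank where
  "frank ps a = tsum H (map (\<lambda>(v, g). g a \<odot>\<^bsub>H\<^esub> v) ps)"

definition slice where
  "slice V g t = sw H V V t (\<lambda>a x. g a \<odot>\<^bsub>V\<^esub> x)"

definition frankT where
  "frankT V ps t = tsum (tensK K H V) (map (\<lambda>(v, g). v \<boxtimes>\<^bsub>tensK K H V\<^esub> slice V g t) ps)"

definition frank_ok where
  "frank_ok ps \<longleftrightarrow> (\<forall>(v, g)\<in>set ps. v \<in> carrier H \<and> functional H g)"

lemma tsum_closed [simp]:
  assumes "kmod Z" "set zs \<subseteq> carrier Z"
  shows "tsum Z zs \<in> carrier Z"
proof -
  interpret Z: Module.module K Z by fact
  show ?thesis using assms(2) by (induction zs) (auto simp: tsum_def)
qed

lemma tsum_linear:
  assumes f: "klinear K Z W f" and Z: "kmod Z" and W: "kmod W" and zs: "set zs \<subseteq> carrier Z"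
  shows "f (tsum Z zs) = tsum W (map f zs)"
  using zs
proof (induction zs)
  case Nil
  thus ?case using klinear_zero[OF f kmod_group[OF Z] kmod_group[OF W]] by (simp add: tsum_def)
next
  case (Cons z zs)
  hence "tsum Z zs \<in> carrier Z" using Z by simp
  thus ?case using Cons by (simp add: tsum_def klinear_add[OF f])
qed

lemma klinear_tsum:
  assumes W: "kmod W" and f: "\<And>p. p \<in> set ps \<Longrightarrow> klinear K Z W (f p)"
  shows "klinear K Z W (\<lambda>x. tsum W (map (\<lambda>p. f p x) ps))"
  using f
proof (induction ps)
  case Nil
  interpret W: Module.module K W by fact
  show ?case by (simp add: tsum_def klinear_def)
next
  case (Cons p ps)
  interpret W: Module.module K W by fact
  have 1: "klinear K Z W (f p)" using Cons by simp
  have 2: "klinear K Z W (\<lambda>x. tsum W (map (\<lambda>p. f p x) ps))" using Cons by simp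
  have "klinear K Z W (\<lambda>x. f p x \<oplus>\<^bsub>W\<^esub> tsum W (map (\<lambda>p. f p x) ps))"
    by (intro klinearI)
      (simp_all add: klinear_closed[OF 1] klinear_closed[OF 2] klinear_add[OF 1] klinear_add[OF 2]
        klinear_smult[OF 1] klinear_smult[OF 2] W.smult_r_distr W.a_ac)
  thus ?case by (simp add: tsum_def)
qed

lemma frank_linear: "frank_ok ps \<Longrightarrow> klinear K H H (frank ps)"
  unfolding frank_def[abs_def] frank_ok_def case_prod_unfold
  by (rule klinear_tsum) (auto intro!: bil2[OF functional_bil])

text \<open>An operator that fixes \<open>F\<close> but not \<open>h\<close> is corrected by rank
  one. The fixed vectors form a subspace missing \<open>h\<close>, so a functional can vanish on it
  and take the value one at \<open>h\<close>.\<close>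

lemma finite_rank_identity:
  assumes "finite F" "F \<subseteq> carrier H"
  shows "\<exists>ps. frank_ok ps \<and> (\<forall>a\<in>F. frank ps a = a)"
  using assms
proof (induction F rule: finite_induct)
  case empty
  show ?case by (intro exI[of _ "[]"]) (simp add: frank_ok_def)
next
  case (insert h F)
  interpret H: Module.module K H by simp
  obtain ps where ps: "frank_ok ps" "\<And>a. a \<in> F \<Longrightarrow> frank ps a = a" using insert by auto
  note lin = frank_linear[OF ps(1)]
  show ?case
  proof (cases "frank ps h = h")
    case True
    thus ?thesis using ps by auto
  next
    case False
    let ?W = "{x \<in> carrier H. frank ps x = x}"
    have "subsp H ?W"
      unfolding subsp_def
      using klinear_add[OF lin] klinear_smult[OF lin]
        klinear_zero[OF lin H.abelian_group_axioms H.abelian_group_axioms] by auto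
    then obtain g where g: "functional H g" "\<And>w. w \<in> ?W \<Longrightarrow> g w = \<zero>\<^bsub>K\<^esub>" "g h = \<one>\<^bsub>K\<^esub>"
      using separating_functional[of H ?W h] False insert.prems by auto
    have hP: "frank ps h \<in> carrier H" "h \<in> carrier H"
      using insert.prems klinear_closed[OF lin] by auto
    \<comment> \<open>The correction adds the defect \<open>h - P h\<close>, weighted by
      \<open>g\<close>: at \<open>h\<close> the defect is repaired, and on \<open>F\<close> nothing
      changes because \<open>g\<close> vanishes there.\<close>
    let ?qs = "(h \<ominus>\<^bsub>H\<^esub> frank ps h, g) # ps"
    have frank_qs: "frank ?qs a = (g a \<odot>\<^bsub>H\<^esub> (h \<ominus>\<^bsub>H\<^esub> frank ps h)) \<oplus>\<^bsub>H\<^esub> frank ps a" for a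
      by (simp add: frank_def tsum_def)
    have "frank ?qs a = a" if "a \<in> insert h F" for a
    proof (cases "a = h")
      case True
      thus ?thesis using hP g(3) unfolding frank_qs
        by (simp add: H.minus_eq H.a_assoc H.l_neg)
    next
      case False
      hence a: "a \<in> ?W" using that ps(2) insert.prems by auto
      thus ?thesis unfolding frank_qs using g(2)[OF a] hP by simp
    qed
    moreover have "frank_ok ?qs" using ps(1) g(1) hP by (simp add: frank_ok_def)
    ultimately show ?thesis by blast
  qed
qed

lemma slice_linear:
  assumes "kmod V" "functional H g"
  shows "klinear K (tensK K H V) V (slice V g)"
  unfolding slice_def[abs_def] using assms by (simp add: sw_klinear_tens functional_bil)

lemma frankT_linear:
  assumes "kmod V" "frank_ok ps"
  shows "klinear K (tensK K H V) (tensK K H V) (frankT V ps)"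
  unfolding frankT_def[abs_def] case_prod_unfold
  by (rule klinear_tsum) (use assms in \<open>auto simp: frank_ok_def slice_linear\<close>)

lemma frankT_pure:
  assumes V: "kmod V" and ps: "frank_ok ps" and "a \<in> carrier H" "x \<in> carrier V"
  shows "frankT V ps (a \<boxtimes>\<^bsub>tensK K H V\<^esub> x) = frank ps a \<boxtimes>\<^bsub>tensK K H V\<^esub> x"
proof -
  have ok: "v \<in> carrier H" "functional H g" "g a \<in> carrier K" if "(v, g) \<in> set ps" for v g
    using ps that assms by (auto simp: frank_ok_def functional_def Pi_iff)
  have "frank ps a \<boxtimes>\<^bsub>tensK K H V\<^esub> x = tsum (tensK K H V) (map ((\<lambda>z. z \<boxtimes>\<^bsub>tensK K H V\<^esub> x) \<circ> (\<lambda>(v, g). g a \<odot>\<^bsub>H\<^esub> v)) ps)"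
    unfolding frank_def map_map[symmetric]
    by (rule tsum_linear) (use assms ok in auto)
  also have "map ((\<lambda>z. z \<boxtimes>\<^bsub>tensK K H V\<^esub> x) \<circ> (\<lambda>(v, g). g a \<odot>\<^bsub>H\<^esub> v)) ps =
      map (\<lambda>(v, g). v \<boxtimes>\<^bsub>tensK K H V\<^esub> slice V g (a \<boxtimes>\<^bsub>tensK K H V\<^esub> x)) ps"
    using assms ok
    by (auto simp: slice_def functional_bil klinear_smult[OF bil1[OF tensK_bil]] klinear_smult[OF bil2[OF tensK_bil]])
  finally show ?thesis by (simp add: frankT_def)
qed

text \<open>A tensor involves finitely many first legs, and any operator fixing these fixes the
  tensor. Together with \<open>finite_rank_identity\<close> this presents \<open>t\<close> by
  finitely many of its slices.\<close>

lemma frankT_identity: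
  assumes V: "kmod V" and t: "t \<in> carrier (tensK K H V)"
  shows "\<exists>F. finite F \<and> F \<subseteq> carrier H \<and> (\<forall>ps. frank_ok ps \<and> (\<forall>a\<in>F. frank ps a = a) \<longrightarrow> frankT V ps t = t)"
  using t
proof (induction rule: tensK_induct[OF kmod_H V, consumes 1, case_names pure add])
  case (pure a x)
  thus ?case using V by (intro exI[of _ "{a}"]) (simp add: frankT_pure)
next
  case (add s t)
  then obtain F G where "finite F" "F \<subseteq> carrier H" "\<forall>ps. frank_ok ps \<and> (\<forall>a\<in>F. frank ps a = a) \<longrightarrow> frankT V ps s = s"
    "finite G" "G \<subseteq> carrier H" "\<forall>ps. frank_ok ps \<and> (\<forall>a\<in>G. frank ps a = a) \<longrightarrow> frankT V ps t = t" by blast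
  thus ?case using add(1,2)
    by (intro exI[of _ "F \<union> G"]) (simp add: klinear_add[OF frankT_linear[OF V]])
qed

lemma homK_kmod [simp]:
  assumes V: "kmod V" and W: "kmod W"
  shows "kmod (homK K V W)"
proof -
  interpret V: Module.module K V by fact
  interpret W: Module.module K W by fact
  have cl: "f x \<in> carrier W" if "f \<in> carrier (homK K V W)" "x \<in> carrier V" for f x
    using that by (auto simp: homK_def klinear_def)
  have ext: "f = g" if "f \<in> carrier (homK K V W)" "g \<in> carrier (homK K V W)" "\<And>x. x \<in> carrier V \<Longrightarrow> f x = g x" for f g
    using that by (intro extensionalityI[of f "carrier V" g]) (auto simp: homK_def)
  have lin: "klinear K V W f" if "f \<in> carrier (homK K V W)" for f
    using that by (simp add: homK_def)
  have add: "f \<oplus>\<^bsub>homK K V W\<^esub> g \<in> carrier (homK K V W)"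
    if "f \<in> carrier (homK K V W)" "g \<in> carrier (homK K V W)" for f g
  proof -
    note fg = lin[OF that(1)] lin[OF that(2)]
    have "klinear K V W (\<lambda>x\<in>carrier V. f x \<oplus>\<^bsub>W\<^esub> g x)"
      by (rule klinearI)
        (simp_all add: fg[THEN klinear_closed] fg[THEN klinear_add] fg[THEN klinear_smult] W.smult_r_distr W.a_ac)
    thus ?thesis by (simp add: homK_def)
  qed
  have smult: "r \<odot>\<^bsub>homK K V W\<^esub> f \<in> carrier (homK K V W)"
    if "f \<in> carrier (homK K V W)" "r \<in> carrier K" for f r
  proof -
    note f = lin[OF that(1)]
    have "klinear K V W (\<lambda>x\<in>carrier V. r \<odot>\<^bsub>W\<^esub> f x)"
      by (rule klinearI)
        (simp_all add: that(2) klinear_closed[OF f] klinear_add[OF f] klinear_smult[OF f] W.smult_r_distr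
          W.smult_assoc1[symmetric] V.R.m_comm)
    thus ?thesis by (simp add: homK_def)
  qed
  have zero: "\<zero>\<^bsub>homK K V W\<^esub> \<in> carrier (homK K V W)"
    unfolding homK_def klinear_def by auto
  have ev: "(f \<oplus>\<^bsub>homK K V W\<^esub> g) x = f x \<oplus>\<^bsub>W\<^esub> g x" "(r \<odot>\<^bsub>homK K V W\<^esub> f) x = r \<odot>\<^bsub>W\<^esub> f x"
    "\<zero>\<^bsub>homK K V W\<^esub> x = \<zero>\<^bsub>W\<^esub>" if "x \<in> carrier V" for f g r x
    using that by (simp_all add: homK_def)
  show ?thesis
  proof (rule moduleI)
    show "abelian_group (homK K V W)"
    proof (rule abelian_groupI)
      fix f assume f: "f \<in> carrier (homK K V W)"
      \<comment> \<open>The additive inverse is supplied by multiplication with minus one.\<close>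
      have "(\<ominus>\<^bsub>K\<^esub> \<one>\<^bsub>K\<^esub>) \<odot>\<^bsub>homK K V W\<^esub> f \<oplus>\<^bsub>homK K V W\<^esub> f = \<zero>\<^bsub>homK K V W\<^esub>"
        by (rule ext) (use f in \<open>simp_all add: add smult zero ev cl V.smult_l_minus W.smult_l_minus W.l_neg\<close>)
      thus "\<exists>g\<in>carrier (homK K V W). g \<oplus>\<^bsub>homK K V W\<^esub> f = \<zero>\<^bsub>homK K V W\<^esub>"
        using smult[OF f] by blast
    next
      fix f g assume "f \<in> carrier (homK K V W)" "g \<in> carrier (homK K V W)"
      thus "f \<oplus>\<^bsub>homK K V W\<^esub> g = g \<oplus>\<^bsub>homK K V W\<^esub> f"
        by (intro ext) (simp_all add: add ev cl W.a_ac)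
    qed (auto intro!: ext simp: add zero ev cl W.a_ac)
  qed (auto intro!: ext simp: K_cring add smult ev cl W.smult_l_distr W.smult_r_distr W.smult_assoc1)
qed

section \<open>Rational morphisms\<close>

lemma homK_carrier: "f \<in> carrier (homK K V W) \<longleftrightarrow> f \<in> extensional (carrier V) \<and> klinear K V W f"
  by (simp add: homK_def)

lemma homK_klinear: "f \<in> carrier (homK K V W) \<Longrightarrow> klinear K V W f"
  by (simp add: homK_def)

lemma homK_closed [simp]: "\<lbrakk>f \<in> carrier (homK K V W); x \<in> carrier V\<rbrakk> \<Longrightarrow> f x \<in> carrier W"
  by (rule klinear_closed[OF homK_klinear])

lemma homK_restrict: "\<lbrakk>kmod V; klinear K V W f\<rbrakk> \<Longrightarrow> (\<lambda>x\<in>carrier V. f x) \<in> carrier (homK K V W)"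
  by (simp add: homK_carrier klinear_cong[of V "\<lambda>x\<in>carrier V. f x" f])

lemma homK_eqI:
  "\<lbrakk>f \<in> carrier (homK K V W); g \<in> carrier (homK K V W); \<And>x. x \<in> carrier V \<Longrightarrow> f x = g x\<rbrakk> \<Longrightarrow> f = g"
  by (rule extensionalityI[of f "carrier V" g]) (auto simp: homK_carrier)

lemma homK_apply [simp]:
  "x \<in> carrier V \<Longrightarrow> (f \<oplus>\<^bsub>homK K V W\<^esub> g) x = f x \<oplus>\<^bsub>W\<^esub> g x"
  "x \<in> carrier V \<Longrightarrow> (r \<odot>\<^bsub>homK K V W\<^esub> f) x = r \<odot>\<^bsub>W\<^esub> f x"
  by (simp_all add: homK_def)

lemma homK_eval_linear [simp]: "x \<in> carrier V \<Longrightarrow> klinear K (homK K V W) W (\<lambda>f. f x)"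
  by (rule klinearI) simp_all

lemma klinear_tensK_eqI:
  assumes A: "kmod A" and B: "kmod B"
    and f: "klinear K (tensK K A B) Z f" and g: "klinear K (tensK K A B) Z g"
    and t: "t \<in> carrier (tensK K A B)"
    and eq: "\<And>x y. \<lbrakk>x \<in> carrier A; y \<in> carrier B\<rbrakk> \<Longrightarrow>
      f (x \<boxtimes>\<^bsub>tensK K A B\<^esub> y) = g (x \<boxtimes>\<^bsub>tensK K A B\<^esub> y)"
  shows "f t = g t"
  using t
  by (induction rule: tensK_induct[OF A B, consumes 1, case_names pure add])
    (simp_all add: eq klinear_add[OF f] klinear_add[OF g])

text \<open>The canonical map from \<open>H \<otimes> Hom(V, W)\<close> to
  \<open>Hom(V, H \<otimes> W)\<close>, evaluated at \<open>x\<close>.\<close>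

definition heval where
  "heval V W t x = sw H (homK K V W) (tensK K H W) t (\<lambda>a f. a \<boxtimes>\<^bsub>tensK K H W\<^esub> f x)"

lemma heval_bil:
  "\<lbrakk>kmod V; kmod W; x \<in> carrier V\<rbrakk> \<Longrightarrow> bil H (homK K V W) (tensK K H W) (\<lambda>a f. a \<boxtimes>\<^bsub>tensK K H W\<^esub> f x)"
  by (simp add: bil_def)

lemma heval_linear:
  "\<lbrakk>kmod V; kmod W; x \<in> carrier V\<rbrakk> \<Longrightarrow> klinear K (tensK K H (homK K V W)) (tensK K H W) (\<lambda>t. heval V W t x)"
  unfolding heval_def by (simp add: sw_klinear_tens heval_bil)

text \<open>One finite-rank operator can be chosen that fixes both tensors. Each is then recovered
  from its slices, which are linear maps from \<open>V\<close> to \<open>W\<close> and as such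
  determined by their values. This makes the definite description in \<open>lAd\<close>
  meaningful.\<close>

lemma heval_inject:
  assumes V [simp]: "kmod V" and W [simp]: "kmod W"
    and t [simp]: "t \<in> carrier (tensK K H (homK K V W))" and t' [simp]: "t' \<in> carrier (tensK K H (homK K V W))"
    and eq: "\<And>x. x \<in> carrier V \<Longrightarrow> heval V W t x = heval V W t' x"
  shows "t = t'"
proof -
  let ?E = "homK K V W"
  obtain F where F: "finite F" "F \<subseteq> carrier H" "\<And>ps. frank_ok ps \<and> (\<forall>a\<in>F. frank ps a = a) \<Longrightarrow> frankT ?E ps t = t"
    using frankT_identity[OF _ t] by auto
  obtain F' where F': "finite F'" "F' \<subseteq> carrier H" "\<And>ps. frank_ok ps \<and> (\<forall>a\<in>F'. frank ps a = a) \<Longrightarrow> frankT ?E ps t' = t'"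
    using frankT_identity[OF _ t'] by auto
  obtain ps where ps: "frank_ok ps" "\<forall>a\<in>F \<union> F'. frank ps a = a"
    using finite_rank_identity[of "F \<union> F'"] F(1,2) F'(1,2) by auto
  \<comment> \<open>A functional on the \<open>H\<close>-leg and evaluation at \<open>x\<close> act
    on different legs and therefore commute.\<close>
  have slice: "slice ?E g s x = slice W g (heval V W s x)"
    if g: "functional H g" and s: "s \<in> carrier (tensK K H ?E)" and x: "x \<in> carrier V" for g s x
  proof -
    note [simp] = functional_bil[OF g] bil_closed[OF functional_bil[OF g]]
    have "slice ?E g s x = sw H ?E W s (\<lambda>a f. g a \<odot>\<^bsub>W\<^esub> f x)"
      unfolding slice_def using s x by (simp add: sw_push[OF _ _ homK_eval_linear])
    also have "\<dots> = slice W g (heval V W s x)"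
      unfolding heval_def using s x
      by (simp add: sw_push[OF _ _ slice_linear[OF W g]]) (simp add: slice_def)
    finally show ?thesis .
  qed
  have "slice ?E g t = slice ?E g t'" if g: "functional H g" for g
    by (rule homK_eqI[where V = V and W = W])
      (use g in \<open>simp_all add: slice eq klinear_closed[OF slice_linear]\<close>)
  hence "frankT ?E ps t = frankT ?E ps t'"
    using ps(1) unfolding frankT_def frank_ok_def
    by (intro arg_cong[where f = "tsum (tensK K H ?E)"] map_cong) auto
  thus ?thesis using F(3) F'(3) ps by simp
qed

lemma klinear_finsum_eq:
  assumes V: "kmod V" and W: "kmod W" and f: "klinear K V W f" and g: "klinear K V W g" and B: "finite B"
    and y: "\<And>s. s \<in> B \<Longrightarrow> y s \<in> carrier V" "\<And>s. s \<in> B \<Longrightarrow> f (y s) = g (y s)"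
  shows "f (finsum V y B) = g (finsum V y B)"
  using B y
proof (induction B rule: finite_induct)
  case empty
  interpret V: Module.module K V by fact
  show ?case
    using klinear_zero[OF f kmod_group[OF V] kmod_group[OF W]] klinear_zero[OF g kmod_group[OF V] kmod_group[OF W]]
    by simp
next
  case (insert s B)
  interpret V: Module.module K V by fact
  have "finsum V y B \<in> carrier V" using insert by (intro V.finsum_closed) auto
  thus ?case using insert by (simp add: Pi_iff klinear_add[OF f] klinear_add[OF g])
qed

section \<open>Right linear maps out of finitely generated modules\<close>

definition ract_right where
  "ract_right R a t = sw H R (tensK K H R) t (\<lambda>h r. h \<boxtimes>\<^bsub>tensK K H R\<^esub> (r \<triangleleft>\<^bsub>R\<^esub> a))"

lemma ract_right_linear: "\<lbrakk>hbimod R; a \<in> carrier H\<rbrakk> \<Longrightarrow> klinear K (tensK K H R) (tensK K H R) (ract_right R a)"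
  unfolding ract_right_def[abs_def] by (simp add: bil_def)

lemma ract_right_pure:
  "\<lbrakk>hbimod R; a \<in> carrier H; h \<in> carrier H; r \<in> carrier R\<rbrakk> \<Longrightarrow>
    ract_right R a (h \<boxtimes>\<^bsub>tensK K H R\<^esub> r) = h \<boxtimes>\<^bsub>tensK K H R\<^esub> (r \<triangleleft>\<^bsub>R\<^esub> a)"
  by (simp add: ract_right_def bil_def)

text \<open>A presentation by a list of pairs. The element of \<open>tensK K H (homK K M R)\<close>
  that it represents no longer shows that its second legs can be chosen right linear; the list keeps
  this information.\<close>

definition hom_pairs where
  "hom_pairs M R ps \<longleftrightarrow> (\<forall>(v, f)\<in>set ps. v \<in> carrier H \<and> f \<in> carrier (homK K M R) \<and> right_linear H M R f)"

definition hom_pairs_sum where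
  "hom_pairs_sum M R ps = tsum (tensK K H (homK K M R)) (map (\<lambda>(v, f). v \<boxtimes>\<^bsub>tensK K H (homK K M R)\<^esub> f) ps)"

lemma hom_pairs_sum_closed:
  "\<lbrakk>kmod M; kmod R; hom_pairs M R ps\<rbrakk> \<Longrightarrow> hom_pairs_sum M R ps \<in> carrier (tensK K H (homK K M R))"
  unfolding hom_pairs_sum_def hom_pairs_def by (rule tsum_closed) auto

lemma hom_pairs_sum_sw:
  assumes "kmod M" "kmod R" "kmod Z" "hom_pairs M R ps" and f: "bil H (homK K M R) Z f"
  shows "sw H (homK K M R) Z (hom_pairs_sum M R ps) f = tsum Z (map (\<lambda>(v, \<phi>). f v \<phi>) ps)"
proof -
  have "sw H (homK K M R) Z (hom_pairs_sum M R ps) f =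
      tsum Z (map (\<lambda>t. sw H (homK K M R) Z t f) (map (\<lambda>(v, f). v \<boxtimes>\<^bsub>tensK K H (homK K M R)\<^esub> f) ps))"
    unfolding hom_pairs_sum_def
    by (rule tsum_linear[OF sw_klinear_tens]) (use assms in \<open>auto simp: hom_pairs_def\<close>)
  also have "\<dots> = tsum Z (map (\<lambda>(v, \<phi>). f v \<phi>) ps)"
    unfolding map_map
    by (intro arg_cong[where f = "tsum Z"] map_cong) (use assms in \<open>auto simp: hom_pairs_def\<close>)
  finally show ?thesis .
qed

text \<open>A right linear map from a finitely generated \<open>M\<close> into \<open>H \<otimes> R\<close> has all its values in \<open>V \<otimes> R\<close> for some
  finite-dimensional \<open>V \<subseteq> H\<close>, and is therefore given by an element of \<open>H \<otimes> Hom(M, R)\<close>.\<close>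

lemma fin_gen_hom_tensor:
  assumes M [simp]: "hbimod M" and R [simp]: "hbimod R" and fg: "right_fin_gen H M"
    and L: "klinear K M (tensK K H R) L"
    and L_ract: "\<And>m a. \<lbrakk>m \<in> carrier M; a \<in> carrier H\<rbrakk> \<Longrightarrow> L (m \<triangleleft>\<^bsub>M\<^esub> a) = ract_right R a (L m)"
  obtains ps where "hom_pairs M R ps" "\<And>m. m \<in> carrier M \<Longrightarrow> heval M R (hom_pairs_sum M R ps) m = L m"
proof -
  note [simp] = klinear_closed[OF L]
  obtain S where S: "finite S" "S \<subseteq> carrier M"
    "\<And>m. m \<in> carrier M \<Longrightarrow> \<exists>c\<in>S \<rightarrow> carrier H. m = (\<Oplus>\<^bsub>M\<^esub>s\<in>S. s \<triangleleft>\<^bsub>M\<^esub> c s)"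
    using fg unfolding right_fin_gen_def by blast
  have "\<exists>F. finite F \<and> F \<subseteq> carrier H \<and> (\<forall>ps. frank_ok ps \<and> (\<forall>a\<in>F. frank ps a = a) \<longrightarrow> frankT R ps (L s) = L s)"
    if "s \<in> S" for s
    using that S(2) by (intro frankT_identity) auto
  then obtain F where F: "\<And>s. s \<in> S \<Longrightarrow> finite (F s) \<and> F s \<subseteq> carrier H \<and>
      (\<forall>ps. frank_ok ps \<and> (\<forall>a\<in>F s. frank ps a = a) \<longrightarrow> frankT R ps (L s) = L s)" by metis
  \<comment> \<open>A single operator serves all generators at once; this is where finiteness of the
    generating set enters.\<close>
  obtain ps where ps: "frank_ok ps" "\<forall>a\<in>\<Union>(F ` S). frank ps a = a"
    using finite_rank_identity[of "\<Union>(F ` S)"] F S(1) by auto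
  have fix_S: "frankT R ps (L s) = L s" if "s \<in> S" for s
    using F[OF that] ps that by auto
  have ps_ok: "v \<in> carrier H" "functional H g" if "(v, g) \<in> set ps" for v g
    using ps(1) that by (auto simp: frank_ok_def)
  \<comment> \<open>The operator acts on the first leg and \<open>H\<close> acts on the second, so
    being fixed passes from the images of the generators to the image of all of
    \<open>M\<close>.\<close>
  have comm: "frankT R ps (ract_right R a t) = ract_right R a (frankT R ps t)"
    if t: "t \<in> carrier (tensK K H R)" and [simp]: "a \<in> carrier H" for t a
    by (rule klinear_tensK_eqI[OF _ _ _ _ t, where Z = "tensK K H R"])
      (simp_all add: lin_comp[OF frankT_linear[OF _ ps(1)]] lin_comp[OF ract_right_linear] ract_right_linear
        frankT_linear ps(1) frankT_pure ract_right_pure klinear_closed[OF frank_linear])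
  have fix_all: "frankT R ps (L m) = L m" if m: "m \<in> carrier M" for m
  proof -
    obtain c where c: "c \<in> S \<rightarrow> carrier H" "m = (\<Oplus>\<^bsub>M\<^esub>s\<in>S. s \<triangleleft>\<^bsub>M\<^esub> c s)" using S(3)[OF m] by blast
    have mem: "s \<in> carrier M" "c s \<in> carrier H" if "s \<in> S" for s using c(1) S(2) that by auto
    show ?thesis
      unfolding c(2)
      by (rule klinear_finsum_eq[where W = "tensK K H R"])
        (simp_all add: S(1) L lin_comp[OF frankT_linear[OF _ ps(1)]] mem L_ract comm fix_S)
  qed
  \<comment> \<open>The fixing operator is a sum of terms \<open>v\<close> times \<open>g\<close>.
    Slicing \<open>L\<close> by the functionals \<open>g\<close> gives the required linear maps,
    with the vectors \<open>v\<close> as first legs.\<close>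
  define qs where "qs = map (\<lambda>(v, g). (v, \<lambda>m\<in>carrier M. slice R g (L m))) ps"
  have slice_ract: "slice R g (ract_right R a t) = slice R g t \<triangleleft>\<^bsub>R\<^esub> a"
    if g: "functional H g" and t: "t \<in> carrier (tensK K H R)" and [simp]: "a \<in> carrier H" for g t a
  proof (rule klinear_tensK_eqI[OF _ _ _ _ t, where Z = R])
    fix h r assume [simp]: "h \<in> carrier H" "r \<in> carrier R"
    have "g h \<in> carrier K" using g by (auto simp: functional_def)
    thus "slice R g (ract_right R a (h \<boxtimes>\<^bsub>tensK K H R\<^esub> r)) = slice R g (h \<boxtimes>\<^bsub>tensK K H R\<^esub> r) \<triangleleft>\<^bsub>R\<^esub> a"
      by (simp add: ract_right_pure slice_def functional_bil[OF g] klinear_smult[OF bil2[OF ract_bil]])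
  qed (simp_all add: lin_comp[OF slice_linear[OF _ g]] slice_linear[OF _ g] ract_right_linear)
  have hom: "(\<lambda>m\<in>carrier M. slice R g (L m)) \<in> carrier (homK K M R)" if "functional H g" for g
    by (rule homK_restrict) (simp_all add: lin_comp[OF slice_linear[OF _ that]] L)
  have qs: "hom_pairs M R qs"
    unfolding hom_pairs_def qs_def right_linear_def
    using ps_ok hom by (auto simp: L_ract slice_ract)
  have "heval M R (hom_pairs_sum M R qs) m = L m" if m: "m \<in> carrier M" for m
  proof -
    have "heval M R (hom_pairs_sum M R qs) m = tsum (tensK K H R) (map (\<lambda>(v, f). v \<boxtimes>\<^bsub>tensK K H R\<^esub> f m) qs)"
      unfolding heval_def by (rule hom_pairs_sum_sw) (simp_all add: m qs heval_bil)
    also have "map (\<lambda>(v, f). v \<boxtimes>\<^bsub>tensK K H R\<^esub> f m) qs = map (\<lambda>(v, g). v \<boxtimes>\<^bsub>tensK K H R\<^esub> slice R g (L m)) ps"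
      using m by (auto simp: qs_def)
    also have "tsum (tensK K H R) \<dots> = L m"
      using fix_all[OF m] by (simp add: frankT_def)
    finally show ?thesis .
  qed
  thus thesis using that qs by blast
qed

text \<open>The right adjoint coaction has its \<open>H\<close>-leg on the right. Flipping makes
  \<open>fin_gen_hom_tensor\<close> applicable to it as well.\<close>

definition flip where
  "flip A B t = sw A B (tensK K B A) t (\<lambda>a b. b \<boxtimes>\<^bsub>tensK K B A\<^esub> a)"

lemma flip_linear [simp]: "\<lbrakk>kmod A; kmod B\<rbrakk> \<Longrightarrow> klinear K (tensK K A B) (tensK K B A) (flip A B)"
  unfolding flip_def[abs_def] by (simp add: bil_def)

lemma flip_closed [simp]: "\<lbrakk>kmod A; kmod B; t \<in> carrier (tensK K A B)\<rbrakk> \<Longrightarrow> flip A B t \<in> carrier (tensK K B A)"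
  by (rule klinear_closed[OF flip_linear])

lemma flip_pure [simp]:
  "\<lbrakk>kmod A; kmod B; a \<in> carrier A; b \<in> carrier B\<rbrakk> \<Longrightarrow> flip A B (a \<boxtimes>\<^bsub>tensK K A B\<^esub> b) = b \<boxtimes>\<^bsub>tensK K B A\<^esub> a"
  by (simp add: flip_def bil_def)

lemma flip_flip [simp]:
  assumes "kmod A" "kmod B" "t \<in> carrier (tensK K A B)"
  shows "flip B A (flip A B t) = t"
  by (rule klinear_tensK_eqI[OF assms(1,2) _ _ assms(3), where Z = "tensK K A B"])
    (use assms in \<open>simp_all add: lin_comp[OF flip_linear]\<close>)

lemma sw_flip:
  assumes "kmod A" "kmod B" "kmod Z" "t \<in> carrier (tensK K A B)" and f: "bil A B Z f"
  shows "sw B A Z (flip A B t) (\<lambda>b a. f a b) = sw A B Z t f"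
  by (rule klinear_tensK_eqI[OF assms(1,2) _ _ assms(4), where Z = Z])
    (use assms f in \<open>simp_all add: lin_comp[OF flip_linear] bil_def\<close>)

end

section \<open>Adjoint coactions and criteria for rationality\<close>

context hopf_algebra_bij
begin

text \<open>The value at \<open>m\<close> of the left adjoint coaction of \<open>\<phi>\<close>, as
  an element of \<open>H \<otimes> N\<close>; it is defined whether or not it comes from a tensor in
  \<open>H \<otimes> Hom(M, N)\<close>.\<close>

definition Lad where
  "Lad M N \<phi> m = (let Z = tensK K H N in lsum Z M m (\<lambda>m1 m0. lsum Z N (\<phi> m0) (\<lambda>n1 n0.
    (n1 \<otimes>\<^bsub>H\<^esub> S' m1) \<boxtimes>\<^bsub>Z\<^esub> n0)))"

definition Rad where
  "Rad M N \<phi> m = (let Z = tensK K N H in rsum Z M m (\<lambda>m0 m1. rsum Z N (\<phi> m0) (\<lambda>n0 n1.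
    n0 \<boxtimes>\<^bsub>Z\<^esub> (n1 \<otimes>\<^bsub>H\<^esub> S m1))))"

context
  fixes M :: "('k, 'h, 'm, 'y) bimod_scheme" and N :: "('k, 'h, 'n, 'z) bimod_scheme"
  assumes M: "bicov M" and Nr: "rcov N" and Nl: "lcov N"
begin

lemma Lad_linear: "klinear K M N \<phi> \<Longrightarrow> klinear K M (tensK K H N) (Lad M N \<phi>)"
  unfolding Lad_def[abs_def] Let_def using M Nl by (simp add: bil_def klinear_closed[of K M N \<phi>] lin_comp[of M N \<phi>])

lemma Rad_linear: "klinear K M N \<phi> \<Longrightarrow> klinear K M (tensK K N H) (Rad M N \<phi>)"
  unfolding Rad_def[abs_def] Let_def using M Nr by (simp add: bil_def klinear_closed[of K M N \<phi>] lin_comp[of M N \<phi>])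

lemma ladj_elem_iff:
  assumes \<phi>: "\<phi> \<in> carrier (homK K M N)"
  shows "ladj_elem K H M N \<phi> t \<longleftrightarrow> t \<in> carrier (tensK K H (homK K M N)) \<and> (\<forall>m\<in>carrier M. heval M N t m = Lad M N \<phi> m)"
  unfolding ladj_elem_def heval_def Lad_def Let_def
  using M Nl \<phi> by (auto simp: sweedler_lcoact sweedler_sw[of H "homK K M N"])

lemma radj_elem_iff:
  assumes \<phi>: "\<phi> \<in> carrier (homK K M N)"
  shows "radj_elem K H M N \<phi> t \<longleftrightarrow> t \<in> carrier (tensK K (homK K M N) H) \<and>
    (\<forall>m\<in>carrier M. sw (homK K M N) H (tensK K N H) t (\<lambda>f a. f m \<boxtimes>\<^bsub>tensK K N H\<^esub> a) = Rad M N \<phi> m)"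
  unfolding radj_elem_def Rad_def Let_def
  using M Nr \<phi> by (auto simp: sweedler_rcoact sweedler_sw[of "homK K M N" H])

text \<open>Uniqueness is injectivity of the canonical evaluation map. From here on
  \<open>lAd\<close> is computed by exhibiting one suitable tensor.\<close>

lemma lAd_eq:
  assumes \<phi>: "\<phi> \<in> carrier (homK K M N)" and t: "ladj_elem K H M N \<phi> t"
  shows "lAd K H M N \<phi> = t"
  unfolding lAd_def
proof (rule the_equality)
  show "ladj_elem K H M N \<phi> t" by (rule t)
  fix s assume s: "ladj_elem K H M N \<phi> s"
  show "s = t"
    by (rule heval_inject[where V = M and W = N])
      (use s t M Nl in \<open>simp_all add: ladj_elem_iff[OF \<phi>]\<close>)
qed

text \<open>The adjoint coactions are additive in \<open>\<phi>\<close>, so the sum of two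
  representing tensors represents the sum of the maps.\<close>

lemma HOM_add:
  assumes \<phi>: "\<phi> \<in> HOM K H M N" and \<psi>: "\<psi> \<in> HOM K H M N"
  shows "\<phi> \<oplus>\<^bsub>homK K M N\<^esub> \<psi> \<in> HOM K H M N"
    and "lAd K H M N (\<phi> \<oplus>\<^bsub>homK K M N\<^esub> \<psi>) = lAd K H M N \<phi> \<oplus>\<^bsub>tensK K H (homK K M N)\<^esub> lAd K H M N \<psi>"
proof -
  let ?E = "homK K M N"
  have hbM: "hbimod M" "hbimod N" using M Nl by simp_all
  have "kmod ?E" using hbM by simp
  then interpret E: Module.module K ?E .
  have "kmod (tensK K H ?E)" "kmod (tensK K ?E H)" using hbM by simp_all
  then interpret HE: Module.module K "tensK K H ?E" + EH: Module.module K "tensK K ?E H" .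
  obtain t s t' s' where t: "radj_elem K H M N \<phi> t" "ladj_elem K H M N \<phi> t'"
    and s: "radj_elem K H M N \<psi> s" "ladj_elem K H M N \<psi> s'" and hom: "\<phi> \<in> carrier ?E" "\<psi> \<in> carrier ?E"
    using \<phi> \<psi> unfolding HOM_def by auto
  have homs: "\<phi> \<oplus>\<^bsub>?E\<^esub> \<psi> \<in> carrier ?E" using hom by simp
  have Lad_add: "Lad M N (\<phi> \<oplus>\<^bsub>?E\<^esub> \<psi>) m = Lad M N \<phi> m \<oplus>\<^bsub>tensK K H N\<^esub> Lad M N \<psi> m" if "m \<in> carrier M" for m
  proof -
    have lin: "klinear K N (tensK K H N) (\<lambda>x. lsum (tensK K H N) N x (\<lambda>n1 n0. (n1 \<otimes>\<^bsub>H\<^esub> S' m1) \<boxtimes>\<^bsub>tensK K H N\<^esub> n0))"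
      if "m1 \<in> carrier H" for m1
      using that Nl by (simp add: bil_def)
    show ?thesis
      unfolding Lad_def Let_def using that M Nl hom
      by (simp add: klinear_add[OF lin] sw_fun_add)
  qed
  have Rad_add: "Rad M N (\<phi> \<oplus>\<^bsub>?E\<^esub> \<psi>) m = Rad M N \<phi> m \<oplus>\<^bsub>tensK K N H\<^esub> Rad M N \<psi> m" if "m \<in> carrier M" for m
  proof -
    have lin: "klinear K N (tensK K N H) (\<lambda>x. rsum (tensK K N H) N x (\<lambda>n0 n1. n0 \<boxtimes>\<^bsub>tensK K N H\<^esub> (n1 \<otimes>\<^bsub>H\<^esub> S m1)))"
      if "m1 \<in> carrier H" for m1
      using that Nr by (simp add: bil_def)
    show ?thesis
      unfolding Rad_def Let_def using that M Nr hom
      by (simp add: klinear_add[OF lin] sw_fun_add)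
  qed
  have l: "ladj_elem K H M N (\<phi> \<oplus>\<^bsub>?E\<^esub> \<psi>) (t' \<oplus>\<^bsub>tensK K H ?E\<^esub> s')"
    using t(2) s(2) hbM
    by (simp add: ladj_elem_iff hom homs Lad_add klinear_add[OF heval_linear])
  have bil: "bil ?E H (tensK K N H) (\<lambda>f a. f m \<boxtimes>\<^bsub>tensK K N H\<^esub> a)" if "m \<in> carrier M" for m
    using that hbM by (simp add: bil_def)
  have r: "radj_elem K H M N (\<phi> \<oplus>\<^bsub>?E\<^esub> \<psi>) (t \<oplus>\<^bsub>tensK K ?E H\<^esub> s)"
    using t(1) s(1) hbM
    by (simp add: radj_elem_iff hom homs Rad_add klinear_add[OF sw_klinear_tens[OF _ _ bil]])
  show "\<phi> \<oplus>\<^bsub>?E\<^esub> \<psi> \<in> HOM K H M N"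
    using l r homs unfolding HOM_def by blast
  show "lAd K H M N (\<phi> \<oplus>\<^bsub>?E\<^esub> \<psi>) = lAd K H M N \<phi> \<oplus>\<^bsub>tensK K H ?E\<^esub> lAd K H M N \<psi>"
    using lAd_eq[OF homs l] lAd_eq[OF hom(1) t(2)] lAd_eq[OF hom(2) s(2)] by simp
qed

text \<open>For colinear \<open>\<phi>\<close> the left adjoint coaction contains the
  \<open>H\<close>-leg \<open>a2 S'(a1)\<close> and the right one \<open>a1 S(a2)\<close>, with
  \<open>a1\<close> and \<open>a2\<close> from one coproduct; both collapse. Bicolinear maps are
  thus coinvariant for the adjoint coactions.\<close>

lemma bicolinear_rational:
  assumes \<phi>: "\<phi> \<in> carrier (homK K M N)"
    and r: "\<And>m. m \<in> carrier M \<Longrightarrow> rcoact N (\<phi> m) = rsum (tensK K N H) M m (\<lambda>m0 m1. \<phi> m0 \<boxtimes>\<^bsub>tensK K N H\<^esub> m1)"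
    and l: "\<And>m. m \<in> carrier M \<Longrightarrow> lcoact N (\<phi> m) = lsum (tensK K H N) M m (\<lambda>m1 m0. m1 \<boxtimes>\<^bsub>tensK K H N\<^esub> \<phi> m0)"
  shows "\<phi> \<in> HOM K H M N" and "lAd K H M N \<phi> = \<one>\<^bsub>H\<^esub> \<boxtimes>\<^bsub>tensK K H (homK K M N)\<^esub> \<phi>"
proof -
  note [simp] = M Nr Nl \<phi> klinear_closed[OF homK_klinear[OF \<phi>]] homK_klinear[OF \<phi>] lin_comp[OF homK_klinear[OF \<phi>]]
  have [simp]: "hbimod N" using Nl by simp
  have "Lad M N \<phi> m = \<one>\<^bsub>H\<^esub> \<boxtimes>\<^bsub>tensK K H N\<^esub> \<phi> m" if [simp]: "m \<in> carrier M" for m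
  proof -
    let ?Z = "tensK K H N"
    have "Lad M N \<phi> m = lsum ?Z M m (\<lambda>m1 m'. lsum ?Z M m' (\<lambda>n1 m0. (n1 \<otimes>\<^bsub>H\<^esub> S' m1) \<boxtimes>\<^bsub>?Z\<^esub> \<phi> m0))"
      unfolding Lad_def Let_def
      by (simp add: l bil_def sw_push[where W = ?Z and g = "\<lambda>t. sw H N ?Z t (\<lambda>n1 n0. (n1 \<otimes>\<^bsub>H\<^esub> S' m1) \<boxtimes>\<^bsub>?Z\<^esub> n0)" for m1])
    also have "\<dots> = lsum ?Z M m (\<lambda>a m0. csum ?Z a (\<lambda>m1 n1. (n1 \<otimes>\<^bsub>H\<^esub> S' m1) \<boxtimes>\<^bsub>?Z\<^esub> \<phi> m0))"
      by (simp add: l_coassoc tri_def bil_def)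
    also have "\<dots> = \<one>\<^bsub>H\<^esub> \<boxtimes>\<^bsub>?Z\<^esub> \<phi> m"
      by (simp add: c_antipode_inv[where f = "\<lambda>z. z \<boxtimes>\<^bsub>?Z\<^esub> y" for y] l_counit)
    finally show ?thesis .
  qed
  hence 1: "ladj_elem K H M N \<phi> (\<one>\<^bsub>H\<^esub> \<boxtimes>\<^bsub>tensK K H (homK K M N)\<^esub> \<phi>)"
    by (simp add: ladj_elem_iff heval_def bil_def)
  have "Rad M N \<phi> m = \<phi> m \<boxtimes>\<^bsub>tensK K N H\<^esub> \<one>\<^bsub>H\<^esub>" if [simp]: "m \<in> carrier M" for m
  proof -
    let ?Z = "tensK K N H"
    have "Rad M N \<phi> m = rsum ?Z M m (\<lambda>m' m1. rsum ?Z M m' (\<lambda>m0 n1. \<phi> m0 \<boxtimes>\<^bsub>?Z\<^esub> (n1 \<otimes>\<^bsub>H\<^esub> S m1)))"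
      unfolding Rad_def Let_def
      by (simp add: r bil_def sw_push[where W = ?Z and g = "\<lambda>t. sw N H ?Z t (\<lambda>n0 n1. n0 \<boxtimes>\<^bsub>?Z\<^esub> (n1 \<otimes>\<^bsub>H\<^esub> S m1))" for m1])
    also have "\<dots> = rsum ?Z M m (\<lambda>m0 a. csum ?Z a (\<lambda>n1 m1. \<phi> m0 \<boxtimes>\<^bsub>?Z\<^esub> (n1 \<otimes>\<^bsub>H\<^esub> S m1)))"
      by (simp add: r_coassoc tri_def bil_def)
    also have "\<dots> = \<phi> m \<boxtimes>\<^bsub>?Z\<^esub> \<one>\<^bsub>H\<^esub>"
      by (simp add: c_antipode2 r_counit[where f = "\<lambda>m. \<phi> m \<boxtimes>\<^bsub>?Z\<^esub> \<one>\<^bsub>H\<^esub>"])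
    finally show ?thesis .
  qed
  hence 2: "radj_elem K H M N \<phi> (\<phi> \<boxtimes>\<^bsub>tensK K (homK K M N) H\<^esub> \<one>\<^bsub>H\<^esub>)"
    by (simp add: radj_elem_iff bil_def)
  show "\<phi> \<in> HOM K H M N" using 1 2 \<phi> unfolding HOM_def by blast
  show "lAd K H M N \<phi> = \<one>\<^bsub>H\<^esub> \<boxtimes>\<^bsub>tensK K H (homK K M N)\<^esub> \<phi>" by (rule lAd_eq[OF \<phi> 1])
qed

text \<open>For right linear \<open>\<phi>\<close> the coproduct legs of \<open>a\<close> cancel in
  the \<open>H\<close>-leg of the adjoint coaction of \<open>\<phi>\<close> at \<open>m a\<close>,
  as \<open>b S'(a1)\<close> on the left and \<open>c S(a2)\<close> on the right. The action thus
  survives only on the other leg, and finite generation of \<open>M\<close> yields a tensor. On the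
  left its second legs are right linear, which is recorded for later use.\<close>

lemma right_linear_rational:
  assumes fg: "right_fin_gen H M" and \<phi>: "\<phi> \<in> carrier (homK K M N)" and rl: "right_linear H M N \<phi>"
  shows "\<phi> \<in> HOM K H M N" and "\<exists>ps. hom_pairs M N ps \<and> lAd K H M N \<phi> = hom_pairs_sum M N ps"
proof -
  note [simp] = M Nr Nl \<phi> klinear_closed[OF homK_klinear[OF \<phi>]] homK_klinear[OF \<phi>] lin_comp[OF homK_klinear[OF \<phi>]]
  have [simp]: "hbimod N" using Nl by simp
  have \<phi>_ract: "\<phi> (m \<triangleleft>\<^bsub>M\<^esub> a) = \<phi> m \<triangleleft>\<^bsub>N\<^esub> a" if "m \<in> carrier M" "a \<in> carrier H" for m a
    using rl that by (simp add: right_linear_def)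
  have "Lad M N \<phi> (m \<triangleleft>\<^bsub>M\<^esub> a) = ract_right N a (Lad M N \<phi> m)" if [simp]: "m \<in> carrier M" "a \<in> carrier H" for m a
  proof -
    let ?Z = "tensK K H N"
    have inner: "csum ?Z a (\<lambda>a1 a2. lsum ?Z N n (\<lambda>n1 n0. csum ?Z a2 (\<lambda>b c. (n1 \<otimes>\<^bsub>H\<^esub> (b \<otimes>\<^bsub>H\<^esub> S' a1) \<otimes>\<^bsub>H\<^esub> S' m1) \<boxtimes>\<^bsub>?Z\<^esub> (n0 \<triangleleft>\<^bsub>N\<^esub> c)))) =
        lsum ?Z N n (\<lambda>n1 n0. (n1 \<otimes>\<^bsub>H\<^esub> S' m1) \<boxtimes>\<^bsub>?Z\<^esub> (n0 \<triangleleft>\<^bsub>N\<^esub> a))" if [simp]: "n \<in> carrier N" "m1 \<in> carrier H" for n m1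
    proof -
      have "csum ?Z a (\<lambda>a1 a2. lsum ?Z N n (\<lambda>n1 n0. csum ?Z a2 (\<lambda>b c. (n1 \<otimes>\<^bsub>H\<^esub> (b \<otimes>\<^bsub>H\<^esub> S' a1) \<otimes>\<^bsub>H\<^esub> S' m1) \<boxtimes>\<^bsub>?Z\<^esub> (n0 \<triangleleft>\<^bsub>N\<^esub> c)))) =
        lsum ?Z N n (\<lambda>n1 n0. csum ?Z a (\<lambda>a1 a2. csum ?Z a2 (\<lambda>b c. (n1 \<otimes>\<^bsub>H\<^esub> (b \<otimes>\<^bsub>H\<^esub> S' a1) \<otimes>\<^bsub>H\<^esub> S' m1) \<boxtimes>\<^bsub>?Z\<^esub> (n0 \<triangleleft>\<^bsub>N\<^esub> c))))"
        by (rule sw_swap) simp_all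
      also have "\<dots> = lsum ?Z N n (\<lambda>n1 n0. (n1 \<otimes>\<^bsub>H\<^esub> S' m1) \<boxtimes>\<^bsub>?Z\<^esub> (n0 \<triangleleft>\<^bsub>N\<^esub> a))"
        by (simp add: c_cancel_inv[where f = "\<lambda>z c. (n1 \<otimes>\<^bsub>H\<^esub> z \<otimes>\<^bsub>H\<^esub> S' m1) \<boxtimes>\<^bsub>?Z\<^esub> (n0 \<triangleleft>\<^bsub>N\<^esub> c)" for n1 n0] bil_def)
      finally show ?thesis .
    qed
    have "Lad M N \<phi> (m \<triangleleft>\<^bsub>M\<^esub> a) = lsum ?Z M m (\<lambda>m1 m0. csum ?Z a (\<lambda>a1 a2. lsum ?Z N (\<phi> m0) (\<lambda>n1 n0. csum ?Z a2 (\<lambda>b c.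
        (n1 \<otimes>\<^bsub>H\<^esub> (b \<otimes>\<^bsub>H\<^esub> S' a1) \<otimes>\<^bsub>H\<^esub> S' m1) \<boxtimes>\<^bsub>?Z\<^esub> (n0 \<triangleleft>\<^bsub>N\<^esub> c)))))"
      unfolding Lad_def Let_def
      by (simp add: l_ract[OF bicov_lcov[OF M]] l_ract[OF Nl] bil_def \<phi>_ract S'_mult m_assoc)
    also have "\<dots> = ract_right N a (Lad M N \<phi> m)"
      unfolding Lad_def Let_def
      by (simp add: inner sw_push[OF _ _ ract_right_linear] ract_right_pure)
    finally show ?thesis .
  qed
  then obtain ps where ps: "hom_pairs M N ps" "\<And>m. m \<in> carrier M \<Longrightarrow> heval M N (hom_pairs_sum M N ps) m = Lad M N \<phi> m"
    using fin_gen_hom_tensor[OF _ _ fg Lad_linear[OF homK_klinear[OF \<phi>]]] by (metis M bicov_hbimod \<open>hbimod N\<close>)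
  have 1: "ladj_elem K H M N \<phi> (hom_pairs_sum M N ps)"
    using ps by (simp add: ladj_elem_iff hom_pairs_sum_closed)
  \<comment> \<open>The right adjoint coaction with its legs exchanged, so that the argument for the
    left one can be repeated.\<close>
  let ?L = "\<lambda>m. flip N H (Rad M N \<phi> m)"
  have L: "klinear K M (tensK K H N) ?L"
    by (rule lin_comp[OF flip_linear]) (simp_all add: Rad_linear[OF homK_klinear[OF \<phi>]])
  have L_eq: "?L m = rsum (tensK K H N) M m (\<lambda>m0 m1. rsum (tensK K H N) N (\<phi> m0) (\<lambda>n0 n1.
      (n1 \<otimes>\<^bsub>H\<^esub> S m1) \<boxtimes>\<^bsub>tensK K H N\<^esub> n0))" if "m \<in> carrier M" for m
    unfolding Rad_def Let_def using that by (simp add: sw_push[OF _ _ flip_linear])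
  have "?L (m \<triangleleft>\<^bsub>M\<^esub> a) = ract_right N a (?L m)" if [simp]: "m \<in> carrier M" "a \<in> carrier H" for m a
  proof -
    let ?Z = "tensK K H N"
    have inner: "csum ?Z a (\<lambda>a1 a2. rsum ?Z N n (\<lambda>n0 n1. csum ?Z a1 (\<lambda>b c. (n1 \<otimes>\<^bsub>H\<^esub> (c \<otimes>\<^bsub>H\<^esub> S a2) \<otimes>\<^bsub>H\<^esub> S m1) \<boxtimes>\<^bsub>?Z\<^esub> (n0 \<triangleleft>\<^bsub>N\<^esub> b)))) =
        rsum ?Z N n (\<lambda>n0 n1. (n1 \<otimes>\<^bsub>H\<^esub> S m1) \<boxtimes>\<^bsub>?Z\<^esub> (n0 \<triangleleft>\<^bsub>N\<^esub> a))" if [simp]: "n \<in> carrier N" "m1 \<in> carrier H" for n m1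
    proof -
      have "csum ?Z a (\<lambda>a1 a2. rsum ?Z N n (\<lambda>n0 n1. csum ?Z a1 (\<lambda>b c. (n1 \<otimes>\<^bsub>H\<^esub> (c \<otimes>\<^bsub>H\<^esub> S a2) \<otimes>\<^bsub>H\<^esub> S m1) \<boxtimes>\<^bsub>?Z\<^esub> (n0 \<triangleleft>\<^bsub>N\<^esub> b)))) =
        rsum ?Z N n (\<lambda>n0 n1. csum ?Z a (\<lambda>a1 a2. csum ?Z a1 (\<lambda>b c. (n1 \<otimes>\<^bsub>H\<^esub> (c \<otimes>\<^bsub>H\<^esub> S a2) \<otimes>\<^bsub>H\<^esub> S m1) \<boxtimes>\<^bsub>?Z\<^esub> (n0 \<triangleleft>\<^bsub>N\<^esub> b))))"
        by (rule sw_swap) simp_all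
      also have "\<dots> = rsum ?Z N n (\<lambda>n0 n1. csum ?Z a (\<lambda>b a'. csum ?Z a' (\<lambda>c a2. (n1 \<otimes>\<^bsub>H\<^esub> (c \<otimes>\<^bsub>H\<^esub> S a2) \<otimes>\<^bsub>H\<^esub> S m1) \<boxtimes>\<^bsub>?Z\<^esub> (n0 \<triangleleft>\<^bsub>N\<^esub> b))))"
        by (simp add: c_coassoc tri_def bil_def)
      also have "\<dots> = rsum ?Z N n (\<lambda>n0 n1. (n1 \<otimes>\<^bsub>H\<^esub> S m1) \<boxtimes>\<^bsub>?Z\<^esub> (n0 \<triangleleft>\<^bsub>N\<^esub> a))"
        by (simp add: c_cancel(4)[where f = "\<lambda>b z. (n1 \<otimes>\<^bsub>H\<^esub> z \<otimes>\<^bsub>H\<^esub> S m1) \<boxtimes>\<^bsub>?Z\<^esub> (n0 \<triangleleft>\<^bsub>N\<^esub> b)" for n1 n0] bil_def)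
      finally show ?thesis .
    qed
    have "?L (m \<triangleleft>\<^bsub>M\<^esub> a) = rsum ?Z M m (\<lambda>m0 m1. csum ?Z a (\<lambda>a1 a2. rsum ?Z N (\<phi> m0) (\<lambda>n0 n1. csum ?Z a1 (\<lambda>b c.
        (n1 \<otimes>\<^bsub>H\<^esub> (c \<otimes>\<^bsub>H\<^esub> S a2) \<otimes>\<^bsub>H\<^esub> S m1) \<boxtimes>\<^bsub>?Z\<^esub> (n0 \<triangleleft>\<^bsub>N\<^esub> b)))))"
      by (simp add: L_eq r_ract[OF bicov_rcov[OF M]] r_ract[OF Nr] bil_def \<phi>_ract S_mult m_assoc)
    also have "\<dots> = ract_right N a (?L m)"
      by (simp add: L_eq inner sw_push[OF _ _ ract_right_linear] ract_right_pure)
    finally show ?thesis .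
  qed
  then obtain qs where qs: "hom_pairs M N qs" "\<And>m. m \<in> carrier M \<Longrightarrow> heval M N (hom_pairs_sum M N qs) m = ?L m"
    using fin_gen_hom_tensor[OF _ _ fg L] by (metis M bicov_hbimod \<open>hbimod N\<close>)
  let ?E = "homK K M N" and ?t = "hom_pairs_sum M N qs"
  have t: "?t \<in> carrier (tensK K H ?E)" using qs by (simp add: hom_pairs_sum_closed)
  have "sw ?E H (tensK K N H) (flip H ?E ?t) (\<lambda>f a. f m \<boxtimes>\<^bsub>tensK K N H\<^esub> a) = Rad M N \<phi> m" if m: "m \<in> carrier M" for m
  proof -
    have "sw ?E H (tensK K N H) (flip H ?E ?t) (\<lambda>f a. f m \<boxtimes>\<^bsub>tensK K N H\<^esub> a) =
        sw H ?E (tensK K N H) ?t (\<lambda>a f. f m \<boxtimes>\<^bsub>tensK K N H\<^esub> a)"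
      by (rule sw_flip) (use m t in \<open>simp_all add: bil_def\<close>)
    also have "\<dots> = flip H N (heval M N ?t m)"
      unfolding heval_def using m t by (simp add: sw_push[OF _ _ flip_linear])
    also have "\<dots> = Rad M N \<phi> m"
      using m klinear_closed[OF Rad_linear[OF homK_klinear[OF \<phi>]] m] by (simp add: qs)
    finally show ?thesis .
  qed
  hence 2: "radj_elem K H M N \<phi> (flip H ?E ?t)"
    using t by (simp add: radj_elem_iff)
  show "\<phi> \<in> HOM K H M N" using 1 2 \<phi> unfolding HOM_def by blast
  show "\<exists>ps. hom_pairs M N ps \<and> lAd K H M N \<phi> = hom_pairs_sum M N ps"
    using ps(1) lAd_eq[OF \<phi> 1] by blast
qed

end

end

context hopf_algebra
begin

text \<open>In \<open>x u \<otimes> n\<close> the element \<open>u\<close> is absorbed into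
  \<open>n\<close> by balancedness, so first factors may be taken coinvariant without any factor
  from \<open>H\<close>.\<close>

lemma coinv_tensH_eqI:
  assumes M: "bicov M" and N: "hbimod N" and Z: "kmod Z" and t: "t \<in> carrier (tensH K H M N)"
    and f: "klinear K (tensH K H M N) Z f" and g: "klinear K (tensH K H M N) Z g"
    and eq: "\<And>x n. \<lbrakk>coinv M x; n \<in> carrier N\<rbrakk> \<Longrightarrow>
      f (x \<boxtimes>\<^bsub>tensH K H M N\<^esub> n) = g (x \<boxtimes>\<^bsub>tensH K H M N\<^esub> n)"
  shows "f t = g t"
proof (rule klinear_tensH_eqI[OF _ N f g t])
  fix m n assume m: "m \<in> carrier M" and n: "n \<in> carrier N"
  show "f (m \<boxtimes>\<^bsub>tensH K H M N\<^esub> n) = g (m \<boxtimes>\<^bsub>tensH K H M N\<^esub> n)"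
  proof (rule coinv_eqI[OF M m Z, where f = "\<lambda>m. f (m \<boxtimes>\<^bsub>tensH K H M N\<^esub> n)" and g = "\<lambda>m. g (m \<boxtimes>\<^bsub>tensH K H M N\<^esub> n)"])
    fix x u assume "coinv M x" "u \<in> carrier H"
    thus "f ((x \<triangleleft>\<^bsub>M\<^esub> u) \<boxtimes>\<^bsub>tensH K H M N\<^esub> n) = g ((x \<triangleleft>\<^bsub>M\<^esub> u) \<boxtimes>\<^bsub>tensH K H M N\<^esub> n)"
      using M N n by (simp add: tensH_balanced eq)
  qed (use M N n in \<open>simp_all add: lin_comp[OF f] lin_comp[OF g]\<close>)
qed (use M in simp)

end

context hopf_algebra_bij
begin

section \<open>The tensor product of rational morphisms\<close>

text \<open>The value of the hat tensor product on a pair, with \<open>lAd\<close> of the second map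
  replaced by a free tensor \<open>t\<close>. Additivity in the second map then follows from
  linearity in \<open>t\<close>.\<close>

definition hatsum where
  "hatsum M M' N N' \<phi> t m n = (let R = tensH K H M' N' in
    sw H (homK K N N') R t (\<lambda>p \<psi>. csum R p (\<lambda>p2 p1. rsum R M m (\<lambda>m' m2. rsum R M m' (\<lambda>m0 m1.
      \<phi> (p2 \<triangleright>\<^bsub>M\<^esub> m0 \<triangleleft>\<^bsub>M\<^esub> S (p1 \<otimes>\<^bsub>H\<^esub> m1)) \<boxtimes>\<^bsub>R\<^esub> \<psi> (m2 \<triangleright>\<^bsub>N\<^esub> n))))))"

lemma lAd_closed:
  assumes "bicov N" "rcov N'" "lcov N'" "\<psi> \<in> HOM K H N N'"
  shows "lAd K H N N' \<psi> \<in> carrier (tensK K H (homK K N N'))"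
proof -
  obtain t where "ladj_elem K H N N' \<psi> t" and \<psi>: "\<psi> \<in> carrier (homK K N N')"
    using assms(4) unfolding HOM_def by auto
  thus ?thesis using lAd_eq[OF assms(1-3) \<psi>] ladj_elem_iff[OF assms(1-3) \<psi>] by metis
qed

context
  fixes M :: "('k, 'h, 'm, 'y) bimod_scheme" and M' :: "('k, 'h, 'm1, 'y1) bimod_scheme"
    and N :: "('k, 'h, 'n, 'z) bimod_scheme" and N' :: "('k, 'h, 'n1, 'z1) bimod_scheme"
    and \<phi> :: "'m \<Rightarrow> 'm1"
  assumes M: "bicov M" and M': "hbimod M'" and N: "bicov N" and N': "hbimod N'"
    and \<phi>: "klinear K M M' \<phi>"
begin

private abbreviation "RR \<equiv> tensH K H M' N'"
private abbreviation "EE \<equiv> homK K N N'"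

lemma hat_bil:
  assumes "m \<in> carrier M" "n \<in> carrier N"
  shows "bil H EE RR (\<lambda>p \<psi>. csum RR p (\<lambda>p2 p1. rsum RR M m (\<lambda>m' m2. rsum RR M m' (\<lambda>m0 m1.
      \<phi> (p2 \<triangleright>\<^bsub>M\<^esub> m0 \<triangleleft>\<^bsub>M\<^esub> S (p1 \<otimes>\<^bsub>H\<^esub> m1)) \<boxtimes>\<^bsub>RR\<^esub> \<psi> (m2 \<triangleright>\<^bsub>N\<^esub> n)))))"
  using assms M M' N N'
  by (intro bilI)
    (simp_all add: bil_def lin_comp[OF \<phi>] klinear_closed[OF \<phi>] homK_closed[where V = N and W = N'])

lemma hatsum_bil:
  assumes "t \<in> carrier (tensK K H EE)"
  shows "bil M N RR (hatsum M M' N N' \<phi> t)"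
proof (rule bilI)
  note [simp] = M M' N N' assms lin_comp[OF \<phi>] klinear_closed[OF \<phi>] homK_closed[where V = N and W = N']
  let ?F = "\<lambda>p \<psi> m n. csum RR p (\<lambda>p2 p1. rsum RR M m (\<lambda>m' m2. rsum RR M m' (\<lambda>m0 m1.
      \<phi> (p2 \<triangleright>\<^bsub>M\<^esub> m0 \<triangleleft>\<^bsub>M\<^esub> S (p1 \<otimes>\<^bsub>H\<^esub> m1)) \<boxtimes>\<^bsub>RR\<^esub> \<psi> (m2 \<triangleright>\<^bsub>N\<^esub> n))))"
  have F: "bil M N RR (?F p \<psi>)" if [simp]: "p \<in> carrier H" and \<psi>: "\<psi> \<in> carrier EE" for p \<psi>
  proof -
    note [simp] = lin_comp[OF homK_klinear[OF \<psi>]] \<psi>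
    show ?thesis by (simp add: bil_def)
  qed
  show "klinear K M RR (\<lambda>m. hatsum M M' N N' \<phi> t m n)" if "n \<in> carrier N" for n
    unfolding hatsum_def Let_def by (rule sw_klinear_param) (simp_all add: bil2[OF F that])
  show "klinear K N RR (hatsum M M' N N' \<phi> t m)" if "m \<in> carrier M" for m
    unfolding hatsum_def Let_def by (rule sw_klinear_param) (simp_all add: bil1[OF F that])
qed

lemma hatsum_tensor_linear:
  assumes "m \<in> carrier M" "n \<in> carrier N"
  shows "klinear K (tensK K H EE) RR (\<lambda>t. hatsum M M' N N' \<phi> t m n)"
  unfolding hatsum_def Let_def using assms M M' N N' by (intro sw_klinear_tens hat_bil) simp_all

text \<open>Because \<open>S (p1 \<otimes> s) = S s \<otimes> S p1\<close>, the first two legs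
  \<open>r\<close> and \<open>s\<close> of \<open>u\<close> meet as \<open>r S(s)\<close> next to
  \<open>x\<close> and collapse; all of \<open>u\<close> then acts on \<open>n\<close>.\<close>

lemma hatsum_coinv_ract:
  assumes [simp]: "t \<in> carrier (tensK K H EE)" "coinv M x" "u \<in> carrier H" "n \<in> carrier N"
  shows "hatsum M M' N N' \<phi> t (x \<triangleleft>\<^bsub>M\<^esub> u) n =
    sw H EE RR t (\<lambda>p \<psi>. csum RR p (\<lambda>p2 p1. \<phi> (p2 \<triangleright>\<^bsub>M\<^esub> x \<triangleleft>\<^bsub>M\<^esub> S p1) \<boxtimes>\<^bsub>RR\<^esub> \<psi> (u \<triangleright>\<^bsub>N\<^esub> n)))"
proof -
  note [simp] = M M' N N' \<phi> lin_comp[OF \<phi>] klinear_closed[OF \<phi>]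
  have "rsum RR M (x \<triangleleft>\<^bsub>M\<^esub> u) (\<lambda>m' m2. rsum RR M m' (\<lambda>m0 m1.
      \<phi> (p2 \<triangleright>\<^bsub>M\<^esub> m0 \<triangleleft>\<^bsub>M\<^esub> S (p1 \<otimes>\<^bsub>H\<^esub> m1)) \<boxtimes>\<^bsub>RR\<^esub> \<psi> (m2 \<triangleright>\<^bsub>N\<^esub> n))) =
    \<phi> (p2 \<triangleright>\<^bsub>M\<^esub> x \<triangleleft>\<^bsub>M\<^esub> S p1) \<boxtimes>\<^bsub>RR\<^esub> \<psi> (u \<triangleright>\<^bsub>N\<^esub> n)"
    if [simp]: "p1 \<in> carrier H" "p2 \<in> carrier H" "\<psi> \<in> carrier EE" for p1 p2 \<psi>
  proof -
    note [simp] = lin_comp[OF homK_klinear[OF that(3)]] homK_closed[OF that(3)]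
    have "rsum RR M (x \<triangleleft>\<^bsub>M\<^esub> u) (\<lambda>m' m2. rsum RR M m' (\<lambda>m0 m1.
        \<phi> (p2 \<triangleright>\<^bsub>M\<^esub> m0 \<triangleleft>\<^bsub>M\<^esub> S (p1 \<otimes>\<^bsub>H\<^esub> m1)) \<boxtimes>\<^bsub>RR\<^esub> \<psi> (m2 \<triangleright>\<^bsub>N\<^esub> n))) =
      csum RR u (\<lambda>u1 u2. csum RR u1 (\<lambda>r s.
        \<phi> (p2 \<triangleright>\<^bsub>M\<^esub> (x \<triangleleft>\<^bsub>M\<^esub> (r \<otimes>\<^bsub>H\<^esub> S s)) \<triangleleft>\<^bsub>M\<^esub> S p1) \<boxtimes>\<^bsub>RR\<^esub> \<psi> (u2 \<triangleright>\<^bsub>N\<^esub> n)))"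
      by (simp add: coinv_ract bil_def S_mult act_mult)
    also have "\<dots> = \<phi> (p2 \<triangleright>\<^bsub>M\<^esub> x \<triangleleft>\<^bsub>M\<^esub> S p1) \<boxtimes>\<^bsub>RR\<^esub> \<psi> (u \<triangleright>\<^bsub>N\<^esub> n)"
      by (simp add: c_antipode2[where f = "\<lambda>z. \<phi> (p2 \<triangleright>\<^bsub>M\<^esub> (x \<triangleleft>\<^bsub>M\<^esub> z) \<triangleleft>\<^bsub>M\<^esub> S p1) \<boxtimes>\<^bsub>RR\<^esub> y" for y] c_counit1)
    finally show ?thesis .
  qed
  thus ?thesis unfolding hatsum_def Let_def by (simp add: homK_closed[where V = N and W = N'])
qed

lemma hatsum_coinv:
  assumes "t \<in> carrier (tensK K H EE)" "coinv M x" "n \<in> carrier N"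
  shows "hatsum M M' N N' \<phi> t x n =
    sw H EE RR t (\<lambda>p \<psi>. csum RR p (\<lambda>p2 p1. \<phi> (p2 \<triangleright>\<^bsub>M\<^esub> x \<triangleleft>\<^bsub>M\<^esub> S p1) \<boxtimes>\<^bsub>RR\<^esub> \<psi> n))"
  using hatsum_coinv_ract[OF assms(1,2) _ assms(3), of "\<one>\<^bsub>H\<^esub>"] M N assms by simp

text \<open>By the preceding formula the value at \<open>x u\<close> and \<open>n\<close> depends on
  \<open>u\<close> and \<open>n\<close> only through \<open>u n\<close>. This is the
  well-definedness of the hat tensor product over \<open>H\<close>.\<close>

lemma hatsum_hbal:
  assumes t: "t \<in> carrier (tensK K H EE)"
  shows "hbal M N RR (hatsum M M' N N' \<phi> t)"
proof -
  note [simp] = M M' N N'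
  have "hatsum M M' N N' \<phi> t (m \<triangleleft>\<^bsub>M\<^esub> a) n = hatsum M M' N N' \<phi> t m (a \<triangleright>\<^bsub>N\<^esub> n)"
    if m: "m \<in> carrier M" and [simp]: "a \<in> carrier H" "n \<in> carrier N" for m a n
  proof (rule coinv_eqI[OF M m, where Z = RR])
    fix x u assume [simp]: "coinv M x" "u \<in> carrier H"
    have "hatsum M M' N N' \<phi> t (x \<triangleleft>\<^bsub>M\<^esub> u \<triangleleft>\<^bsub>M\<^esub> a) n = hatsum M M' N N' \<phi> t (x \<triangleleft>\<^bsub>M\<^esub> (u \<otimes>\<^bsub>H\<^esub> a)) n"
      by (simp add: act_mult)
    also have "\<dots> = hatsum M M' N N' \<phi> t (x \<triangleleft>\<^bsub>M\<^esub> u) (a \<triangleright>\<^bsub>N\<^esub> n)"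
      by (simp add: hatsum_coinv_ract t act_mult(1))
    finally show "hatsum M M' N N' \<phi> t (x \<triangleleft>\<^bsub>M\<^esub> u \<triangleleft>\<^bsub>M\<^esub> a) n = hatsum M M' N N' \<phi> t (x \<triangleleft>\<^bsub>M\<^esub> u) (a \<triangleright>\<^bsub>N\<^esub> n)" .
  qed (simp_all add: bil_comp1[OF hatsum_bil[OF t]])
  thus ?thesis using hatsum_bil[OF t] by (simp add: hbal_def)
qed

lemma hatsum_one:
  assumes [simp]: "\<psi> \<in> carrier EE" "coinv M x" "n \<in> carrier N"
  shows "hatsum M M' N N' \<phi> (\<one>\<^bsub>H\<^esub> \<boxtimes>\<^bsub>tensK K H EE\<^esub> \<psi>) x n = \<phi> x \<boxtimes>\<^bsub>RR\<^esub> \<psi> n"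
  using M M' N N'
  by (simp add: hatsum_coinv bil_def lin_comp[OF \<phi>] klinear_closed[OF \<phi>] homK_closed[OF assms(1)] c_one)

text \<open>Here the list presentation is essential: the right action passes through each second leg
  separately, and each of these is right linear.\<close>

lemma hatsum_ract:
  assumes ps: "hom_pairs N N' ps" and [simp]: "m \<in> carrier M" "n \<in> carrier N" "a \<in> carrier H"
  shows "hatsum M M' N N' \<phi> (hom_pairs_sum N N' ps) m (n \<triangleleft>\<^bsub>N\<^esub> a) =
    hatsum M M' N N' \<phi> (hom_pairs_sum N N' ps) m n \<triangleleft>\<^bsub>RR\<^esub> a"
proof -
  note [simp] = M M' N N' klinear_closed[OF \<phi>] homK_closed[where V = N and W = N']
  let ?G = "\<lambda>n p \<psi>. csum RR p (\<lambda>p2 p1. rsum RR M m (\<lambda>m' m2. rsum RR M m' (\<lambda>m0 m1.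
      \<phi> (p2 \<triangleright>\<^bsub>M\<^esub> m0 \<triangleleft>\<^bsub>M\<^esub> S (p1 \<otimes>\<^bsub>H\<^esub> m1)) \<boxtimes>\<^bsub>RR\<^esub> \<psi> (m2 \<triangleright>\<^bsub>N\<^esub> n))))"
  have eq: "hatsum M M' N N' \<phi> (hom_pairs_sum N N' ps) m n = tsum RR (map (\<lambda>(v, \<psi>). ?G n v \<psi>) ps)"
    if "n \<in> carrier N" for n
    unfolding hatsum_def Let_def by (rule hom_pairs_sum_sw) (use that ps in \<open>simp_all add: hat_bil\<close>)
  have G: "?G (n \<triangleleft>\<^bsub>N\<^esub> a) v \<psi> = ?G n v \<psi> \<triangleleft>\<^bsub>RR\<^esub> a" "?G n v \<psi> \<in> carrier RR"
    if "(v, \<psi>) \<in> set ps" for v \<psi>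
  proof -
    have [simp]: "v \<in> carrier H" "\<psi> \<in> carrier EE" and rl: "right_linear H N N' \<psi>"
      using that ps by (auto simp: hom_pairs_def)
    have "\<psi> (c \<triangleright>\<^bsub>N\<^esub> (n \<triangleleft>\<^bsub>N\<^esub> a)) = \<psi> (c \<triangleright>\<^bsub>N\<^esub> n) \<triangleleft>\<^bsub>N'\<^esub> a" if "c \<in> carrier H" for c
      using rl that by (simp add: right_linear_def act_mult(3)[symmetric])
    thus "?G (n \<triangleleft>\<^bsub>N\<^esub> a) v \<psi> = ?G n v \<psi> \<triangleleft>\<^bsub>RR\<^esub> a"
      by (simp add: sw_push[where W = RR and g = "\<lambda>z. z \<triangleleft>\<^bsub>RR\<^esub> a"])
    show "?G n v \<psi> \<in> carrier RR" by simp
  qed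
  have "tsum RR (map (\<lambda>(v, \<psi>). ?G n v \<psi>) ps) \<triangleleft>\<^bsub>RR\<^esub> a =
      tsum RR (map (\<lambda>z. z \<triangleleft>\<^bsub>RR\<^esub> a) (map (\<lambda>(v, \<psi>). ?G n v \<psi>) ps))"
    by (rule tsum_linear[where f = "\<lambda>z. z \<triangleleft>\<^bsub>RR\<^esub> a"]) (use G(2) in auto)
  also have "\<dots> = tsum RR (map (\<lambda>(v, \<psi>). ?G (n \<triangleleft>\<^bsub>N\<^esub> a) v \<psi>) ps)"
    unfolding map_map by (intro arg_cong[where f = "tsum RR"] map_cong refl) (use G(1) in auto)
  finally show ?thesis by (simp add: eq)
qed

end

context
  fixes M :: "('k, 'h, 'm, 'y) bimod_scheme" and M' :: "('k, 'h, 'm1, 'y1) bimod_scheme"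
    and N :: "('k, 'h, 'n, 'z) bimod_scheme" and N' :: "('k, 'h, 'n1, 'z1) bimod_scheme"
    and \<phi> :: "'m \<Rightarrow> 'm1" and \<psi> :: "'n \<Rightarrow> 'n1"
  assumes M: "bicov M" and M': "hbimod M'" and N: "bicov N" and N'r: "rcov N'" and N'l: "lcov N'"
    and \<phi>: "\<phi> \<in> HOM K H M M'" and \<psi>: "\<psi> \<in> HOM K H N N'"
begin

private lemma N': "hbimod N'"
  using N'r by simp

private lemma \<phi>_lin: "klinear K M M' \<phi>"
  using \<phi> by (simp add: HOM_def homK_carrier)

private lemma lAd_mem: "lAd K H N N' \<psi> \<in> carrier (tensK K H (homK K N N'))"
  by (rule lAd_closed[OF N N'r N'l \<psi>])

lemma hat_tensor_eq:
  assumes t: "t \<in> carrier (tensH K H M N)"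
  shows "hat_tensor K H M M' N N' \<phi> \<psi> t = sw M N (tensH K H M' N') t (hatsum M M' N N' \<phi> (lAd K H N N' \<psi>))"
  unfolding hat_tensor_def hatsum_def Let_def
  using t M N N' \<phi> \<psi> lAd_mem
  by (simp add: sweedler_sw_tensH[where M = M and N = N] sweedler_comult sweedler_rcoact
      sweedler_sw[of H "homK K N N'"])

lemma hat_tensor_linear: "klinear K (tensH K H M N) (tensH K H M' N') (hat_tensor K H M M' N N' \<phi> \<psi>)"
  by (rule iffD2[OF klinear_cong[OF hat_tensor_eq]])
    (use M N M' N' in \<open>simp_all add: sw_klinear_tensH hatsum_hbal[OF M M' N N' \<phi>_lin lAd_mem]\<close>)

lemma hat_tensor_pure:
  "\<lbrakk>m \<in> carrier M; n \<in> carrier N\<rbrakk> \<Longrightarrow> hat_tensor K H M M' N N' \<phi> \<psi> (m \<boxtimes>\<^bsub>tensH K H M N\<^esub> n) =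
    hatsum M M' N N' \<phi> (lAd K H N N' \<psi>) m n"
  using M N M' N' by (simp add: hat_tensor_eq hatsum_hbal[OF M M' N N' \<phi>_lin lAd_mem])

lemma hat_tensor_ract:
  assumes fg: "right_fin_gen H N" and rl: "right_linear H N N' \<psi>"
    and t: "t \<in> carrier (tensH K H M N)" and a: "a \<in> carrier H"
  shows "hat_tensor K H M M' N N' \<phi> \<psi> (t \<triangleleft>\<^bsub>tensH K H M N\<^esub> a) =
    hat_tensor K H M M' N N' \<phi> \<psi> t \<triangleleft>\<^bsub>tensH K H M' N'\<^esub> a"
proof -
  have "\<psi> \<in> carrier (homK K N N')" using \<psi> by (simp add: HOM_def)
  then obtain ps where ps: "hom_pairs N N' ps" "lAd K H N N' \<psi> = hom_pairs_sum N N' ps"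
    using right_linear_rational(2)[OF N N'r N'l fg _ rl] by blast
  show ?thesis
    by (rule klinear_tensH_eqI[OF _ _ _ _ t, where Z = "tensH K H M' N'"])
      (use M N M' N' a ps in \<open>simp_all add: lin_comp[OF hat_tensor_linear] hat_tensor_pure hatsum_ract[OF M M' N N' \<phi>_lin]\<close>)
qed

end

end

section \<open>Rationality of identities and connections\<close>

context hopf_algebra
begin

lemma klinear_sum:
  assumes W: "kmod W" and f: "klinear K V W f" and g: "klinear K V W g"
  shows "klinear K V W (\<lambda>x. f x \<oplus>\<^bsub>W\<^esub> g x)"
proof -
  interpret W: Module.module K W by fact
  show ?thesis
    by (rule klinearI)
      (simp_all add: klinear_closed[OF f] klinear_closed[OF g] klinear_add[OF f] klinear_add[OF g]
        klinear_smult[OF f] klinear_smult[OF g] W.smult_r_distr W.a_ac)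
qed

lemma sw_tensK_id:
  assumes "kmod A" "kmod B" "t \<in> carrier (tensK K A B)"
  shows "sw A B (tensK K A B) t (\<lambda>x y. x \<boxtimes>\<^bsub>tensK K A B\<^esub> y) = t"
  by (rule klinear_tensK_eqI[OF assms(1,2) _ _ assms(3), where Z = "tensK K A B"])
    (use assms in \<open>simp_all add: bil_def\<close>)

lemma homK_add_sub:
  assumes V: "kmod V" and W: "kmod W" and f: "f \<in> carrier (homK K V W)" and g: "g \<in> carrier (homK K V W)"
  shows "f \<ominus>\<^bsub>homK K V W\<^esub> g \<in> carrier (homK K V W)" and "g \<oplus>\<^bsub>homK K V W\<^esub> (f \<ominus>\<^bsub>homK K V W\<^esub> g) = f"
proof -
  have "kmod (homK K V W)" using V W by simp
  then interpret E: Module.module K "homK K V W" .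
  show "f \<ominus>\<^bsub>homK K V W\<^esub> g \<in> carrier (homK K V W)" using f g by simp
  have "g \<oplus>\<^bsub>homK K V W\<^esub> (f \<ominus>\<^bsub>homK K V W\<^esub> g) = f \<oplus>\<^bsub>homK K V W\<^esub> (g \<oplus>\<^bsub>homK K V W\<^esub> \<ominus>\<^bsub>homK K V W\<^esub> g)"
    using f g unfolding E.minus_eq by (intro E.a_lcomm) simp_all
  thus "g \<oplus>\<^bsub>homK K V W\<^esub> (f \<ominus>\<^bsub>homK K V W\<^esub> g) = f"
    using f g by (simp add: E.r_neg)
qed

lemma compose_homK:
  assumes V: "kmod V" and f: "klinear K V U f" and g: "klinear K U W g"
  shows "compose (carrier V) g f \<in> carrier (homK K V W)"
  unfolding compose_def by (rule homK_restrict[OF V lin_comp[OF g f]])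

end

context hopf_algebra_bij
begin

lemma id_rational:
  assumes N [simp]: "bicov N"
  shows "(\<lambda>n\<in>carrier N. n) \<in> HOM K H N N"
    and "lAd K H N N (\<lambda>n\<in>carrier N. n) = \<one>\<^bsub>H\<^esub> \<boxtimes>\<^bsub>tensK K H (homK K N N)\<^esub> (\<lambda>n\<in>carrier N. n)"
proof -
  have 1: "(\<lambda>n\<in>carrier N. n) \<in> carrier (homK K N N)"
    by (rule homK_restrict) simp_all
  show "(\<lambda>n\<in>carrier N. n) \<in> HOM K H N N"
    "lAd K H N N (\<lambda>n\<in>carrier N. n) = \<one>\<^bsub>H\<^esub> \<boxtimes>\<^bsub>tensK K H (homK K N N)\<^esub> (\<lambda>n\<in>carrier N. n)"
    by (rule bicolinear_rational[OF N _ _ 1]; simp add: sw_tensK_id)+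
qed

lemma dconn_rational:
  assumes d: "fodc W d" and M [simp]: "bicov M"
  defines "P \<equiv> tensH K H M W"
  shows "(\<lambda>m\<in>carrier M. dconn M W d m) \<in> HOM K H M P"
    and "lAd K H M P (\<lambda>m\<in>carrier M. dconn M W d m) = \<one>\<^bsub>H\<^esub> \<boxtimes>\<^bsub>tensK K H (homK K M P)\<^esub> (\<lambda>m\<in>carrier M. dconn M W d m)"
proof -
  note [simp] = fodc_bicov[OF d] dconn_closed[OF d]
  have 1: "(\<lambda>m\<in>carrier M. dconn M W d m) \<in> carrier (homK K M P)"
    unfolding P_def by (rule homK_restrict) (simp_all add: dconn_linear[OF d])
  have r: "rcov P" and l: "lcov P" unfolding P_def by simp_all
  show "(\<lambda>m\<in>carrier M. dconn M W d m) \<in> HOM K H M P"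
    "lAd K H M P (\<lambda>m\<in>carrier M. dconn M W d m) = \<one>\<^bsub>H\<^esub> \<boxtimes>\<^bsub>tensK K H (homK K M P)\<^esub> (\<lambda>m\<in>carrier M. dconn M W d m)"
    unfolding P_def
    by (rule bicolinear_rational[OF M r l 1, unfolded P_def]; simp add: rcoact_dconn[OF d] lcoact_dconn[OF d])+
qed

text \<open>The inhomogeneous Leibniz terms of two connections cancel, so \<open>D\<close> is the
  bicolinear canonical connection plus a right linear map. Both are rational, the second because
  \<open>M\<close> is finitely generated.\<close>

lemma connection_rational:
  assumes d: "fodc W d" and M [simp]: "bicov M" and fg: "right_fin_gen H M"
  defines "P \<equiv> tensH K H M W"
  defines "dM \<equiv> \<lambda>m\<in>carrier M. dconn M W d m"
  assumes D: "D \<in> carrier (homK K M P)" and conn: "right_conn M W d D"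
  shows "right_linear H M P (D \<ominus>\<^bsub>homK K M P\<^esub> dM)" and "D \<ominus>\<^bsub>homK K M P\<^esub> dM \<in> HOM K H M P"
    and "D \<in> HOM K H M P" and "dM \<oplus>\<^bsub>homK K M P\<^esub> (D \<ominus>\<^bsub>homK K M P\<^esub> dM) = D"
proof -
  note [simp] = fodc_bicov[OF d] dconn_closed[OF d] fodc_closed[OF d]
  have "kmod P" unfolding P_def by simp
  then interpret P: Module.module K P .
  have hbP: "hbimod P" "rcov P" "lcov P" unfolding P_def by simp_all
  have dM: "dM \<in> HOM K H M P" unfolding dM_def P_def by (rule dconn_rational[OF d M])
  hence dM': "dM \<in> carrier (homK K M P)" by (simp add: HOM_def)
  let ?E = "D \<ominus>\<^bsub>homK K M P\<^esub> dM"
  have E: "?E \<in> carrier (homK K M P)" and sum: "dM \<oplus>\<^bsub>homK K M P\<^esub> ?E = D"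
    by (rule homK_add_sub[OF _ _ D dM']; simp add: P.module_axioms)+
  note cl = homK_closed[OF D] homK_closed[OF dM'] homK_closed[OF E]
  have D_eq: "D m = dM m \<oplus>\<^bsub>P\<^esub> ?E m" if "m \<in> carrier M" for m
    using arg_cong[OF sum, of "\<lambda>f. f m"] that by simp
  show rl: "right_linear H M P ?E"
    unfolding right_linear_def
  proof (intro ballI)
    fix m a assume [simp]: "m \<in> carrier M" "a \<in> carrier H"
    have pure: "m \<boxtimes>\<^bsub>P\<^esub> d a \<in> carrier P" unfolding P_def by simp
    have act: "x \<triangleleft>\<^bsub>P\<^esub> a \<in> carrier P" if "x \<in> carrier P" for x using hbP that by simp
    have dM_ract: "dM (m \<triangleleft>\<^bsub>M\<^esub> a) = (dM m \<triangleleft>\<^bsub>P\<^esub> a) \<oplus>\<^bsub>P\<^esub> (m \<boxtimes>\<^bsub>P\<^esub> d a)"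
      by (simp add: dM_def P_def dconn_leibniz[OF d])
    \<comment> \<open>The Leibniz rules of \<open>D\<close> and \<open>dM\<close> are expanded until
      \<open>dM (m a)\<close> can be cancelled from both sides.\<close>
    have "dM (m \<triangleleft>\<^bsub>M\<^esub> a) \<oplus>\<^bsub>P\<^esub> ?E (m \<triangleleft>\<^bsub>M\<^esub> a) = (D m \<triangleleft>\<^bsub>P\<^esub> a) \<oplus>\<^bsub>P\<^esub> (m \<boxtimes>\<^bsub>P\<^esub> d a)"
      using conn unfolding right_conn_def P_def[symmetric] by (simp add: D_eq[symmetric])
    also have "\<dots> = ((dM m \<triangleleft>\<^bsub>P\<^esub> a) \<oplus>\<^bsub>P\<^esub> (?E m \<triangleleft>\<^bsub>P\<^esub> a)) \<oplus>\<^bsub>P\<^esub> (m \<boxtimes>\<^bsub>P\<^esub> d a)"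
      using hbP(1) cl by (simp add: D_eq klinear_add[OF bil2[OF ract_bil]])
    also have "\<dots> = dM (m \<triangleleft>\<^bsub>M\<^esub> a) \<oplus>\<^bsub>P\<^esub> (?E m \<triangleleft>\<^bsub>P\<^esub> a)"
      unfolding dM_ract using pure act cl by (simp add: P.a_ac)
    finally show "?E (m \<triangleleft>\<^bsub>M\<^esub> a) = ?E m \<triangleleft>\<^bsub>P\<^esub> a"
      using cl act by (simp add: P.add.l_cancel)
  qed
  show E_hom: "?E \<in> HOM K H M P"
    by (rule right_linear_rational(1)[OF M hbP(2,3) fg E rl])
  show "D \<in> HOM K H M P"
    using HOM_add(1)[OF M hbP(2,3) dM E_hom] sum by simp
  show "dM \<oplus>\<^bsub>homK K M P\<^esub> ?E = D" by (rule sum)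
qed

section \<open>Sums of connections\<close>

definition sum_left where
  "sum_left M N W f = compose (carrier (tensH K H M N)) (woronowicz23 K H M W N)
    (hat_tensor K H M (tensH K H M W) N N f (\<lambda>n\<in>carrier N. n))"

definition sum_right where
  "sum_right M N W g = compose (carrier (tensH K H M N)) (assoc_left K H M N W)
    (hat_tensor K H M M N (tensH K H N W) (\<lambda>m\<in>carrier M. m) g)"

context
  fixes M :: "('k, 'h, 'm, 'y) bimod_scheme" and N :: "('k, 'h, 'n, 'z) bimod_scheme"
    and W :: "('k, 'h, 'w, 'v) bimod_scheme" and d
  assumes M: "bicov M" and N: "bicov N" and d: "fodc W d"
begin

private abbreviation "MN \<equiv> tensH K H M N"
private abbreviation "MW \<equiv> tensH K H M W"
private abbreviation "NW \<equiv> tensH K H N W"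
private abbreviation "MNW \<equiv> tensH K H (tensH K H M N) W"
private abbreviation "idM \<equiv> \<lambda>m\<in>carrier M. m"
private abbreviation "idN \<equiv> \<lambda>n\<in>carrier N. n"
private abbreviation "dMN \<equiv> \<lambda>t\<in>carrier (tensH K H M N). dconn (tensH K H M N) W d t"

private lemmas facts = M N bicov_hbimod[OF M] bicov_hbimod[OF N] bicov_rcov[OF M] bicov_rcov[OF N]
  bicov_lcov[OF N] fodc_bicov[OF d] fodc_linear[OF d] fodc_closed[OF d] bicov_hbimod[OF fodc_bicov[OF d]]

lemma sum_left_homK:
  assumes f: "f \<in> HOM K H M MW"
  shows "sum_left M N W f \<in> carrier (homK K MN MNW)"
  unfolding sum_left_def
  by (rule compose_homK[OF _ hat_tensor_linear[OF M _ N _ _ f id_rational(1)[OF N]] woronowicz23_linear])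
    (simp_all add: facts)

lemma sum_right_homK:
  assumes g: "g \<in> HOM K H N NW"
  shows "sum_right M N W g \<in> carrier (homK K MN MNW)"
  unfolding sum_right_def
  by (rule compose_homK[OF _ hat_tensor_linear[OF M _ N _ _ id_rational(1)[OF M] g] assoc_left_linear])
    (simp_all add: facts)

text \<open>The identity of \<open>N\<close> has \<open>lAd\<close> equal to the unit tensored with
  itself, so the coproduct legs in the hat tensor product become units and drop out.\<close>

lemma sum_left_pure:
  assumes f: "f \<in> HOM K H M MW" and [simp]: "m \<in> carrier M" "n \<in> carrier N"
  shows "sum_left M N W f (m \<boxtimes>\<^bsub>MN\<^esub> n) = woronowicz23 K H M W N
    (rsum (tensH K H MW N) M m (\<lambda>m' m2. rsum (tensH K H MW N) M m' (\<lambda>m0 m1.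
      f (m0 \<triangleleft>\<^bsub>M\<^esub> S m1) \<boxtimes>\<^bsub>tensH K H MW N\<^esub> (m2 \<triangleright>\<^bsub>N\<^esub> n))))"
proof -
  note [simp] = facts
  have fh: "f \<in> carrier (homK K M MW)" using f by (simp add: HOM_def)
  note [simp] = homK_closed[OF fh] lin_comp[OF homK_klinear[OF fh]]
  have idN: "idN \<in> carrier (homK K N N)" by (rule homK_restrict) simp_all
  have bilH: "bil H (homK K N N) (tensH K H MW N) (\<lambda>p \<psi>. csum (tensH K H MW N) p (\<lambda>p2 p1.
      rsum (tensH K H MW N) M m (\<lambda>m' m2. rsum (tensH K H MW N) M m' (\<lambda>m0 m1.
      f (p2 \<triangleright>\<^bsub>M\<^esub> m0 \<triangleleft>\<^bsub>M\<^esub> S (p1 \<otimes>\<^bsub>H\<^esub> m1)) \<boxtimes>\<^bsub>tensH K H MW N\<^esub> \<psi> (m2 \<triangleright>\<^bsub>N\<^esub> n)))))"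
    by (rule hat_bil[OF M _ N _ homK_klinear[OF fh]]) simp_all
  have "sum_left M N W f (m \<boxtimes>\<^bsub>MN\<^esub> n) = woronowicz23 K H M W N
      (hatsum M MW N N f (\<one>\<^bsub>H\<^esub> \<boxtimes>\<^bsub>tensK K H (homK K N N)\<^esub> idN) m n)"
    unfolding sum_left_def compose_def
    by (simp add: hat_tensor_pure[OF M _ N _ _ f id_rational(1)[OF N]] id_rational(2)[OF N])
  also have "hatsum M MW N N f (\<one>\<^bsub>H\<^esub> \<boxtimes>\<^bsub>tensK K H (homK K N N)\<^esub> idN) m n =
      csum (tensH K H MW N) \<one>\<^bsub>H\<^esub> (\<lambda>p2 p1.
      rsum (tensH K H MW N) M m (\<lambda>m' m2. rsum (tensH K H MW N) M m' (\<lambda>m0 m1.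
      f (p2 \<triangleright>\<^bsub>M\<^esub> m0 \<triangleleft>\<^bsub>M\<^esub> S (p1 \<otimes>\<^bsub>H\<^esub> m1)) \<boxtimes>\<^bsub>tensH K H MW N\<^esub> (m2 \<triangleright>\<^bsub>N\<^esub> n))))"
    unfolding hatsum_def Let_def by (subst sw_pure[OF _ _ bilH]) (simp_all add: idN)
  also have "\<dots> = rsum (tensH K H MW N) M m (\<lambda>m' m2. rsum (tensH K H MW N) M m' (\<lambda>m0 m1.
      f (m0 \<triangleleft>\<^bsub>M\<^esub> S m1) \<boxtimes>\<^bsub>tensH K H MW N\<^esub> (m2 \<triangleright>\<^bsub>N\<^esub> n)))"
    by (simp add: c_one bil_def)
  finally show ?thesis .
qed

lemma sum_left_coinv:
  assumes f: "f \<in> HOM K H M MW" and [simp]: "coinv M x" "n \<in> carrier N"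
  shows "sum_left M N W f (x \<boxtimes>\<^bsub>MN\<^esub> n) = woronowicz23 K H M W N (f x \<boxtimes>\<^bsub>tensH K H MW N\<^esub> n)"
proof -
  note [simp] = facts
  have fh: "f \<in> carrier (homK K M MW)" using f by (simp add: HOM_def)
  show ?thesis
    by (simp add: sum_left_pure[OF f] coinv_rsum bil_def homK_closed[OF fh] lin_comp[OF homK_klinear[OF fh]])
qed

text \<open>The right action touches only the last factor, where the identity of \<open>N\<close>
  stands, and the braiding respects it. Thus the left summand of any rational \<open>f\<close> is
  right linear, including that of a connection, and contributes no Leibniz term.\<close>

lemma sum_left_ract:
  assumes f: "f \<in> HOM K H M MW" and t: "t \<in> carrier MN" and [simp]: "a \<in> carrier H"
    and fg: "right_fin_gen H N"
  shows "sum_left M N W f (t \<triangleleft>\<^bsub>MN\<^esub> a) = sum_left M N W f t \<triangleleft>\<^bsub>MNW\<^esub> a"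
proof -
  note [simp] = facts
  have cl: "hat_tensor K H M MW N N f idN t \<in> carrier (tensH K H MW N)"
    by (rule klinear_closed[OF hat_tensor_linear[OF M _ N _ _ f id_rational(1)[OF N]] t]) simp_all
  have "right_linear H N N idN" by (simp add: right_linear_def)
  thus ?thesis
    using t cl unfolding sum_left_def compose_def
    by (simp add: hat_tensor_ract[OF M _ N _ _ f id_rational(1)[OF N] fg _ t] woronowicz23_ract)
qed

lemma sum_right_pure:
  assumes g: "g \<in> HOM K H N NW" and "m \<in> carrier M" "n \<in> carrier N"
  shows "sum_right M N W g (m \<boxtimes>\<^bsub>MN\<^esub> n) = assoc_left K H M N W (hatsum M M N NW idM (lAd K H N NW g) m n)"
  unfolding sum_right_def compose_def using assms
  by (simp add: hat_tensor_pure[OF M _ N _ _ id_rational(1)[OF M] g] facts)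

lemma sum_right_add:
  assumes f: "f \<in> HOM K H N NW" and g: "g \<in> HOM K H N NW"
  shows "sum_right M N W (f \<oplus>\<^bsub>homK K N NW\<^esub> g) = sum_right M N W f \<oplus>\<^bsub>homK K MN MNW\<^esub> sum_right M N W g"
proof -
  note [simp] = facts
  have r: "rcov NW" and l: "lcov NW" by simp_all
  have "kmod (homK K MN MNW)" by simp
  then interpret HE: Module.module K "homK K MN MNW" .
  note fg = HOM_add[OF N r l f g]
  note cl = lAd_closed[OF N r l f] lAd_closed[OF N r l g]
  have idM: "klinear K M M idM" by (rule homK_klinear[OF homK_restrict]) simp_all
  have lin: "klinear K (tensK K H (homK K N NW)) MNW (\<lambda>t. assoc_left K H M N W (hatsum M M N NW idM t m n))"
    if "m \<in> carrier M" "n \<in> carrier N" for m n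
    by (rule lin_comp[OF assoc_left_linear hatsum_tensor_linear[OF M _ N _ idM]]) (simp_all add: that)
  note homs = sum_right_homK[OF f] sum_right_homK[OF g] sum_right_homK[OF fg(1)]
  show ?thesis
  proof (rule homK_eqI[OF homs(3) HE.a_closed[OF homs(1,2)]])
    fix t assume t: "t \<in> carrier MN"
    show "sum_right M N W (f \<oplus>\<^bsub>homK K N NW\<^esub> g) t = (sum_right M N W f \<oplus>\<^bsub>homK K MN MNW\<^esub> sum_right M N W g) t"
      by (rule klinear_tensH_eqI[OF _ _ homK_klinear[OF homs(3)] homK_klinear[OF HE.a_closed[OF homs(1,2)]] t])
        (simp_all add: sum_right_pure f g fg klinear_add[OF lin] cl)
  qed
qed

lemma sum_right_ract:
  assumes g: "g \<in> HOM K H N NW" and rl: "right_linear H N NW g" and t: "t \<in> carrier MN"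
    and [simp]: "a \<in> carrier H" and fg: "right_fin_gen H N"
  shows "sum_right M N W g (t \<triangleleft>\<^bsub>MN\<^esub> a) = sum_right M N W g t \<triangleleft>\<^bsub>MNW\<^esub> a"
proof -
  note [simp] = facts
  have cl: "hat_tensor K H M M N NW idM g t \<in> carrier (tensH K H M NW)"
    by (rule klinear_closed[OF hat_tensor_linear[OF M _ N _ _ id_rational(1)[OF M] g] t]) simp_all
  show ?thesis
    using t cl unfolding sum_right_def compose_def
    by (simp add: hat_tensor_ract[OF M _ N _ _ id_rational(1)[OF M] g fg rl t] assoc_left_ract)
qed

lemma sum_right_dconn_coinv:
  assumes [simp]: "coinv M x" "n \<in> carrier N"
  shows "sum_right M N W (\<lambda>n\<in>carrier N. dconn N W d n) (x \<boxtimes>\<^bsub>MN\<^esub> n) =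
    assoc_left K H M N W (x \<boxtimes>\<^bsub>tensH K H M NW\<^esub> dconn N W d n)"
proof -
  note [simp] = facts
  have idM: "klinear K M M idM" by (rule homK_klinear[OF homK_restrict]) simp_all
  have dN: "(\<lambda>n\<in>carrier N. dconn N W d n) \<in> carrier (homK K N NW)"
    by (rule homK_restrict) (simp_all add: dconn_linear[OF d])
  show ?thesis
    by (simp add: sum_right_pure dconn_rational[OF d N] hatsum_one[OF M _ N _ idM] dN)
qed

lemma coinv_tensH:
  assumes [simp]: "coinv M x" "coinv N y"
  shows "coinv MN (x \<boxtimes>\<^bsub>MN\<^esub> y)"
  unfolding coinv_def[of MN] by (simp add: facts rcoact_tensH_pure[OF M N] coinv_rsum bil_def)

text \<open>After writing the second factor as \<open>y v\<close> with \<open>y\<close> coinvariant,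
  both sides give \<open>x \<otimes> y \<otimes> d v\<close>: on the left by the formula for
  \<open>N\<close>, on the right because \<open>x \<otimes> y\<close> is itself coinvariant.\<close>

lemma sum_right_dconn: "sum_right M N W (\<lambda>n\<in>carrier N. dconn N W d n) = dMN"
proof -
  note [simp] = facts
  note homs = sum_right_homK[OF dconn_rational(1)[OF d N]]
  have dMN: "dMN \<in> carrier (homK K MN MNW)"
    by (rule homK_restrict) (simp_all add: dconn_linear[OF d] M N)
  show ?thesis
  proof (rule homK_eqI[OF homs dMN])
    fix t assume t: "t \<in> carrier MN"
    show "sum_right M N W (\<lambda>n\<in>carrier N. dconn N W d n) t = dMN t"
    proof (rule coinv_tensH_eqI[OF M _ _ t homK_klinear[OF homs] homK_klinear[OF dMN]])
      fix x n assume [simp]: "coinv M x" and n [simp]: "n \<in> carrier N"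
      have "assoc_left K H M N W (x \<boxtimes>\<^bsub>tensH K H M NW\<^esub> dconn N W d n) = dconn MN W d (x \<boxtimes>\<^bsub>MN\<^esub> n)"
      proof (rule coinv_eqI[OF N n, where Z = MNW])
        fix y v assume [simp]: "coinv N y" "v \<in> carrier H"
        have "dconn MN W d (x \<boxtimes>\<^bsub>MN\<^esub> (y \<triangleleft>\<^bsub>N\<^esub> v)) = dconn MN W d ((x \<boxtimes>\<^bsub>MN\<^esub> y) \<triangleleft>\<^bsub>MN\<^esub> v)"
          by simp
        also have "\<dots> = (x \<boxtimes>\<^bsub>MN\<^esub> y) \<boxtimes>\<^bsub>MNW\<^esub> d v"
          by (rule dconn_coinv[OF d]) (simp_all add: coinv_tensH rcov_tensH[OF M N])
        also have "\<dots> = assoc_left K H M N W (x \<boxtimes>\<^bsub>tensH K H M NW\<^esub> dconn N W d (y \<triangleleft>\<^bsub>N\<^esub> v))"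
          by (simp add: dconn_coinv[OF d])
        finally show "assoc_left K H M N W (x \<boxtimes>\<^bsub>tensH K H M NW\<^esub> dconn N W d (y \<triangleleft>\<^bsub>N\<^esub> v)) =
            dconn MN W d (x \<boxtimes>\<^bsub>MN\<^esub> (y \<triangleleft>\<^bsub>N\<^esub> v))" by simp
      qed (simp_all add: lin_comp[OF assoc_left_linear] lin_dconn[OF d])
      thus "sum_right M N W (\<lambda>n\<in>carrier N. dconn N W d n) (x \<boxtimes>\<^bsub>MN\<^esub> n) = dMN (x \<boxtimes>\<^bsub>MN\<^esub> n)"
        by (simp add: sum_right_dconn_coinv)
    qed simp_all
  qed
qed

text \<open>On \<open>x \<otimes> n\<close> with \<open>x\<close> coinvariant, the canonical
  connection of the tensor product is that of \<open>N\<close> with \<open>x\<close> placed in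
  front. The Leibniz rule is inherited from \<open>N\<close>, a bimodule for which
  \<open>dconn_leibniz\<close> is available.\<close>

lemma dconn_tensH_leibniz:
  assumes t: "t \<in> carrier MN" and [simp]: "a \<in> carrier H"
  shows "dconn MN W d (t \<triangleleft>\<^bsub>MN\<^esub> a) = (dconn MN W d t \<triangleleft>\<^bsub>MNW\<^esub> a) \<oplus>\<^bsub>MNW\<^esub> (t \<boxtimes>\<^bsub>MNW\<^esub> d a)"
proof (rule coinv_tensH_eqI[OF M _ _ t, where Z = MNW])
  note [simp] = facts dconn_closed[OF d]
  fix x n assume [simp]: "coinv M x" "n \<in> carrier N"
  have eq: "dconn MN W d (x \<boxtimes>\<^bsub>MN\<^esub> n) = assoc_left K H M N W (x \<boxtimes>\<^bsub>tensH K H M NW\<^esub> dconn N W d n)"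
    if "n \<in> carrier N" for n
    using fun_cong[OF sum_right_dconn, of "x \<boxtimes>\<^bsub>MN\<^esub> n"] that by (simp add: sum_right_dconn_coinv)
  have ract: "x \<boxtimes>\<^bsub>tensH K H M NW\<^esub> (y \<triangleleft>\<^bsub>NW\<^esub> a) = (x \<boxtimes>\<^bsub>tensH K H M NW\<^esub> y) \<triangleleft>\<^bsub>tensH K H M NW\<^esub> a"
    if "y \<in> carrier NW" for y
    using that by simp
  show "dconn MN W d ((x \<boxtimes>\<^bsub>MN\<^esub> n) \<triangleleft>\<^bsub>MN\<^esub> a) =
      (dconn MN W d (x \<boxtimes>\<^bsub>MN\<^esub> n) \<triangleleft>\<^bsub>MNW\<^esub> a) \<oplus>\<^bsub>MNW\<^esub> ((x \<boxtimes>\<^bsub>MN\<^esub> n) \<boxtimes>\<^bsub>MNW\<^esub> d a)"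
    by (simp add: eq dconn_leibniz[OF d] klinear_add[OF bil1[OF tensH_bil]] klinear_add[OF assoc_left_linear])
      (simp add: ract assoc_left_ract del: act_tensH_pure)
qed (simp_all add: facts klinear_sum lin_dconn[OF d] rcov_tensH[OF M N])

text \<open>The left summand at \<open>x \<otimes> n\<close> sees only the value of the map at the
  coinvariant \<open>x\<close>, and such tensors span.\<close>

lemma sum_left_eqI:
  assumes f: "f \<in> HOM K H M MW" and g: "g \<in> HOM K H M MW" and eq: "\<And>x. coinv M x \<Longrightarrow> f x = g x"
  shows "sum_left M N W f = sum_left M N W g"
proof (rule homK_eqI[OF sum_left_homK[OF f] sum_left_homK[OF g]])
  fix t assume t: "t \<in> carrier MN"
  show "sum_left M N W f t = sum_left M N W g t"
    by (rule coinv_tensH_eqI[OF M _ _ t homK_klinear[OF sum_left_homK[OF f]] homK_klinear[OF sum_left_homK[OF g]]])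
      (simp_all add: facts sum_left_coinv f g eq)
qed

end

lemma canonical_connection_eq:
  assumes "bicovariant_calculus K H \<Omega>" and M: "rcov M"
  shows "canonical_connection K H \<Omega> M = (\<lambda>m\<in>carrier M. dconn M (forms \<Omega> 1) (\<lambda>a. diff \<Omega> 0 (incl \<Omega> a)) m)"
  unfolding canonical_connection_def dconn_def Let_def
  by (rule restrict_ext) (use M in \<open>simp add: sweedler_rcoact del: One_nat_def\<close>)

lemma Con_iff:
  "D \<in> Con K H \<Omega> M \<longleftrightarrow> D \<in> carrier (homK K M (tensH K H M (forms \<Omega> 1))) \<and>
    right_conn M (forms \<Omega> 1) (\<lambda>a. diff \<Omega> 0 (incl \<Omega> a)) D"
  unfolding Con_def right_conn_def by (auto simp: homK_carrier)

end

theorem theorem4p19: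
  fixes K :: "'k ring" and H :: "('k, 'h) hopf" and \<Omega> :: "('k, 'h, 'w) calculus"
    and M :: "('k, 'h, 'm) bimod" and N :: "('k, 'h, 'n) bimod"
    and DM :: "'m \<Rightarrow> ('m \<times> 'w \<Rightarrow>\<^sub>0 int) set"
    and DN :: "'n \<Rightarrow> ('n \<times> 'w \<Rightarrow>\<^sub>0 int) set"
  assumes "hopf_algebra K H"
    and "bij_betw (antipode H) (carrier H) (carrier H)"
    and "bicovariant_calculus K H \<Omega>"
    and "bicovariant_bimodule K H M" and "right_fin_gen H M"
    and "bicovariant_bimodule K H N" and "right_fin_gen H N"
    and "DM \<in> Con K H \<Omega> M" and "DN \<in> Con K H \<Omega> N"
  shows "connection_sum K H \<Omega> M N DM DN \<in> Con K H \<Omega> (tensH K H M N) \<and>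
    (\<forall>m\<in>carrier M. \<forall>n\<in>carrier N.
      connection_sum K H \<Omega> M N DM DN (m \<boxtimes>\<^bsub>tensH K H M N\<^esub> n) =
        woronowicz23 K H M (forms \<Omega> 1) N
          (sweedler (tensH K H (tensH K H M (forms \<Omega> 1)) N) (rcoact M m) (\<lambda>m' m2.
           sweedler (tensH K H (tensH K H M (forms \<Omega> 1)) N) (rcoact M m') (\<lambda>m0 m1.
             DM (m0 \<triangleleft>\<^bsub>M\<^esub> antipode H m1)
               \<boxtimes>\<^bsub>tensH K H (tensH K H M (forms \<Omega> 1)) N\<^esub> (m2 \<triangleright>\<^bsub>N\<^esub> n))))
        \<oplus>\<^bsub>tensH K H (tensH K H M N) (forms \<Omega> 1)\<^esub>
        assoc_left K H M N (forms \<Omega> 1)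
          (sweedler (tensH K H M (tensH K H N (forms \<Omega> 1)))
            (lAd K H N (tensH K H N (forms \<Omega> 1)) DN) (\<lambda>p DN0.
           sweedler (tensH K H M (tensH K H N (forms \<Omega> 1))) (comult H p) (\<lambda>p2 p1.
           sweedler (tensH K H M (tensH K H N (forms \<Omega> 1))) (rcoact M m) (\<lambda>m' m2.
           sweedler (tensH K H M (tensH K H N (forms \<Omega> 1))) (rcoact M m') (\<lambda>m0 m1.
             (p2 \<triangleright>\<^bsub>M\<^esub> m0 \<triangleleft>\<^bsub>M\<^esub> antipode H (p1 \<otimes>\<^bsub>H\<^esub> m1))
               \<boxtimes>\<^bsub>tensH K H M (tensH K H N (forms \<Omega> 1))\<^esub> DN0 (m2 \<triangleright>\<^bsub>N\<^esub> n))))))) \<and>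
    connection_sum K H \<Omega> M N DM DN =
      canonical_connection K H \<Omega> (tensH K H M N)
      \<oplus>\<^bsub>homK K (tensH K H M N) (tensH K H (tensH K H M N) (forms \<Omega> 1))\<^esub>
      compose (carrier (tensH K H M N)) (woronowicz23 K H M (forms \<Omega> 1) N)
        (sigma_tensor K H M (tensH K H M (forms \<Omega> 1)) N N
          (DM \<ominus>\<^bsub>homK K M (tensH K H M (forms \<Omega> 1))\<^esub> canonical_connection K H \<Omega> M)
          (\<lambda>n\<in>carrier N. n))
      \<oplus>\<^bsub>homK K (tensH K H M N) (tensH K H (tensH K H M N) (forms \<Omega> 1))\<^esub>
      compose (carrier (tensH K H M N)) (assoc_left K H M N (forms \<Omega> 1))
        (sigma_tensor K H M M N (tensH K H N (forms \<Omega> 1))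
          (\<lambda>m\<in>carrier M. m)
          (DN \<ominus>\<^bsub>homK K N (tensH K H N (forms \<Omega> 1))\<^esub> canonical_connection K H \<Omega> N))"
proof -
  \<comment> \<open>Keeps the degree in \<open>forms \<Omega> 1\<close> from being rewritten to a
    successor, so that instantiated facts continue to match.\<close>
  note [simp del] = One_nat_def
  interpret hopf_algebra_bij K H
    by (intro hopf_algebra_bij.intro hopf_algebra_bij_axioms.intro assms(1,2))
  let ?W = "forms \<Omega> 1" and ?d = "\<lambda>a. diff \<Omega> 0 (incl \<Omega> a)"
  let ?MN = "tensH K H M N" and ?MW = "tensH K H M (forms \<Omega> 1)" and ?NW = "tensH K H N (forms \<Omega> 1)"
  let ?MNW = "tensH K H (tensH K H M N) (forms \<Omega> 1)"
  let ?A = "sum_left M N ?W" and ?B = "sum_right M N ?W"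
  note M = assms(4) and fgM = assms(5) and N = assms(6) and fgN = assms(7)
  have d: "fodc ?W ?d" by (rule calculus_fodc[OF assms(3)])
  note W = fodc_bicov[OF d]
  have DM: "DM \<in> carrier (homK K M ?MW)" "right_conn M ?W ?d DM"
    and DN: "DN \<in> carrier (homK K N ?NW)" "right_conn N ?W ?d DN"
    using assms(8,9) by (simp_all add: Con_iff)
  have cc: "canonical_connection K H \<Omega> V = (\<lambda>m\<in>carrier V. dconn V ?W ?d m)" if "rcov V" for V :: "('k, 'h, 'v) bimod"
    by (rule canonical_connection_eq[OF assms(3) that])
  let ?EM = "DM \<ominus>\<^bsub>homK K M ?MW\<^esub> canonical_connection K H \<Omega> M"
  let ?EN = "DN \<ominus>\<^bsub>homK K N ?NW\<^esub> canonical_connection K H \<Omega> N"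
  let ?dT = "canonical_connection K H \<Omega> ?MN"
  note EM = connection_rational[OF d M fgM DM, folded cc[OF bicov_rcov[OF M]]]
  note EN = connection_rational[OF d N fgN DN, folded cc[OF bicov_rcov[OF N]]]
  have dN: "canonical_connection K H \<Omega> N \<in> HOM K H N ?NW"
    unfolding cc[OF bicov_rcov[OF N]] by (rule dconn_rational(1)[OF d N])
  have hb: "hbimod M" "hbimod N" "hbimod ?W" using M N W by simp_all
  have "kmod ?MNW" "kmod (homK K ?MN ?MNW)" using hb by simp_all
  then interpret R: Module.module K ?MNW + HR: Module.module K "homK K ?MN ?MNW" .
  have sum: "connection_sum K H \<Omega> M N DM DN = ?A DM \<oplus>\<^bsub>homK K ?MN ?MNW\<^esub> ?B DN"
    unfolding connection_sum_def sum_left_def sum_right_def ..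
  have zero: "canonical_connection K H \<Omega> M x = \<zero>\<^bsub>?MW\<^esub>" if "coinv M x" for x
    using that M by (simp add: cc dconn_coinv_zero[OF d])
  \<comment> \<open>The canonical connection vanishes on coinvariants, so \<open>DM\<close> and its
    right linear part agree there and have the same left summand.\<close>
  have A: "?A DM = ?A ?EM"
  proof (rule sum_left_eqI[OF M N d EM(3,2)])
    fix x assume x: "coinv M x"
    have "kmod ?MW" using hb by simp
    then interpret P: Module.module K ?MW .
    have "?EM \<in> carrier (homK K M ?MW)" using EM(2) by (simp add: HOM_def)
    hence "?EM x \<in> carrier ?MW" using x by simp
    thus "DM x = ?EM x"
      using arg_cong[OF EM(4), of "\<lambda>f. f x"] x by (simp add: zero)
  qed
  have dT: "?B (canonical_connection K H \<Omega> N) = ?dT"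
    unfolding cc[OF bicov_rcov[OF N]] cc[OF rcov_tensH[OF M N]] by (rule sum_right_dconn[OF M N d])
  \<comment> \<open>The right summand is additive; its value at the canonical connection of
    \<open>N\<close> is the canonical connection of the tensor product.\<close>
  have B: "?B DN = ?dT \<oplus>\<^bsub>homK K ?MN ?MNW\<^esub> ?B ?EN"
    using sum_right_add[OF M N d dN EN(2)] unfolding EN(4) dT .
  note homs = sum_left_homK[OF M N d EM(2)] sum_right_homK[OF M N d EN(2)] sum_right_homK[OF M N d dN, unfolded dT]
  \<comment> \<open>This decomposition is the last claim up to notation. The Leibniz rule also
    follows from it: the first term supplies the inhomogeneous part and the other two are right
    linear.\<close>
  have total: "connection_sum K H \<Omega> M N DM DN =
      ?dT \<oplus>\<^bsub>homK K ?MN ?MNW\<^esub> ?A ?EM \<oplus>\<^bsub>homK K ?MN ?MNW\<^esub> ?B ?EN"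
    unfolding sum A B using homs by (simp add: HR.a_ac)
  have hom: "connection_sum K H \<Omega> M N DM DN \<in> carrier (homK K ?MN ?MNW)"
    unfolding total using homs by simp
  have ract_add: "(s \<oplus>\<^bsub>?MNW\<^esub> t) \<triangleleft>\<^bsub>?MNW\<^esub> a = (s \<triangleleft>\<^bsub>?MNW\<^esub> a) \<oplus>\<^bsub>?MNW\<^esub> (t \<triangleleft>\<^bsub>?MNW\<^esub> a)"
    if "s \<in> carrier ?MNW" "t \<in> carrier ?MNW" "a \<in> carrier H" for s t a
    by (rule klinear_add[OF bil2[OF ract_bil]]) (use hb that in simp_all)
  have "right_conn ?MN ?W ?d (connection_sum K H \<Omega> M N DM DN)"
    unfolding right_conn_def
  proof (intro conjI ballI)
    show "klinear K ?MN ?MNW (connection_sum K H \<Omega> M N DM DN)" by (rule homK_klinear[OF hom])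
    fix t a assume t: "t \<in> carrier ?MN" and a: "a \<in> carrier H"
    have ta: "t \<triangleleft>\<^bsub>?MN\<^esub> a \<in> carrier ?MN" using hb t a by simp
    have ract: "z \<triangleleft>\<^bsub>?MNW\<^esub> a \<in> carrier ?MNW" if "z \<in> carrier ?MNW" for z using hb a that by simp
    have pure: "t \<boxtimes>\<^bsub>?MNW\<^esub> ?d a \<in> carrier ?MNW" using hb t fodc_closed[OF d a] by simp
    note cl = homs[THEN homK_closed, OF t]
    have dT_ract: "?dT (t \<triangleleft>\<^bsub>?MN\<^esub> a) = (?dT t \<triangleleft>\<^bsub>?MNW\<^esub> a) \<oplus>\<^bsub>?MNW\<^esub> (t \<boxtimes>\<^bsub>?MNW\<^esub> ?d a)"
      unfolding cc[OF rcov_tensH[OF M N]] using t ta by (simp add: dconn_tensH_leibniz[OF M N d t a])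
    show "connection_sum K H \<Omega> M N DM DN (t \<triangleleft>\<^bsub>?MN\<^esub> a) =
        (connection_sum K H \<Omega> M N DM DN t \<triangleleft>\<^bsub>?MNW\<^esub> a) \<oplus>\<^bsub>?MNW\<^esub> (t \<boxtimes>\<^bsub>?MNW\<^esub> ?d a)"
      unfolding total using t ta a cl ract pure
      by (simp add: dT_ract sum_left_ract[OF M N d EM(2) t a fgN] sum_right_ract[OF M N d EN(2,1) t a fgN]
          ract_add R.a_ac)
  qed
  hence con: "connection_sum K H \<Omega> M N DM DN \<in> Con K H \<Omega> ?MN"
    using hom by (simp add: Con_iff)
  have elem: "connection_sum K H \<Omega> M N DM DN (m \<boxtimes>\<^bsub>?MN\<^esub> n) =
        woronowicz23 K H M ?W N
          (sweedler (tensH K H ?MW N) (rcoact M m) (\<lambda>m' m2.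
           sweedler (tensH K H ?MW N) (rcoact M m') (\<lambda>m0 m1.
             DM (m0 \<triangleleft>\<^bsub>M\<^esub> S m1) \<boxtimes>\<^bsub>tensH K H ?MW N\<^esub> (m2 \<triangleright>\<^bsub>N\<^esub> n))))
        \<oplus>\<^bsub>?MNW\<^esub>
        assoc_left K H M N ?W
          (sweedler (tensH K H M ?NW) (lAd K H N ?NW DN) (\<lambda>p DN0.
           sweedler (tensH K H M ?NW) (comult H p) (\<lambda>p2 p1.
           sweedler (tensH K H M ?NW) (rcoact M m) (\<lambda>m' m2.
           sweedler (tensH K H M ?NW) (rcoact M m') (\<lambda>m0 m1.
             (p2 \<triangleright>\<^bsub>M\<^esub> m0 \<triangleleft>\<^bsub>M\<^esub> S (p1 \<otimes>\<^bsub>H\<^esub> m1)) \<boxtimes>\<^bsub>tensH K H M ?NW\<^esub> DN0 (m2 \<triangleright>\<^bsub>N\<^esub> n))))))"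
    if mn: "m \<in> carrier M" "n \<in> carrier N" for m n
  proof -
    \<comment> \<open>Membership in the tensor product allows the outer \<open>sweedler\<close> in
      the claim to be read as \<open>sw\<close>.\<close>
    have t: "lAd K H N ?NW DN \<in> carrier (tensK K H (homK K N ?NW))"
      by (rule lAd_closed[OF N _ _ EN(3)]) (use N W in simp_all)
    have "m \<boxtimes>\<^bsub>?MN\<^esub> n \<in> carrier ?MN" using hb mn by simp
    hence "connection_sum K H \<Omega> M N DM DN (m \<boxtimes>\<^bsub>?MN\<^esub> n) =
        ?A DM (m \<boxtimes>\<^bsub>?MN\<^esub> n) \<oplus>\<^bsub>?MNW\<^esub> ?B DN (m \<boxtimes>\<^bsub>?MN\<^esub> n)"
      by (simp add: sum)
    thus ?thesis
      using mn t M N W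
      by (simp add: sum_left_pure[OF M N d EM(3)] sum_right_pure[OF M N d EN(3)] hatsum_def Let_def
          sweedler_rcoact sweedler_comult sweedler_sw[of H "homK K N ?NW"])
  qed
  \<comment> \<open>The identity and the difference of connections are right linear, so the guard in
    \<open>sigma_tensor\<close> holds and its value is the hat tensor product rather than
    \<open>undefined\<close>; likewise for the right summand.\<close>
  have sA: "sum_left M N ?W ?EM = compose (carrier ?MN) (woronowicz23 K H M ?W N)
      (sigma_tensor K H M ?MW N N ?EM (\<lambda>n\<in>carrier N. n))"
    using EM(1) hb unfolding sum_left_def sigma_tensor_def by (simp add: right_linear_def)
  have sB: "sum_right M N ?W ?EN = compose (carrier ?MN) (assoc_left K H M N ?W)
      (sigma_tensor K H M M N ?NW (\<lambda>m\<in>carrier M. m) ?EN)"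
    using EN(1) hb unfolding sum_right_def sigma_tensor_def by (simp add: right_linear_def)
  show ?thesis
    using con elem total[unfolded sA sB] by blast
qed

end
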